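(* Let $\mathfrak{G}$ be a separable Hilbert space. Suppose $F \in L^\infty_{\mathfrak{L}(\mathfrak{G})}$ and $F \ge 0$ a.e. on $\mathbb{T}$. For $F$ to be factorable, it is sufficient that there exists a function $\psi$ in $L^\infty_{\mathfrak{L}(\mathfrak{G})}$ such that (i) $\psi F \in H^\infty_{\mathfrak{L}(\mathfrak{G})}$; (ii) for all $\zeta \in \mathbb{T}$ except at most a set of measure zero, the restriction of the operator $\psi(\zeta)$ to the closed subspace $\overline{F(\zeta)\mathfrak{G}}$ is one-to-one. If these conditions are met and $F = G^*G$ a.e. on $\mathbb{T}$ with $G \in N^+_{\mathfrak{L}(\mathfrak{G})}$ outer, then $\psi G^* \in H^\infty_{\mathfrak{L}(\mathfrak{G})}$.
   Context: $\mathbb{D} = \{z : |z|<1\}$ and $\mathbb{T} = \{\zeta : |\zeta|=1\}$ are the open unit disk and the unit circle in the complex plane; $\mathbb{T}$ carries normalized Lebesgue measure $\sigma$. $\mathfrak{L}(\mathfrak{G})$ is the space of bounded linear operators on $\mathfrak{G}$. Functions $f$ and $F$ on $\mathbb{T}$ with values in $\mathfrak{G}$ and $\mathfrak{L}(\mathfrak{G})$, respectively, are weakly measurable if $\langle f(\zeta), v\rangle$ and $\langle F(\zeta)u, v\rangle$ are measurable for all $u,v \in \mathfrak{G}$. $L^2_{\mathfrak{G}}$ and $L^\infty_{\mathfrak{L}(\mathfrak{G})}$ are the standard Lebesgue spaces of weakly measurable functions on $\mathbb{T}$ with values in $\mathfrak{G}$ and $\mathfrak{L}(\mathfrak{G})$.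 $H^2_{\mathfrak{G}}$ and $H^\infty_{\mathfrak{L}(\mathfrak{G})}$ are the analogous Hardy classes of analytic functions on $\mathbb{D}$. $N^+_{\mathfrak{L}(\mathfrak{G})}$ is the space of all analytic $\mathfrak{L}(\mathfrak{G})$-valued functions $F$ on $\mathbb{D}$ such that $\varphi F \in H^\infty_{\mathfrak{L}(\mathfrak{G})}$ for some bounded scalar outer function $\varphi$. Elements of $H^2_{\mathfrak{G}}$, $H^\infty_{\mathfrak{L}(\mathfrak{G})}$ and $N^+_{\mathfrak{L}(\mathfrak{G})}$ are identified with their nontangential boundary functions on $\mathbb{T}$ (limits taken in norm for vector-valued functions and in the strong operator topology for operator-valued functions), so that $H^2_{\mathfrak{G}} \subseteq L^2_{\mathfrak{G}}$ and $H^\infty_{\mathfrak{L}(\mathfrak{G})} \subseteq L^\infty_{\mathfrak{L}(\mathfrak{G})}$. A function $F \in H^\infty_{\mathfrak{L}(\mathfrak{G})}$ is outer if $F H^2_{\mathfrak{G}}$ is dense in $H^2_{\mathfrak{F}}$ for some closed subspace $\mathfrak{F}$ of $\mathfrak{G}$. A function $F \in N^+_{\mathfrak{L}(\mathfrak{G})}$ is outer if there is a bounded scalar outer function $\varphi$ such that $\varphi F \in H^\infty_{\mathfrak{L}(\mathfrak{G})}$ and $\varphi F$ is outer in the preceding sense. A nonnegative weakly measurable $\mathfrak{L}(\mathfrak{G})$-valued function $F$ on $\mathbb{T}$ is called factorable if there is a function $G \in N^+_{\mathfrak{L}(\mathfrak{G})}$ such that $F = G^*G$ a.e. on $\mathbb{T}$.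 Here $G^*$ denotes the pointwise adjoint $\zeta \mapsto G(\zeta)^*$ on $\mathbb{T}$. *)

theory Defs
  imports "HOL-Analysis.Analysis"
begin

section \<open>Complex Hilbert spaces\<close>

text \<open>The distribution only has real inner product spaces. A complex Hilbert space is taken here
  to be a real one carrying a compatible complex structure, so that the topology, the norm and
  the type of bounded (real-linear) operators are those of the library.\<close>

class scaleC =
  fixes scaleC :: "complex \<Rightarrow> 'a \<Rightarrow> 'a"  (infixr \<open>*\<^sub>C\<close> 75)

class complex_normed_vector = real_normed_vector + scaleC +
  assumes scaleC_add_right: "a *\<^sub>C (x + y) = a *\<^sub>C x + a *\<^sub>C y"
    and scaleC_add_left: "(a + b) *\<^sub>C x = a *\<^sub>C x + b *\<^sub>C x"
    and scaleC_scaleC: "a *\<^sub>C (b *\<^sub>C x) = (a * b) *\<^sub>C x"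
    and scaleR_scaleC: "r *\<^sub>R x = complex_of_real r *\<^sub>C x"
    and norm_scaleC: "norm (a *\<^sub>C x) = cmod a * norm x"

text \<open>The inner product is linear in the first argument.\<close>

class complex_inner = complex_normed_vector + real_inner +
  fixes cinner :: "'a \<Rightarrow> 'a \<Rightarrow> complex"
  assumes cinner_commute: "cinner x y = cnj (cinner y x)"
    and cinner_add_left: "cinner (x + y) z = cinner x z + cinner y z"
    and cinner_scaleC_left: "cinner (a *\<^sub>C x) y = a * cinner x y"
    and inner_eq_Re_cinner: "inner x y = Re (cinner x y)"

class chilbert_space = complex_inner + complete_space

instantiation complex :: chilbert_space
begin

definition scaleC_complex :: "complex \<Rightarrow> complex \<Rightarrow> complex"
  where "scaleC_complex a x = a * x"

definition cinner_complex :: "complex \<Rightarrow> complex \<Rightarrow> complex"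
  where "cinner_complex x y = x * cnj y"

instance
  by standard
    (auto simp: scaleC_complex_def cinner_complex_def algebra_simps scaleR_conv_of_real
      norm_mult inner_complex_def)

end

instantiation blinfun :: (real_normed_vector, complex_normed_vector) complex_normed_vector
begin

definition scaleC_blinfun :: "complex \<Rightarrow> 'a \<Rightarrow>\<^sub>L 'b \<Rightarrow> 'a \<Rightarrow>\<^sub>L 'b"
  where "scaleC_blinfun a A = Blinfun (\<lambda>x. a *\<^sub>C blinfun_apply A x)"

lemma blinfun_apply_scaleC: "blinfun_apply (a *\<^sub>C A) x = a *\<^sub>C blinfun_apply A x"
proof -
  have "bounded_linear (\<lambda>x. a *\<^sub>C blinfun_apply A x)"
  proof (rule bounded_linear_intro)
    show "a *\<^sub>C blinfun_apply A (x + y) = a *\<^sub>C blinfun_apply A x + a *\<^sub>C blinfun_apply A y" for x y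
      by (simp add: blinfun.add_right scaleC_add_right)
    show "a *\<^sub>C blinfun_apply A (r *\<^sub>R x) = r *\<^sub>R (a *\<^sub>C blinfun_apply A x)" for r x
      by (simp add: blinfun.scaleR_right scaleR_scaleC scaleC_scaleC mult.commute)
    show "norm (a *\<^sub>C blinfun_apply A x) \<le> norm x * (cmod a * norm A)" for x
      using mult_left_mono[OF norm_blinfun[of A x], of "cmod a"]
      by (simp add: norm_scaleC mult_ac)
  qed
  then show ?thesis
    by (simp add: scaleC_blinfun_def bounded_linear_Blinfun_apply)
qed

instance
proof
  fix a b :: complex and r :: real and A B :: "'a \<Rightarrow>\<^sub>L 'b"
  show "a *\<^sub>C (A + B) = a *\<^sub>C A + a *\<^sub>C B"
    by (rule blinfun_eqI) (simp add: blinfun_apply_scaleC blinfun.add_left scaleC_add_right)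
  show "(a + b) *\<^sub>C A = a *\<^sub>C A + b *\<^sub>C A"
    by (rule blinfun_eqI) (simp add: blinfun_apply_scaleC blinfun.add_left scaleC_add_left)
  show sc: "a *\<^sub>C (b *\<^sub>C A) = (a * b) *\<^sub>C A" for a b and A :: "'a \<Rightarrow>\<^sub>L 'b"
    by (rule blinfun_eqI) (simp add: blinfun_apply_scaleC scaleC_scaleC)
  show re: "r *\<^sub>R A = complex_of_real r *\<^sub>C A" for r and A :: "'a \<Rightarrow>\<^sub>L 'b"
    by (rule blinfun_eqI) (simp add: blinfun_apply_scaleC blinfun.scaleR_left scaleR_scaleC)
  have le: "norm (a *\<^sub>C A) \<le> cmod a * norm A" for a and A :: "'a \<Rightarrow>\<^sub>L 'b"
  proof (rule norm_blinfun_bound)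
    show "norm (blinfun_apply (a *\<^sub>C A) x) \<le> cmod a * norm A * norm x" for x
      using mult_left_mono[OF norm_blinfun[of A x], of "cmod a"]
      by (simp add: norm_scaleC blinfun_apply_scaleC mult_ac)
  qed simp
  show "norm (a *\<^sub>C A) = cmod a * norm A"
  proof (cases "a = 0")
    case True
    then show ?thesis using le[of a A] by simp
  next
    case False
    have "A = inverse a *\<^sub>C (a *\<^sub>C A)"
      using False re[of 1 A] by (simp add: sc)
    then have "norm A \<le> cmod (inverse a) * norm (a *\<^sub>C A)"
      using le[of "inverse a" "a *\<^sub>C A"] by simp
    then have "cmod a * norm A \<le> norm (a *\<^sub>C A)"
      using False by (simp add: norm_divide field_simps)
    then show ?thesis using le[of a A] by simp
  qed
qed

end

text \<open>The bounded complex-linear operators, a subset of the library's bounded real-linear ones.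
  The norm \<open>norm A\<close> is the usual operator norm.\<close>

definition cbounded_ops :: "('g::complex_normed_vector \<Rightarrow>\<^sub>L 'g) set"
  where "cbounded_ops = {A. \<forall>c x. blinfun_apply A (c *\<^sub>C x) = c *\<^sub>C blinfun_apply A x}"

text \<open>The adjoint exists uniquely (Riesz) for members of \<open>cbounded_ops\<close> on a Hilbert space;
  it is applied only to those.\<close>

definition cadjoint :: "('g::chilbert_space \<Rightarrow>\<^sub>L 'g) \<Rightarrow> ('g \<Rightarrow>\<^sub>L 'g)"
  where "cadjoint A =
    (THE B. \<forall>x y. cinner (blinfun_apply A x) y = cinner x (blinfun_apply B y))"

definition nonneg_op :: "('g::complex_inner \<Rightarrow>\<^sub>L 'g) \<Rightarrow> bool"
  where "nonneg_op A \<longleftrightarrow> (\<forall>u. cinner (blinfun_apply A u) u \<in> \<real>\<^sub>\<ge>\<^sub>0)"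

definition closed_csubspace :: "'g::complex_normed_vector set \<Rightarrow> bool"
  where "closed_csubspace M \<longleftrightarrow>
    closed M \<and> 0 \<in> M \<and> (\<forall>x\<in>M. \<forall>y\<in>M. x + y \<in> M) \<and> (\<forall>c. \<forall>x\<in>M. c *\<^sub>C x \<in> M)"

section \<open>Functions on the unit circle\<close>

text \<open>Normalized Lebesgue measure on the unit circle, with the Lebesgue (completed) sigma-algebra.\<close>

definition circle_measure :: "complex measure"  (\<open>\<sigma>\<close>)
  where "\<sigma> = completion
    (distr (restrict_space lborel {0..<1::real}) (restrict_space borel (sphere 0 1))
      (\<lambda>t. cis (2 * pi * t)))"

text \<open>Functions on the circle and on the open disk are total functions on \<^typ>\<open>complex\<close>; their values
  elsewhere are never constrained.\<close>

definition weakly_measurable_op :: "(complex \<Rightarrow> 'g::complex_inner \<Rightarrow>\<^sub>L 'g) \<Rightarrow> bool"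
  where "weakly_measurable_op F \<longleftrightarrow>
    (\<forall>\<zeta>\<in>sphere 0 1. F \<zeta> \<in> cbounded_ops) \<and>
    (\<forall>u v. (\<lambda>\<zeta>. cinner (blinfun_apply (F \<zeta>) u) v) \<in> borel_measurable \<sigma>)"

definition Linf_op :: "(complex \<Rightarrow> 'g::complex_inner \<Rightarrow>\<^sub>L 'g) set"
  where "Linf_op = {F. weakly_measurable_op F \<and> (\<exists>C. AE \<zeta> in \<sigma>. norm (F \<zeta>) \<le> C)}"

section \<open>Hardy classes on the unit disk\<close>

text \<open>Complex differentiability in norm at every point of the disk.\<close>

definition analytic_disk :: "(complex \<Rightarrow> 'b::complex_normed_vector) \<Rightarrow> bool"
  where "analytic_disk f \<longleftrightarrow>
    (\<forall>z\<in>ball 0 1. \<exists>d. (f has_derivative (\<lambda>h. h *\<^sub>C d)) (at z))"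

definition H2 :: "(complex \<Rightarrow> 'g::complex_inner) set"
  where "H2 = {f. analytic_disk f \<and>
    (\<exists>C. \<forall>r\<in>{0..<1::real}. (\<integral>\<zeta>. (norm (f (of_real r * \<zeta>)))\<^sup>2 \<partial>\<sigma>) \<le> C)}"

definition H2_norm :: "(complex \<Rightarrow> 'g::complex_inner) \<Rightarrow> real"
  where "H2_norm f =
    sqrt (SUP r\<in>{0..<1::real}. \<integral>\<zeta>. (norm (f (of_real r * \<zeta>)))\<^sup>2 \<partial>\<sigma>)"

definition H2_in :: "'g::complex_inner set \<Rightarrow> (complex \<Rightarrow> 'g) set"
  where "H2_in M = {f \<in> H2. \<forall>z\<in>ball 0 1. f z \<in> M}"

definition analytic_op :: "(complex \<Rightarrow> 'g::complex_inner \<Rightarrow>\<^sub>L 'g) \<Rightarrow> bool"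
  where "analytic_op F \<longleftrightarrow> analytic_disk F \<and> (\<forall>z\<in>ball 0 1. F z \<in> cbounded_ops)"

definition Hinf_op :: "(complex \<Rightarrow> 'g::complex_inner \<Rightarrow>\<^sub>L 'g) set"
  where "Hinf_op = {F. analytic_op F \<and> (\<exists>C. \<forall>z\<in>ball 0 1. norm (F z) \<le> C)}"

text \<open>Classical definition of a scalar outer function; \<open>k\<close> is \<open>log \<bar>\<phi>\<bar>\<close> on the circle.
  In particular \<open>\<phi>\<close> has no zeros.\<close>

definition scalar_outer :: "(complex \<Rightarrow> complex) \<Rightarrow> bool"
  where "scalar_outer \<phi> \<longleftrightarrow>
    (\<exists>\<alpha> k. cmod \<alpha> = 1 \<and> integrable \<sigma> (k :: complex \<Rightarrow> real) \<and>
      (\<forall>z\<in>ball 0 1. \<phi> z = \<alpha> * exp (\<integral>\<zeta>. (\<zeta> + z) / (\<zeta> - z) * of_real (k \<zeta>) \<partial>\<sigma>)))"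

definition bounded_scalar_outer :: "(complex \<Rightarrow> complex) \<Rightarrow> bool"
  where "bounded_scalar_outer \<phi> \<longleftrightarrow> scalar_outer \<phi> \<and> bounded (\<phi> ` ball 0 1)"

definition Nplus_op :: "(complex \<Rightarrow> 'g::complex_inner \<Rightarrow>\<^sub>L 'g) set"
  where "Nplus_op = {F. analytic_op F \<and>
    (\<exists>\<phi>. bounded_scalar_outer \<phi> \<and> (\<lambda>z. \<phi> z *\<^sub>C F z) \<in> Hinf_op)}"

definition outer_Hinf :: "(complex \<Rightarrow> 'g::complex_inner \<Rightarrow>\<^sub>L 'g) \<Rightarrow> bool"
  where "outer_Hinf F \<longleftrightarrow> F \<in> Hinf_op \<and>
    (\<exists>M. closed_csubspace M \<and>
      (\<forall>f\<in>H2. (\<lambda>z. blinfun_apply (F z) (f z)) \<in> H2_in M) \<and>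
      (\<forall>h\<in>H2_in M. \<forall>\<epsilon>>0. \<exists>f\<in>H2. H2_norm (\<lambda>z. h z - blinfun_apply (F z) (f z)) < \<epsilon>))"

definition outer_Nplus :: "(complex \<Rightarrow> 'g::complex_inner \<Rightarrow>\<^sub>L 'g) \<Rightarrow> bool"
  where "outer_Nplus F \<longleftrightarrow> F \<in> Nplus_op \<and>
    (\<exists>\<phi>. bounded_scalar_outer \<phi> \<and> outer_Hinf (\<lambda>z. \<phi> z *\<^sub>C F z))"

section \<open>Boundary functions and factorability\<close>

definition stolz_region :: "real \<Rightarrow> complex \<Rightarrow> complex set"
  where "stolz_region a \<zeta> = {z \<in> ball 0 1. cmod (z - \<zeta>) < a * (1 - cmod z)}"

definition nontangential_limit :: "(complex \<Rightarrow> 'b::topological_space) \<Rightarrow> complex \<Rightarrow> 'b \<Rightarrow> bool"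
  where "nontangential_limit f \<zeta> l \<longleftrightarrow>
    (\<forall>a>1. (f \<longlongrightarrow> l) (at \<zeta> within stolz_region a \<zeta>))"

text \<open>\<open>\<Phi>\<close> is (a representative of) the nontangential boundary function of \<open>F\<close>, in the strong
  operator topology.\<close>

definition has_boundary_op ::
    "(complex \<Rightarrow> 'g::complex_inner \<Rightarrow>\<^sub>L 'g) \<Rightarrow> (complex \<Rightarrow> 'g \<Rightarrow>\<^sub>L 'g) \<Rightarrow> bool"
  where "has_boundary_op F \<Phi> \<longleftrightarrow>
    (AE \<zeta> in \<sigma>. \<forall>u. nontangential_limit (\<lambda>z. blinfun_apply (F z) u) \<zeta> (blinfun_apply (\<Phi> \<zeta>) u))"

text \<open>Membership of a function given on the circle in \<open>Hinf_op\<close>, under the identification of a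
  Hardy class function with its boundary function.\<close>

definition Hinf_op_boundary :: "(complex \<Rightarrow> 'g::complex_inner \<Rightarrow>\<^sub>L 'g) set"
  where "Hinf_op_boundary = {\<Phi>. \<exists>H\<in>Hinf_op. has_boundary_op H \<Phi>}"

text \<open>\<open>F = G\<^sup>* G\<close> a.e. on the circle, where \<open>\<Gamma>\<close> is the boundary function of \<open>G\<close>.\<close>

definition factorization ::
    "(complex \<Rightarrow> 'g::chilbert_space \<Rightarrow>\<^sub>L 'g) \<Rightarrow> (complex \<Rightarrow> 'g \<Rightarrow>\<^sub>L 'g)
      \<Rightarrow> (complex \<Rightarrow> 'g \<Rightarrow>\<^sub>L 'g) \<Rightarrow> bool"
  where "factorization F G \<Gamma> \<longleftrightarrow>
    has_boundary_op G \<Gamma> \<and> (AE \<zeta> in \<sigma>. F \<zeta> = cadjoint (\<Gamma> \<zeta>) o\<^sub>L \<Gamma> \<zeta>)"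

definition factorable :: "(complex \<Rightarrow> 'g::chilbert_space \<Rightarrow>\<^sub>L 'g) \<Rightarrow> bool"
  where "factorable F \<longleftrightarrow>
    weakly_measurable_op F \<and> (AE \<zeta> in \<sigma>. nonneg_op (F \<zeta>)) \<and>
    (\<exists>G\<in>Nplus_op. \<exists>\<Gamma>. factorization F G \<Gamma>)"

end

theory Submission
  imports Defs "HOL-Complex_Analysis.Complex_Analysis"
begin

text \<open>
  Consider in the Hilbert space \<open>L2\<close> of square-integrable functions on the circle the elements
  \<open>x u = F\<^sup>1\<^sup>/\<^sup>2 u\<close> and the isometry \<open>U\<close> of multiplication by the coordinate \<open>\<zeta>\<close>. The inner product of
  \<open>U\<^sup>k (x u)\<close> and \<open>x v\<close> is the integral of \<open>\<zeta>\<^sup>k \<langle>F u, v\<rangle>\<close>, a Fourier coefficient of \<open>F\<close>. Let \<open>K n\<close> be the closed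
  span of the \<open>U\<^sup>k (x u)\<close> with \<open>k \<ge> n\<close>. If the \<open>K n\<close> have intersection \<open>0\<close>, the Wold decomposition of \<open>U\<close> on
  \<open>K 0\<close> provides operators \<open>A n\<close> such that the sum over \<open>n\<close> of \<open>\<langle>A n u, A (n + k) v\<rangle>\<close> is this Fourier
  coefficient (\<open>pure_isometry_factorization\<close>). Then \<open>G z = \<Sum>\<^sub>n z\<^sup>n A n\<close> is bounded and analytic, and its boundary
  function \<open>\<Gamma>\<close> satisfies \<open>\<Gamma>\<^sup>* \<Gamma> = F\<close>, since both sides have the same Fourier coefficients.

  The hypotheses on \<open>\<psi>\<close> yield the trivial intersection. Multiplication by \<open>\<psi> F\<^sup>1\<^sup>/\<^sup>2\<close> takes \<open>U\<^sup>k (x u)\<close> to \<open>\<zeta>\<^sup>k \<psi> F u\<close>,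
  the boundary function of an analytic function with a zero of order at least \<open>k\<close> at the origin. For \<open>w\<close> in every
  \<open>K n\<close> all Fourier coefficients of \<open>\<psi> F\<^sup>1\<^sup>/\<^sup>2 w\<close> therefore vanish, so \<open>\<psi> F\<^sup>1\<^sup>/\<^sup>2 w = 0\<close>. As the values of
  \<open>F\<^sup>1\<^sup>/\<^sup>2 w\<close> lie in the closure of the range of \<open>F\<close>, where \<open>\<psi>\<close> is injective, \<open>F\<^sup>1\<^sup>/\<^sup>2 w = 0\<close>. This makes \<open>w\<close>
  orthogonal to \<open>K 0\<close>, hence \<open>w = 0\<close> (\<open>analytic_factorization_exists\<close>).

  For an outer factor \<open>G\<close> with boundary function \<open>\<Gamma>\<close> there are a scalar \<open>\<phi>\<close> and a closed subspace \<open>M\<close> such that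
  the functions \<open>\<phi> G f\<close>, with \<open>f\<close> in \<open>H2\<close>, are dense among the \<open>H2\<close> functions with values in \<open>M\<close>. On the circle
  \<open>\<psi> \<Gamma>\<^sup>* (\<phi> \<Gamma> f) = \<phi> \<psi> F f\<close> is the boundary function of an \<open>H2\<close> function. Approximating constants shows that
  \<open>\<psi> \<Gamma>\<^sup>*\<close> has no Fourier coefficients of negative index, and a bounded function with this property
  belongs to \<open>Hinf_op_boundary\<close> (\<open>outer_factor_mult_cadjoint_Hinf\<close>).

  Three analytic facts support this. Power series with square-summable coefficients in a
  separable Hilbert space have nontangential boundary functions (\<open>fatou_ex\<close>): the Hardy-Littlewood maximal inequality
  on the circle, obtained from Vitali's covering lemma, controls the oscillation of a sparse subsequence of partial
  sums in Stolz regions. An integrable function is determined by its Fourier coefficients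
  (\<open>fourier_null_AE_eq_0\<close>). A nonnegative operator has a square root that is the limit of an iteration and so
  depends measurably on the operator (\<open>measurable_square_root\<close>).
\<close>

section \<open>Complex Hilbert spaces\<close>

instance chilbert_space \<subseteq> banach ..

lemma cinner_scaleC_right: "cinner x (a *\<^sub>C y) = cnj a * cinner x (y::'a::complex_inner)"
  by (metis cinner_commute cinner_scaleC_left complex_cnj_mult)

lemma cinner_add_right: "cinner x (y + z) = cinner x y + cinner x (z::'a::complex_inner)"
  by (metis cinner_add_left cinner_commute complex_cnj_add)

lemma Im_cinner: "Im (cinner x y) = inner x (\<i> *\<^sub>C (y::'a::complex_inner))"
  by (simp add: inner_eq_Re_cinner cinner_scaleC_right)

lemma cinner_eq_inner: "cinner x y = Complex (inner x y) (inner x (\<i> *\<^sub>C (y::'a::complex_inner)))"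
  by (simp add: complex_eq_iff Im_cinner inner_eq_Re_cinner)

lemma cinner_self: "cinner x x = complex_of_real ((norm (x::'a::complex_inner))\<^sup>2)"
proof -
  have "Im (cinner x x) = Im (cnj (cinner x x))"
    by (rule arg_cong[OF cinner_commute])
  then have "Im (cinner x x) = 0" by simp
  then show ?thesis
    by (simp add: complex_eq_iff dot_square_norm flip: inner_eq_Re_cinner)
qed

text \<open>The projection theorem below works with the real inner product; on complex subspaces the two
  notions of orthogonality agree.\<close>

lemma cinner_0_iff_inner: "(\<forall>c. inner x (c *\<^sub>C y) = 0) \<longleftrightarrow> cinner x (y::'a::complex_inner) = 0"
proof
  assume *: "\<forall>c. inner x (c *\<^sub>C y) = 0"
  have "inner x y = 0" using *[rule_format, of 1] scaleR_scaleC[of 1 y] by simp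
  moreover have "inner x (\<i> *\<^sub>C y) = 0" using * by blast
  ultimately show "cinner x y = 0" by (simp add: cinner_eq_inner complex_eq_iff)
qed (simp add: inner_eq_Re_cinner cinner_scaleC_right)

lemma norm_cinner_le: "cmod (cinner x y) \<le> norm x * norm (y::'a::complex_inner)"
proof (cases "cinner x y = 0")
  case False
  define u where "u = cnj (cinner x y) / cmod (cinner x y)"
  have u: "cmod u = 1" using False by (simp add: u_def norm_divide)
  have "u * cinner x y = (cmod (cinner x y))\<^sup>2 / cmod (cinner x y)"
    by (simp add: u_def complex_norm_square mult.commute del: of_real_power)
  then have "u * cinner x y = cmod (cinner x y)"
    by (simp add: power2_eq_square)
  then have "cmod (cinner x y) = Re (cinner (u *\<^sub>C x) y)"
    by (metis cinner_scaleC_left Re_complex_of_real)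
  also have "\<dots> = inner (u *\<^sub>C x) y" by (simp add: inner_eq_Re_cinner)
  also have "\<dots> \<le> norm (u *\<^sub>C x) * norm y" by (rule norm_cauchy_schwarz)
  finally show ?thesis using u by (simp add: norm_scaleC)
qed simp

lemma scaleC_0_0 [simp]: "0 *\<^sub>C (x::'a::complex_normed_vector) = 0"
  using norm_scaleC[of 0 x] by simp

lemma scaleC_1 [simp]: "1 *\<^sub>C (x::'a::complex_normed_vector) = x"
  using scaleR_scaleC[of 1 x] by simp

lemma bounded_bilinear_scaleC:
  "bounded_bilinear (\<lambda>(c::complex) (x::'a::complex_normed_vector). c *\<^sub>C x)"
proof
  show "(r *\<^sub>R a) *\<^sub>C b = r *\<^sub>R a *\<^sub>C b" for r a and b :: 'a
    by (simp add: scaleR_conv_of_real scaleC_scaleC scaleR_scaleC[of r "a *\<^sub>C b"])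
  show "a *\<^sub>C r *\<^sub>R b = r *\<^sub>R a *\<^sub>C b" for r a and b :: 'a
    by (simp add: scaleR_scaleC scaleC_scaleC mult.commute)
  show "\<exists>K. \<forall>a b::'a. norm (a *\<^sub>C b) \<le> norm a * norm b * K"
    by (rule exI[of _ 1]) (simp add: norm_scaleC)
qed (auto simp: scaleC_add_left scaleC_add_right)

interpretation scaleC: bounded_bilinear "\<lambda>(c::complex) (x::'a::complex_normed_vector). c *\<^sub>C x"
  by (rule bounded_bilinear_scaleC)

lemma bounded_bilinear_cinner: "bounded_bilinear (cinner :: 'a::complex_inner \<Rightarrow> 'a \<Rightarrow> complex)"
proof
  show "cinner (r *\<^sub>R a) b = r *\<^sub>R cinner a b" for r and a b :: 'a
    by (simp add: scaleR_scaleC[of r a] cinner_scaleC_left scaleR_conv_of_real)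
  show "cinner a (r *\<^sub>R b) = r *\<^sub>R cinner a b" for r and a b :: 'a
    by (simp add: scaleR_scaleC[of r b] cinner_scaleC_right scaleR_conv_of_real)
  show "\<exists>K. \<forall>a b::'a. norm (cinner a b) \<le> norm a * norm b * K"
    by (rule exI[of _ 1]) (simp add: norm_cinner_le)
qed (auto simp: cinner_add_left cinner_add_right)

interpretation cinner: bounded_bilinear "cinner :: 'a::complex_inner \<Rightarrow> 'a \<Rightarrow> complex"
  by (rule bounded_bilinear_cinner)

lemma cinner_ext:
  assumes "\<And>v. cinner x v = cinner y (v::'a::complex_inner)"
  shows "x = y"
proof -
  have "cinner (x - y) (x - y) = 0" using assms by (simp add: cinner.diff_left)
  then show ?thesis by (simp add: cinner_self)
qed

lemma cinner_ext_right:
  assumes "\<And>v. cinner v x = cinner v (y::'a::complex_inner)"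
  shows "x = y"
proof -
  have "cinner (x - y) (x - y) = 0" using assms by (simp add: cinner.diff_right)
  then show ?thesis by (simp add: cinner_self)
qed

lemma norm_diff_sq:
  "(norm (x - y))\<^sup>2 = (norm x)\<^sup>2 + (norm y)\<^sup>2 - 2 * Re (cinner x (y::'a::complex_inner))"
  by (simp add: power2_norm_eq_inner inner_diff_left inner_diff_right inner_commute
      flip: inner_eq_Re_cinner)

lemma norm_add_sq_le: "(norm (x + y))\<^sup>2 \<le> 2 * (norm x)\<^sup>2 + 2 * (norm (y::'a::real_normed_vector))\<^sup>2"
proof -
  have "(norm (x + y))\<^sup>2 \<le> (norm x + norm y)\<^sup>2"
    by (intro power_mono norm_triangle_ineq) auto
  also have "\<dots> \<le> 2 * (norm x)\<^sup>2 + 2 * (norm y)\<^sup>2"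
    using sum_squares_bound[of "norm x" "norm y"] by (simp add: power2_sum)
  finally show ?thesis .
qed

lemma norm_diff_sq_le: "(norm (x - y))\<^sup>2 \<le> 2 * (norm x)\<^sup>2 + 2 * (norm (y::'a::real_normed_vector))\<^sup>2"
  using norm_add_sq_le[of x "- y"] by simp

subsection \<open>Closed subspaces and orthogonal projections\<close>

lemma closed_csubspaceD:
  assumes "closed_csubspace M"
  shows "closed M" "0 \<in> M" "x \<in> M \<Longrightarrow> y \<in> M \<Longrightarrow> x + y \<in> M" "x \<in> M \<Longrightarrow> c *\<^sub>C x \<in> M"
  using assms by (auto simp: closed_csubspace_def)

lemma closed_csubspace_diff:
  assumes "closed_csubspace M" "x \<in> M" "y \<in> M"
  shows "x - y \<in> M"
proof -
  have "x + (- 1) *\<^sub>C y \<in> M" by (intro closed_csubspaceD[OF assms(1)] assms)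
  then show ?thesis by (simp add: scaleC.minus_left)
qed

lemma closed_csubspace_scaleR:
  assumes "closed_csubspace M" "x \<in> M"
  shows "r *\<^sub>R x \<in> M"
  using closed_csubspaceD(4)[OF assms] by (simp add: scaleR_scaleC)

lemma closed_csubspace_sum:
  assumes "closed_csubspace M" "\<And>i. i \<in> I \<Longrightarrow> f i \<in> M"
  shows "sum f I \<in> M"
  using assms(2) by (induction I rule: infinite_finite_induct) (auto intro: closed_csubspaceD[OF assms(1)])

text \<open>By the parallelogram identity a minimizing sequence for the distance to \<open>M\<close> is Cauchy. The
  remainder at the closest point is orthogonal to \<open>M\<close>, since otherwise a small step inside \<open>M\<close> would
  come closer.\<close>

theorem orthogonal_projection:
  fixes x :: "'h::chilbert_space"
  assumes M: "closed_csubspace M"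
  obtains p where "p \<in> M" "\<And>m. m \<in> M \<Longrightarrow> cinner (x - p) m = 0"
proof -
  define d where "d = infdist x M"
  have ne: "M \<noteq> {}" using closed_csubspaceD(2)[OF M] by auto
  have d_le: "d \<le> norm (x - m)" if "m \<in> M" for m
    using infdist_le[OF that, of x] by (simp add: d_def dist_norm)
  have d0: "0 \<le> d" by (simp add: d_def infdist_nonneg)
  have "\<exists>m\<in>M. norm (x - m) < d + 1 / real (Suc n)" for n
  proof -
    have "\<exists>m\<in>M. dist x m < d + 1 / real (Suc n)"
    proof (rule ccontr)
      assume "\<not> ?thesis"
      then have "d + 1 / real (Suc n) \<le> (INF m\<in>M. dist x m)"
        by (intro cINF_greatest[OF ne]) (auto simp: not_less)
      also have "\<dots> = d" using ne by (simp add: d_def infdist_def)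
      finally show False by simp
    qed
    then show ?thesis by (simp add: dist_norm)
  qed
  then obtain m where m: "\<And>n. m n \<in> M" "\<And>n. norm (x - m n) < d + 1 / real (Suc n)"
    by metis
  have lim: "(\<lambda>n. 4 * (d + 1 / real (Suc n))\<^sup>2) \<longlonglongrightarrow> 4 * (d + 0)\<^sup>2"
  proof -
    have "(\<lambda>n. 1 / real (Suc n)) \<longlonglongrightarrow> 0"
      using LIMSEQ_inverse_real_of_nat by (simp add: inverse_eq_divide)
    then show ?thesis by (intro tendsto_mult tendsto_power tendsto_add tendsto_const)
  qed
  have est: "(norm (m i - m j))\<^sup>2 \<le> 4 * (d + 1 / real (Suc N))\<^sup>2 - 4 * d\<^sup>2" if "i \<ge> N" "j \<ge> N" for i j N
  proof -
    have mid: "(1/2) *\<^sub>R (m i + m j) \<in> M"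
      by (intro closed_csubspace_scaleR[OF M] closed_csubspaceD(3)[OF M] m)
    have "d \<le> norm (x - (1/2) *\<^sub>R (m i + m j))" by (rule d_le[OF mid])
    then have 1: "d\<^sup>2 \<le> (norm (x - (1/2) *\<^sub>R (m i + m j)))\<^sup>2" using d0 by (rule power_mono)
    have up: "(norm (x - m k))\<^sup>2 \<le> (d + 1 / real (Suc N))\<^sup>2" if "k \<ge> N" for k
    proof (rule power_mono)
      have "1 / real (Suc k) \<le> 1 / real (Suc N)" using that by (simp add: frac_le)
      then show "norm (x - m k) \<le> d + 1 / real (Suc N)" using m(2)[of k] by linarith
    qed simp
    define a b where "a = x - m i" and "b = x - m j"
    have "a + b = 2 *\<^sub>R x - (m i + m j)" by (simp add: a_def b_def scaleR_2)
    then have "x - (1/2) *\<^sub>R (m i + m j) = (1/2) *\<^sub>R (a + b)" by (simp add: scaleR_right_diff_distrib)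
    then have n: "norm (x - (1/2) *\<^sub>R (m i + m j)) = norm (a + b) / 2" by simp
    have "m i - m j = b - a" by (simp add: a_def b_def)
    then have "(norm (m i - m j))\<^sup>2 + (norm (a + b))\<^sup>2 = 2 * (norm a)\<^sup>2 + 2 * (norm b)\<^sup>2"
      by (simp add: power2_norm_eq_inner inner_diff_left inner_diff_right
          inner_add_left inner_add_right inner_commute)
    then have "(norm (m i - m j))\<^sup>2 + 4 * (norm (x - (1/2) *\<^sub>R (m i + m j)))\<^sup>2
        = 2 * (norm (x - m i))\<^sup>2 + 2 * (norm (x - m j))\<^sup>2"
      by (simp add: n a_def[symmetric] b_def[symmetric] power_divide)
    with 1 up[OF that(1)] up[OF that(2)] show ?thesis by linarith
  qed
  have "Cauchy m"
  proof (rule metric_CauchyI)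
    fix e :: real assume e: "e > 0"
    have "\<forall>\<^sub>F n in sequentially. 4 * (d + 1 / real (Suc n))\<^sup>2 < 4 * d\<^sup>2 + e\<^sup>2"
      using e by (intro order_tendstoD(2)[OF lim]) simp
    then obtain N where N: "4 * (d + 1 / real (Suc N))\<^sup>2 < 4 * d\<^sup>2 + e\<^sup>2"
      unfolding eventually_sequentially by blast
    have "dist (m i) (m j) < e" if "i \<ge> N" "j \<ge> N" for i j
    proof -
      have "(norm (m i - m j))\<^sup>2 < e\<^sup>2" using est[OF that] N by linarith
      then show ?thesis using e by (auto simp: dist_norm intro: power2_less_imp_less)
    qed
    then show "\<exists>N. \<forall>i\<ge>N. \<forall>j\<ge>N. dist (m i) (m j) < e" by blast
  qed
  then obtain p where p: "m \<longlonglongrightarrow> p" by (auto simp: Cauchy_convergent_iff convergent_def)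
  have pM: "p \<in> M"
    by (rule closed_sequentially[OF closed_csubspaceD(1)[OF M] m(1) p])
  have "norm (x - p) \<le> d"
  proof (rule LIMSEQ_le)
    show "(\<lambda>n. norm (x - m n)) \<longlonglongrightarrow> norm (x - p)" by (intro tendsto_intros p)
    show "(\<lambda>n. d + 1 / real (Suc n)) \<longlonglongrightarrow> d"
      using tendsto_add[OF tendsto_const LIMSEQ_inverse_real_of_nat, of d] by (simp add: inverse_eq_divide)
    show "\<exists>N. \<forall>n\<ge>N. norm (x - m n) \<le> d + 1 / real (Suc n)" using m(2) less_imp_le by blast
  qed
  then have min: "norm (x - p) \<le> norm (x - q)" if "q \<in> M" for q
    using d_le[OF that] by linarith
  have orth: "inner (x - p) y = 0" if y: "y \<in> M" for y
  proof (rule ccontr)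
    assume nz: "inner (x - p) y \<noteq> 0"
    then have y0: "norm y \<noteq> 0" by auto
    define t where "t = inner (x - p) y / (norm y)\<^sup>2"
    have "p + t *\<^sub>R y \<in> M" by (intro closed_csubspaceD(3)[OF M] pM closed_csubspace_scaleR[OF M] y)
    then have "(norm (x - p))\<^sup>2 \<le> (norm (x - (p + t *\<^sub>R y)))\<^sup>2"
      by (intro power_mono min) auto
    also have "\<dots> = (norm (x - p - t *\<^sub>R y))\<^sup>2" by (simp add: algebra_simps)
    also have "\<dots> = (norm (x - p))\<^sup>2 - 2 * t * inner (x - p) y + t\<^sup>2 * (norm y)\<^sup>2"
    proof -
      have "(norm (u - t *\<^sub>R y))\<^sup>2 = (norm u)\<^sup>2 - 2 * t * inner u y + t\<^sup>2 * (norm y)\<^sup>2" for u :: 'h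
        unfolding power2_norm_eq_inner
        by (simp add: inner_diff_left inner_diff_right inner_commute power2_eq_square)
      then show ?thesis .
    qed
    also have "\<dots> = (norm (x - p))\<^sup>2 - (inner (x - p) y)\<^sup>2 / (norm y)\<^sup>2"
      using y0 by (simp add: t_def power2_eq_square field_simps)
    finally show False using nz y0 by (simp add: divide_le_0_iff)
  qed
  show ?thesis
  proof (rule that[OF pM])
    show "cinner (x - p) y = 0" if "y \<in> M" for y
      using orth closed_csubspaceD(4)[OF M that] by (simp flip: cinner_0_iff_inner)
  qed
qed

text \<open>Working with the smallest closed subspace instead of explicit linear combinations reduces
  statements about a closed span to statements about its generators.\<close>

definition cclspan :: "'h::complex_normed_vector set \<Rightarrow> 'h set"
  where "cclspan S = \<Inter>{M. closed_csubspace M \<and> S \<subseteq> M}"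

lemma closed_csubspace_cclspan: "closed_csubspace (cclspan S)"
  unfolding cclspan_def closed_csubspace_def by (auto intro!: closed_Inter)

lemma cclspan_superset: "x \<in> S \<Longrightarrow> x \<in> cclspan S"
  by (auto simp: cclspan_def)

lemma cclspan_minimal: "closed_csubspace M \<Longrightarrow> S \<subseteq> M \<Longrightarrow> cclspan S \<subseteq> M"
  by (auto simp: cclspan_def)

lemma closed_csubspace_vimage:
  assumes "closed_csubspace M" "bounded_linear f" "\<And>c x. f (c *\<^sub>C x) = c *\<^sub>C f x"
  shows "closed_csubspace (f -` M)"
proof -
  interpret f: bounded_linear f by fact
  have "closed (f -` M)"
    by (intro closed_vimage closed_csubspaceD(1)[OF assms(1)] f.continuous_on continuous_on_id)
  then show ?thesis
    unfolding closed_csubspace_def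
    using closed_csubspaceD[OF assms(1)] by (auto simp: f.zero f.add assms(3))
qed

lemma closed_csubspace_0: "closed_csubspace {0}"
  by (auto simp: closed_csubspace_def scaleC.zero_right)

lemma closed_csubspace_orth: "closed_csubspace {x::'h::complex_inner. cinner x y = 0}"
proof -
  have "bounded_linear (\<lambda>x. cinner x y)" by (rule cinner.bounded_linear_left)
  then have "closed_csubspace ((\<lambda>x. cinner x y) -` {0})"
    by (intro closed_csubspace_vimage closed_csubspace_0) (auto simp: cinner_scaleC_left scaleC_complex_def)
  then show ?thesis by (simp add: vimage_def)
qed

lemma cinner_eq_0_commute: "cinner x y = 0 \<longleftrightarrow> cinner y (x::'h::complex_inner) = 0"
  by (metis cinner_commute complex_cnj_zero)

lemma cclspan_orth:
  assumes "x \<in> cclspan S" "\<And>s. s \<in> S \<Longrightarrow> cinner s y = 0"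
  shows "cinner x (y::'h::complex_inner) = 0"
  using cclspan_minimal[OF closed_csubspace_orth, of S y] assms by auto

lemma cclspan_orth_right:
  assumes "x \<in> cclspan S" "\<And>s. s \<in> S \<Longrightarrow> cinner y s = 0"
  shows "cinner y (x::'h::complex_inner) = 0"
  using cclspan_orth[of x S y] assms by (metis cinner_eq_0_commute)

lemma cclspan_image:
  assumes "x \<in> cclspan S" "bounded_linear f" "\<And>c x. f (c *\<^sub>C x) = c *\<^sub>C f x"
    "\<And>s. s \<in> S \<Longrightarrow> f s \<in> M" "closed_csubspace M"
  shows "f x \<in> M"
  using cclspan_minimal[OF closed_csubspace_vimage[OF assms(5,2,3)], of S] assms(1,4) by auto

subsection \<open>Riesz representation and adjoints\<close>

text \<open>The orthogonal complement of the kernel is spanned by one vector \<open>e\<close>, and the representing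
  vector is a multiple of it.\<close>

theorem Riesz_representation:
  fixes \<phi> :: "'h::chilbert_space \<Rightarrow> complex"
  assumes bl: "bounded_linear \<phi>" and lin: "\<And>c x. \<phi> (c *\<^sub>C x) = c * \<phi> x"
  obtains y where "\<And>x. \<phi> x = cinner x y"
proof (cases "\<forall>x. \<phi> x = 0")
  case True
  then show ?thesis by (intro that[of 0]) (simp add: cinner.zero_right)
next
  case False
  then obtain x where x: "\<phi> x \<noteq> 0" by blast
  interpret bounded_linear \<phi> by fact
  have N: "closed_csubspace (\<phi> -` {0})"
    by (intro closed_csubspace_vimage closed_csubspace_0 bl) (auto simp: lin scaleC_complex_def)
  obtain p where p: "p \<in> \<phi> -` {0}" "\<And>m. m \<in> \<phi> -` {0} \<Longrightarrow> cinner (x - p) m = 0"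
    by (rule orthogonal_projection[OF N, of x]) blast
  define e where "e = x - p"
  have e: "\<phi> e = \<phi> x" using p(1) by (simp add: e_def diff)
  have e0: "norm e \<noteq> 0" using e x zero by auto
  define y where "y = (cnj (\<phi> e) / (norm e)\<^sup>2) *\<^sub>C e"
  have "\<phi> z = cinner z y" for z
  proof -
    have "\<phi> (z - (\<phi> z / \<phi> e) *\<^sub>C e) = 0" using e x by (simp add: diff lin)
    then have "cinner e (z - (\<phi> z / \<phi> e) *\<^sub>C e) = 0" using p(2) by (simp add: e_def)
    then have "cinner (z - (\<phi> z / \<phi> e) *\<^sub>C e) e = 0" by (metis cinner_eq_0_commute)
    then have "cinner z e = \<phi> z / \<phi> e * (norm e)\<^sup>2"
      by (simp add: cinner.diff_left cinner_scaleC_left cinner_self)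
    then show ?thesis using e0 e x by (simp add: y_def cinner_scaleC_right)
  qed
  then show ?thesis by (rule that)
qed

lemma blinfun_cadjoint_exists:
  fixes A :: "'h::chilbert_space \<Rightarrow>\<^sub>L 'h"
  assumes A: "A \<in> cbounded_ops"
  shows "\<exists>B. B \<in> cbounded_ops \<and> norm B \<le> norm A \<and>
    (\<forall>x y. cinner (blinfun_apply A x) y = cinner x (blinfun_apply B y))"
proof -
  have lin: "blinfun_apply A (c *\<^sub>C x) = c *\<^sub>C blinfun_apply A x" for c x
    using A by (auto simp: cbounded_ops_def)
  have "\<exists>z. \<forall>x. cinner (blinfun_apply A x) y = cinner x z" for y
  proof -
    have "bounded_linear (\<lambda>x. cinner (blinfun_apply A x) y)"
      by (intro bounded_linear_compose[OF cinner.bounded_linear_left] blinfun.bounded_linear_right)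
    then obtain z where "\<And>x. cinner (blinfun_apply A x) y = cinner x z"
      by (rule Riesz_representation) (auto simp: lin cinner_scaleC_left)
    then show ?thesis by blast
  qed
  then obtain b where b: "\<And>x y. cinner (blinfun_apply A x) y = cinner x (b y)" by metis
  have scal: "b (c *\<^sub>C x) = c *\<^sub>C b x" for c x
    by (rule cinner_ext_right) (simp add: b[symmetric] cinner_scaleC_right)
  have bnd: "norm (b y) \<le> norm y * norm A" for y
  proof -
    have "(norm (b y))\<^sup>2 = Re (cinner (b y) (b y))" by (simp add: cinner_self)
    also have "\<dots> = Re (cinner (blinfun_apply A (b y)) y)" by (simp add: b)
    also have "\<dots> \<le> norm (blinfun_apply A (b y)) * norm y"
      using norm_cinner_le complex_Re_le_cmod order_trans by blast
    also have "\<dots> \<le> norm A * norm (b y) * norm y"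
      by (intro mult_right_mono norm_blinfun) auto
    finally have "norm (b y) * norm (b y) \<le> (norm y * norm A) * norm (b y)"
      by (simp add: power2_eq_square mult_ac)
    then show ?thesis by (cases "norm (b y) = 0") (auto dest: mult_right_le_imp_le)
  qed
  have bl: "bounded_linear b"
  proof (rule bounded_linear_intro[where K="norm A"])
    show "b (x + y) = b x + b y" for x y by (rule cinner_ext_right) (simp add: b[symmetric] cinner_add_right)
    show "b (r *\<^sub>R x) = r *\<^sub>R b x" for r x by (simp add: scaleR_scaleC scal)
  qed (rule bnd)
  show ?thesis
  proof (intro exI[of _ "Blinfun b"] conjI allI)
    show "norm (Blinfun b) \<le> norm A"
      by (rule norm_blinfun_bound) (auto simp: bounded_linear_Blinfun_apply[OF bl] bnd mult.commute)
  qed (auto simp: cbounded_ops_def bounded_linear_Blinfun_apply[OF bl] scal b)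
qed

lemma
  fixes A :: "'h::chilbert_space \<Rightarrow>\<^sub>L 'h"
  assumes A: "A \<in> cbounded_ops"
  shows cadjoint_in_cbounded_ops: "cadjoint A \<in> cbounded_ops"
    and norm_cadjoint_le: "norm (cadjoint A) \<le> norm A"
    and cinner_cadjoint: "cinner (blinfun_apply A x) y = cinner x (blinfun_apply (cadjoint A) y)"
proof -
  obtain B where B: "B \<in> cbounded_ops" "norm B \<le> norm A"
    "\<forall>x y. cinner (blinfun_apply A x) y = cinner x (blinfun_apply B y)"
    using blinfun_cadjoint_exists[OF A] by blast
  have "cadjoint A = B"
    unfolding cadjoint_def
  proof (rule the_equality)
    show "\<forall>x y. cinner (blinfun_apply A x) y = cinner x (blinfun_apply B y)" by (rule B(3))
  next
    fix C assume C: "\<forall>x y. cinner (blinfun_apply A x) y = cinner x (blinfun_apply C y)"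
    show "C = B"
      by (rule blinfun_eqI, rule cinner_ext_right) (simp flip: B(3)[rule_format] C[rule_format])
  qed
  with B show "cadjoint A \<in> cbounded_ops" "norm (cadjoint A) \<le> norm A"
    "cinner (blinfun_apply A x) y = cinner x (blinfun_apply (cadjoint A) y)" by auto
qed

lemma cbounded_opsD: "A \<in> cbounded_ops \<Longrightarrow> blinfun_apply A (c *\<^sub>C x) = c *\<^sub>C blinfun_apply A x"
  by (auto simp: cbounded_ops_def)

section \<open>Orthonormal systems\<close>

text \<open>Zero vectors are admitted in an orthonormal system, so that the Gram-Schmidt process keeps the
  indices of the vectors it starts from, without a case distinction on the dimension.\<close>

definition orthosys :: "(nat \<Rightarrow> 'h::complex_inner) \<Rightarrow> bool"
  where "orthosys b \<longleftrightarrow> (\<forall>i j. i \<noteq> j \<longrightarrow> cinner (b i) (b j) = 0) \<and> (\<forall>i. norm (b i) = 0 \<or> norm (b i) = 1)"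

lemma orthosysD:
  assumes "orthosys b"
  shows "i \<noteq> j \<Longrightarrow> cinner (b i) (b j) = 0" "norm (b i) = 0 \<or> norm (b i) = 1" "norm (b i) \<le> 1"
proof -
  show *: "norm (b i) = 0 \<or> norm (b i) = 1" and "i \<noteq> j \<Longrightarrow> cinner (b i) (b j) = 0"
    using assms unfolding orthosys_def by blast+
  from * show "norm (b i) \<le> 1" by linarith
qed

lemma cinner_orthosys_self: "orthosys b \<Longrightarrow> cinner (b i) (b i) *\<^sub>C b i = b i"
  using orthosysD(2)[of b i] by (auto simp: cinner_self)

lemma norm_sum_orthosys:
  assumes b: "orthosys b" and fin: "finite I"
  shows "(norm (\<Sum>i\<in>I. c i *\<^sub>C b i))\<^sup>2 = (\<Sum>i\<in>I. (cmod (c i))\<^sup>2 * (norm (b i))\<^sup>2)"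
proof -
  have "complex_of_real ((norm (\<Sum>i\<in>I. c i *\<^sub>C b i))\<^sup>2) = (\<Sum>i\<in>I. \<Sum>j\<in>I. c i * cnj (c j) * cinner (b i) (b j))"
    unfolding cinner_self[symmetric] cinner.sum_left cinner.sum_right
    by (subst sum.swap) (simp add: cinner_scaleC_left cinner_scaleC_right mult_ac)
  also have "\<dots> = (\<Sum>i\<in>I. \<Sum>j\<in>I. if j = i then c i * cnj (c i) * cinner (b i) (b i) else 0)"
    by (intro sum.cong refl) (auto simp: orthosysD(1)[OF b])
  also have "\<dots> = (\<Sum>i\<in>I. c i * cnj (c i) * cinner (b i) (b i))" using fin by (simp add: sum.delta)
  also have "\<dots> = complex_of_real (\<Sum>i\<in>I. (cmod (c i))\<^sup>2 * (norm (b i))\<^sup>2)"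
    by (simp add: cinner_self complex_norm_square[symmetric])
  finally show ?thesis by (simp only: of_real_eq_iff)
qed

lemma norm_sum_orthosys_le:
  assumes b: "orthosys b" and fin: "finite I"
  shows "(norm (\<Sum>i\<in>I. c i *\<^sub>C b i))\<^sup>2 \<le> (\<Sum>i\<in>I. (cmod (c i))\<^sup>2)"
  unfolding norm_sum_orthosys[OF assms]
proof (rule sum_mono)
  fix i
  have "(norm (b i))\<^sup>2 \<le> 1" using orthosysD(2)[OF b, of i] by auto
  then show "(cmod (c i))\<^sup>2 * (norm (b i))\<^sup>2 \<le> (cmod (c i))\<^sup>2"
    using mult_left_mono[of "(norm (b i))\<^sup>2" 1 "(cmod (c i))\<^sup>2"] by simp
qed

lemma cinner_sum_orthosys:
  assumes b: "orthosys b"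
  shows "cinner (\<Sum>i<N. c i *\<^sub>C b i) (b j) = (if j < N then c j * cinner (b j) (b j) else 0)"
proof -
  have "cinner (\<Sum>i<N. c i *\<^sub>C b i) (b j) = (\<Sum>i<N. if i = j then c j * cinner (b j) (b j) else 0)"
    unfolding cinner.sum_left by (intro sum.cong refl) (auto simp: cinner_scaleC_left orthosysD(1)[OF b])
  then show ?thesis by simp
qed

lemma orthosys_bessel:
  assumes b: "orthosys b"
  shows "(\<Sum>i<N. (cmod (cinner y (b i)))\<^sup>2) \<le> (norm y)\<^sup>2"
proof -
  define s where "s = (\<Sum>i<N. cinner y (b i) *\<^sub>C b i)"
  have "cinner y s = (\<Sum>i<N. cnj (cinner y (b i)) * cinner y (b i))"
    by (simp add: s_def cinner.sum_right cinner_scaleC_right)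
  then have 1: "Re (cinner y s) = (\<Sum>i<N. (cmod (cinner y (b i)))\<^sup>2)"
  proof -
    have "cnj z * z = complex_of_real ((cmod z)\<^sup>2)" for z
      by (simp only: complex_norm_square mult.commute)
    then show ?thesis
      using \<open>cinner y s = _\<close> by (simp only: Re_sum Re_complex_of_real)
  qed
  have "0 \<le> (norm (y - s))\<^sup>2" by simp
  also have "\<dots> = (norm y)\<^sup>2 + (norm s)\<^sup>2 - 2 * Re (cinner y s)" by (rule norm_diff_sq)
  also have "(norm s)\<^sup>2 \<le> (\<Sum>i<N. (cmod (cinner y (b i)))\<^sup>2)"
    unfolding s_def by (rule norm_sum_orthosys_le[OF b]) simp
  finally show ?thesis using 1 by simp
qed

lemma orthosys_summable: "orthosys b \<Longrightarrow> summable (\<lambda>i. (cmod (cinner y (b i)))\<^sup>2)"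
  by (rule summableI_nonneg_bounded[OF _ orthosys_bessel]) auto

lemma summable_mult_cnj:
  assumes c: "summable (\<lambda>i. (cmod (c i))\<^sup>2)" and d: "summable (\<lambda>i. (cmod (d i))\<^sup>2)"
  shows "summable (\<lambda>i. norm (c i * cnj (d i)))"
proof (rule summable_comparison_test')
  show "summable (\<lambda>i. (cmod (c i))\<^sup>2 + (cmod (d i))\<^sup>2)" by (rule summable_add[OF c d])
  fix i
  have "0 \<le> cmod (c i) * cmod (d i)" by simp
  then have "cmod (c i) * cmod (d i) \<le> (cmod (c i))\<^sup>2 + (cmod (d i))\<^sup>2"
    using sum_squares_bound[of "cmod (c i)" "cmod (d i)"] by linarith
  then show "norm (norm (c i * cnj (d i))) \<le> (cmod (c i))\<^sup>2 + (cmod (d i))\<^sup>2"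
    by (simp add: norm_mult)
qed

lemma orthosys_series:
  fixes b :: "nat \<Rightarrow> 'h::chilbert_space"
  assumes b: "orthosys b" and c: "summable (\<lambda>i. (cmod (c i))\<^sup>2)"
  shows "summable (\<lambda>i. c i *\<^sub>C b i)"
  unfolding summable_Cauchy
proof (intro allI impI)
  fix e :: real assume e: "0 < e"
  from c[unfolded summable_Cauchy, rule_format, of "e\<^sup>2"] e
  obtain N where N: "\<forall>m\<ge>N. \<forall>n. norm (\<Sum>i=m..<n. (cmod (c i))\<^sup>2) < e\<^sup>2" by auto
  have "norm (\<Sum>i=m..<n. c i *\<^sub>C b i) < e" if "m \<ge> N" for m n
  proof -
    have "(norm (\<Sum>i=m..<n. c i *\<^sub>C b i))\<^sup>2 \<le> (\<Sum>i=m..<n. (cmod (c i))\<^sup>2)"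
      by (rule norm_sum_orthosys_le[OF b]) simp
    also have "\<dots> < e\<^sup>2" using N[rule_format, OF that, of n] by (simp add: sum_nonneg)
    finally show ?thesis using e by (intro power2_less_imp_less[of _ e]) auto
  qed
  then show "\<exists>N. \<forall>m\<ge>N. \<forall>n. norm (\<Sum>i=m..<n. c i *\<^sub>C b i) < e" by blast
qed

lemma orthosys_cinner_series:
  fixes b :: "nat \<Rightarrow> 'h::chilbert_space"
  assumes b: "orthosys b" and c: "summable (\<lambda>i. (cmod (c i))\<^sup>2)" and d: "summable (\<lambda>i. (cmod (d i))\<^sup>2)"
  shows "(\<lambda>i. c i * cnj (d i) * cinner (b i) (b i)) sums cinner (\<Sum>i. c i *\<^sub>C b i) (\<Sum>i. d i *\<^sub>C b i)"
proof -
  have "(\<lambda>N. cinner (\<Sum>i<N. c i *\<^sub>C b i) (\<Sum>i<N. d i *\<^sub>C b i)) \<longlonglongrightarrow> cinner (\<Sum>i. c i *\<^sub>C b i) (\<Sum>i. d i *\<^sub>C b i)"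
    by (intro cinner.tendsto summable_LIMSEQ orthosys_series b c d)
  moreover have "cinner (\<Sum>i<N. c i *\<^sub>C b i) (\<Sum>i<N. d i *\<^sub>C b i) = (\<Sum>i<N. c i * cnj (d i) * cinner (b i) (b i))" for N
  proof -
    have "cinner (\<Sum>i<N. c i *\<^sub>C b i) (\<Sum>i<N. d i *\<^sub>C b i) = (\<Sum>j<N. cnj (d j) * cinner (\<Sum>i<N. c i *\<^sub>C b i) (b j))"
      by (simp only: cinner.sum_right cinner_scaleC_right)
    also have "\<dots> = (\<Sum>j<N. cnj (d j) * (c j * cinner (b j) (b j)))"
      by (intro sum.cong refl) (simp add: cinner_sum_orthosys[OF b])
    finally show ?thesis by (simp add: mult_ac)
  qed
  ultimately show ?thesis by (simp add: sums_def)
qed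

text \<open>The expansion of \<open>y\<close> converges inside \<open>M\<close>, and its remainder is orthogonal to the whole system, so
  totality in \<open>M\<close> forces it to vanish.\<close>

theorem orthosys_parseval:
  fixes b :: "nat \<Rightarrow> 'h::chilbert_space"
  assumes b: "orthosys b" and M: "closed_csubspace M" "\<And>i. b i \<in> M" "y \<in> M"
    and total: "\<And>z. z \<in> M \<Longrightarrow> (\<And>i. cinner z (b i) = 0) \<Longrightarrow> z = 0"
  shows "(\<lambda>i. cinner y (b i) * cnj (cinner y' (b i))) sums cinner y y'"
proof -
  define s where "s = (\<Sum>i. cinner y (b i) *\<^sub>C b i)"
  have ser: "(\<lambda>N. \<Sum>i<N. cinner y (b i) *\<^sub>C b i) \<longlonglongrightarrow> s"
    unfolding s_def by (intro summable_LIMSEQ orthosys_series orthosys_summable b)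
  have sM: "s \<in> M"
    by (rule closed_sequentially[OF closed_csubspaceD(1)[OF M(1)] _ ser])
      (intro closed_csubspace_sum[OF M(1)] closed_csubspaceD(4)[OF M(1)] M(2))
  have "cinner (y - s) (b j) = 0" for j
  proof -
    have "(\<lambda>N. cinner (\<Sum>i<N. cinner y (b i) *\<^sub>C b i) (b j)) \<longlonglongrightarrow> cinner s (b j)"
      by (intro cinner.tendsto ser tendsto_const)
    moreover have "\<forall>\<^sub>F N in sequentially. cinner (\<Sum>i<N. cinner y (b i) *\<^sub>C b i) (b j) = cinner y (b j)"
      using eventually_gt_at_top[of j]
    proof eventually_elim
      case (elim N)
      have "cinner (\<Sum>i<N. cinner y (b i) *\<^sub>C b i) (b j) = cinner y (b j) * cinner (b j) (b j)"
        using elim by (simp add: cinner_sum_orthosys[OF b])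
      also have "\<dots> = cinner y (cinner (b j) (b j) *\<^sub>C b j)"
        by (simp add: cinner_scaleC_right cinner_self)
      finally show ?case by (simp add: cinner_orthosys_self[OF b])
    qed
    ultimately have "cinner s (b j) = cinner y (b j)"
      using tendsto_unique[OF sequentially_bot _ tendsto_eventually] by blast
    then show ?thesis by (simp add: cinner.diff_left)
  qed
  then have "y - s = 0" by (intro total closed_csubspace_diff M sM)
  then have "(\<lambda>N. cinner (\<Sum>i<N. cinner y (b i) *\<^sub>C b i) y') \<longlonglongrightarrow> cinner y y'"
    using ser by (intro cinner.tendsto tendsto_const) simp
  moreover have "cinner (\<Sum>i<N. cinner y (b i) *\<^sub>C b i) y' = (\<Sum>i<N. cinner y (b i) * cnj (cinner y' (b i)))" for N
    by (simp add: cinner.sum_left cinner_scaleC_left flip: cinner_commute)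
  ultimately show ?thesis by (simp add: sums_def)
qed

text \<open>As \<open>inverse 0 = 0\<close>, a vector that depends linearly on its predecessors is turned into the
  zero vector.\<close>

function gram_schmidt :: "(nat \<Rightarrow> 'h::complex_inner) \<Rightarrow> nat \<Rightarrow> 'h"
  where "gram_schmidt w n =
    (let r = w n - (\<Sum>j\<in>{..<n}. cinner (w n) (gram_schmidt w j) *\<^sub>C gram_schmidt w j) in inverse (norm r) *\<^sub>R r)"
  by pat_completeness auto
termination by (relation "Wellfounded.measure snd") auto

declare gram_schmidt.simps [simp del]

lemma gram_schmidt_norm:
  fixes w :: "nat \<Rightarrow> 'h::complex_inner"
  shows "norm (gram_schmidt w n) = 0 \<or> norm (gram_schmidt w n) = 1"
proof -
  have "norm (inverse (norm r) *\<^sub>R r) = 0 \<or> norm (inverse (norm r) *\<^sub>R r) = 1" for r :: 'h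
    by (cases "r = 0") simp_all
  then show ?thesis by (subst (1 2) gram_schmidt.simps) (simp only: Let_def)
qed

lemma gram_schmidt_orth_less: "j < n \<Longrightarrow> cinner (gram_schmidt w n) (gram_schmidt w j) = 0"
proof (induction n arbitrary: j rule: less_induct)
  case (less n)
  let ?g = "gram_schmidt w"
  define r where "r = w n - (\<Sum>k\<in>{..<n}. cinner (w n) (?g k) *\<^sub>C ?g k)"
  have *: "cinner (?g k) (?g j) = (if k = j then cinner (?g j) (?g j) else 0)" if "k < n" for k
    using less.IH[of k j] less.IH[of j k] that less.prems by (cases k j rule: linorder_cases) (auto simp: cinner_eq_0_commute)
  have "cinner (\<Sum>k\<in>{..<n}. cinner (w n) (?g k) *\<^sub>C ?g k) (?g j)
      = (\<Sum>k\<in>{..<n}. if k = j then cinner (w n) (?g j) * cinner (?g j) (?g j) else 0)"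
    unfolding cinner.sum_left cinner_scaleC_left
  proof (intro sum.cong refl)
    fix k assume "k \<in> {..<n}"
    then show "cinner (w n) (?g k) * cinner (?g k) (?g j)
        = (if k = j then cinner (w n) (?g j) * cinner (?g j) (?g j) else 0)"
      using *[of k] by (cases "k = j") simp_all
  qed
  also have "\<dots> = cinner (w n) (?g j) * cinner (?g j) (?g j)" using less.prems by simp
  also have "\<dots> = cinner (w n) (?g j)"
    using gram_schmidt_norm[of w j] by (auto simp: cinner_self cinner.zero_right)
  finally have "cinner r (?g j) = 0" by (simp add: r_def cinner.diff_left)
  moreover have "?g n = inverse (norm r) *\<^sub>R r" by (simp add: gram_schmidt.simps[of w n] r_def Let_def)
  ultimately show ?case by (simp add: cinner.scaleR_left)
qed

lemma orthosys_gram_schmidt: "orthosys (gram_schmidt w)"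
  unfolding orthosys_def using gram_schmidt_norm gram_schmidt_orth_less
  by (metis cinner_eq_0_commute linorder_neqE_nat)

lemma gram_schmidt_in:
  assumes M: "closed_csubspace M" and w: "\<And>k. w k \<in> M"
  shows "gram_schmidt w n \<in> M"
proof (induction n rule: less_induct)
  case (less n)
  show ?case
    unfolding gram_schmidt.simps[of w n] Let_def
    by (intro closed_csubspace_scaleR[OF M] closed_csubspace_diff[OF M] closed_csubspace_sum[OF M]
        closed_csubspaceD(4)[OF M] w less) simp
qed

lemma in_cclspan_gram_schmidt: "w n \<in> cclspan (range (gram_schmidt w))"
proof -
  let ?g = "gram_schmidt w" and ?M = "cclspan (range (gram_schmidt w))"
  have M: "closed_csubspace ?M" by (rule closed_csubspace_cclspan)
  have g: "?g k \<in> ?M" for k by (rule cclspan_superset) auto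
  define r where "r = w n - (\<Sum>k\<in>{..<n}. cinner (w n) (?g k) *\<^sub>C ?g k)"
  have "r = norm r *\<^sub>R ?g n"
    by (cases "r = 0") (simp_all add: gram_schmidt.simps[of w n] r_def[symmetric])
  then have "r \<in> ?M" using closed_csubspace_scaleR[OF M g] by metis
  moreover have "(\<Sum>k\<in>{..<n}. cinner (w n) (?g k) *\<^sub>C ?g k) \<in> ?M"
    by (intro closed_csubspace_sum[OF M] closed_csubspaceD(4)[OF M] g)
  ultimately have "r + (\<Sum>k\<in>{..<n}. cinner (w n) (?g k) *\<^sub>C ?g k) \<in> ?M"
    by (rule closed_csubspaceD(3)[OF M])
  then show ?thesis by (simp add: r_def)
qed

text \<open>Zero entries stay in place. Because of this the system built below from the images of an
  orthonormal system can be matched with that system index by index.\<close>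

lemma gram_schmidt_eq_0:
  assumes "w n = 0"
  shows "gram_schmidt w n = 0"
  using assms by (simp add: gram_schmidt.simps[of w n] cinner.zero_left)

lemma total_orthosys_exists:
  "\<exists>e :: nat \<Rightarrow> 'g::{complex_inner, second_countable_topology}. orthosys e \<and> cclspan (range e) = UNIV"
proof -
  obtain D :: "'g set" where D: "countable D" "\<And>X. open X \<Longrightarrow> X \<noteq> {} \<Longrightarrow> \<exists>d\<in>D. d \<in> X"
    using countable_dense_exists[where 'a='g] by blast
  then have ne: "D \<noteq> {}" using D(2)[of UNIV] by auto
  define d where "d = from_nat_into D"
  have rd: "range d = D" unfolding d_def by (rule range_from_nat_into[OF ne D(1)])
  let ?M = "cclspan (range (gram_schmidt d))"
  have "closed ?M" by (rule closed_csubspaceD(1)[OF closed_csubspace_cclspan])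
  moreover have "D \<subseteq> ?M" using rd in_cclspan_gram_schmidt[of d] by auto
  ultimately have "?M = UNIV" using D(2)[of "- ?M"] by (auto simp: open_Compl)
  then show ?thesis using orthosys_gram_schmidt by blast
qed

section \<open>Factorization along a pure isometry\<close>

lemma cinner_funpow:
  fixes U :: "'h::complex_inner \<Rightarrow> 'h"
  assumes "\<And>x y. cinner (U x) (U y) = cinner x y"
  shows "cinner ((U ^^ n) x) ((U ^^ n) y) = cinner x y"
proof (induction n)
  case (Suc n)
  then show ?case by (simp add: assms)
qed simp

lemma bounded_linear_funpow:
  fixes U :: "'h::real_normed_vector \<Rightarrow> 'h"
  assumes "bounded_linear U"
  shows "bounded_linear (U ^^ n)"
proof (induction n)
  case 0
  show ?case by (simp add: bounded_linear_ident id_def)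
next
  case (Suc n)
  have "bounded_linear (\<lambda>x. U ((U ^^ n) x))" by (rule bounded_linear_compose[OF assms Suc])
  then show ?case by (simp add: o_def)
qed

lemma scaleC_funpow:
  fixes U :: "'h::complex_normed_vector \<Rightarrow> 'h"
  assumes "\<And>c x. U (c *\<^sub>C x) = c *\<^sub>C U x"
  shows "(U ^^ n) (c *\<^sub>C x) = c *\<^sub>C (U ^^ n) x"
proof (induction n)
  case (Suc n)
  then show ?case by (simp add: assms)
qed simp

text \<open>This is the Wold decomposition in coordinates. Let \<open>K n\<close> be the closed span of the vectors
  \<open>U\<^sup>k (x u)\<close> with \<open>k \<ge> n\<close>. When the \<open>K n\<close> intersect in \<open>0\<close>, the space \<open>K 0\<close> is the orthogonal sum of the
  translates \<open>U\<^sup>n W\<close> of the wandering subspace \<open>W = K 0 \<ominus> K 1\<close>. Now \<open>W\<close> is generated by the projections of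
  the \<open>x u\<close>, so its dimension does not exceed that of the parameter space, and \<open>W\<close> can be placed
  isometrically into that space. The operator \<open>A n\<close> takes \<open>u\<close> to the component of \<open>x u\<close> in \<open>U\<^sup>n W\<close>, moved
  there. Since \<open>U\<close> shifts the components, the sums of products of the \<open>A n\<close> reproduce the
  inner products of the vectors \<open>U\<^sup>a (x u)\<close>.\<close>

theorem pure_isometry_factorization:
  fixes U :: "'h::chilbert_space \<Rightarrow> 'h" and x :: "'g::{chilbert_space, second_countable_topology} \<Rightarrow> 'h"
  assumes Ubl: "bounded_linear U" and UC: "\<And>c z. U (c *\<^sub>C z) = c *\<^sub>C U z"
    and Uiso: "\<And>y z. cinner (U y) (U z) = cinner y z"
    and xbl: "bounded_linear x" and xC: "\<And>c u. x (c *\<^sub>C u) = c *\<^sub>C x u"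
    and pure: "\<And>z. (\<And>n. z \<in> cclspan {(U ^^ k) (x u) |k u. n \<le> k}) \<Longrightarrow> z = 0"
  obtains A :: "nat \<Rightarrow> 'g \<Rightarrow> 'g" where
    "\<And>n. bounded_linear (A n)" "\<And>n c u. A n (c *\<^sub>C u) = c *\<^sub>C A n u"
    "\<And>n u. norm (A n u) \<le> norm (x u)"
    "\<And>a u v. (\<lambda>m. cinner (A m u) (A (m + a) v)) sums cinner ((U ^^ a) (x u)) (x v)"
proof -
  define K where "K n = cclspan {(U ^^ k) (x u) |k u. n \<le> k}" for n
  have K: "closed_csubspace (K n)" for n unfolding K_def by (rule closed_csubspace_cclspan)
  have Kgen: "(U ^^ k) (x u) \<in> K n" if "n \<le> k" for n k u
    unfolding K_def using that by (intro cclspan_superset) auto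
  have Kdec: "K (Suc n) \<subseteq> K n" for n
    unfolding K_def by (intro cclspan_minimal closed_csubspace_cclspan) (force intro: cclspan_superset)
  have Kanti: "K m \<subseteq> K n" if "n \<le> m" for m n
    using that by (induction m rule: dec_induct) (use Kdec in auto)
  have Ublk: "bounded_linear (U ^^ n)" for n by (rule bounded_linear_funpow[OF Ubl])
  have UCk: "(U ^^ n) (c *\<^sub>C z) = c *\<^sub>C (U ^^ n) z" for n c z by (rule scaleC_funpow[OF UC])
  have Uisok: "cinner ((U ^^ n) y) ((U ^^ n) z) = cinner y z" for n y z by (rule cinner_funpow[OF Uiso])
  have Ushift: "(U ^^ n) z \<in> K (n + m)" if "z \<in> K m" for n m z
    using that unfolding K_def[of m]
    by (rule cclspan_image[OF _ Ublk UCk _ K]) (auto simp flip: funpow_add[unfolded o_def, THEN fun_cong] intro!: Kgen)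
  obtain e :: "nat \<Rightarrow> 'g" where e: "orthosys e" "cclspan (range e) = UNIV"
    using total_orthosys_exists by blast
  have "\<exists>p. p \<in> K 1 \<and> (\<forall>m\<in>K 1. cinner (x (e i) - p) m = 0)" for i
    using orthogonal_projection[OF K, of 1 "x (e i)"] by metis
  then obtain p where p: "\<And>i. p i \<in> K 1" "\<And>i m. m \<in> K 1 \<Longrightarrow> cinner (x (e i) - p i) m = 0" by metis
  \<comment> \<open>the component of \<open>x (e i)\<close> in the wandering subspace\<close>
  define w where "w i = x (e i) - p i" for i
  define f where "f = gram_schmidt w"
  have fo: "orthosys f" unfolding f_def by (rule orthosys_gram_schmidt)
  have wK: "w i \<in> K 0" for i
    unfolding w_def using Kgen[of 0 0 "e i"] p(1)[of i] Kdec[of 0] by (auto intro!: closed_csubspace_diff[OF K])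
  have fK: "f i \<in> K 0" for i unfolding f_def by (rule gram_schmidt_in[OF K wK])
  have f1: "cinner m (f i) = 0" if m: "m \<in> K 1" for m i
  proof -
    have "f i \<in> {z. cinner z m = 0}"
      unfolding f_def by (rule gram_schmidt_in[OF closed_csubspace_orth]) (use p(2)[OF m] in \<open>simp add: w_def\<close>)
    then show ?thesis by (simp add: cinner_eq_0_commute)
  qed
  \<comment> \<open>needed because \<open>e i\<close> will take the place of \<open>f i\<close>\<close>
  have f0: "f i = 0" if "e i = 0" for i
  proof -
    have "x (e i) = 0" using that bounded_linear.linear[OF xbl] by (simp add: linear_0)
    then have "cinner (p i) (p i) = 0" using p(2)[OF p(1), of i i] by (simp add: cinner.minus_left)
    then have "w i = 0" using \<open>x (e i) = 0\<close> by (simp add: w_def cinner_self)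
    then show ?thesis unfolding f_def by (rule gram_schmidt_eq_0)
  qed
  have UfK: "(U ^^ n) (f i) \<in> K n" for n i using Ushift[OF fK, of n] by simp
  have Uf_orth: "cinner z ((U ^^ n) (f i)) = 0" if "z \<in> K (Suc n)" for z n i
    using that unfolding K_def
  proof (rule cclspan_orth)
    fix s assume "s \<in> {(U ^^ k) (x u) |k u. Suc n \<le> k}"
    then obtain k u where s: "s = (U ^^ k) (x u)" "Suc n \<le> k" by auto
    then have "s = (U ^^ n) ((U ^^ (k - n)) (x u))"
      by (simp flip: funpow_add[unfolded o_def, THEN fun_cong])
    then have "cinner s ((U ^^ n) (f i)) = cinner ((U ^^ (k - n)) (x u)) (f i)" by (simp add: Uisok)
    also have "\<dots> = 0" using s(2) by (intro f1 Kgen) auto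
    finally show "cinner s ((U ^^ n) (f i)) = 0" .
  qed
  have Uf_less: "cinner ((U ^^ n) (f j)) ((U ^^ m) (f i)) = 0" if "m < n" for m n i j
    using Uf_orth[of "(U ^^ n) (f j)" m i] UfK[of n j] Kanti[of "Suc m" n] that by auto
  \<comment> \<open>by induction \<open>y\<close> lies in every \<open>K n\<close>: its part orthogonal to \<open>K (Suc n)\<close> is orthogonal to all generators of \<open>K n\<close>\<close>
  have total: "y = 0" if y0: "y \<in> K 0" and orth: "\<And>m i. cinner y ((U ^^ m) (f i)) = 0" for y
  proof (rule pure)
    fix n
    have "y \<in> K n"
    proof (induction n)
      case (Suc n)
      obtain q where q: "q \<in> K (Suc n)" "\<And>m. m \<in> K (Suc n) \<Longrightarrow> cinner (y - q) m = 0"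
        by (rule orthogonal_projection[OF K])  blast
      define r where "r = y - q"
      have rK: "r \<in> K n" unfolding r_def using Suc q(1) Kdec[of n] by (auto intro: closed_csubspace_diff[OF K])
      have rf: "cinner ((U ^^ n) (f i)) r = 0" for i
        using orth[of n i] Uf_orth[OF q(1), of i] by (simp add: r_def cinner.diff_left cinner_eq_0_commute[of _ "y - q"])
      have rw: "cinner ((U ^^ n) (w i)) r = 0" for i
      proof -
        have "(U ^^ n) (w i) \<in> {z. cinner z r = 0}"
          by (rule cclspan_image[OF in_cclspan_gram_schmidt[of w i] Ublk UCk _ closed_csubspace_orth])
            (use rf in \<open>auto simp: f_def\<close>)
        then show ?thesis by simp
      qed
      have re: "cinner ((U ^^ n) (x (e i))) r = 0" for i
      proof -
        have "x (e i) = w i + p i" by (simp add: w_def)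
        then have "(U ^^ n) (x (e i)) = (U ^^ n) (w i) + (U ^^ n) (p i)"
          using bounded_linear.linear[OF Ublk] by (simp add: linear_add)
        moreover have "cinner ((U ^^ n) (p i)) r = 0"
          using q(2)[of "(U ^^ n) (p i)"] Ushift[OF p(1), of n i] by (simp add: r_def cinner_eq_0_commute)
        ultimately show ?thesis using rw by (simp add: cinner_add_left)
      qed
      have ru: "cinner ((U ^^ n) (x u)) r = 0" for u
      proof -
        have bl: "bounded_linear (\<lambda>u. (U ^^ n) (x u))" by (rule bounded_linear_compose[OF Ublk xbl])
        have "(U ^^ n) (x u) \<in> {z. cinner z r = 0}"
          by (rule cclspan_image[OF _ bl _ _ closed_csubspace_orth, of u "range e"])
            (use e(2) re in \<open>auto simp: xC UCk\<close>)
        then show ?thesis by simp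
      qed
      have "cinner r r = 0"
        using rK unfolding K_def[of n]
      proof (rule cclspan_orth)
        fix s assume "s \<in> {(U ^^ k) (x u) |k u. n \<le> k}"
        then obtain k u where s: "s = (U ^^ k) (x u)" "n \<le> k" by auto
        show "cinner s r = 0"
        proof (cases "k = n")
          case False
          then have "s \<in> K (Suc n)" using s by (auto intro: Kgen)
          then show ?thesis using q(2) by (simp add: r_def cinner_eq_0_commute)
        qed (use ru s in simp)
      qed
      then have "y = q" by (simp add: r_def cinner_self)
      then show ?case using q(1) by simp
    qed (rule y0)
    then show "y \<in> cclspan {(U ^^ k) (x u) |k u. n \<le> k}" by (simp add: K_def)
  qed
  \<comment> \<open>all translates of the \<open>f i\<close> in one sequence, an orthonormal system that is total in \<open>K 0\<close>\<close>
  define b where "b k = (case prod_decode k of (m, i) \<Rightarrow> (U ^^ m) (f i))" for k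
  have bo: "orthosys b"
    unfolding orthosys_def
  proof (intro conjI allI impI)
    fix k l :: nat assume kl: "k \<noteq> l"
    obtain m i n j where d: "prod_decode k = (m, i)" "prod_decode l = (n, j)" by (metis surj_pair)
    have mn: "(m, i) \<noteq> (n, j)" using kl d by (metis prod_decode_inverse)
    show "cinner (b k) (b l) = 0"
    proof (cases m n rule: linorder_cases)
      case less
      then show ?thesis using Uf_less[OF less, of j i] d by (simp add: b_def cinner_eq_0_commute)
    next
      case equal
      then show ?thesis using mn d orthosysD(1)[OF fo, of i j] by (simp add: b_def Uisok)
    next
      case greater
      then show ?thesis using Uf_less[OF greater, of i j] d by (simp add: b_def)
    qed
  next
    fix k
    obtain m i where d: "prod_decode k = (m, i)" by (metis surj_pair)
    have "complex_of_real ((norm (b k))\<^sup>2) = complex_of_real ((norm (f i))\<^sup>2)"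
      using d by (simp only: b_def prod.case Uisok flip: cinner_self)
    then have "(norm (b k))\<^sup>2 = (norm (f i))\<^sup>2" by (simp only: of_real_eq_iff)
    then have "norm (b k) = norm (f i)" by simp
    then show "norm (b k) = 0 \<or> norm (b k) = 1" using orthosysD(2)[OF fo, of i] by simp
  qed
  have bK: "b k \<in> K 0" for k
    using UfK Kanti[of 0] by (auto simp: b_def split: prod.split)
  have btotal: "y = 0" if "y \<in> K 0" "\<And>k. cinner y (b k) = 0" for y
  proof (rule total[OF that(1)])
    fix m i
    show "cinner y ((U ^^ m) (f i)) = 0" using that(2)[of "prod_encode (m, i)"] by (simp add: b_def)
  qed
  have go: "orthosys (\<lambda>i. (U ^^ m) (f i))" for m
  proof -
    have "(U ^^ m) (f i) = b (prod_encode (m, i))" for i by (simp add: b_def)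
    then show ?thesis using bo inj_prod_encode[of UNIV] by (auto simp: orthosys_def inj_def)
  qed
  define c where "c m u i = cinner (x u) ((U ^^ m) (f i))" for m u i
  have csum: "summable (\<lambda>i. (cmod (c m u i))\<^sup>2)" for m u
    unfolding c_def by (rule orthosys_summable[OF go])
  \<comment> \<open>the expansion of the component in \<open>U\<^sup>m W\<close>, with \<open>U\<^sup>m (f i)\<close> replaced by \<open>e i\<close>\<close>
  define A where "A m u = (\<Sum>i. c m u i *\<^sub>C e i)" for m u
  have Aser: "summable (\<lambda>i. c m u i *\<^sub>C e i)" for m u by (rule orthosys_series[OF e(1) csum])
  have cinnerA: "(\<lambda>i. c m u i * cnj (c n v i)) sums cinner (A m u) (A n v)" for m n u v
  proof -
    have "c m u i * cnj (c n v i) * cinner (e i) (e i) = c m u i * cnj (c n v i)" for i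
    proof (cases "e i = 0")
      case True
      then have "(U ^^ m) (f i) = 0" using f0 bounded_linear.linear[OF Ublk[of m]] by (simp add: linear_0)
      then show ?thesis by (simp add: c_def cinner.zero_right)
    next
      case False
      then show ?thesis using orthosysD(2)[OF e(1), of i] by (simp add: cinner_self)
    qed
    with orthosys_cinner_series[OF e(1) csum[of m u] csum[of n v]] show ?thesis by (simp add: A_def)
  qed
  have cadd: "c m (u + v) i = c m u i + c m v i" for m u v i
    using bounded_linear.linear[OF xbl] by (simp add: c_def linear_add cinner_add_left)
  have cscal: "c m (z *\<^sub>C u) i = z * c m u i" for m u z i by (simp add: c_def xC cinner_scaleC_left)
  have AC: "A n (z *\<^sub>C u) = z *\<^sub>C A n u" for n z u
    unfolding A_def cscal scaleC_scaleC[symmetric]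
    by (rule bounded_linear.suminf[OF scaleC.bounded_linear_right Aser, symmetric])
  have Anorm: "norm (A n u) \<le> norm (x u)" for n u
  proof -
    have "(norm (A n u))\<^sup>2 \<le> (norm (x u))\<^sup>2"
    proof (rule LIMSEQ_le_const2)
      show "(\<lambda>N. (norm (\<Sum>i<N. c n u i *\<^sub>C e i))\<^sup>2) \<longlonglongrightarrow> (norm (A n u))\<^sup>2"
        unfolding A_def by (intro tendsto_power tendsto_norm summable_LIMSEQ Aser)
      show "\<exists>N. \<forall>M\<ge>N. (norm (\<Sum>i<M. c n u i *\<^sub>C e i))\<^sup>2 \<le> (norm (x u))\<^sup>2"
        using order_trans[OF norm_sum_orthosys_le[OF e(1)] orthosys_bessel[OF go]] by (auto simp: c_def)
    qed
    then show ?thesis by (rule power2_le_imp_le) simp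
  qed
  obtain B where B: "\<And>u. norm (x u) \<le> norm u * B" using bounded_linear.bounded[OF xbl] by blast
  have Abl: "bounded_linear (A n)" for n
  proof (rule bounded_linear_intro[where K=B])
    show "A n (u + v) = A n u + A n v" for u v
      unfolding A_def cadd scaleC_add_left by (rule suminf_add[OF Aser Aser, symmetric])
    show "A n (r *\<^sub>R u) = r *\<^sub>R A n u" for r u by (simp add: scaleR_scaleC AC)
    show "norm (A n u) \<le> norm u * B" for u using Anorm B order_trans by blast
  qed
  have main: "(\<lambda>m. cinner (A m u) (A (m + a) v)) sums cinner ((U ^^ a) (x u)) (x v)" for a u v
  proof -
    let ?y = "(U ^^ a) (x u)" and ?z = "x v"
    define T where "T = (\<lambda>(m, i). cinner ?y ((U ^^ m) (f i)) * cnj (cinner ?z ((U ^^ m) (f i))))"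
    have Tb: "T (prod_decode k) = cinner ?y (b k) * cnj (cinner ?z (b k))" for k
      by (simp add: T_def b_def split: prod.split)
    have "(\<lambda>k. T (prod_decode k)) sums cinner ?y ?z"
      unfolding Tb using Kgen[of 0 a u] by (intro orthosys_parseval[OF bo K bK _ btotal]) auto
    moreover have "summable (\<lambda>k. norm (T (prod_decode k)))"
      unfolding Tb by (intro summable_mult_cnj orthosys_summable bo)
    ultimately have "((\<lambda>k. T (prod_decode k)) has_sum cinner ?y ?z) UNIV"
      by (intro norm_summable_imp_has_sum)
    then have hs: "(T has_sum cinner ?y ?z) (Sigma UNIV (\<lambda>_. UNIV))"
      using has_sum_reindex_bij_betw[OF bij_prod_decode, of T "cinner ?y ?z"] by simp
    \<comment> \<open>the first \<open>a\<close> components of \<open>U\<^sup>a (x u)\<close> vanish, and the others are those of \<open>x u\<close>\<close>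
    define S where "S m = (if m < a then 0 else cinner (A (m - a) u) (A m v))" for m
    have inner: "((\<lambda>i. T (m, i)) has_sum S m) UNIV" for m
    proof (cases "m < a")
      case True
      then have "cinner ?y ((U ^^ m) (f i)) = 0" for i
        using Uf_orth[of ?y m i] Kgen[of "Suc m" a u] by auto
      then show ?thesis using True by (simp add: T_def S_def)
    next
      case False
      have cy: "cinner ?y ((U ^^ m) (f i)) = c (m - a) u i" for i
      proof -
        have "(U ^^ m) (f i) = (U ^^ a) ((U ^^ (m - a)) (f i))"
          using False by (simp flip: funpow_add[unfolded o_def, THEN fun_cong])
        then show ?thesis by (simp add: Uisok c_def)
      qed
      have "(\<lambda>i. T (m, i)) = (\<lambda>i. c (m - a) u i * cnj (c m v i))" by (simp add: T_def cy c_def)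
      then show ?thesis
        using norm_summable_imp_has_sum[OF summable_mult_cnj[OF csum csum] cinnerA, of "m - a" u m v] False
        by (simp add: S_def)
    qed
    have "(S has_sum cinner ?y ?z) UNIV"
      using has_sum_SigmaD[OF hs inner] by simp
    then have "S sums cinner ?y ?z" by (rule has_sum_imp_sums)
    then have "(\<lambda>m. S (m + a)) sums (cinner ?y ?z - (\<Sum>m<a. S m))" by (rule sums_split_initial_segment)
    moreover have "(\<Sum>m<a. S m) = 0" by (simp add: S_def)
    ultimately show ?thesis by (simp add: S_def)
  qed
  show ?thesis by (rule that[OF Abl AC Anorm main])
qed

section \<open>Integration on the unit circle\<close>

definition arc_measure :: "complex measure"
  where "arc_measure = distr (restrict_space lborel {0..<1::real}) (restrict_space borel (sphere 0 1))
      (\<lambda>t. cis (2 * pi * t))"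

lemma sigma_eq: "\<sigma> = completion arc_measure"
  by (simp add: circle_measure_def arc_measure_def)

lemma cis_measurable [measurable]:
  "(\<lambda>t::real. cis (2 * pi * t)) \<in> restrict_space lborel {0..<1} \<rightarrow>\<^sub>M restrict_space borel (sphere 0 1)"
proof -
  have "continuous_on UNIV (\<lambda>t::real. cis (2 * pi * t))"
    by (intro continuous_intros)
  then have "(\<lambda>t::real. cis (2 * pi * t)) \<in> borel_measurable borel"
    by (rule borel_measurable_continuous_onI)
  then show ?thesis
    by (intro measurable_restrict_space2 measurable_restrict_space1) (auto simp: cong: measurable_cong_sets)
qed

lemma space_arc_measure [simp]: "space arc_measure = sphere 0 1"
  by (simp add: arc_measure_def space_restrict_space)

lemma sets_arc_measure: "sets arc_measure = sets (restrict_space borel (sphere 0 1))"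
  by (simp add: arc_measure_def)

lemma space_sigma [simp]: "space \<sigma> = sphere 0 1"
  by (simp add: sigma_eq)

lemma sphere_borel [measurable]: "sphere (0::complex) 1 \<in> sets borel"
  by (simp add: borel_closed)

lemma emeasure_arc_measure: "emeasure arc_measure (sphere 0 1) = 1"
proof -
  have "sphere 0 1 \<in> sets (restrict_space borel (sphere (0::complex) 1))"
    by (simp add: sets_restrict_space_iff)
  moreover have "(\<lambda>t. cis (2 * pi * t)) -` sphere 0 1 \<inter> {0..<1::real} = {0..<1}" by auto
  ultimately show ?thesis
    unfolding arc_measure_def
    by (subst emeasure_distr[OF cis_measurable]) (auto simp: space_restrict_space emeasure_restrict_space)
qed

lemma emeasure_sigma: "emeasure \<sigma> (sphere 0 1) = 1"
proof -
  have "sphere 0 1 \<in> sets arc_measure" using sets.top[of arc_measure] by simp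
  then show ?thesis by (simp add: sigma_eq emeasure_arc_measure)
qed

interpretation sigma: finite_measure \<sigma>
  by (rule finite_measureI) (simp add: emeasure_sigma)

lemma measure_sigma [simp]: "measure \<sigma> (sphere 0 1) = 1"
  by (simp add: measure_def emeasure_sigma)

interpretation sigma: complete_measure \<sigma>
  unfolding sigma_eq by unfold_locales

lemma AE_sphere: "AE \<zeta> in \<sigma>. \<zeta> \<in> sphere 0 1"
  using AE_space[of \<sigma>] by simp

lemma borel_in_sigma: "A \<in> sets borel \<Longrightarrow> A \<inter> sphere 0 1 \<in> sets \<sigma>"
  by (auto simp: sigma_eq sets_arc_measure sets_restrict_space intro!: sets_completionI_sets)

lemma measurable_sigmaI: "f \<in> restrict_space borel (sphere 0 1) \<rightarrow>\<^sub>M N \<Longrightarrow> f \<in> \<sigma> \<rightarrow>\<^sub>M N"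
  unfolding sigma_eq by (rule measurable_completion) (simp add: sets_arc_measure cong: measurable_cong_sets)

lemma borel_measurable_sigma: "f \<in> borel_measurable borel \<Longrightarrow> f \<in> borel_measurable \<sigma>"
  by (intro measurable_sigmaI measurable_restrict_space1)

lemma borel_measurable_sigma_continuous:
  "continuous_on (sphere 0 1) f \<Longrightarrow> f \<in> borel_measurable \<sigma>"
  by (intro measurable_sigmaI borel_measurable_continuous_on_restrict)

lemma integral_sigma_eq:
  fixes f :: "complex \<Rightarrow> 'b::{banach, second_countable_topology}"
  assumes "continuous_on (sphere 0 1) f"
  shows "(\<integral>\<zeta>. f \<zeta> \<partial>\<sigma>) = (LINT t:{0..<1}|lborel. f (cis (2 * pi * t)))"
proof -
  have m: "f \<in> borel_measurable (restrict_space borel (sphere 0 1))"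
    by (rule borel_measurable_continuous_on_restrict[OF assms])
  have m2: "f \<in> borel_measurable arc_measure"
    unfolding arc_measure_def measurable_distr_eq1 by (rule m)
  have "(\<integral>\<zeta>. f \<zeta> \<partial>\<sigma>) = (\<integral>\<zeta>. f \<zeta> \<partial>arc_measure)"
    unfolding sigma_eq
    by (rule integral_completion[OF m2])
  also have "\<dots> = (\<integral>t. f (cis (2 * pi * t)) \<partial>restrict_space lborel {0..<1})"
    unfolding arc_measure_def by (rule integral_distr[OF cis_measurable m])
  also have "\<dots> = (LINT t:{0..<1}|lborel. f (cis (2 * pi * t)))"
    by (subst integral_restrict_space) (auto simp: set_lebesgue_integral_def)
  finally show ?thesis .
qed

lemma integrable_sigma_bounded:
  fixes f :: "complex \<Rightarrow> 'b::{banach, second_countable_topology}"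
  assumes "f \<in> borel_measurable \<sigma>" "AE \<zeta> in \<sigma>. norm (f \<zeta>) \<le> C"
  shows "integrable \<sigma> f"
  by (rule sigma.integrable_const_bound[OF assms(2,1)])

lemma integrable_sigma_continuous:
  fixes f :: "complex \<Rightarrow> 'b::{banach, second_countable_topology}"
  assumes "continuous_on (sphere 0 1) f"
  shows "integrable \<sigma> f"
proof -
  have "compact (f ` sphere 0 1)" by (intro compact_continuous_image assms) auto
  then obtain C where "\<forall>\<zeta>\<in>sphere 0 1. norm (f \<zeta>) \<le> C"
    by (auto dest!: compact_imp_bounded simp: bounded_iff)
  then show ?thesis
    by (intro integrable_sigma_bounded[of _ C] borel_measurable_sigma_continuous assms AE_I2) auto
qed

lemma sphere_ne_0: "\<zeta> \<in> sphere 0 1 \<Longrightarrow> \<zeta> \<noteq> (0::complex)"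
  by auto

lemma sphere_cnj: "\<zeta> \<in> sphere 0 1 \<Longrightarrow> cnj \<zeta> = inverse (\<zeta>::complex)"
  by (simp add: inverse_complex_def norm_eq_1 cmod_def)
     (simp add: complex_eq_iff)

lemma norm_sphere_powi [simp]: "cmod \<zeta> = 1 \<Longrightarrow> cmod (\<zeta> powi n) = 1"
  by (simp add: norm_power_int)

lemma continuous_on_sphere_powi [continuous_intros]:
  "continuous_on (sphere 0 1) (\<lambda>\<zeta>::complex. \<zeta> powi n)"
  by (intro continuous_intros) auto

lemma measurable_powi [measurable]: "(\<lambda>\<zeta>::complex. \<zeta> powi n) \<in> borel_measurable \<sigma>"
  by (intro borel_measurable_sigma_continuous continuous_intros)

lemma integral_powi: "(\<integral>\<zeta>. \<zeta> powi n \<partial>\<sigma>) = (if n = 0 then 1 else 0)"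
proof (cases "n = 0")
  case True
  then show ?thesis by simp
next
  case False
  define c :: complex where "c = \<i> * 2 * pi * n"
  have c: "c \<noteq> 0" using False by (simp add: c_def)
  define G where "G = (\<lambda>t::real. exp (c * of_real t) / c)"
  have powi_exp: "cis (2 * pi * t) powi n = exp (c * of_real t)" for t
  proof -
    have "\<i> * complex_of_real (of_int n * (2 * pi * t)) = c * of_real t"
      by (simp add: c_def mult_ac)
    then show ?thesis by (subst cis_power_int, subst cis_conv_exp) (simp add: c_def mult_ac)
  qed
  have der: "(G has_vector_derivative cis (2 * pi * t) powi n) (at t within S)" for t S
  proof -
    have "((\<lambda>z. exp (c * z) / c) has_field_derivative exp (c * of_real t)) (at (of_real t))"
      using c by (auto intro!: derivative_eq_intros)
    then show ?thesis
      unfolding G_def powi_exp by (rule has_vector_derivative_real_field)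
  qed
  have cont: "continuous_on S (\<lambda>t. cis (2 * pi * t) powi n)" for S
    unfolding powi_exp by (intro continuous_intros)
  have sm: "set_borel_measurable lborel A (\<lambda>t. cis (2 * pi * t) powi n)" if "A \<in> sets borel" for A
    unfolding set_borel_measurable_def
    using that borel_measurable_continuous_onI[OF cont] by (intro borel_measurable_scaleR) auto
  have "AE t in lborel. t \<noteq> (1::real)" by (rule AE_lborel_singleton)
  then have ae: "AE t in lborel. (t \<in> {0..1::real}) = (t \<in> {0..<1})"
    by eventually_elim auto
  have "(\<integral>\<zeta>. \<zeta> powi n \<partial>\<sigma>) = (LINT t:{0..<1}|lborel. cis (2 * pi * t) powi n)"
    by (intro integral_sigma_eq continuous_intros)
  also have "\<dots> = (LINT t:{0..1}|lborel. cis (2 * pi * t) powi n)"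
    by (rule set_integral_cong_set[OF sm sm ae]) auto
  also have "\<dots> = G 1 - G 0"
    unfolding set_lebesgue_integral_def
  proof (rule integral_FTC_atLeastAtMost)
    show "continuous_on {0..1} (\<lambda>t. cis (2 * pi * t) powi n)" by (rule cont)
  qed (auto intro: der)
  also have "\<dots> = 0"
    using c exp_integer_2pi[of "of_int n"] by (simp add: G_def c_def mult_ac)
  finally show ?thesis using False by simp
qed

section \<open>Weak and strong measurability\<close>

lemma dense_sequence_exists:
  "\<exists>d::nat \<Rightarrow> 'a::second_countable_topology. \<forall>S. open S \<longrightarrow> S \<noteq> {} \<longrightarrow> (\<exists>n. d n \<in> S)"
proof -
  obtain D :: "'a set" where D: "countable D" "\<And>X. open X \<Longrightarrow> X \<noteq> {} \<Longrightarrow> \<exists>d\<in>D. d \<in> X"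
    using countable_dense_exists[where 'a='a] by blast
  then have "D \<noteq> {}" using D(2)[of UNIV] by auto
  then have "range (from_nat_into D) = D" using D(1) by (rule range_from_nat_into)
  with D(2) show ?thesis by (intro exI[of _ "from_nat_into D"]) (metis rangeE)
qed

text \<open>Pettis: the norm is a supremum over a dense sequence of functionals, so the preimage of a closed
  ball is a countable intersection of measurable sets, and every open set is a countable union of balls.\<close>

lemma borel_measurable_weak:
  fixes f :: "'a \<Rightarrow> 'g::{complex_inner, second_countable_topology}"
  assumes f: "\<And>v. (\<lambda>x. cinner (f x) v) \<in> borel_measurable M"
  shows "f \<in> borel_measurable M"
proof (rule borel_measurableI)
  fix S :: "'g set" assume S: "open S"
  obtain d :: "nat \<Rightarrow> 'g" where d: "\<And>S. open S \<Longrightarrow> S \<noteq> {} \<Longrightarrow> \<exists>n. d n \<in> S"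
    using dense_sequence_exists by metis
  have norm_iff: "norm y \<le> r \<longleftrightarrow> (\<forall>n. cmod (cinner y (d n)) \<le> r * norm (d n))" if r: "0 < r" for y r
  proof
    assume "norm y \<le> r"
    then show "\<forall>n. cmod (cinner y (d n)) \<le> r * norm (d n)"
      using norm_cinner_le mult_right_mono norm_ge_zero order_trans by metis
  next
    assume *: "\<forall>n. cmod (cinner y (d n)) \<le> r * norm (d n)"
    show "norm y \<le> r"
    proof (rule ccontr)
      assume n: "\<not> norm y \<le> r"
      let ?X = "{z. r * norm z < cmod (cinner y z)}"
      have "open ?X" by (intro open_Collect_less continuous_intros cinner.continuous_on)
      moreover have "y \<in> ?X"
      proof -
        have "r * norm y < norm y * norm y"
          by (rule mult_strict_right_mono) (use n r in linarith)+
        then show ?thesis by (simp add: cinner_self norm_mult power2_eq_square)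
      qed
      ultimately obtain n where "d n \<in> ?X" using d by blast
      with * show False by (auto simp: not_le[symmetric])
    qed
  qed
  have cb: "{x \<in> space M. norm (f x - c) \<le> r} \<in> sets M" if r: "0 < r" for c r
  proof -
    have [measurable]: "(\<lambda>x. cinner (f x - c) v) \<in> borel_measurable M" for v
      using f by (simp add: cinner.diff_left)
    have "{x \<in> space M. norm (f x - c) \<le> r}
        = {x \<in> space M. \<forall>n. cmod (cinner (f x - c) (d n)) \<le> r * norm (d n)}"
      using norm_iff[OF r] by auto
    also have "\<dots> \<in> sets M" by measurable
    finally show ?thesis .
  qed
  define I where "I = {(n, k). cball (d n) (1 / real (Suc k)) \<subseteq> S}"
  have "S = (\<Union>(n, k)\<in>I. cball (d n) (1 / real (Suc k)))"
  proof
    show "S \<subseteq> (\<Union>(n, k)\<in>I. cball (d n) (1 / real (Suc k)))"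
    proof
      fix x assume "x \<in> S"
      then obtain e where e: "e > 0" "ball x e \<subseteq> S" using S open_contains_ball by blast
      obtain k where k: "1 / real (Suc k) < e / 2"
        using e reals_Archimedean[of "e/2"] by (auto simp: inverse_eq_divide)
      obtain n where n: "d n \<in> ball x (1 / real (Suc k))" using d[of "ball x (1 / real (Suc k))"] by auto
      have "cball (d n) (1 / real (Suc k)) \<subseteq> ball x e"
      proof
        fix y assume "y \<in> cball (d n) (1 / real (Suc k))"
        then show "y \<in> ball x e" using n k dist_triangle[of x y "d n"] by auto
      qed
      with e have "(n, k) \<in> I" by (auto simp: I_def)
      then show "x \<in> (\<Union>(n, k)\<in>I. cball (d n) (1 / real (Suc k)))"
        using n by (force simp: dist_commute)
    qed
  qed (auto simp: I_def)
  then have "f -` S \<inter> space M = (\<Union>(n, k)\<in>I. {x \<in> space M. norm (f x - d n) \<le> 1 / real (Suc k)})"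
    by (auto simp: dist_norm norm_minus_commute) (force simp: dist_norm norm_minus_commute)
  also have "\<dots> \<in> sets M"
    by (intro sets.countable_UN' countableI_type) (auto intro!: cb)
  finally show "f -` S \<inter> space M \<in> sets M" .
qed

lemma borel_measurable_cinner [measurable (raw)]:
  fixes f g :: "'a \<Rightarrow> 'g::{complex_inner, second_countable_topology}"
  assumes "f \<in> borel_measurable M" "g \<in> borel_measurable M"
  shows "(\<lambda>x. cinner (f x) (g x)) \<in> borel_measurable M"
proof -
  have "continuous_on UNIV (\<lambda>x::'g \<times> 'g. cinner (fst x) (snd x))"
    by (intro cinner.continuous_on continuous_intros)
  from borel_measurable_continuous_Pair[OF assms this] show ?thesis by simp
qed

lemma borel_measurable_scaleC [measurable (raw)]:
  fixes g :: "'a \<Rightarrow> 'g::{complex_normed_vector, second_countable_topology}"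
  assumes "f \<in> borel_measurable M" "g \<in> borel_measurable M"
  shows "(\<lambda>x. f x *\<^sub>C (g x)) \<in> borel_measurable M"
proof -
  have "continuous_on UNIV (\<lambda>x::complex \<times> 'g. fst x *\<^sub>C snd x)"
    by (intro scaleC.continuous_on continuous_intros)
  from borel_measurable_continuous_Pair[OF assms this] show ?thesis by simp
qed

text \<open>Clear for simple functions \<open>f\<close>; the general case follows by pointwise limits.\<close>

lemma borel_measurable_blinfun_apply:
  fixes f :: "'a \<Rightarrow> 'g::{real_normed_vector, second_countable_topology}"
    and \<Phi> :: "'a \<Rightarrow> 'g \<Rightarrow>\<^sub>L 'h::{real_normed_vector, second_countable_topology}"
  assumes \<Phi>: "\<And>u. (\<lambda>x. blinfun_apply (\<Phi> x) u) \<in> borel_measurable M"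
    and f: "f \<in> borel_measurable M"
  shows "(\<lambda>x. blinfun_apply (\<Phi> x) (f x)) \<in> borel_measurable M"
proof -
  obtain F where F: "\<And>i. simple_function M (F i)" "\<And>x. x \<in> space M \<Longrightarrow> (\<lambda>i. F i x) \<longlonglongrightarrow> f x"
    using borel_measurable_implies_sequence_metric[OF f, of undefined] by metis
  have "(\<lambda>x. blinfun_apply (\<Phi> x) (F i x)) \<in> borel_measurable M" for i
  proof -
    have [measurable]: "(\<lambda>x. blinfun_apply (\<Phi> x) u) \<in> borel_measurable M" for u by (rule \<Phi>)
    have [measurable]: "F i -` {y} \<inter> space M \<in> sets M" for y
      using F(1)[of i] by (rule simple_functionD)
    have fin: "finite (F i ` space M)" using F(1)[of i] by (rule simple_functionD)
    have "(\<lambda>x. \<Sum>y\<in>F i ` space M. indicator (F i -` {y} \<inter> space M) x *\<^sub>R blinfun_apply (\<Phi> x) y)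
        \<in> borel_measurable M" (is "?g \<in> _") by measurable
    moreover have "?g x = blinfun_apply (\<Phi> x) (F i x)" if "x \<in> space M" for x
    proof -
      have "?g x = (\<Sum>y\<in>F i ` space M. if y = F i x then blinfun_apply (\<Phi> x) y else 0)"
        using that by (intro sum.cong) (auto simp: indicator_def)
      also have "\<dots> = blinfun_apply (\<Phi> x) (F i x)" using that fin by (simp add: sum.delta)
      finally show ?thesis .
    qed
    ultimately show ?thesis by (simp cong: measurable_cong)
  qed
  then show ?thesis
    by (rule borel_measurable_LIMSEQ_metric[where f="\<lambda>i x. blinfun_apply (\<Phi> x) (F i x)"]) (intro blinfun.tendsto tendsto_const F(2))
qed

lemma borel_measurable_cadjoint:
  fixes \<Phi> :: "'a \<Rightarrow> 'g::{chilbert_space, second_countable_topology} \<Rightarrow>\<^sub>L 'g"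
  assumes \<Phi>: "\<And>u. (\<lambda>x. blinfun_apply (\<Phi> x) u) \<in> borel_measurable M"
    and c: "\<And>x. x \<in> space M \<Longrightarrow> \<Phi> x \<in> cbounded_ops"
  shows "(\<lambda>x. blinfun_apply (cadjoint (\<Phi> x)) u) \<in> borel_measurable M"
proof (rule borel_measurable_weak)
  fix v
  have [measurable]: "cnj \<in> borel_measurable borel"
    by (intro borel_measurable_continuous_onI continuous_intros)
  have [measurable]: "(\<lambda>x. blinfun_apply (\<Phi> x) v) \<in> borel_measurable M" by (rule \<Phi>)
  have "(\<lambda>x. cnj (cinner (blinfun_apply (\<Phi> x) v) u)) \<in> borel_measurable M" by measurable
  moreover have "cnj (cinner (blinfun_apply (\<Phi> x) v) u) = cinner (blinfun_apply (cadjoint (\<Phi> x)) u) v"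
    if "x \<in> space M" for x
    using cinner_cadjoint[OF c[OF that], of v u] by (metis cinner_commute)
  ultimately show "(\<lambda>x. cinner (blinfun_apply (cadjoint (\<Phi> x)) u) v) \<in> borel_measurable M"
    by (simp cong: measurable_cong)
qed

text \<open>An arbitrary \<open>g\<close> is possible here because \<open>\<sigma>\<close> is complete.\<close>

lemma borel_measurable_sigma_AE:
  fixes f g :: "complex \<Rightarrow> 'b::topological_space"
  assumes f: "f \<in> borel_measurable \<sigma>" and ae: "AE \<zeta> in \<sigma>. f \<zeta> = g \<zeta>"
  shows "g \<in> borel_measurable \<sigma>"
proof (rule borel_measurableI)
  fix S :: "'b set" assume "open S"
  then have "f -` S \<inter> space \<sigma> \<in> sets \<sigma>" using f by (intro measurable_sets) auto
  then show "g -` S \<inter> space \<sigma> \<in> sets \<sigma>"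
    by (rule sigma.in_sets_AE[of "f -` S \<inter> space \<sigma>", rotated]) (use ae in \<open>auto elim: eventually_mono\<close>)
qed

lemma AE_eq_0_weak:
  fixes w :: "'a \<Rightarrow> 'g::{complex_inner, second_countable_topology}"
  assumes "\<And>v. AE x in M. cinner (w x) v = 0"
  shows "AE x in M. w x = 0"
proof -
  obtain d :: "nat \<Rightarrow> 'g" where d: "\<And>S. open S \<Longrightarrow> S \<noteq> {} \<Longrightarrow> \<exists>n. d n \<in> S"
    using dense_sequence_exists by metis
  have "AE x in M. \<forall>n. cinner (w x) (d n) = 0" using assms by (simp add: AE_all_countable)
  then show ?thesis
  proof eventually_elim
    case (elim x)
    have "cinner (w x) v = 0" for v
    proof (rule ccontr)
      assume v: "cinner (w x) v \<noteq> 0"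
      have "open {v. cinner (w x) v \<noteq> 0}"
        by (intro open_Collect_neq cinner.continuous_on continuous_intros)
      then obtain n where "d n \<in> {v. cinner (w x) v \<noteq> 0}" using d v by blast
      with elim show False by auto
    qed
    then show ?case by (metis cinner_ext cinner.zero_left)
  qed
qed

section \<open>Uniqueness of Fourier coefficients\<close>

text \<open>Uniqueness of Fourier coefficients says that only null functions belong to this class. The class is
  enlarged step by step: its members stay in it, or at least have vanishing integral, after
  multiplication by polynomials, continuous functions and indicators of open and Borel sets.\<close>

definition fourier_null :: "(complex \<Rightarrow> complex) \<Rightarrow> bool"
  where "fourier_null h \<longleftrightarrow> integrable \<sigma> h \<and> (\<forall>n. (\<integral>\<zeta>. \<zeta> powi n * h \<zeta> \<partial>\<sigma>) = 0)"

lemma integrable_mult_continuous: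
  fixes h :: "complex \<Rightarrow> complex"
  assumes h: "integrable \<sigma> h" and c: "continuous_on (sphere 0 1) c"
  shows "integrable \<sigma> (\<lambda>\<zeta>. c \<zeta> * h \<zeta>)"
proof -
  have "compact (c ` sphere 0 1)" by (intro compact_continuous_image c) auto
  then obtain C where "\<forall>\<zeta>\<in>sphere 0 1. norm (c \<zeta>) \<le> C"
    by (auto dest!: compact_imp_bounded simp: bounded_iff)
  then have C: "norm (c \<zeta>) \<le> C" if "\<zeta> \<in> sphere 0 1" for \<zeta> using that by blast
  have [measurable]: "c \<in> borel_measurable \<sigma>" "h \<in> borel_measurable \<sigma>"
    using borel_measurable_sigma_continuous[OF c] h by auto
  show ?thesis
  proof (rule Bochner_Integration.integrable_bound)
    show "integrable \<sigma> (\<lambda>\<zeta>. C * norm (h \<zeta>))" using h by auto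
    have "norm (c \<zeta> * h \<zeta>) \<le> norm (C * norm (h \<zeta>))" if "\<zeta> \<in> sphere 0 1" for \<zeta>
      using mult_right_mono[OF order_trans[OF C[OF that] abs_ge_self] norm_ge_zero[of "h \<zeta>"]] by (simp add: norm_mult abs_mult)
    then show "AE \<zeta> in \<sigma>. norm (c \<zeta> * h \<zeta>) \<le> norm (C * norm (h \<zeta>))" by (intro AE_I2) simp
  qed measurable
qed

lemma sphere_powi_add: "cmod \<zeta> = 1 \<Longrightarrow> \<zeta> powi (n + k) = \<zeta> powi n * \<zeta> powi k"
  by (intro power_int_add) auto

lemma fourier_null_integrable: "fourier_null h \<Longrightarrow> integrable \<sigma> (\<lambda>\<zeta>. \<zeta> powi n * h \<zeta>)"
  by (auto simp: fourier_null_def intro!: integrable_mult_continuous continuous_intros)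

lemma fourier_null_powi:
  assumes "fourier_null h"
  shows "fourier_null (\<lambda>\<zeta>. \<zeta> powi k * h \<zeta>)"
  unfolding fourier_null_def
proof (intro conjI allI)
  fix n
  have "(\<integral>\<zeta>. \<zeta> powi n * (\<zeta> powi k * h \<zeta>) \<partial>\<sigma>) = (\<integral>\<zeta>. \<zeta> powi (n + k) * h \<zeta> \<partial>\<sigma>)"
    by (intro Bochner_Integration.integral_cong) (auto simp: sphere_powi_add)
  then show "(\<integral>\<zeta>. \<zeta> powi n * (\<zeta> powi k * h \<zeta>) \<partial>\<sigma>) = 0"
    using assms by (simp add: fourier_null_def)
qed (rule fourier_null_integrable[OF assms])

lemma fourier_null_add:
  assumes "fourier_null h" "fourier_null k"
  shows "fourier_null (\<lambda>\<zeta>. h \<zeta> + k \<zeta>)"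
  using assms fourier_null_integrable[OF assms(1)] fourier_null_integrable[OF assms(2)]
  by (auto simp: fourier_null_def distrib_left)

lemma fourier_null_cmult: "fourier_null h \<Longrightarrow> fourier_null (\<lambda>\<zeta>. c * h \<zeta>)"
  by (auto simp: fourier_null_def mult.left_commute[of _ c])

lemma fourier_null_cong:
  assumes "fourier_null h" "\<And>\<zeta>. \<zeta> \<in> sphere 0 1 \<Longrightarrow> h \<zeta> = k \<zeta>"
  shows "fourier_null k"
proof -
  have "integrable \<sigma> h = integrable \<sigma> k"
    "(\<integral>\<zeta>. \<zeta> powi n * h \<zeta> \<partial>\<sigma>) = (\<integral>\<zeta>. \<zeta> powi n * k \<zeta> \<partial>\<sigma>)" for n
    using assms(2) by (auto intro!: Bochner_Integration.integrable_cong Bochner_Integration.integral_cong)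
  with assms(1) show ?thesis by (simp add: fourier_null_def)
qed

text \<open>On the circle a real-linear function of \<open>\<zeta>\<close> is a combination of \<open>\<zeta>\<close> and \<open>\<zeta>\<^sup>-\<^sup>1\<close>.\<close>

lemma fourier_null_polynomial:
  assumes "real_polynomial_function g" "fourier_null h"
  shows "fourier_null (\<lambda>\<zeta>. of_real (g \<zeta>) * h \<zeta>)"
  using assms
proof (induction arbitrary: h rule: real_polynomial_function.induct)
  case (linear f)
  interpret f: bounded_linear f by fact
  define c where "c = Complex (f 1 / 2) (- f \<i> / 2)"
  have "of_real (f \<zeta>) * h \<zeta> = c * (\<zeta> powi 1 * h \<zeta>) + cnj c * (\<zeta> powi (-1) * h \<zeta>)"
    if "\<zeta> \<in> sphere 0 1" for \<zeta>
  proof -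
    have "\<zeta> = Re \<zeta> *\<^sub>R 1 + Im \<zeta> *\<^sub>R \<i>" by (simp add: complex_eq_iff)
    then have "f \<zeta> = f (Re \<zeta> *\<^sub>R 1 + Im \<zeta> *\<^sub>R \<i>)" by (rule arg_cong)
    also have "\<dots> = Re \<zeta> * f 1 + Im \<zeta> * f \<i>" by (simp only: f.add f.scaleR real_scaleR_def)
    finally have "of_real (f \<zeta>) = c * \<zeta> + cnj c * cnj \<zeta>"
      by (simp add: c_def complex_eq_iff)
    then show ?thesis using sphere_cnj[OF that] by (simp add: algebra_simps power_int_minus)
  qed
  moreover have "fourier_null (\<lambda>\<zeta>. c * (\<zeta> powi 1 * h \<zeta>) + cnj c * (\<zeta> powi (-1) * h \<zeta>))"
    by (intro fourier_null_add fourier_null_cmult fourier_null_powi linear)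
  ultimately show ?case by (auto elim: fourier_null_cong)
next
  case (const c)
  then show ?case by (rule fourier_null_cmult)
next
  case (add f g)
  then show ?case using fourier_null_add[OF add.IH(1) add.IH(2)] by (simp add: distrib_right)
next
  case (mult f g)
  then show ?case using mult.IH(1)[OF mult.IH(2)] by (simp add: mult.assoc)
qed

text \<open>Stone-Weierstrass: \<open>c\<close> is a uniform limit of polynomials in the real coordinates.\<close>

lemma fourier_null_continuous:
  assumes c: "continuous_on (sphere 0 1) c" and h: "fourier_null h"
  shows "(\<integral>\<zeta>. of_real (c \<zeta>) * h \<zeta> \<partial>\<sigma>) = 0"
proof -
  have int: "integrable \<sigma> h" using h by (simp add: fourier_null_def)
  have "cmod (\<integral>\<zeta>. of_real (c \<zeta>) * h \<zeta> \<partial>\<sigma>) \<le> e * (\<integral>\<zeta>. cmod (h \<zeta>) \<partial>\<sigma>)" if e: "e > 0" for e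
  proof -
    obtain g where g: "real_polynomial_function g" "\<And>\<zeta>. \<zeta> \<in> sphere 0 1 \<Longrightarrow> \<bar>c \<zeta> - g \<zeta>\<bar> < e"
      using Stone_Weierstrass_real_polynomial_function[OF _ c e] by (auto simp: compact_sphere)
    have gc: "continuous_on (sphere 0 1) g"
      using g(1) by (simp add: continuous_on_polymonial_function real_polynomial_function_eq)
    have i1: "integrable \<sigma> (\<lambda>\<zeta>. of_real (c \<zeta>) * h \<zeta>)" and i2: "integrable \<sigma> (\<lambda>\<zeta>. of_real (g \<zeta>) * h \<zeta>)"
      by (intro integrable_mult_continuous int continuous_intros c gc)+
    have "(\<integral>\<zeta>. \<zeta> powi 0 * (of_real (g \<zeta>) * h \<zeta>) \<partial>\<sigma>) = 0"
      using fourier_null_polynomial[OF g(1) h] unfolding fourier_null_def by blast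
    then have "(\<integral>\<zeta>. of_real (c \<zeta>) * h \<zeta> \<partial>\<sigma>) = (\<integral>\<zeta>. of_real (c \<zeta>) * h \<zeta> - of_real (g \<zeta>) * h \<zeta> \<partial>\<sigma>)"
      using i1 i2 by simp
    also have "cmod \<dots> \<le> (\<integral>\<zeta>. e * cmod (h \<zeta>) \<partial>\<sigma>)"
    proof (rule order_trans[OF integral_norm_bound integral_mono])
      show "integrable \<sigma> (\<lambda>\<zeta>. cmod (of_real (c \<zeta>) * h \<zeta> - of_real (g \<zeta>) * h \<zeta>))" using i1 i2 by auto
      show "integrable \<sigma> (\<lambda>\<zeta>. e * cmod (h \<zeta>))" using int by auto
      show "cmod (of_real (c \<zeta>) * h \<zeta> - of_real (g \<zeta>) * h \<zeta>) \<le> e * cmod (h \<zeta>)" if "\<zeta> \<in> space \<sigma>" for \<zeta>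
      proof -
        have "cmod (of_real (c \<zeta>) * h \<zeta> - of_real (g \<zeta>) * h \<zeta>) = \<bar>c \<zeta> - g \<zeta>\<bar> * cmod (h \<zeta>)"
          by (metis left_diff_distrib norm_mult norm_of_real of_real_diff)
        then show ?thesis using g(2)[of \<zeta>] that by (simp add: mult_right_mono less_imp_le)
      qed
    qed
    also have "\<dots> = e * (\<integral>\<zeta>. cmod (h \<zeta>) \<partial>\<sigma>)" by simp
    finally show ?thesis .
  qed note est = this
  have "((\<lambda>e. e * (\<integral>\<zeta>. cmod (h \<zeta>) \<partial>\<sigma>)) \<longlongrightarrow> 0 * (\<integral>\<zeta>. cmod (h \<zeta>) \<partial>\<sigma>)) (at_right 0)"
    by (intro tendsto_intros)
  then have "cmod (\<integral>\<zeta>. of_real (c \<zeta>) * h \<zeta> \<partial>\<sigma>) \<le> 0 * (\<integral>\<zeta>. cmod (h \<zeta>) \<partial>\<sigma>)"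
    by (rule tendsto_lowerbound) (auto simp: eventually_at_filter est)
  then show ?thesis by simp
qed

text \<open>The indicator of \<open>U\<close> is the limit of the continuous functions \<open>\<zeta> \<mapsto> min 1 (n d(\<zeta>))\<close>, where \<open>d\<close> is the
  distance to the complement of \<open>U\<close>.\<close>

lemma fourier_null_open:
  assumes U: "open U" and h: "fourier_null h"
  shows "(\<integral>\<zeta>. indicator U \<zeta> * h \<zeta> \<partial>\<sigma>) = 0"
proof (cases "U = UNIV")
  case True
  then show ?thesis using fourier_null_continuous[OF _ h, of "\<lambda>_. 1"] by simp
next
  case False
  define c where "c n \<zeta> = min 1 (real n * infdist \<zeta> (- U))" for n and \<zeta> :: complex
  have c0: "0 \<le> c n \<zeta>" "c n \<zeta> \<le> 1" for n \<zeta> by (auto simp: c_def infdist_nonneg)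
  have cc: "continuous_on (sphere 0 1) (c n)" for n
    unfolding c_def by (intro continuous_intros)
  have int: "integrable \<sigma> h" using h by (simp add: fourier_null_def)
  then have [measurable]: "h \<in> borel_measurable \<sigma>" by auto
  have [measurable]: "c n \<in> borel_measurable \<sigma>" for n by (rule borel_measurable_sigma_continuous[OF cc])
  have [measurable]: "(indicator U :: complex \<Rightarrow> complex) \<in> borel_measurable \<sigma>"
    using U by (intro borel_measurable_sigma borel_measurable_indicator) auto
  have lim: "(\<lambda>n. of_real (c n \<zeta>) * h \<zeta>) \<longlonglongrightarrow> indicator U \<zeta> * h \<zeta>" for \<zeta>
  proof (cases "\<zeta> \<in> U")
    case True
    have "infdist \<zeta> (- U) > 0"
      using False U True by (intro infdist_pos_not_in_closed) auto
    then obtain N where N: "1 < real N * infdist \<zeta> (- U)" using reals_Archimedean3 by blast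
    have "c n \<zeta> = 1" if "n \<ge> N" for n
    proof -
      have "real N * infdist \<zeta> (- U) \<le> real n * infdist \<zeta> (- U)"
        using that by (intro mult_right_mono) (auto simp: infdist_nonneg)
      then show ?thesis using N by (simp add: c_def)
    qed
    then have "\<forall>\<^sub>F n in sequentially. of_real (c n \<zeta>) * h \<zeta> = indicator U \<zeta> * h \<zeta>"
      using True by (auto simp: eventually_sequentially)
    then show ?thesis by (rule tendsto_eventually)
  qed (simp add: c_def)
  have "(\<lambda>n. \<integral>\<zeta>. of_real (c n \<zeta>) * h \<zeta> \<partial>\<sigma>) \<longlonglongrightarrow> (\<integral>\<zeta>. indicator U \<zeta> * h \<zeta> \<partial>\<sigma>)"
  proof (rule integral_dominated_convergence[where w="\<lambda>\<zeta>. cmod (h \<zeta>)"])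
    show "AE \<zeta> in \<sigma>. norm (of_real (c n \<zeta>) * h \<zeta>) \<le> cmod (h \<zeta>)" for n
      using c0 by (intro AE_I2) (auto simp: norm_mult intro: mult_left_le_one_le)
  qed (use int lim in \<open>auto\<close>)
  then show ?thesis by (simp add: fourier_null_continuous[OF cc h] LIMSEQ_const_iff)
qed

text \<open>The open sets are an intersection-stable generator of the Borel sets.\<close>

lemma fourier_null_borel:
  assumes A: "A \<in> sets borel" and h: "fourier_null h"
  shows "(\<integral>\<zeta>. indicator A \<zeta> * h \<zeta> \<partial>\<sigma>) = 0"
proof -
  have int: "integrable \<sigma> h" using h by (simp add: fourier_null_def)
  then have [measurable]: "h \<in> borel_measurable \<sigma>" by auto
  have m: "(indicator A :: complex \<Rightarrow> complex) \<in> borel_measurable \<sigma>" if "A \<in> sets borel" for A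
    using that by (intro borel_measurable_sigma borel_measurable_indicator)
  have i: "integrable \<sigma> (\<lambda>\<zeta>. indicator A \<zeta> * h \<zeta>)" if "A \<in> sets borel" for A
  proof (rule Bochner_Integration.integrable_bound[OF int])
    show "(\<lambda>\<zeta>. indicator A \<zeta> * h \<zeta>) \<in> borel_measurable \<sigma>" using m[OF that] by measurable
  qed (auto simp: indicator_def)
  have bor: "sets (borel :: complex measure) = sigma_sets UNIV {S. open S}"
    by (simp add: borel_def)
  have "Int_stable {S :: complex set. open S}" by (auto simp: Int_stable_def)
  moreover have "{S :: complex set. open S} \<subseteq> Pow UNIV" by auto
  moreover have "A \<in> sigma_sets UNIV {S. open S}" using A bor by simp
  ultimately show ?thesis
  proof (induction rule: sigma_sets_induct_disjoint)
    case (basic A)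
    then show ?case by (intro fourier_null_open h) auto
  next
    case empty
    then show ?case by simp
  next
    case (compl A)
    have "(\<integral>\<zeta>. indicator (UNIV - A) \<zeta> * h \<zeta> \<partial>\<sigma>) = (\<integral>\<zeta>. indicator UNIV \<zeta> * h \<zeta> - indicator A \<zeta> * h \<zeta> \<partial>\<sigma>)"
      by (intro Bochner_Integration.integral_cong) (auto simp: indicator_def)
    also have "\<dots> = (\<integral>\<zeta>. indicator UNIV \<zeta> * h \<zeta> \<partial>\<sigma>) - (\<integral>\<zeta>. indicator A \<zeta> * h \<zeta> \<partial>\<sigma>)"
      using compl(1) bor by (intro Bochner_Integration.integral_diff i) auto
    finally show ?case using compl(2) fourier_null_open[OF open_UNIV h] by simp
  next
    case (union A)
    have A: "A n \<in> sets borel" for n using union(2) bor by auto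
    have ir: "complex_of_real (indicator B \<zeta>) = indicator B \<zeta>" for B and \<zeta> :: complex
      by (simp add: indicator_def)
    have isum: "(\<lambda>n. indicator (A n) \<zeta> :: real) sums indicator (\<Union>n. A n) \<zeta>" for \<zeta>
      using union(1) by (intro indicator_sums) (auto simp: disjoint_family_on_def)
    have "(\<lambda>N. \<integral>\<zeta>. (\<Sum>n<N. indicator (A n) \<zeta> * h \<zeta>) \<partial>\<sigma>) \<longlonglongrightarrow> (\<integral>\<zeta>. indicator (\<Union>n. A n) \<zeta> * h \<zeta> \<partial>\<sigma>)"
    proof (rule integral_dominated_convergence[where w="\<lambda>\<zeta>. cmod (h \<zeta>)"])
      show "(\<lambda>\<zeta>. indicator (\<Union>n. A n) \<zeta> * h \<zeta>) \<in> borel_measurable \<sigma>"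
        using m[of "\<Union>n. A n"] A by measurable
      show "(\<lambda>\<zeta>. \<Sum>n<N. indicator (A n) \<zeta> * h \<zeta>) \<in> borel_measurable \<sigma>" for N
        using m[OF A] by measurable
      have "(\<lambda>N. \<Sum>n<N. indicator (A n) \<zeta> * h \<zeta>) \<longlonglongrightarrow> indicator (\<Union>n. A n) \<zeta> * h \<zeta>" for \<zeta>
        using sums_mult2[OF sums_of_real[OF isum], of \<zeta> "h \<zeta>"] by (simp add: sums_def ir)
      then show "AE \<zeta> in \<sigma>. (\<lambda>N. \<Sum>n<N. indicator (A n) \<zeta> * h \<zeta>) \<longlonglongrightarrow> indicator (\<Union>n. A n) \<zeta> * h \<zeta>"
        by simp
      have "cmod (\<Sum>n<N. indicator (A n) \<zeta> * h \<zeta>) \<le> cmod (h \<zeta>)" for N \<zeta>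
      proof -
        have "(\<Sum>n<N. indicator (A n) \<zeta> :: real) \<le> (\<Sum>n. indicator (A n) \<zeta>)"
          by (rule sum_le_suminf[OF sums_summable[OF isum]]) auto
        also have "\<dots> = indicator (\<Union>n. A n) \<zeta>" by (rule sums_unique[OF isum, symmetric])
        also have "\<dots> \<le> 1" by (simp add: indicator_def)
        finally have le1: "(\<Sum>n<N. indicator (A n) \<zeta> :: real) \<le> 1" .
        have "(\<Sum>n<N. indicator (A n) \<zeta> * h \<zeta>) = of_real (\<Sum>n<N. indicator (A n) \<zeta>) * h \<zeta>"
          by (simp add: sum_distrib_right ir)
        then have "cmod (\<Sum>n<N. indicator (A n) \<zeta> * h \<zeta>) = (\<Sum>n<N. indicator (A n) \<zeta>) * cmod (h \<zeta>)"
          by (simp only: norm_mult norm_of_real abs_of_nonneg[OF sum_nonneg[OF indicator_pos_le]])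
        also have "\<dots> \<le> 1 * cmod (h \<zeta>)" by (intro mult_right_mono le1) auto
        finally show ?thesis by simp
      qed
      then show "AE \<zeta> in \<sigma>. norm (\<Sum>n<N. indicator (A n) \<zeta> * h \<zeta>) \<le> cmod (h \<zeta>)" for N by simp
    qed (use int in auto)
    moreover have "(\<integral>\<zeta>. (\<Sum>n<N. indicator (A n) \<zeta> * h \<zeta>) \<partial>\<sigma>) = 0" for N
      using union(3) by (subst Bochner_Integration.integral_sum) (auto intro: i A)
    ultimately show ?case by (simp add: LIMSEQ_const_iff)
  qed
qed

text \<open>A measurable subset of the circle differs from a Borel set by a null set, so all set integrals of \<open>h\<close>
  vanish. Testing with the sets where the real or the imaginary part has a fixed sign gives the claim.\<close>

theorem fourier_null_AE_eq_0:
  assumes h: "fourier_null h"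
  shows "AE \<zeta> in \<sigma>. h \<zeta> = 0"
proof -
  have int: "integrable \<sigma> h" using h by (simp add: fourier_null_def)
  then have [measurable]: "h \<in> borel_measurable \<sigma>" by auto
  have set0: "(\<integral>\<zeta>. indicator A \<zeta> * h \<zeta> \<partial>\<sigma>) = 0" if A: "A \<in> sets \<sigma>" for A
  proof -
    obtain S N N' where S: "A = S \<union> N" "N \<subseteq> N'" "N' \<in> null_sets arc_measure" "S \<in> sets arc_measure"
      using A unfolding sigma_eq by (rule sets_completionE)
    obtain B where B: "B \<in> sets borel" "S = B \<inter> sphere 0 1"
      using S(4) by (auto simp: sets_arc_measure sets_restrict_space)
    have "N' \<in> null_sets \<sigma>" unfolding sigma_eq by (rule null_sets_completionI[OF S(3)])
    then have "AE \<zeta> in \<sigma>. \<zeta> \<notin> N'" by (rule AE_not_in)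
    moreover have "AE \<zeta> in \<sigma>. \<zeta> \<in> sphere 0 1" by (rule AE_sphere)
    ultimately have "AE \<zeta> in \<sigma>. indicator A \<zeta> * h \<zeta> = indicator B \<zeta> * h \<zeta>"
    proof eventually_elim
      case (elim \<zeta>)
      then have "\<zeta> \<in> A \<longleftrightarrow> \<zeta> \<in> B" using S(1,2) B(2) by auto
      then show ?case by (simp add: indicator_def)
    qed
    moreover have mA: "(indicator A :: complex \<Rightarrow> complex) \<in> borel_measurable \<sigma>"
      using A by (rule borel_measurable_indicator)
    moreover have mB: "(indicator B :: complex \<Rightarrow> complex) \<in> borel_measurable \<sigma>"
      using B(1) by (intro borel_measurable_sigma borel_measurable_indicator)
    ultimately have "(\<integral>\<zeta>. indicator A \<zeta> * h \<zeta> \<partial>\<sigma>) = (\<integral>\<zeta>. indicator B \<zeta> * h \<zeta> \<partial>\<sigma>)"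
      using mA mB by (intro integral_cong_AE borel_measurable_times) auto
    then show ?thesis using fourier_null_borel[OF B(1) h] by simp
  qed
  have real0: "AE \<zeta> in \<sigma>. r \<zeta> = 0"
    if r: "integrable \<sigma> r" "\<And>A. A \<in> sets \<sigma> \<Longrightarrow> (\<integral>\<zeta>. indicator A \<zeta> * r \<zeta> \<partial>\<sigma>) = 0" for r :: "complex \<Rightarrow> real"
  proof -
    have [measurable]: "r \<in> borel_measurable \<sigma>" using r(1) by auto
    define A where "A = {\<zeta> \<in> space \<sigma>. 0 \<le> r \<zeta>}"
    define B where "B = {\<zeta> \<in> space \<sigma>. r \<zeta> < 0}"
    have AB: "A \<in> sets \<sigma>" "B \<in> sets \<sigma>" unfolding A_def B_def by measurable
    have ii: "integrable \<sigma> (\<lambda>\<zeta>. indicator C \<zeta> * r \<zeta>)" if "C \<in> sets \<sigma>" for C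
      using integrable_real_mult_indicator[OF that r(1)] by (simp add: mult.commute)
    have "(\<integral>\<zeta>. \<bar>r \<zeta>\<bar> \<partial>\<sigma>) = (\<integral>\<zeta>. indicator A \<zeta> * r \<zeta> - indicator B \<zeta> * r \<zeta> \<partial>\<sigma>)"
      by (intro Bochner_Integration.integral_cong) (auto simp: A_def B_def indicator_def)
    also have "\<dots> = 0" using r(2) AB ii by simp
    finally have "(\<integral>\<zeta>. \<bar>r \<zeta>\<bar> \<partial>\<sigma>) = 0" .
    then show ?thesis using r(1) by (simp add: integral_nonneg_eq_0_iff_AE)
  qed
  have ii: "integrable \<sigma> (\<lambda>\<zeta>. indicator A \<zeta> * h \<zeta>)" if A: "A \<in> sets \<sigma>" for A
    using A by (intro Bochner_Integration.integrable_bound[OF int]) (auto simp: indicator_def)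
  have "AE \<zeta> in \<sigma>. Re (h \<zeta>) = 0"
  proof (rule real0)
    fix A assume A: "A \<in> sets \<sigma>"
    have "(\<integral>\<zeta>. indicator A \<zeta> * Re (h \<zeta>) \<partial>\<sigma>) = (\<integral>\<zeta>. Re (indicator A \<zeta> * h \<zeta>) \<partial>\<sigma>)"
      by (intro Bochner_Integration.integral_cong) (auto simp: indicator_def)
    then show "(\<integral>\<zeta>. indicator A \<zeta> * Re (h \<zeta>) \<partial>\<sigma>) = 0"
      by (simp only: integral_Re[OF ii[OF A]] set0[OF A]) simp
  qed (use int in auto)
  moreover have "AE \<zeta> in \<sigma>. Im (h \<zeta>) = 0"
  proof (rule real0)
    fix A assume A: "A \<in> sets \<sigma>"
    have "(\<integral>\<zeta>. indicator A \<zeta> * Im (h \<zeta>) \<partial>\<sigma>) = (\<integral>\<zeta>. Im (indicator A \<zeta> * h \<zeta>) \<partial>\<sigma>)"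
      by (intro Bochner_Integration.integral_cong) (auto simp: indicator_def)
    then show "(\<integral>\<zeta>. indicator A \<zeta> * Im (h \<zeta>) \<partial>\<sigma>) = 0"
      by (simp only: integral_Im[OF ii[OF A]] set0[OF A]) simp
  qed (use int in auto)
  ultimately show ?thesis by eventually_elim (simp add: complex_eq_iff)
qed

section \<open>The maximal inequality on the circle\<close>

text \<open>Jordan's inequality, from the concavity of the sine.\<close>

lemma sin_pi_ge:
  assumes "0 \<le> s" "s \<le> 1/2"
  shows "2 * s \<le> sin (pi * s)"
proof -
  have "concave_on {0..pi} sin"
  proof (rule f''_le0_imp_concave)
    show "(sin has_real_derivative cos x) (at x)" for x :: real by (rule DERIV_sin)
    show "(cos has_real_derivative - sin x) (at x)" for x :: real by (rule DERIV_cos)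
    show "- sin x \<le> 0" if "x \<in> {0..pi}" for x using that sin_ge_zero by auto
  qed auto
  from concave_onD[OF this, of "2 * s" 0 "pi / 2"] assms show ?thesis
    by (simp add: mult_ac)
qed

text \<open>By Jordan's inequality a chord shorter than \<open>\<rho>\<close> subtends an arc of normalized length at most
  \<open>\<rho>/4\<close>. When the circle is cut open at \<open>1\<close>, the disk is therefore covered by an interval of length \<open>\<rho>/2\<close>
  around its centre and two intervals of length \<open>\<rho>/4\<close> at the ends of the parameter interval.\<close>

lemma emeasure_sigma_ball_le:
  assumes \<zeta>: "\<zeta> \<in> sphere 0 1" and \<rho>: "0 < \<rho>"
  shows "emeasure \<sigma> (ball \<zeta> \<rho> \<inter> sphere 0 1) \<le> ennreal \<rho>"
proof -
  define x where "x = Arg2pi \<zeta> / (2 * pi)"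
  have x: "0 \<le> x" "x < 1" using Arg2pi_ge_0[of \<zeta>] Arg2pi_lt_2pi[of \<zeta>] by (auto simp: x_def field_simps)
  have \<zeta>x: "\<zeta> = cis (2 * pi * x)"
    using Arg2pi_eq[of \<zeta>] \<zeta> by (simp add: x_def cis_conv_exp)
  have chord: "dist \<zeta> (cis (2 * pi * t)) = 2 * \<bar>sin (pi * (t - x))\<bar>" for t
  proof -
    have "cis (2 * pi * t) - \<zeta> = \<zeta> * (cis (2 * pi * (t - x)) - 1)"
      by (simp add: \<zeta>x right_diff_distrib cis_mult)
    then have "dist (cis (2 * pi * t)) \<zeta> = cmod (cis (2 * pi * (t - x)) - 1)"
      using \<zeta> by (simp add: dist_norm norm_mult)
    also have "\<dots> = 2 * \<bar>sin (2 * pi * (t - x) / 2)\<bar>"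
      unfolding cis_conv_exp by (rule dist_exp_i_1)
    finally show ?thesis by (simp add: dist_commute)
  qed
  have sub: "t \<in> {x - \<rho>/4..x + \<rho>/4} \<union> {0..\<rho>/4} \<union> {1 - \<rho>/4..1}"
    if t: "0 \<le> t" "t < 1" "cis (2 * pi * t) \<in> ball \<zeta> \<rho>" for t
  proof -
    have d: "2 * \<bar>sin (pi * (t - x))\<bar> < \<rho>" using t(3) chord by simp
    define s where "s = \<bar>t - x\<bar>"
    have s: "0 \<le> s" "s < 1" using t x by (auto simp: s_def)
    have "pi * s = pi * (t - x) \<or> pi * s = - (pi * (t - x))"
      by (auto simp: s_def abs_if algebra_simps)
    then have "\<bar>sin (pi * (t - x))\<bar> = \<bar>sin (pi * s)\<bar>"
      by (elim disjE) (simp_all only: sin_minus abs_minus_cancel)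
    also have "\<dots> = sin (pi * s)" using s by (simp add: sin_ge_zero)
    finally have ds: "2 * sin (pi * s) < \<rho>" using d by simp
    show ?thesis
    proof (cases "s \<le> 1/2")
      case True
      then show ?thesis using sin_pi_ge[OF s(1) True] ds by (auto simp: s_def abs_if split: if_splits)
    next
      case False
      have "sin (pi * (1 - s)) = sin (pi * s)" by (simp add: right_diff_distrib)
      with sin_pi_ge[of "1 - s"] False s ds have "4 * (1 - s) < \<rho>" by auto
      then show ?thesis using t x by (auto simp: s_def abs_if split: if_splits)
    qed
  qed
  have bs: "ball \<zeta> \<rho> \<inter> sphere 0 1 \<in> sets arc_measure"
    by (auto simp: sets_arc_measure sets_restrict_space)
  have "emeasure \<sigma> (ball \<zeta> \<rho> \<inter> sphere 0 1) = emeasure arc_measure (ball \<zeta> \<rho> \<inter> sphere 0 1)"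
    unfolding sigma_eq using bs by (rule emeasure_completion[OF sets_completionI_sets, THEN trans]) (use bs in simp)
  also have "\<dots> = emeasure (restrict_space lborel {0..<1})
      ((\<lambda>t. cis (2 * pi * t)) -` (ball \<zeta> \<rho> \<inter> sphere 0 1) \<inter> space (restrict_space lborel {0..<1::real}))"
    unfolding arc_measure_def
    by (rule emeasure_distr[OF cis_measurable]) (use bs in \<open>simp add: sets_arc_measure\<close>)
  also have "\<dots> = emeasure lborel
      ((\<lambda>t. cis (2 * pi * t)) -` (ball \<zeta> \<rho> \<inter> sphere 0 1) \<inter> space (restrict_space lborel {0..<1::real}))"
    by (rule emeasure_restrict_space) (auto simp: space_restrict_space)
  also have "\<dots> \<le> emeasure lborel ({x - \<rho>/4..x + \<rho>/4} \<union> {0..\<rho>/4} \<union> {1 - \<rho>/4..1})"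
  proof (rule emeasure_mono)
    show "(\<lambda>t. cis (2 * pi * t)) -` (ball \<zeta> \<rho> \<inter> sphere 0 1) \<inter> space (restrict_space lborel {0..<1::real})
        \<subseteq> {x - \<rho>/4..x + \<rho>/4} \<union> {0..\<rho>/4} \<union> {1 - \<rho>/4..1}"
    proof
      fix t assume "t \<in> (\<lambda>t. cis (2 * pi * t)) -` (ball \<zeta> \<rho> \<inter> sphere 0 1) \<inter> space (restrict_space lborel {0..<1::real})"
      then show "t \<in> {x - \<rho>/4..x + \<rho>/4} \<union> {0..\<rho>/4} \<union> {1 - \<rho>/4..1}"
        by (intro sub) (auto simp: space_restrict_space)
    qed
  qed auto
  also have "\<dots> \<le> emeasure lborel {x - \<rho>/4..x + \<rho>/4} + emeasure lborel {0..\<rho>/4} + emeasure lborel {1 - \<rho>/4..1}"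
    by (rule order_trans[OF emeasure_subadditive add_right_mono[OF emeasure_subadditive]]) auto
  also have "\<dots> = ennreal \<rho>"
    using \<rho> by (simp add: flip: ennreal_plus)
  finally show ?thesis .
qed

text \<open>Among the disks whose mass exceeds \<open>l \<rho>\<close> Vitali's lemma selects disjoint ones whose fivefold
  enlargements cover all of them; \<open>U\<close> is the union of the enlargements. Disjointness bounds the total
  radius by the integral of \<open>h\<close> divided by \<open>l\<close>.\<close>

theorem hardy_littlewood_weak_type:
  fixes h :: "complex \<Rightarrow> real"
  assumes h: "integrable \<sigma> h" "\<And>\<zeta>. 0 \<le> h \<zeta>" and l: "0 < l"
  obtains U where "U \<in> sets \<sigma>" "emeasure \<sigma> U \<le> ennreal (5 / l * (\<integral>\<zeta>. h \<zeta> \<partial>\<sigma>))"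
    "\<And>\<zeta> \<rho>. \<zeta> \<in> sphere 0 1 - U \<Longrightarrow> 0 < \<rho> \<Longrightarrow> (\<integral>\<xi>. indicator (ball \<zeta> \<rho>) \<xi> * h \<xi> \<partial>\<sigma>) \<le> l * \<rho>"
proof -
  have [measurable]: "h \<in> borel_measurable \<sigma>" using h(1) by auto
  have mi [measurable]: "(indicator (ball \<zeta> \<rho>) :: complex \<Rightarrow> real) \<in> borel_measurable \<sigma>" for \<zeta> \<rho>
    by (intro borel_measurable_sigma borel_measurable_indicator) auto
  have int_i: "integrable \<sigma> (\<lambda>\<xi>. indicator (ball \<zeta> \<rho>) \<xi> * h \<xi>)" for \<zeta> \<rho>
  proof (rule Bochner_Integration.integrable_bound[OF h(1)])
    show "(\<lambda>\<xi>. indicator (ball \<zeta> \<rho>) \<xi> * h \<xi>) \<in> borel_measurable \<sigma>" by measurable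
  qed (auto simp: indicator_def)
  define K where "K = {(\<zeta>, \<rho>). \<zeta> \<in> sphere 0 1 \<and> 0 < \<rho> \<and> l * \<rho> < (\<integral>\<xi>. indicator (ball \<zeta> \<rho>) \<xi> * h \<xi> \<partial>\<sigma>)}"
  have rb: "0 < snd i \<and> snd i \<le> (\<integral>\<zeta>. h \<zeta> \<partial>\<sigma>) / l" if "i \<in> K" for i
  proof -
    have "l * snd i < (\<integral>\<xi>. indicator (ball (fst i) (snd i)) \<xi> * h \<xi> \<partial>\<sigma>)"
      using that by (auto simp: K_def)
    also have "\<dots> \<le> (\<integral>\<xi>. h \<xi> \<partial>\<sigma>)"
      by (intro integral_mono int_i h(1)) (auto simp: indicator_def h(2))
    finally show ?thesis using that l by (auto simp: K_def field_simps)
  qed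
  obtain C where C: "countable C" "C \<subseteq> K"
    "pairwise (\<lambda>i j. disjnt (ball (fst i) (snd i)) (ball (fst j) (snd j))) C"
    "(\<Union>i\<in>K. ball (fst i) (snd i)) \<subseteq> (\<Union>i\<in>C. ball (fst i) (5 * snd i))"
    by (rule Vitali_covering_lemma_balls[OF order_refl rb])
  define U where "U = (\<Union>i\<in>C. ball (fst i) (5 * snd i) \<inter> sphere 0 1)"
  define A where "A n = (if n \<in> to_nat_on C ` C then ball (fst (from_nat_into C n)) (5 * snd (from_nat_into C n)) \<inter> sphere 0 1 else {})" for n
  define B where "B n = (if n \<in> to_nat_on C ` C then ball (fst (from_nat_into C n)) (snd (from_nat_into C n)) \<inter> sphere 0 1 else {})" for n
  have inC: "from_nat_into C n \<in> C" if "n \<in> to_nat_on C ` C" for n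
    using that C(1) by auto
  have UA: "U = (\<Union>n. A n)"
    using C(1) by (force simp: U_def A_def)
  have sA: "A n \<in> sets \<sigma>" and sB: "B n \<in> sets \<sigma>" for n
    by (auto simp: A_def B_def intro!: borel_in_sigma)
  have "disjoint_family B"
    unfolding disjoint_family_on_def
  proof (intro ballI impI)
    fix m n :: nat assume mn: "m \<noteq> n"
    show "B m \<inter> B n = {}"
    proof (cases "m \<in> to_nat_on C ` C \<and> n \<in> to_nat_on C ` C")
      case True
      then have "from_nat_into C m \<noteq> from_nat_into C n" using mn C(1) by auto
      then have "disjnt (ball (fst (from_nat_into C m)) (snd (from_nat_into C m)))
          (ball (fst (from_nat_into C n)) (snd (from_nat_into C n)))"
        using True inC C(3) by (auto simp: pairwise_def)
      then show ?thesis by (auto simp: B_def disjnt_def)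
    qed (auto simp: B_def)
  qed
  note disB = this
  define \<nu> where "\<nu> = density \<sigma> (\<lambda>\<xi>. ennreal (h \<xi>))"
  have \<nu>: "emeasure \<nu> (ball \<zeta> \<rho> \<inter> sphere 0 1) = ennreal (\<integral>\<xi>. indicator (ball \<zeta> \<rho>) \<xi> * h \<xi> \<partial>\<sigma>)" for \<zeta> \<rho>
  proof -
    have "emeasure \<nu> (ball \<zeta> \<rho> \<inter> sphere 0 1) = (\<integral>\<^sup>+\<xi>. ennreal (h \<xi>) * indicator (ball \<zeta> \<rho> \<inter> sphere 0 1) \<xi> \<partial>\<sigma>)"
      unfolding \<nu>_def by (rule emeasure_density) (auto intro: borel_in_sigma)
    also have "\<dots> = (\<integral>\<^sup>+\<xi>. ennreal (indicator (ball \<zeta> \<rho>) \<xi> * h \<xi>) \<partial>\<sigma>)"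
      by (intro nn_integral_cong) (auto simp: indicator_def)
    also have "\<dots> = ennreal (\<integral>\<xi>. indicator (ball \<zeta> \<rho>) \<xi> * h \<xi> \<partial>\<sigma>)"
      by (intro nn_integral_eq_integral int_i) (auto simp: indicator_def h(2))
    finally show ?thesis .
  qed
  have AB: "emeasure \<sigma> (A n) \<le> ennreal (5 / l) * emeasure \<nu> (B n)" for n
  proof (cases "n \<in> to_nat_on C ` C")
    case True
    define \<zeta> \<rho> where "\<zeta> = fst (from_nat_into C n)" and "\<rho> = snd (from_nat_into C n)"
    have K: "\<zeta> \<in> sphere 0 1" "0 < \<rho>" "l * \<rho> < (\<integral>\<xi>. indicator (ball \<zeta> \<rho>) \<xi> * h \<xi> \<partial>\<sigma>)"
      using inC[OF True] C(2) by (auto simp: K_def \<zeta>_def \<rho>_def)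
    have "emeasure \<sigma> (A n) \<le> ennreal (5 * \<rho>)"
      using emeasure_sigma_ball_le[OF K(1), of "5 * \<rho>"] K(2) True by (simp add: A_def \<zeta>_def \<rho>_def)
    also have "\<dots> \<le> ennreal (5 / l * (\<integral>\<xi>. indicator (ball \<zeta> \<rho>) \<xi> * h \<xi> \<partial>\<sigma>))"
      using K l by (intro ennreal_leI) (simp add: field_simps)
    also have "\<dots> = ennreal (5 / l) * emeasure \<nu> (B n)"
      using True l ennreal_mult'[of "5 / l" "\<integral>\<xi>. indicator (ball \<zeta> \<rho>) \<xi> * h \<xi> \<partial>\<sigma>"]
      by (simp add: B_def \<nu> flip: \<zeta>_def \<rho>_def)
    finally show ?thesis .
  qed (simp add: A_def)
  have "emeasure \<sigma> U \<le> (\<Sum>n. emeasure \<sigma> (A n))"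
    unfolding UA by (rule emeasure_subadditive_countably) (use sA in auto)
  also have "\<dots> \<le> (\<Sum>n. ennreal (5 / l) * emeasure \<nu> (B n))"
    by (intro suminf_le AB) auto
  also have "\<dots> = ennreal (5 / l) * (\<Sum>n. emeasure \<nu> (B n))" by simp
  also have "(\<Sum>n. emeasure \<nu> (B n)) = emeasure \<nu> (\<Union>n. B n)"
    by (rule suminf_emeasure) (use sB disB in \<open>auto simp: \<nu>_def\<close>)
  also have "emeasure \<nu> (\<Union>n. B n) \<le> emeasure \<nu> (space \<nu>)" by (rule emeasure_space)
  also have "emeasure \<nu> (space \<nu>) = ennreal (\<integral>\<xi>. h \<xi> \<partial>\<sigma>)"
  proof -
    have "emeasure \<nu> (space \<nu>) = (\<integral>\<^sup>+\<xi>. ennreal (h \<xi>) * indicator (space \<sigma>) \<xi> \<partial>\<sigma>)"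
      unfolding \<nu>_def space_density by (rule emeasure_density) (simp_all del: space_sigma)
    also have "\<dots> = (\<integral>\<^sup>+\<xi>. ennreal (h \<xi>) \<partial>\<sigma>)" by (intro nn_integral_cong) auto
    also have "\<dots> = ennreal (\<integral>\<xi>. h \<xi> \<partial>\<sigma>)"
      by (intro nn_integral_eq_integral h(1)) (auto simp: h(2))
    finally show ?thesis .
  qed
  also have "ennreal (5 / l) * ennreal (\<integral>\<xi>. h \<xi> \<partial>\<sigma>) = ennreal (5 / l * (\<integral>\<xi>. h \<xi> \<partial>\<sigma>))"
    using l by (intro ennreal_mult'[symmetric]) auto
  finally have mU: "emeasure \<sigma> U \<le> ennreal (5 / l * (\<integral>\<xi>. h \<xi> \<partial>\<sigma>))"
    by (simp add: mult_left_mono)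
  show ?thesis
  proof (rule that[OF _ mU])
    show "U \<in> sets \<sigma>" unfolding UA using sA by auto
    fix \<zeta> \<rho> assume \<zeta>: "\<zeta> \<in> sphere 0 1 - U" and \<rho>: "(0::real) < \<rho>"
    show "(\<integral>\<xi>. indicator (ball \<zeta> \<rho>) \<xi> * h \<xi> \<partial>\<sigma>) \<le> l * \<rho>"
    proof (rule ccontr)
      assume "\<not> ?thesis"
      then have "(\<zeta>, \<rho>) \<in> K" using \<zeta> \<rho> by (auto simp: K_def)
      then have "\<zeta> \<in> (\<Union>i\<in>K. ball (fst i) (snd i))" using \<rho> by force
      then have "\<zeta> \<in> (\<Union>i\<in>C. ball (fst i) (5 * snd i))" using C(4) by blast
      then show False using \<zeta> unfolding U_def by blast
    qed
  qed
qed

section \<open>The Poisson kernel\<close>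

definition poisson :: "complex \<Rightarrow> complex \<Rightarrow> real"
  where "poisson z \<zeta> = (1 - (cmod z)\<^sup>2) / (cmod (\<zeta> - z))\<^sup>2"

lemma dist_sphere_ge: "\<zeta> \<in> sphere 0 1 \<Longrightarrow> 1 - cmod z \<le> cmod (\<zeta> - z)"
  using norm_triangle_ineq2[of \<zeta> z] by simp

lemma poisson_nonneg: "z \<in> ball 0 1 \<Longrightarrow> 0 \<le> poisson z \<zeta>"
  by (auto simp: poisson_def power2_eq_square intro!: divide_nonneg_nonneg mult_le_one)

lemma continuous_poisson: "z \<in> ball 0 1 \<Longrightarrow> continuous_on (sphere 0 1) (poisson z)"
  unfolding poisson_def by (intro continuous_intros) auto

text \<open>Integrate the geometric series term by term. The signs \<open>e = - 1\<close> and \<open>e = 1\<close> serve the two halves of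
  the Poisson kernel.\<close>

lemma integral_geometric:
  assumes w: "cmod w < 1" and e: "e = 1 \<or> e = - 1"
  shows "(\<integral>\<zeta>. \<zeta> powi m / (1 - w * \<zeta> powi e) \<partial>\<sigma>) = (if 0 \<le> - e * m then w ^ nat (- e * m) else 0)"
proof -
  define f where "f k \<zeta> = \<zeta> powi m * (w * \<zeta> powi e) ^ k" for k \<zeta>
  have fk: "f k \<zeta> = w ^ k * \<zeta> powi (m + e * int k)" if "\<zeta> \<in> sphere 0 1" for k \<zeta>
  proof -
    have "(\<zeta> powi e) ^ k = \<zeta> powi (e * int k)" by (simp add: power_int_mult)
    then show ?thesis using that by (simp add: f_def power_mult_distrib sphere_powi_add mult_ac)
  qed
  have nf: "cmod (f k \<zeta>) = cmod w ^ k" if "\<zeta> \<in> sphere 0 1" for k \<zeta>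
    using that by (simp add: fk norm_mult norm_power)
  have "continuous_on (sphere 0 1) (f k)" for k
    unfolding f_def by (intro continuous_intros)
  then have intf: "integrable \<sigma> (f k)" for k by (rule integrable_sigma_continuous)
  have "(\<lambda>k. \<integral>\<zeta>. f k \<zeta> \<partial>\<sigma>) sums (\<integral>\<zeta>. (\<Sum>k. f k \<zeta>) \<partial>\<sigma>)"
  proof (rule sums_integral[OF intf])
    show "AE \<zeta> in \<sigma>. summable (\<lambda>k. norm (f k \<zeta>))"
      using w by (intro AE_I2) (simp add: nf)
    have "(\<integral>\<zeta>. norm (f k \<zeta>) \<partial>\<sigma>) = (\<integral>\<zeta>. cmod w ^ k \<partial>\<sigma>)" for k
      by (intro Bochner_Integration.integral_cong) (auto simp: nf)
    then show "summable (\<lambda>k. \<integral>\<zeta>. norm (f k \<zeta>) \<partial>\<sigma>)" using w by simp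
  qed
  moreover have "(\<integral>\<zeta>. f k \<zeta> \<partial>\<sigma>) = (if k = nat (- e * m) then if 0 \<le> - e * m then w ^ k else 0 else 0)" for k
  proof -
    have "(\<integral>\<zeta>. f k \<zeta> \<partial>\<sigma>) = (\<integral>\<zeta>. w ^ k * \<zeta> powi (m + e * int k) \<partial>\<sigma>)"
      by (intro Bochner_Integration.integral_cong) (auto simp: fk)
    also have "\<dots> = (if m + e * int k = 0 then w ^ k else 0)" by (simp add: integral_powi)
    finally show ?thesis using e by auto
  qed
  ultimately have "(\<lambda>k. if k = nat (- e * m) then if 0 \<le> - e * m then w ^ k else 0 else 0) sums (\<integral>\<zeta>. (\<Sum>k. f k \<zeta>) \<partial>\<sigma>)"
    by simp
  then have "(\<integral>\<zeta>. (\<Sum>k. f k \<zeta>) \<partial>\<sigma>) = (if 0 \<le> - e * m then w ^ nat (- e * m) else 0)"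
    using sums_unique2[OF sums_single[of "nat (- e * m)" "\<lambda>k. if 0 \<le> - e * m then w ^ k else 0"]] by simp
  moreover have "(\<integral>\<zeta>. (\<Sum>k. f k \<zeta>) \<partial>\<sigma>) = (\<integral>\<zeta>. \<zeta> powi m / (1 - w * \<zeta> powi e) \<partial>\<sigma>)"
  proof (intro Bochner_Integration.integral_cong refl)
    fix \<zeta> assume "\<zeta> \<in> space \<sigma>"
    then have "cmod (w * \<zeta> powi e) < 1" using w by (simp add: norm_mult)
    then have "(\<lambda>k. \<zeta> powi m * (w * \<zeta> powi e) ^ k) sums (\<zeta> powi m * (1 / (1 - w * \<zeta> powi e)))"
      by (intro sums_mult geometric_sums)
    then show "(\<Sum>k. f k \<zeta>) = \<zeta> powi m / (1 - w * \<zeta> powi e)"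
      by (simp add: f_def sums_iff)
  qed
  ultimately show ?thesis by simp
qed

text \<open>By partial fractions the Poisson kernel is the sum of a geometric series in \<open>z \<zeta>\<^sup>-\<^sup>1\<close> and one in
  \<open>cnj z \<zeta>\<close> without constant term; only the first one contributes.\<close>

lemma integral_poisson_power:
  assumes z: "z \<in> ball 0 1"
  shows "(\<integral>\<zeta>. of_real (poisson z \<zeta>) * \<zeta> ^ n \<partial>\<sigma>) = z ^ n"
proof -
  have z1: "cmod z < 1" "cmod (cnj z) < 1" using z by auto
  have nz: "1 - z * \<zeta> powi (-1) \<noteq> 0" "1 - cnj z * \<zeta> powi 1 \<noteq> 0" if "\<zeta> \<in> sphere 0 1" for \<zeta>
  proof -
    have "cmod (z * \<zeta> powi (-1)) < 1" "cmod (cnj z * \<zeta> powi 1) < 1"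
      using that z1 by (auto simp: norm_mult norm_inverse)
    then show "1 - z * \<zeta> powi (-1) \<noteq> 0" "1 - cnj z * \<zeta> powi 1 \<noteq> 0" by auto
  qed
  have eq: "of_real (poisson z \<zeta>) * \<zeta> ^ n
      = \<zeta> powi int n / (1 - z * \<zeta> powi (-1)) + cnj z * (\<zeta> powi (int n + 1) / (1 - cnj z * \<zeta> powi 1))"
    if \<zeta>: "\<zeta> \<in> sphere 0 1" for \<zeta>
  proof -
    have \<zeta>0: "\<zeta> \<noteq> 0" and c: "cnj \<zeta> = inverse \<zeta>" using \<zeta> sphere_cnj by auto
    have nz1: "\<zeta> - z \<noteq> 0" using z1 \<zeta> by auto
    have nz2: "1 - cnj z * \<zeta> \<noteq> 0" using nz(2)[OF \<zeta>] by simp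
    have "complex_of_real ((cmod (\<zeta> - z))\<^sup>2) = (\<zeta> - z) * (inverse \<zeta> - cnj z)"
      by (simp only: complex_norm_square complex_cnj_diff c)
    also have "\<dots> = (\<zeta> - z) * (1 - cnj z * \<zeta>) / \<zeta>" using \<zeta>0 by (simp add: field_simps)
    finally have d: "complex_of_real ((cmod (\<zeta> - z))\<^sup>2) = (\<zeta> - z) * (1 - cnj z * \<zeta>) / \<zeta>" .
    have "complex_of_real (poisson z \<zeta>) = (1 - z * cnj z) / ((\<zeta> - z) * (1 - cnj z * \<zeta>) / \<zeta>)"
      unfolding poisson_def of_real_divide d by (simp add: complex_norm_square del: of_real_power)
    also have "\<dots> = (1 - z * cnj z) * \<zeta> / ((\<zeta> - z) * (1 - cnj z * \<zeta>))" by simp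
    also have "(1 - z * cnj z) * \<zeta> = \<zeta> * (1 - cnj z * \<zeta>) + cnj z * \<zeta> * (\<zeta> - z)" by (simp add: algebra_simps)
    also have "\<dots> / ((\<zeta> - z) * (1 - cnj z * \<zeta>)) = \<zeta> / (\<zeta> - z) + cnj z * \<zeta> / (1 - cnj z * \<zeta>)"
      using nz1 nz2 by (simp add: add_divide_distrib)
    also have "\<zeta> / (\<zeta> - z) = 1 / (1 - z * \<zeta> powi (-1))"
      using \<zeta>0 nz1 by (simp add: power_int_minus field_simps)
    finally show ?thesis
      using \<zeta>0 by (simp add: power_int_add distrib_right distrib_left mult_ac)
  qed
  have i1: "integrable \<sigma> (\<lambda>\<zeta>. \<zeta> powi int n / (1 - z * \<zeta> powi (-1)))"
    and i2: "integrable \<sigma> (\<lambda>\<zeta>. \<zeta> powi (int n + 1) / (1 - cnj z * \<zeta> powi 1))"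
    using nz by (auto intro!: integrable_sigma_continuous continuous_on_divide continuous_intros)
  have "(\<integral>\<zeta>. of_real (poisson z \<zeta>) * \<zeta> ^ n \<partial>\<sigma>)
      = (\<integral>\<zeta>. \<zeta> powi int n / (1 - z * \<zeta> powi (-1)) + cnj z * (\<zeta> powi (int n + 1) / (1 - cnj z * \<zeta> powi 1)) \<partial>\<sigma>)"
    by (intro Bochner_Integration.integral_cong) (auto simp: eq)
  also have "\<dots> = (\<integral>\<zeta>. \<zeta> powi int n / (1 - z * \<zeta> powi (-1)) \<partial>\<sigma>)
      + cnj z * (\<integral>\<zeta>. \<zeta> powi (int n + 1) / (1 - cnj z * \<zeta> powi 1) \<partial>\<sigma>)"
    using Bochner_Integration.integral_add[OF i1 integrable_mult_right[of "cnj z", OF i2]]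
    by (simp only: integral_mult_right_zero)
  also have "\<dots> = z ^ n"
    using integral_geometric[OF z1(1), of "-1" "int n"] integral_geometric[OF z1(2), of 1 "int n + 1"] by simp
  finally show ?thesis .
qed

text \<open>In a Stolz region with vertex \<open>\<zeta>\<close> the Poisson kernel is dominated by a sum of normalized
  indicators of concentric disks of dyadic radii, which bounds Poisson integrals by the maximal function.\<close>

lemma poisson_integral_stolz_le:
  fixes h :: "complex \<Rightarrow> real"
  assumes h: "integrable \<sigma> h" "\<And>\<zeta>. 0 \<le> h \<zeta>" and \<zeta>: "\<zeta> \<in> sphere 0 1" and a: "1 < a"
    and max: "\<And>\<rho>. 0 < \<rho> \<Longrightarrow> (\<integral>\<xi>. indicator (ball \<zeta> \<rho>) \<xi> * h \<xi> \<partial>\<sigma>) \<le> l * \<rho>"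
    and z: "z \<in> stolz_region a \<zeta>"
  shows "(\<integral>\<xi>. poisson z \<xi> * h \<xi> \<partial>\<sigma>) \<le> 16 * (1 + a)\<^sup>2 * l"
proof -
  define \<delta> where "\<delta> = 1 - cmod z"
  have \<delta>: "0 < \<delta>" "\<delta> \<le> 1" using z by (auto simp: \<delta>_def stolz_region_def)
  have zb: "z \<in> ball 0 1" using z by (simp add: stolz_region_def)
  define A where "A = 1 + a"
  have A: "A > 2" using a by (simp add: A_def)
  have near: "cmod (\<xi> - \<zeta>) \<le> A * cmod (\<xi> - z)" if "\<xi> \<in> sphere 0 1" for \<xi>
  proof -
    have "cmod (\<xi> - \<zeta>) \<le> cmod (\<xi> - z) + cmod (z - \<zeta>)"
      using norm_triangle_ineq[of "\<xi> - z" "z - \<zeta>"] by simp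
    also have "cmod (z - \<zeta>) \<le> a * \<delta>" using z by (simp add: stolz_region_def \<delta>_def)
    also have "a * \<delta> \<le> a * cmod (\<xi> - z)" using dist_sphere_ge[OF that, of z] a by (simp add: \<delta>_def)
    finally show ?thesis by (simp add: A_def distrib_right)
  qed
  have P1: "poisson z \<xi> \<le> 2 * \<delta> / d\<^sup>2" if "0 < d" "d \<le> cmod (\<xi> - z)" for \<xi> d
  proof -
    have "1 - (cmod z)\<^sup>2 = \<delta> * (1 + cmod z)" by (simp add: \<delta>_def power2_eq_square algebra_simps)
    also have "\<dots> \<le> \<delta> * 2" using \<delta> zb by (intro mult_left_mono) auto
    finally have "1 - (cmod z)\<^sup>2 \<le> 2 * \<delta>" by simp
    moreover have "d\<^sup>2 \<le> (cmod (\<xi> - z))\<^sup>2" using that by (intro power_mono) auto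
    ultimately show ?thesis
      unfolding poisson_def using that \<delta> by (intro frac_le) auto
  qed
  \<comment> \<open>value of the kernel bound where the distance from the vertex is between \<open>2\<^sup>k\<^sup>-\<^sup>1 \<delta>\<close> and \<open>2\<^sup>k \<delta>\<close>\<close>
  define c where "c k = 8 * A\<^sup>2 / (4 ^ k * \<delta>)" for k :: nat
  have c0: "0 \<le> c k" for k using \<delta> by (simp add: c_def)
  obtain K where "2 / \<delta> < 2 ^ K" using real_arch_pow[of 2 "2 / \<delta>"] by auto
  then have K: "2 < 2 ^ K * \<delta>" using \<delta> by (simp add: field_simps)
  have dom: "poisson z \<xi> \<le> (\<Sum>k\<le>K. c k * indicator (ball \<zeta> (2 ^ k * \<delta>)) \<xi>)" if \<xi>: "\<xi> \<in> sphere 0 1" for \<xi>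
  proof -
    define k where "k = (LEAST k. cmod (\<xi> - \<zeta>) < 2 ^ k * \<delta>)"
    have "cmod (\<xi> - \<zeta>) \<le> 2" using norm_triangle_ineq4[of \<xi> \<zeta>] \<xi> \<zeta> by simp
    then have exK: "cmod (\<xi> - \<zeta>) < 2 ^ K * \<delta>" using K by linarith
    then have k: "cmod (\<xi> - \<zeta>) < 2 ^ k * \<delta>" "k \<le> K"
      unfolding k_def by (rule LeastI, rule Least_le)
    have "poisson z \<xi> \<le> c k"
    proof (cases k)
      case 0
      have "poisson z \<xi> \<le> 2 * \<delta> / \<delta>\<^sup>2" using dist_sphere_ge[OF \<xi>, of z] \<delta> by (intro P1) (auto simp: \<delta>_def)
      also have "\<dots> = 2 / \<delta>" using \<delta> by (simp add: power2_eq_square)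
      also have "\<dots> \<le> 8 * A\<^sup>2 / \<delta>"
      proof (rule divide_right_mono)
        have "1 \<le> A\<^sup>2" using A by (intro one_le_power) auto
        then show "2 \<le> 8 * A\<^sup>2" by linarith
      qed (use \<delta> in auto)
      finally show ?thesis using 0 by (simp add: c_def)
    next
      case (Suc j)
      then have "\<not> cmod (\<xi> - \<zeta>) < 2 ^ j * \<delta>" using not_less_Least[of j "\<lambda>k. cmod (\<xi> - \<zeta>) < 2 ^ k * \<delta>"] by (simp add: k_def)
      then have "2 ^ j * \<delta> / A \<le> cmod (\<xi> - z)" using near[OF \<xi>] A by (simp add: field_simps)
      then have "poisson z \<xi> \<le> 2 * \<delta> / (2 ^ j * \<delta> / A)\<^sup>2" using \<delta> A by (intro P1) auto
      also have "\<dots> = c k"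
      proof -
        have "(2 ^ j)\<^sup>2 = (4::real) ^ j" by (simp add: power2_eq_square flip: power_mult_distrib)
        then show ?thesis using \<delta> A Suc by (simp add: c_def power2_eq_square field_simps)
      qed
      finally show ?thesis .
    qed
    also have "\<dots> = c k * indicator (ball \<zeta> (2 ^ k * \<delta>)) \<xi>" using k by (simp add: dist_norm norm_minus_commute)
    also have "\<dots> \<le> (\<Sum>k\<le>K. c k * indicator (ball \<zeta> (2 ^ k * \<delta>)) \<xi>)"
      using k(2) c0 by (intro member_le_sum) auto
    finally show ?thesis .
  qed
  have [measurable]: "h \<in> borel_measurable \<sigma>" using h(1) by auto
  have [measurable]: "poisson z \<in> borel_measurable \<sigma>"
    by (rule borel_measurable_sigma_continuous[OF continuous_poisson[OF zb]])
  have mi [measurable]: "(indicator (ball \<zeta> \<rho>) :: complex \<Rightarrow> real) \<in> borel_measurable \<sigma>" for \<rho>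
    by (intro borel_measurable_sigma borel_measurable_indicator) auto
  have int_i: "integrable \<sigma> (\<lambda>\<xi>. indicator (ball \<zeta> \<rho>) \<xi> * h \<xi>)" for \<rho>
  proof (rule Bochner_Integration.integrable_bound[OF h(1)])
    show "(\<lambda>\<xi>. indicator (ball \<zeta> \<rho>) \<xi> * h \<xi>) \<in> borel_measurable \<sigma>" by measurable
  qed (auto simp: indicator_def)
  have l: "0 \<le> l"
  proof -
    have "0 \<le> (\<integral>\<xi>. indicator (ball \<zeta> 1) \<xi> * h \<xi> \<partial>\<sigma>)" by (intro integral_nonneg_AE AE_I2) (auto simp: h(2))
    also have "\<dots> \<le> l * 1" by (rule max) simp
    finally show ?thesis by simp
  qed
  have int_s: "integrable \<sigma> (\<lambda>\<xi>. \<Sum>k\<le>K. c k * (indicator (ball \<zeta> (2 ^ k * \<delta>)) \<xi> * h \<xi>))"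
    using int_i by auto
  have ds: "poisson z \<xi> * h \<xi> \<le> (\<Sum>k\<le>K. c k * (indicator (ball \<zeta> (2 ^ k * \<delta>)) \<xi> * h \<xi>))"
    if "\<xi> \<in> sphere 0 1" for \<xi>
    using mult_right_mono[OF dom[OF that] h(2), of \<xi>] by (simp only: sum_distrib_right mult.assoc)
  have "(\<integral>\<xi>. poisson z \<xi> * h \<xi> \<partial>\<sigma>) \<le> (\<integral>\<xi>. (\<Sum>k\<le>K. c k * (indicator (ball \<zeta> (2 ^ k * \<delta>)) \<xi> * h \<xi>)) \<partial>\<sigma>)"
  proof (rule integral_mono)
    show "integrable \<sigma> (\<lambda>\<xi>. poisson z \<xi> * h \<xi>)"
      using ds poisson_nonneg[OF zb] h(2)
      by (intro Bochner_Integration.integrable_bound[OF int_s]) (auto intro!: AE_I2 order_trans[OF ds abs_ge_self])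
  qed (use int_s ds in auto)
  also have "\<dots> = (\<Sum>k\<le>K. c k * (\<integral>\<xi>. indicator (ball \<zeta> (2 ^ k * \<delta>)) \<xi> * h \<xi> \<partial>\<sigma>))"
    using int_i by simp
  also have "\<dots> \<le> (\<Sum>k\<le>K. c k * (l * (2 ^ k * \<delta>)))"
    using \<delta> by (intro sum_mono mult_left_mono max c0) auto
  also have "\<dots> = (\<Sum>k\<le>K. 8 * A\<^sup>2 * l * (1 / 2) ^ k)"
  proof (rule sum.cong[OF refl])
    fix k
    have "(4::real) ^ k = 2 ^ k * 2 ^ k" by (simp flip: power_mult_distrib)
    then show "c k * (l * (2 ^ k * \<delta>)) = 8 * A\<^sup>2 * l * (1 / 2) ^ k"
      using \<delta> by (simp add: c_def field_simps)
  qed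
  also have "\<dots> = 8 * A\<^sup>2 * l * (\<Sum>k\<le>K. (1 / 2) ^ k)" by (simp add: sum_distrib_left)
  also have "\<dots> \<le> 8 * A\<^sup>2 * l * 2"
  proof (rule mult_left_mono)
    have "(\<Sum>k\<le>K. (1 / 2) ^ k) \<le> (\<Sum>k. (1 / 2 :: real) ^ k)"
      by (intro sum_le_suminf summable_geometric) auto
    then show "(\<Sum>k\<le>K. (1 / 2 :: real) ^ k) \<le> 2" by (simp add: suminf_geometric)
  qed (use l in auto)
  finally show ?thesis by (simp add: A_def)
qed

section \<open>Square-integrable functions\<close>

definition sq_integrable :: "(complex \<Rightarrow> 'g::{real_normed_vector, second_countable_topology}) \<Rightarrow> bool"
  where "sq_integrable f \<longleftrightarrow> f \<in> borel_measurable \<sigma> \<and> integrable \<sigma> (\<lambda>\<zeta>. (norm (f \<zeta>))\<^sup>2)"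

lemma sq_integrable_bounded:
  fixes f :: "complex \<Rightarrow> 'g::{real_normed_vector, second_countable_topology}"
  assumes "f \<in> borel_measurable \<sigma>" "AE \<zeta> in \<sigma>. norm (f \<zeta>) \<le> C"
  shows "sq_integrable f"
  unfolding sq_integrable_def
proof (intro conjI integrable_sigma_bounded)
  show "AE \<zeta> in \<sigma>. norm ((norm (f \<zeta>))\<^sup>2) \<le> C\<^sup>2"
    using assms(2) by eventually_elim (auto intro: power_mono)
  show "(\<lambda>\<zeta>. (norm (f \<zeta>))\<^sup>2) \<in> borel_measurable \<sigma>" using assms(1) by measurable
qed (rule assms(1))

lemma sq_integrable_continuous:
  fixes f :: "complex \<Rightarrow> 'g::{real_normed_vector, second_countable_topology}"
  assumes "continuous_on (sphere 0 1) f"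
  shows "sq_integrable f"
  unfolding sq_integrable_def
  by (intro conjI borel_measurable_sigma_continuous integrable_sigma_continuous continuous_intros assms)

lemma sq_integrable_const: "sq_integrable (\<lambda>\<zeta>. c)"
  by (rule sq_integrable_continuous[OF continuous_on_const])

lemma sq_integrable_bound:
  fixes f :: "complex \<Rightarrow> 'g::{real_normed_vector, second_countable_topology}"
    and g :: "complex \<Rightarrow> 'h::{real_normed_vector, second_countable_topology}"
  assumes "sq_integrable f" "g \<in> borel_measurable \<sigma>" "AE \<zeta> in \<sigma>. norm (g \<zeta>) \<le> C * norm (f \<zeta>)"
  shows "sq_integrable g"
  unfolding sq_integrable_def
proof (intro conjI, rule assms(2), rule Bochner_Integration.integrable_bound)
  show "integrable \<sigma> (\<lambda>\<zeta>. C\<^sup>2 * (norm (f \<zeta>))\<^sup>2)" using assms(1) by (auto simp: sq_integrable_def)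
  show "AE \<zeta> in \<sigma>. norm ((norm (g \<zeta>))\<^sup>2) \<le> norm (C\<^sup>2 * (norm (f \<zeta>))\<^sup>2)"
    using assms(3)
  proof eventually_elim
    case (elim \<zeta>)
    then have "(norm (g \<zeta>))\<^sup>2 \<le> (C * norm (f \<zeta>))\<^sup>2" by (intro power_mono) auto
    then show ?case by (simp add: power_mult_distrib)
  qed
  show "(\<lambda>\<zeta>. (norm (g \<zeta>))\<^sup>2) \<in> borel_measurable \<sigma>" using assms(2) by measurable
qed

lemma sq_integrable_add:
  fixes f g :: "complex \<Rightarrow> 'g::{real_normed_vector, second_countable_topology}"
  assumes "sq_integrable f" "sq_integrable g"
  shows "sq_integrable (\<lambda>\<zeta>. f \<zeta> + g \<zeta>)"
proof -
  have [measurable]: "f \<in> borel_measurable \<sigma>" "g \<in> borel_measurable \<sigma>"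
    using assms by (auto simp: sq_integrable_def)
  have "integrable \<sigma> (\<lambda>\<zeta>. (norm (f \<zeta> + g \<zeta>))\<^sup>2)"
  proof (rule Bochner_Integration.integrable_bound)
  show "integrable \<sigma> (\<lambda>\<zeta>. 2 * (norm (f \<zeta>))\<^sup>2 + 2 * (norm (g \<zeta>))\<^sup>2)"
    using assms by (auto simp: sq_integrable_def)
  show "AE \<zeta> in \<sigma>. norm ((norm (f \<zeta> + g \<zeta>))\<^sup>2) \<le> norm (2 * (norm (f \<zeta>))\<^sup>2 + 2 * (norm (g \<zeta>))\<^sup>2)"
    using norm_add_sq_le[of "f _" "g _"] by (intro AE_I2) auto
    show "(\<lambda>\<zeta>. (norm (f \<zeta> + g \<zeta>))\<^sup>2) \<in> borel_measurable \<sigma>" by measurable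
  qed
  then show ?thesis by (simp add: sq_integrable_def)
qed

lemma sq_integrable_minus:
  fixes f g :: "complex \<Rightarrow> 'g::{real_normed_vector, second_countable_topology}"
  shows "sq_integrable f \<Longrightarrow> sq_integrable (\<lambda>\<zeta>. - f \<zeta>)"
  by (auto simp: sq_integrable_def)

lemma sq_integrable_diff:
  fixes f g :: "complex \<Rightarrow> 'g::{real_normed_vector, second_countable_topology}"
  assumes "sq_integrable f" "sq_integrable g"
  shows "sq_integrable (\<lambda>\<zeta>. f \<zeta> - g \<zeta>)"
  using sq_integrable_add[OF assms(1) sq_integrable_minus[OF assms(2)]] by simp

lemma sq_integrable_scaleC:
  fixes f :: "complex \<Rightarrow> 'g::{complex_normed_vector, second_countable_topology}"
  assumes "sq_integrable f"
  shows "sq_integrable (\<lambda>\<zeta>. c *\<^sub>C f \<zeta>)"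
proof (rule sq_integrable_bound[OF assms, of _ "cmod c"])
  have [measurable]: "f \<in> borel_measurable \<sigma>" using assms by (auto simp: sq_integrable_def)
  show "(\<lambda>\<zeta>. c *\<^sub>C f \<zeta>) \<in> borel_measurable \<sigma>" by measurable
qed (simp add: norm_scaleC)

lemma integrable_norm_mult:
  assumes "sq_integrable f" "sq_integrable g"
  shows "integrable \<sigma> (\<lambda>\<zeta>. norm (f \<zeta>) * norm (g \<zeta>))"
proof (rule Bochner_Integration.integrable_bound)
  have [measurable]: "f \<in> borel_measurable \<sigma>" "g \<in> borel_measurable \<sigma>"
    using assms by (auto simp: sq_integrable_def)
  show "integrable \<sigma> (\<lambda>\<zeta>. (norm (f \<zeta>))\<^sup>2 + (norm (g \<zeta>))\<^sup>2)"
    using assms by (auto simp: sq_integrable_def)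
  show "(\<lambda>\<zeta>. norm (f \<zeta>) * norm (g \<zeta>)) \<in> borel_measurable \<sigma>" by measurable
  have "\<bar>norm (f \<zeta>) * norm (g \<zeta>)\<bar> \<le> (norm (f \<zeta>))\<^sup>2 + (norm (g \<zeta>))\<^sup>2" for \<zeta>
  proof -
    have "0 \<le> norm (f \<zeta>) * norm (g \<zeta>)" by simp
    then show ?thesis
      using sum_squares_bound[of "norm (f \<zeta>)" "norm (g \<zeta>)"] by (simp only: abs_of_nonneg)
  qed
  then show "AE \<zeta> in \<sigma>. norm (norm (f \<zeta>) * norm (g \<zeta>)) \<le> norm ((norm (f \<zeta>))\<^sup>2 + (norm (g \<zeta>))\<^sup>2)" by simp
qed

text \<open>Cauchy-Schwarz: the integral of \<open>(s * norm (f \<zeta>) - t * norm (g \<zeta>))\<^sup>2\<close> is a nonnegative quadratic form in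
  \<open>s\<close> and \<open>t\<close>.\<close>

lemma integral_norm_mult_le:
  assumes f: "sq_integrable f" and g: "sq_integrable g"
  shows "(\<integral>\<zeta>. norm (f \<zeta>) * norm (g \<zeta>) \<partial>\<sigma>)
    \<le> sqrt (\<integral>\<zeta>. (norm (f \<zeta>))\<^sup>2 \<partial>\<sigma>) * sqrt (\<integral>\<zeta>. (norm (g \<zeta>))\<^sup>2 \<partial>\<sigma>)"
proof -
  define A B I where "A = (\<integral>\<zeta>. (norm (f \<zeta>))\<^sup>2 \<partial>\<sigma>)" and "B = (\<integral>\<zeta>. (norm (g \<zeta>))\<^sup>2 \<partial>\<sigma>)"
    and "I = (\<integral>\<zeta>. norm (f \<zeta>) * norm (g \<zeta>) \<partial>\<sigma>)"
  have AB: "0 \<le> A" "0 \<le> B" by (auto simp: A_def B_def)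
  have I0: "0 \<le> I" by (auto simp: I_def)
  have iA: "integrable \<sigma> (\<lambda>\<zeta>. (norm (f \<zeta>))\<^sup>2)" and iB: "integrable \<sigma> (\<lambda>\<zeta>. (norm (g \<zeta>))\<^sup>2)"
    using f g by (auto simp: sq_integrable_def)
  have iI: "integrable \<sigma> (\<lambda>\<zeta>. norm (f \<zeta>) * norm (g \<zeta>))" by (rule integrable_norm_mult[OF f g])
  have q: "0 \<le> s\<^sup>2 * A - 2 * s * t * I + t\<^sup>2 * B" for s t
  proof -
    have "0 \<le> (\<integral>\<zeta>. (s * norm (f \<zeta>) - t * norm (g \<zeta>))\<^sup>2 \<partial>\<sigma>)" by simp
    also have "\<dots> = (\<integral>\<zeta>. s\<^sup>2 * (norm (f \<zeta>))\<^sup>2 - 2 * s * t * (norm (f \<zeta>) * norm (g \<zeta>)) + t\<^sup>2 * (norm (g \<zeta>))\<^sup>2 \<partial>\<sigma>)"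
      by (intro Bochner_Integration.integral_cong) (auto simp: power2_eq_square algebra_simps)
    also have "\<dots> = s\<^sup>2 * A - 2 * s * t * I + t\<^sup>2 * B"
      using iA iB iI by (simp add: A_def B_def I_def)
    finally show ?thesis .
  qed
  have "I\<^sup>2 \<le> A * B"
  proof (cases "A = 0")
    case True
    have "I = 0"
    proof (rule ccontr)
      assume "I \<noteq> 0"
      then have "0 \<le> B - (B + 1)" using q[of "(B + 1) / (2 * I)" 1] True by simp
      then show False by simp
    qed
    then show ?thesis using AB by simp
  next
    case False
    have "0 \<le> I\<^sup>2 * A - 2 * I * A * I + A\<^sup>2 * B" by (rule q)
    then have "0 \<le> A * (A * B - I\<^sup>2)" by (simp add: power2_eq_square algebra_simps)
    then show ?thesis using False AB by (simp add: zero_le_mult_iff)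
  qed
  then have "I \<le> sqrt (A * B)" by (rule real_le_rsqrt)
  then show ?thesis by (simp add: A_def B_def I_def real_sqrt_mult)
qed

lemma integral_norm_le:
  assumes f: "sq_integrable f"
  shows "(\<integral>\<zeta>. norm (f \<zeta>) \<partial>\<sigma>) \<le> sqrt (\<integral>\<zeta>. (norm (f \<zeta>))\<^sup>2 \<partial>\<sigma>)"
  using integral_norm_mult_le[OF f sq_integrable_const[of "1::real"]] by simp

lemma sq_integrable_integrable:
  fixes f :: "complex \<Rightarrow> 'g::{banach, second_countable_topology}"
  assumes f: "sq_integrable f"
  shows "integrable \<sigma> f"
proof (rule Bochner_Integration.integrable_bound)
  show "integrable \<sigma> (\<lambda>\<zeta>. norm (f \<zeta>) * norm (1::real))"
    by (rule integrable_norm_mult[OF f sq_integrable_const])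
  show "f \<in> borel_measurable \<sigma>" using f by (auto simp: sq_integrable_def)
qed simp

lemma integrable_powi_cinner:
  fixes f g :: "complex \<Rightarrow> 'g::{chilbert_space, second_countable_topology}"
  assumes f: "sq_integrable f" and g: "sq_integrable g"
  shows "integrable \<sigma> (\<lambda>\<zeta>. \<zeta> powi k * cinner (f \<zeta>) (g \<zeta>))"
proof (rule Bochner_Integration.integrable_bound[OF integrable_norm_mult[OF f g]])
  have [measurable]: "f \<in> borel_measurable \<sigma>" "g \<in> borel_measurable \<sigma>"
    using assms by (auto simp: sq_integrable_def)
  show "(\<lambda>\<zeta>. \<zeta> powi k * cinner (f \<zeta>) (g \<zeta>)) \<in> borel_measurable \<sigma>" by measurable
  show "AE \<zeta> in \<sigma>. norm (\<zeta> powi k * cinner (f \<zeta>) (g \<zeta>)) \<le> norm (norm (f \<zeta>) * norm (g \<zeta>))"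
    by (intro AE_I2) (auto simp: norm_mult norm_cinner_le)
qed

lemma norm_integral_powi_cinner_le:
  fixes f g :: "complex \<Rightarrow> 'g::{chilbert_space, second_countable_topology}"
  assumes f: "sq_integrable f" and g: "sq_integrable g"
  shows "cmod (\<integral>\<zeta>. \<zeta> powi k * cinner (f \<zeta>) (g \<zeta>) \<partial>\<sigma>)
    \<le> sqrt (\<integral>\<zeta>. (norm (f \<zeta>))\<^sup>2 \<partial>\<sigma>) * sqrt (\<integral>\<zeta>. (norm (g \<zeta>))\<^sup>2 \<partial>\<sigma>)"
proof -
  have "cmod (\<integral>\<zeta>. \<zeta> powi k * cinner (f \<zeta>) (g \<zeta>) \<partial>\<sigma>) \<le> (\<integral>\<zeta>. cmod (\<zeta> powi k * cinner (f \<zeta>) (g \<zeta>)) \<partial>\<sigma>)"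
    by (rule integral_norm_bound)
  also have "\<dots> \<le> (\<integral>\<zeta>. norm (f \<zeta>) * norm (g \<zeta>) \<partial>\<sigma>)"
    by (intro integral_mono integrable_norm integrable_powi_cinner integrable_norm_mult f g)
      (auto simp: norm_mult norm_cinner_le)
  also note integral_norm_mult_le[OF f g]
  finally show ?thesis .
qed

section \<open>Power series with square-summable coefficients and their boundary functions\<close>

definition psum :: "(nat \<Rightarrow> 'g::complex_normed_vector) \<Rightarrow> nat \<Rightarrow> complex \<Rightarrow> 'g"
  where "psum a N z = (\<Sum>n<N. z ^ n *\<^sub>C a n)"

text \<open>For square-summable coefficients these are exactly the functions of class \<open>H2\<close> on the disk.\<close>

definition hardy :: "(nat \<Rightarrow> 'g::complex_normed_vector) \<Rightarrow> complex \<Rightarrow> 'g"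
  where "hardy a z = (\<Sum>n. z ^ n *\<^sub>C a n)"

lemma continuous_psum [continuous_intros]: "continuous_on S (psum a N)"
  unfolding psum_def by (intro continuous_intros scaleC.continuous_on)

lemma sq_integrable_psum:
  fixes a :: "nat \<Rightarrow> 'g::{chilbert_space, second_countable_topology}"
  shows "sq_integrable (psum a N)"
  by (intro sq_integrable_continuous continuous_psum)

lemma borel_measurable_psum:
  fixes a :: "nat \<Rightarrow> 'g::{chilbert_space, second_countable_topology}"
  shows "psum a N \<in> borel_measurable \<sigma>"
  by (intro borel_measurable_sigma_continuous continuous_psum)

lemma integral_norm_psum:
  fixes a :: "nat \<Rightarrow> 'g::{chilbert_space, second_countable_topology}"
  shows "(\<integral>\<zeta>. (norm (psum a N \<zeta>))\<^sup>2 \<partial>\<sigma>) = (\<Sum>n<N. (norm (a n))\<^sup>2)"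
proof -
  have eq: "complex_of_real ((norm (psum a N \<zeta>))\<^sup>2) = (\<Sum>n<N. \<Sum>m<N. \<zeta> powi (int n - int m) * cinner (a n) (a m))"
    if "\<zeta> \<in> sphere 0 1" for \<zeta>
  proof -
    have p: "\<zeta> ^ n * cnj \<zeta> ^ m = \<zeta> powi (int n - int m)" for n m
      using sphere_ne_0[OF that] by (simp add: sphere_cnj[OF that] power_int_diff power_inverse divide_inverse)
    have "complex_of_real ((norm (psum a N \<zeta>))\<^sup>2) = (\<Sum>n<N. \<Sum>m<N. (\<zeta> ^ n * cnj \<zeta> ^ m) * cinner (a n) (a m))"
      unfolding cinner_self[symmetric] psum_def cinner.sum_left cinner.sum_right
      by (simp add: cinner_scaleC_left cinner_scaleC_right mult_ac) (rule sum.swap)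
    then show ?thesis by (simp only: p)
  qed
  have "complex_of_real (\<integral>\<zeta>. (norm (psum a N \<zeta>))\<^sup>2 \<partial>\<sigma>) = (\<integral>\<zeta>. complex_of_real ((norm (psum a N \<zeta>))\<^sup>2) \<partial>\<sigma>)"
    by (rule integral_complex_of_real[symmetric])
  also have "\<dots> = (\<integral>\<zeta>. (\<Sum>n<N. \<Sum>m<N. \<zeta> powi (int n - int m) * cinner (a n) (a m)) \<partial>\<sigma>)"
    by (intro Bochner_Integration.integral_cong) (simp_all only: eq space_sigma)
  also have "\<dots> = (\<Sum>n<N. \<Sum>m<N. (\<integral>\<zeta>. \<zeta> powi (int n - int m) * cinner (a n) (a m) \<partial>\<sigma>))"
    by (simp add: integrable_sigma_continuous continuous_on_sphere_powi)
  also have "\<dots> = (\<Sum>n<N. \<Sum>m<N. if m = n then cinner (a n) (a m) else 0)"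
    by (intro sum.cong refl) (auto simp: integral_powi)
  also have "\<dots> = complex_of_real (\<Sum>n<N. (norm (a n))\<^sup>2)"
    by (simp add: sum.delta cinner_self)
  finally show ?thesis by (simp only: of_real_eq_iff)
qed

lemma psum_diff:
  assumes "N \<le> M"
  shows "psum a M z - psum a N z = psum (\<lambda>n. if n < N then 0 else a n) M z"
proof -
  have "psum a M z = (\<Sum>n<M. z ^ n *\<^sub>C (if n < N then a n else 0)) + psum (\<lambda>n. if n < N then 0 else a n) M z"
    unfolding psum_def by (simp flip: sum.distrib) (rule sum.cong, auto simp: scaleC.zero_right)
  also have "(\<Sum>n<M. z ^ n *\<^sub>C (if n < N then a n else 0)) = (\<Sum>n<N. z ^ n *\<^sub>C (if n < N then a n else 0))"
    using assms by (intro sum.mono_neutral_right) (auto simp: scaleC.zero_right)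
  also have "\<dots> = psum a N z" unfolding psum_def by (intro sum.cong) auto
  finally show ?thesis by simp
qed

lemma sum_tail:
  fixes N M :: nat
  assumes "N \<le> M"
  shows "(\<Sum>n<M. (norm (if n < N then 0 else a n))\<^sup>2) = (\<Sum>n=N..<M. (norm (a n :: 'a::real_normed_vector))\<^sup>2)"
  by (rule sum.mono_neutral_cong_right) auto

lemma integral_scaleC_left:
  fixes v :: "'g::{chilbert_space, second_countable_topology}"
  assumes "integrable \<sigma> g"
  shows "integrable \<sigma> (\<lambda>\<zeta>. g \<zeta> *\<^sub>C v)" "(\<integral>\<zeta>. g \<zeta> *\<^sub>C v \<partial>\<sigma>) = (\<integral>\<zeta>. g \<zeta> \<partial>\<sigma>) *\<^sub>C v"
  using integrable_bounded_linear[OF scaleC.bounded_linear_left assms]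
    integral_bounded_linear[OF scaleC.bounded_linear_left assms] by auto

lemma poisson_psum:
  fixes a :: "nat \<Rightarrow> 'g::{chilbert_space, second_countable_topology}"
  assumes z: "z \<in> ball 0 1"
  shows "psum a N z = (\<integral>\<zeta>. of_real (poisson z \<zeta>) *\<^sub>C psum a N \<zeta> \<partial>\<sigma>)"
proof -
  have i: "integrable \<sigma> (\<lambda>\<zeta>. complex_of_real (poisson z \<zeta>) * \<zeta> ^ n)" for n
    by (intro integrable_sigma_continuous continuous_intros continuous_poisson[OF z])
  have "(\<integral>\<zeta>. of_real (poisson z \<zeta>) *\<^sub>C psum a N \<zeta> \<partial>\<sigma>) = (\<integral>\<zeta>. (\<Sum>n<N. (of_real (poisson z \<zeta>) * \<zeta> ^ n) *\<^sub>C a n) \<partial>\<sigma>)"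
    by (simp add: psum_def scaleC.sum_right scaleC_scaleC)
  also have "\<dots> = (\<Sum>n<N. (\<integral>\<zeta>. of_real (poisson z \<zeta>) * \<zeta> ^ n \<partial>\<sigma>) *\<^sub>C a n)"
    by (subst Bochner_Integration.integral_sum) (auto simp: integral_scaleC_left i)
  finally show ?thesis by (simp add: integral_poisson_power[OF z] psum_def)
qed

lemma integral_poisson: "z \<in> ball 0 1 \<Longrightarrow> (\<integral>\<zeta>. poisson z \<zeta> \<partial>\<sigma>) = 1"
  using integral_poisson_power[of z 0] by simp

lemma norm_psum_le_poisson:
  fixes a :: "nat \<Rightarrow> 'g::{chilbert_space, second_countable_topology}"
  assumes z: "z \<in> ball 0 1"
  shows "norm (psum a N z) \<le> (\<integral>\<zeta>. poisson z \<zeta> * norm (psum a N \<zeta>) \<partial>\<sigma>)"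
proof -
  have "norm (psum a N z) \<le> (\<integral>\<zeta>. norm (of_real (poisson z \<zeta>) *\<^sub>C psum a N \<zeta>) \<partial>\<sigma>)"
    unfolding poisson_psum[OF z] by (rule integral_norm_bound)
  then show ?thesis by (simp add: norm_scaleC poisson_nonneg[OF z])
qed

text \<open>A partial sum is the Poisson integral of its values on the circle, so in a Stolz region it is
  dominated by the maximal function of its norm.\<close>

lemma stolz_region_psum_weak_type:
  fixes a :: "nat \<Rightarrow> 'g::{chilbert_space, second_countable_topology}"
  assumes l: "0 < l"
  obtains U where "U \<in> sets \<sigma>" "emeasure \<sigma> U \<le> ennreal (5 / l * sqrt (\<Sum>n<N. (norm (a n))\<^sup>2))"
    "\<And>\<zeta> b z. \<zeta> \<in> sphere 0 1 - U \<Longrightarrow> 1 < b \<Longrightarrow> z \<in> stolz_region b \<zeta> \<Longrightarrow> norm (psum a N z) \<le> 16 * (1 + b)\<^sup>2 * l"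
proof -
  have h: "integrable \<sigma> (\<lambda>\<zeta>. norm (psum a N \<zeta>))"
    by (intro integrable_sigma_continuous continuous_intros)
  obtain U where U: "U \<in> sets \<sigma>" "emeasure \<sigma> U \<le> ennreal (5 / l * (\<integral>\<zeta>. norm (psum a N \<zeta>) \<partial>\<sigma>))"
    "\<And>\<zeta> \<rho>. \<zeta> \<in> sphere 0 1 - U \<Longrightarrow> 0 < \<rho> \<Longrightarrow> (\<integral>\<xi>. indicator (ball \<zeta> \<rho>) \<xi> * norm (psum a N \<xi>) \<partial>\<sigma>) \<le> l * \<rho>"
    by (rule hardy_littlewood_weak_type[OF h _ l]) auto
  show ?thesis
  proof (rule that[OF U(1)])
    have "(\<integral>\<zeta>. norm (psum a N \<zeta>) \<partial>\<sigma>) \<le> sqrt (\<Sum>n<N. (norm (a n))\<^sup>2)"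
      using integral_norm_le[OF sq_integrable_psum, of a N] by (simp add: integral_norm_psum)
    then show "emeasure \<sigma> U \<le> ennreal (5 / l * sqrt (\<Sum>n<N. (norm (a n))\<^sup>2))"
      using l by (intro order_trans[OF U(2)] ennreal_leI mult_left_mono) auto
    fix \<zeta> b z assume *: "\<zeta> \<in> sphere 0 1 - U" "1 < b" "z \<in> stolz_region b \<zeta>"
    have "norm (psum a N z) \<le> (\<integral>\<zeta>. poisson z \<zeta> * norm (psum a N \<zeta>) \<partial>\<sigma>)"
      using *(3) by (intro norm_psum_le_poisson) (simp add: stolz_region_def)
    also have "\<dots> \<le> 16 * (1 + b)\<^sup>2 * l"
      using * U(3)[OF *(1)] by (intro poisson_integral_stolz_le[OF h]) auto
    finally show "norm (psum a N z) \<le> 16 * (1 + b)\<^sup>2 * l" .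
  qed
qed

lemma norm_coeff_le:
  fixes a :: "nat \<Rightarrow> 'g::real_normed_vector"
  assumes "summable (\<lambda>n. (norm (a n))\<^sup>2)"
  shows "norm (a n) \<le> sqrt (\<Sum>n. (norm (a n))\<^sup>2)"
proof (rule real_le_rsqrt)
  show "(norm (a n))\<^sup>2 \<le> (\<Sum>n. (norm (a n))\<^sup>2)"
    using sum_le_suminf[OF assms, of "{n}"] by simp
qed

lemma psum_tendsto_hardy:
  fixes a :: "nat \<Rightarrow> 'g::chilbert_space"
  assumes b: "\<And>n. norm (a n) \<le> C" and z: "z \<in> ball 0 1"
  shows "(\<lambda>N. psum a N z) \<longlonglongrightarrow> hardy a z"
proof -
  have "summable (\<lambda>n. z ^ n *\<^sub>C a n)"
  proof (rule summable_comparison_test')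
    show "summable (\<lambda>n. C * cmod z ^ n)" using z by (intro summable_mult summable_geometric) auto
    show "norm (z ^ n *\<^sub>C a n) \<le> C * cmod z ^ n" for n
      using mult_right_mono[OF b, of "cmod z ^ n" n] by (simp add: norm_scaleC norm_power mult.commute)
  qed
  then show ?thesis unfolding psum_def hardy_def by (rule summable_LIMSEQ)
qed

lemma dyadic_increments:
  fixes s :: "nat \<Rightarrow> 'a::real_normed_vector"
  assumes "\<And>k. k \<ge> k0 \<Longrightarrow> norm (s (Suc k) - s k) \<le> C * (1/2) ^ k" and km: "k0 \<le> k" "k \<le> m" and C: "0 \<le> C"
  shows "norm (s m - s k) \<le> 2 * C * (1/2) ^ k"
proof -
  have "norm (s m - s k) \<le> 2 * C * ((1/2) ^ k - (1/2) ^ m)"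
    using km(2)
  proof (induction m rule: dec_induct)
    case (step m)
    have "norm (s (Suc m) - s k) \<le> norm (s (Suc m) - s m) + norm (s m - s k)"
      using norm_triangle_ineq[of "s (Suc m) - s m" "s m - s k"] by simp
    also have "\<dots> \<le> C * (1/2) ^ m + 2 * C * ((1/2) ^ k - (1/2) ^ m)"
      using assms(1)[of m] step km(1) by (intro add_mono) auto
    also have "\<dots> = 2 * C * ((1/2) ^ k - (1/2) ^ Suc m)" by (simp add: algebra_simps)
    finally show ?case .
  qed simp
  also have "\<dots> \<le> 2 * C * (1/2) ^ k" using C by (intro mult_left_mono) auto
  finally show ?thesis .
qed

lemma radial_in_stolz:
  assumes "\<zeta> \<in> sphere 0 1" "1 < b" "0 \<le> r" "r < 1"
  shows "of_real r * \<zeta> \<in> stolz_region b \<zeta>"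
proof -
  have "of_real r * \<zeta> - \<zeta> = of_real (r - 1) * \<zeta>" by (simp add: algebra_simps)
  then have "cmod (of_real r * \<zeta> - \<zeta>) = 1 - r"
    using assms by (simp add: norm_mult del: of_real_diff)
  then show ?thesis using assms by (simp add: stolz_region_def norm_mult)
qed

lemma stolz_region_nontrivial:
  assumes \<zeta>: "\<zeta> \<in> sphere 0 1" and b: "1 < b"
  shows "at \<zeta> within stolz_region b \<zeta> \<noteq> bot"
proof -
  have "\<zeta> islimpt stolz_region b \<zeta>"
  proof (rule islimpt_sequential[THEN iffD2], intro exI conjI allI)
    define s where "s n = of_real (1 - 1 / real (Suc n)) * \<zeta>" for n
    have r: "0 \<le> 1 - 1 / real (Suc n)" "1 - 1 / real (Suc n) < 1" for n by auto
    show "s n \<in> stolz_region b \<zeta> - {\<zeta>}" for n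
    proof -
      have "s n \<in> stolz_region b \<zeta>" unfolding s_def by (rule radial_in_stolz[OF \<zeta> b r])
      moreover have "\<zeta> \<notin> stolz_region b \<zeta>" using \<zeta> by (simp add: stolz_region_def)
      ultimately show ?thesis by auto
    qed
    have "(\<lambda>n. 1 / real (Suc n)) \<longlonglongrightarrow> 0"
      using LIMSEQ_inverse_real_of_nat by (simp add: inverse_eq_divide)
    then have "(\<lambda>n. of_real (1 - 1 / real (Suc n)) * \<zeta>) \<longlonglongrightarrow> of_real (1 - 0) * \<zeta>"
      by (intro tendsto_mult tendsto_of_real tendsto_diff tendsto_const)
    then show "s \<longlonglongrightarrow> \<zeta>" by (simp add: s_def[abs_def])
  qed
  then show ?thesis by (simp add: trivial_limit_within)
qed

lemma continuous_stolz_le: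
  fixes f :: "complex \<Rightarrow> 'a::real_normed_vector"
  assumes "continuous_on UNIV f" "\<zeta> \<in> sphere 0 1" "1 < b" "\<And>z. z \<in> stolz_region b \<zeta> \<Longrightarrow> norm (f z) \<le> C"
  shows "norm (f \<zeta>) \<le> C"
proof (rule tendsto_upperbound)
  show "((\<lambda>z. norm (f z)) \<longlongrightarrow> norm (f \<zeta>)) (at \<zeta> within stolz_region b \<zeta>)"
  proof (rule tendsto_norm)
    have "(f \<longlongrightarrow> f \<zeta>) (at \<zeta>)" using assms(1) by (simp add: continuous_on_eq_continuous_at isCont_def)
    then show "(f \<longlongrightarrow> f \<zeta>) (at \<zeta> within stolz_region b \<zeta>)" by (rule tendsto_within_subset) simp
  qed
  show "\<forall>\<^sub>F z in at \<zeta> within stolz_region b \<zeta>. norm (f z) \<le> C"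
    using assms(4) by (simp add: eventually_at_filter)
qed (rule stolz_region_nontrivial[OF assms(2,3)])

text \<open>Along a subsequence with summable increments the partial sums converge uniformly in almost every
  Stolz region, by the weak-type inequality and the Borel-Cantelli lemma.\<close>

theorem fatou_ex:
  fixes a :: "nat \<Rightarrow> 'g::{chilbert_space, second_countable_topology}"
  assumes a: "summable (\<lambda>n. (norm (a n))\<^sup>2)"
  shows "\<exists>g N. g \<in> borel_measurable \<sigma> \<and> strict_mono (N :: nat \<Rightarrow> nat) \<and>
    (AE \<zeta> in \<sigma>. (\<lambda>k. psum a (N k) \<zeta>) \<longlonglongrightarrow> g \<zeta>) \<and>
    (AE \<zeta> in \<sigma>. nontangential_limit (hardy a) \<zeta> (g \<zeta>))"
proof -
  have tail: "\<exists>N>m. \<forall>M\<ge>N. (\<Sum>n=N..<M. (norm (a n))\<^sup>2) \<le> e" if "e > 0" for e m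
  proof -
    from a[unfolded summable_Cauchy, rule_format, OF that]
    obtain N0 where N0: "\<forall>p\<ge>N0. \<forall>q. norm (\<Sum>n=p..<q. (norm (a n))\<^sup>2) < e" by blast
    show ?thesis
    proof (intro exI conjI allI impI)
      show "m < N0 + Suc m" by simp
      show "(\<Sum>n=N0 + Suc m..<M. (norm (a n))\<^sup>2) \<le> e" for M
        using N0[rule_format, of "N0 + Suc m" M] by (simp add: abs_less_iff less_imp_le)
    qed
  qed
  have "\<exists>N. \<forall>k. (\<forall>M\<ge>N k. (\<Sum>n=N k..<M. (norm (a n))\<^sup>2) \<le> (1/16) ^ k) \<and> N k < N (Suc k)"
  proof (rule dependent_nat_choice)
    show "\<exists>x. \<forall>M\<ge>x. (\<Sum>n=x..<M. (norm (a n))\<^sup>2) \<le> (1/16) ^ 0" using tail[of 1 0] by auto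
    show "\<exists>y. (\<forall>M\<ge>y. (\<Sum>n=y..<M. (norm (a n))\<^sup>2) \<le> (1/16) ^ Suc k) \<and> x < y" for x k
      using tail[of "(1/16) ^ Suc k" x] by auto
  qed
  then obtain N where N: "\<And>k M. N k \<le> M \<Longrightarrow> (\<Sum>n=N k..<M. (norm (a n))\<^sup>2) \<le> (1/16) ^ k"
    and Nm: "\<And>k. N k < N (Suc k)" by blast
  have sm: "strict_mono N" using Nm by (simp add: strict_mono_Suc_iff)
  define c where "c k n = (if n < N k then 0 else a n)" for k n
  have inc: "psum a (N (Suc k)) z - psum a (N k) z = psum (c k) (N (Suc k)) z" for k z
    unfolding c_def by (rule psum_diff) (use Nm in \<open>simp add: less_imp_le\<close>)
  have "\<exists>U. U \<in> sets \<sigma> \<and> emeasure \<sigma> U \<le> ennreal (5 * (1/2) ^ k) \<and>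
      (\<forall>\<zeta> b z. \<zeta> \<in> sphere 0 1 - U \<longrightarrow> 1 < b \<longrightarrow> z \<in> stolz_region b \<zeta> \<longrightarrow>
        norm (psum a (N (Suc k)) z - psum a (N k) z) \<le> 16 * (1 + b)\<^sup>2 * (1/2) ^ k)" for k
  proof -
    obtain U where U: "U \<in> sets \<sigma>"
      "emeasure \<sigma> U \<le> ennreal (5 / (1/2) ^ k * sqrt (\<Sum>n<N (Suc k). (norm (c k n))\<^sup>2))"
      "\<And>\<zeta> b z. \<zeta> \<in> sphere 0 1 - U \<Longrightarrow> 1 < b \<Longrightarrow> z \<in> stolz_region b \<zeta> \<Longrightarrow>
        norm (psum (c k) (N (Suc k)) z) \<le> 16 * (1 + b)\<^sup>2 * (1/2) ^ k"
      by (rule stolz_region_psum_weak_type[where l="(1/2) ^ k" and N="N (Suc k)" and a="c k"]) auto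
    have "(\<Sum>n<N (Suc k). (norm (c k n))\<^sup>2) \<le> (1/16) ^ k"
      unfolding c_def using Nm[of k] N[of k "N (Suc k)"] by (subst sum_tail) auto
    also have "\<dots> = ((1/4) ^ k)\<^sup>2" by (simp add: power2_eq_square flip: power_mult_distrib)
    finally have "sqrt (\<Sum>n<N (Suc k). (norm (c k n))\<^sup>2) \<le> (1/4) ^ k" by (intro real_le_lsqrt) auto
    then have "5 / (1/2) ^ k * sqrt (\<Sum>n<N (Suc k). (norm (c k n))\<^sup>2) \<le> 5 / (1/2) ^ k * (1/4) ^ k"
      by (intro mult_left_mono) auto
    also have "\<dots> = 5 * (1/2) ^ k"
    proof -
      have "(4::real) ^ k = 2 ^ k * 2 ^ k" by (simp flip: power_mult_distrib)
      then show ?thesis by (simp add: field_simps)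
    qed
    finally have "emeasure \<sigma> U \<le> ennreal (5 * (1/2) ^ k)"
      using U(2) order_trans ennreal_leI by blast
    then show ?thesis using U(1,3) by (auto simp: inc)
  qed
  then obtain U where U: "\<And>k. U k \<in> sets \<sigma>" "\<And>k. emeasure \<sigma> (U k) \<le> ennreal (5 * (1/2) ^ k)"
    "\<And>k \<zeta> b z. \<zeta> \<in> sphere 0 1 - U k \<Longrightarrow> 1 < b \<Longrightarrow> z \<in> stolz_region b \<zeta> \<Longrightarrow>
        norm (psum a (N (Suc k)) z - psum a (N k) z) \<le> 16 * (1 + b)\<^sup>2 * (1/2) ^ k"
    by metis
  have "AE \<zeta> in \<sigma>. \<forall>\<^sub>F k in sequentially. \<zeta> \<in> space \<sigma> - U k"
  proof (rule borel_cantelli_AE1)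
    show "emeasure \<sigma> (U k) < \<infinity>" for k by (rule le_less_trans[OF U(2)]) simp
    show "summable (\<lambda>k. measure \<sigma> (U k))"
    proof (rule summable_comparison_test')
      show "summable (\<lambda>k. 5 * (1/2::real) ^ k)" by (intro summable_mult summable_geometric) auto
      show "norm (measure \<sigma> (U k)) \<le> 5 * (1/2) ^ k" for k
        using U(2)[of k] by (simp add: sigma.emeasure_eq_measure)
    qed
  qed (rule U(1))
  note BC = this
  define g where "g \<zeta> = lim (\<lambda>k. psum a (N k) \<zeta>)" for \<zeta>
  have gm: "g \<in> borel_measurable \<sigma>"
    unfolding g_def by (intro borel_measurable_lim_metric borel_measurable_psum)
  have good: "(\<lambda>k. psum a (N k) \<zeta>) \<longlonglongrightarrow> g \<zeta> \<and> nontangential_limit (hardy a) \<zeta> (g \<zeta>)"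
    if ev: "\<forall>\<^sub>F k in sequentially. \<zeta> \<in> space \<sigma> - U k" for \<zeta>
  proof -
    obtain k0 where k0: "\<And>k. k \<ge> k0 \<Longrightarrow> \<zeta> \<in> sphere 0 1 - U k"
      using ev by (auto simp: eventually_sequentially)
    have \<zeta>: "\<zeta> \<in> sphere 0 1" using k0[of k0] by simp
    define D where "D b = 16 * (1 + b)\<^sup>2" for b :: real
    have D0: "0 \<le> D b" for b by (simp add: D_def)
    have st: "norm (psum a (N (Suc k)) z - psum a (N k) z) \<le> D b * (1/2) ^ k"
      if "k \<ge> k0" "1 < b" "z \<in> stolz_region b \<zeta>" for k b z
      using U(3)[OF k0[OF that(1)] that(2,3)] by (simp add: D_def)
    have at\<zeta>: "norm (psum a (N (Suc k)) \<zeta> - psum a (N k) \<zeta>) \<le> D 2 * (1/2) ^ k" if "k \<ge> k0" for k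
      by (rule continuous_stolz_le[OF _ \<zeta>, of _ 2]) (use st[OF that, of 2] in \<open>auto intro!: continuous_intros\<close>)
    have small: "\<exists>k\<ge>k0. C * (1/2) ^ k < e" if "e > 0" for C e :: real
    proof -
      have "(\<lambda>k. C * (1/2) ^ k) \<longlonglongrightarrow> C * 0" by (intro tendsto_intros LIMSEQ_power_zero) auto
      then have "\<forall>\<^sub>F k in sequentially. C * (1/2) ^ k < e" using that by (intro order_tendstoD) auto
      then obtain K where "\<And>k. k \<ge> K \<Longrightarrow> C * (1/2) ^ k < e" by (auto simp: eventually_sequentially)
      then show ?thesis by (intro exI[of _ "max k0 K"]) auto
    qed
    have "Cauchy (\<lambda>k. psum a (N k) \<zeta>)"
    proof (rule CauchyI')
      fix e :: real assume "e > 0"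
      then obtain k where k: "k \<ge> k0" "(4 * D 2) * (1/2) ^ k < e" using small by blast
      have "dist (psum a (N m) \<zeta>) (psum a (N n) \<zeta>) < e" if mn: "m \<ge> k" "n \<ge> k" for m n
      proof -
        have "norm (psum a (N m) \<zeta> - psum a (N k) \<zeta>) \<le> 2 * D 2 * (1/2) ^ k"
          "norm (psum a (N n) \<zeta> - psum a (N k) \<zeta>) \<le> 2 * D 2 * (1/2) ^ k"
          using dyadic_increments[where s="\<lambda>k. psum a (N k) \<zeta>", OF at\<zeta> k(1) _ D0] mn by auto
        then have "dist (psum a (N m) \<zeta>) (psum a (N n) \<zeta>) \<le> (4 * D 2) * (1/2) ^ k"
          using dist_triangle2[of "psum a (N m) \<zeta>" "psum a (N n) \<zeta>" "psum a (N k) \<zeta>"] by (simp add: dist_norm)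
        then show ?thesis using k(2) by linarith
      qed
      then show "\<exists>M. \<forall>m\<ge>M. \<forall>n>m. dist (psum a (N m) \<zeta>) (psum a (N n) \<zeta>) < e"
        by (intro exI[of _ k]) auto
    qed
    then have lim: "(\<lambda>k. psum a (N k) \<zeta>) \<longlonglongrightarrow> g \<zeta>"
      unfolding g_def by (simp add: Cauchy_convergent_iff convergent_LIMSEQ_iff)
    have "(hardy a \<longlongrightarrow> g \<zeta>) (at \<zeta> within stolz_region b \<zeta>)" if b: "1 < b" for b
    proof (rule swap_uniform_limit[where F=sequentially and f="\<lambda>k. psum a (N k)" and g="\<lambda>k. psum a (N k) \<zeta>"])
      show "\<forall>\<^sub>F k in sequentially. (psum a (N k) \<longlongrightarrow> psum a (N k) \<zeta>) (at \<zeta> within stolz_region b \<zeta>)"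
      proof (intro always_eventually allI)
        fix k
        have "(psum a (N k) \<longlongrightarrow> psum a (N k) \<zeta>) (at \<zeta>)"
          using continuous_psum[of UNIV a "N k"] by (simp add: continuous_on_eq_continuous_at isCont_def)
        then show "(psum a (N k) \<longlongrightarrow> psum a (N k) \<zeta>) (at \<zeta> within stolz_region b \<zeta>)"
          by (rule tendsto_within_subset) simp
      qed
      show "uniform_limit (stolz_region b \<zeta>) (\<lambda>k. psum a (N k)) (hardy a) sequentially"
      proof (rule uniform_limitI)
        fix e :: real assume "e > 0"
        then obtain k where k: "k \<ge> k0" "(4 * D b) * (1/2) ^ k < e" using small by blast
        have "dist (psum a (N m) z) (hardy a z) < e" if m: "m \<ge> k" and z: "z \<in> stolz_region b \<zeta>" for m z
        proof -
          have zb: "z \<in> ball 0 1" using z by (simp add: stolz_region_def)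
          have "(\<lambda>n. psum a n z) \<longlonglongrightarrow> hardy a z"
            by (rule psum_tendsto_hardy[OF norm_coeff_le[OF a] zb])
          then have "(\<lambda>n. psum a (N n) z) \<longlonglongrightarrow> hardy a z"
            using LIMSEQ_subseq_LIMSEQ[OF _ sm] by (simp add: o_def)
          then have "(\<lambda>n. norm (psum a (N n) z - psum a (N m) z)) \<longlonglongrightarrow> norm (hardy a z - psum a (N m) z)"
            by (intro tendsto_intros)
          moreover have "\<forall>n\<ge>m. norm (psum a (N n) z - psum a (N m) z) \<le> 2 * D b * (1/2) ^ m"
            using dyadic_increments[where s="\<lambda>k. psum a (N k) z", OF st[OF _ b z] order_trans[OF k(1) m] _ D0] by blast
          ultimately have "norm (hardy a z - psum a (N m) z) \<le> 2 * D b * (1/2) ^ m"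
            using LIMSEQ_le_const2 by blast
          also have "\<dots> \<le> 2 * D b * (1/2) ^ k" using m D0 by (intro mult_left_mono power_decreasing) auto
          also have "\<dots> \<le> (4 * D b) * (1/2) ^ k" using D0[of b] by (intro mult_right_mono) auto
          also note k(2)
          finally show ?thesis by (simp add: dist_norm norm_minus_commute)
        qed
        then show "\<forall>\<^sub>F n in sequentially. \<forall>x\<in>stolz_region b \<zeta>. dist (psum a (N n) x) (hardy a x) < e"
          unfolding eventually_sequentially by blast
      qed
    qed (use lim in auto)
    with lim show ?thesis by (simp add: nontangential_limit_def)
  qed
  have "AE \<zeta> in \<sigma>. (\<lambda>k. psum a (N k) \<zeta>) \<longlonglongrightarrow> g \<zeta>" "AE \<zeta> in \<sigma>. nontangential_limit (hardy a) \<zeta> (g \<zeta>)"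
    using BC good by (auto elim: eventually_mono)
  with gm sm show ?thesis by blast
qed

text \<open>A single function is chosen that is both a limit of partial sums on the circle, which gives access to
  mean square estimates, and the nontangential limit of the power series.\<close>

definition bdry :: "(nat \<Rightarrow> 'g::{chilbert_space, second_countable_topology}) \<Rightarrow> complex \<Rightarrow> 'g"
  where "bdry a = (SOME g. g \<in> borel_measurable \<sigma> \<and>
    (\<exists>N. strict_mono (N :: nat \<Rightarrow> nat) \<and> (AE \<zeta> in \<sigma>. (\<lambda>k. psum a (N k) \<zeta>) \<longlonglongrightarrow> g \<zeta>)) \<and>
    (AE \<zeta> in \<sigma>. nontangential_limit (hardy a) \<zeta> (g \<zeta>)))"

context
  fixes a :: "nat \<Rightarrow> 'g::{chilbert_space, second_countable_topology}"
  assumes a: "summable (\<lambda>n. (norm (a n))\<^sup>2)"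
begin

lemma
  shows bdry_measurable: "bdry a \<in> borel_measurable \<sigma>"
    and bdry_subseq: "\<exists>N. strict_mono (N :: nat \<Rightarrow> nat) \<and> (AE \<zeta> in \<sigma>. (\<lambda>k. psum a (N k) \<zeta>) \<longlonglongrightarrow> bdry a \<zeta>)"
    and fatou: "AE \<zeta> in \<sigma>. nontangential_limit (hardy a) \<zeta> (bdry a \<zeta>)"
proof -
  have "\<exists>g. g \<in> borel_measurable \<sigma> \<and>
    (\<exists>N. strict_mono (N :: nat \<Rightarrow> nat) \<and> (AE \<zeta> in \<sigma>. (\<lambda>k. psum a (N k) \<zeta>) \<longlonglongrightarrow> g \<zeta>)) \<and>
    (AE \<zeta> in \<sigma>. nontangential_limit (hardy a) \<zeta> (g \<zeta>))"
    using fatou_ex[OF a] by blast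
  from someI_ex[OF this, folded bdry_def]
  show "bdry a \<in> borel_measurable \<sigma>"
    "\<exists>N. strict_mono (N :: nat \<Rightarrow> nat) \<and> (AE \<zeta> in \<sigma>. (\<lambda>k. psum a (N k) \<zeta>) \<longlonglongrightarrow> bdry a \<zeta>)"
    "AE \<zeta> in \<sigma>. nontangential_limit (hardy a) \<zeta> (bdry a \<zeta>)" by blast+
qed

text \<open>Fatou's lemma along the subsequence on which the partial sums converge.\<close>

lemma bdry_psum_diff:
  shows "integrable \<sigma> (\<lambda>\<zeta>. (norm (bdry a \<zeta> - psum a M \<zeta>))\<^sup>2)"
    and "(\<integral>\<zeta>. (norm (bdry a \<zeta> - psum a M \<zeta>))\<^sup>2 \<partial>\<sigma>) \<le> (\<Sum>n. (norm (a (n + M)))\<^sup>2)"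
proof -
  have [measurable]: "bdry a \<in> borel_measurable \<sigma>" "psum a N \<in> borel_measurable \<sigma>" for N
    by (rule bdry_measurable borel_measurable_psum)+
  obtain N :: "nat \<Rightarrow> nat" where N: "strict_mono N" "AE \<zeta> in \<sigma>. (\<lambda>k. psum a (N k) \<zeta>) \<longlonglongrightarrow> bdry a \<zeta>"
    using bdry_subseq by blast
  let ?T = "\<Sum>n. (norm (a (n + M)))\<^sup>2"
  have sT: "summable (\<lambda>n. (norm (a (n + M)))\<^sup>2)" using a by (rule summable_ignore_initial_segment)
  have T0: "0 \<le> ?T" by (intro suminf_nonneg sT) auto
  have "(\<integral>\<^sup>+\<zeta>. ennreal ((norm (bdry a \<zeta> - psum a M \<zeta>))\<^sup>2) \<partial>\<sigma>)
      = (\<integral>\<^sup>+\<zeta>. liminf (\<lambda>k. ennreal ((norm (psum a (N k) \<zeta> - psum a M \<zeta>))\<^sup>2)) \<partial>\<sigma>)"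
  proof (rule nn_integral_cong_AE)
    show "AE \<zeta> in \<sigma>. ennreal ((norm (bdry a \<zeta> - psum a M \<zeta>))\<^sup>2)
        = liminf (\<lambda>k. ennreal ((norm (psum a (N k) \<zeta> - psum a M \<zeta>))\<^sup>2))"
      using N(2)
    proof eventually_elim
      case (elim \<zeta>)
      have "(\<lambda>k. ennreal ((norm (psum a (N k) \<zeta> - psum a M \<zeta>))\<^sup>2)) \<longlonglongrightarrow> ennreal ((norm (bdry a \<zeta> - psum a M \<zeta>))\<^sup>2)"
        by (intro tendsto_ennrealI tendsto_power tendsto_norm tendsto_diff elim tendsto_const)
      then show ?case using lim_imp_Liminf[OF sequentially_bot] by metis
    qed
  qed
  also have "\<dots> \<le> liminf (\<lambda>k. \<integral>\<^sup>+\<zeta>. ennreal ((norm (psum a (N k) \<zeta> - psum a M \<zeta>))\<^sup>2) \<partial>\<sigma>)"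
    by (rule nn_integral_liminf) measurable
  also have "\<dots> \<le> limsup (\<lambda>k. \<integral>\<^sup>+\<zeta>. ennreal ((norm (psum a (N k) \<zeta> - psum a M \<zeta>))\<^sup>2) \<partial>\<sigma>)"
    by (rule Liminf_le_Limsup) simp
  also have "\<dots> \<le> ennreal ?T"
  proof (rule Limsup_bounded)
    show "\<forall>\<^sub>F k in sequentially. (\<integral>\<^sup>+\<zeta>. ennreal ((norm (psum a (N k) \<zeta> - psum a M \<zeta>))\<^sup>2) \<partial>\<sigma>) \<le> ennreal ?T"
      using eventually_ge_at_top[of M]
    proof eventually_elim
      case (elim k)
      then have MN: "M \<le> N k" using seq_suble[OF N(1), of k] by linarith
      have "(\<integral>\<^sup>+\<zeta>. ennreal ((norm (psum a (N k) \<zeta> - psum a M \<zeta>))\<^sup>2) \<partial>\<sigma>)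
          = ennreal (\<integral>\<zeta>. (norm (psum (\<lambda>n. if n < M then 0 else a n) (N k) \<zeta>))\<^sup>2 \<partial>\<sigma>)"
        unfolding psum_diff[OF MN]
        by (intro nn_integral_eq_integral) (use sq_integrable_psum in \<open>auto simp: sq_integrable_def\<close>)
      also have "\<dots> = ennreal (\<Sum>n=M..<N k. (norm (a n))\<^sup>2)"
        by (simp only: integral_norm_psum sum_tail[OF MN])
      also have "(\<Sum>n=M..<N k. (norm (a n))\<^sup>2) = (\<Sum>n<N k - M. (norm (a (n + M)))\<^sup>2)"
        using MN sum.shift_bounds_nat_ivl[of "\<lambda>n. (norm (a n))\<^sup>2" 0 M "N k - M"] by (simp add: lessThan_atLeast0)
      also have "ennreal \<dots> \<le> ennreal ?T" by (intro ennreal_leI sum_le_suminf sT) auto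
      finally show ?case .
    qed
  qed
  finally have le: "(\<integral>\<^sup>+\<zeta>. ennreal ((norm (bdry a \<zeta> - psum a M \<zeta>))\<^sup>2) \<partial>\<sigma>) \<le> ennreal ?T" .
  show i: "integrable \<sigma> (\<lambda>\<zeta>. (norm (bdry a \<zeta> - psum a M \<zeta>))\<^sup>2)"
    by (rule integrableI_bounded) (use le in \<open>auto simp: less_top[symmetric] top_unique\<close>)
  then have "ennreal (\<integral>\<zeta>. (norm (bdry a \<zeta> - psum a M \<zeta>))\<^sup>2 \<partial>\<sigma>) \<le> ennreal ?T"
    using le by (subst (asm) nn_integral_eq_integral) auto
  then show "(\<integral>\<zeta>. (norm (bdry a \<zeta> - psum a M \<zeta>))\<^sup>2 \<partial>\<sigma>) \<le> ?T"
    using T0 by simp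
qed

lemma sq_integrable_bdry: "sq_integrable (bdry a)"
  using bdry_psum_diff(1)[of 0] bdry_measurable by (simp add: sq_integrable_def psum_def)

lemma integral_norm_bdry_le: "(\<integral>\<zeta>. (norm (bdry a \<zeta>))\<^sup>2 \<partial>\<sigma>) \<le> (\<Sum>n. (norm (a n))\<^sup>2)"
  using bdry_psum_diff(2)[of 0] by (simp add: psum_def)

lemma bdry_psum_tendsto: "(\<lambda>M. sqrt (\<integral>\<zeta>. (norm (bdry a \<zeta> - psum a M \<zeta>))\<^sup>2 \<partial>\<sigma>)) \<longlonglongrightarrow> 0"
proof -
  have "(\<lambda>M. \<Sum>n. (norm (a (n + M)))\<^sup>2) \<longlonglongrightarrow> (\<Sum>n. (norm (a n))\<^sup>2) - (\<Sum>n. (norm (a n))\<^sup>2)"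
    unfolding suminf_minus_initial_segment[OF a]
    by (intro tendsto_diff tendsto_const summable_LIMSEQ a)
  then have "(\<lambda>M. \<Sum>n. (norm (a (n + M)))\<^sup>2) \<longlonglongrightarrow> 0" by simp
  then have "(\<lambda>M. \<integral>\<zeta>. (norm (bdry a \<zeta> - psum a M \<zeta>))\<^sup>2 \<partial>\<sigma>) \<longlonglongrightarrow> 0"
    by (rule tendsto_sandwich[rotated 2, OF tendsto_const])
      (auto intro!: always_eventually bdry_psum_diff(2) integral_nonneg_AE)
  then show ?thesis using tendsto_real_sqrt by fastforce
qed

lemma integral_psum_tendsto:
  assumes g: "sq_integrable g"
  shows "(\<lambda>M. \<integral>\<zeta>. \<zeta> powi k * cinner (psum a M \<zeta>) (g \<zeta>) \<partial>\<sigma>)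
    \<longlonglongrightarrow> (\<integral>\<zeta>. \<zeta> powi k * cinner (bdry a \<zeta>) (g \<zeta>) \<partial>\<sigma>)"
proof (rule Lim_null[THEN iffD2], rule Lim_null_comparison)
  let ?B = "sqrt (\<integral>\<zeta>. (norm (g \<zeta>))\<^sup>2 \<partial>\<sigma>)"
  show "(\<lambda>M. sqrt (\<integral>\<zeta>. (norm (bdry a \<zeta> - psum a M \<zeta>))\<^sup>2 \<partial>\<sigma>) * ?B) \<longlonglongrightarrow> 0"
    by (rule tendsto_mult_left_zero[OF bdry_psum_tendsto])
  show "\<forall>\<^sub>F M in sequentially. norm ((\<integral>\<zeta>. \<zeta> powi k * cinner (psum a M \<zeta>) (g \<zeta>) \<partial>\<sigma>)
      - (\<integral>\<zeta>. \<zeta> powi k * cinner (bdry a \<zeta>) (g \<zeta>) \<partial>\<sigma>))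
      \<le> sqrt (\<integral>\<zeta>. (norm (bdry a \<zeta> - psum a M \<zeta>))\<^sup>2 \<partial>\<sigma>) * ?B"
  proof (intro always_eventually allI)
    fix M
    have i1: "integrable \<sigma> (\<lambda>\<zeta>. \<zeta> powi k * cinner (psum a M \<zeta>) (g \<zeta>))"
      and i2: "integrable \<sigma> (\<lambda>\<zeta>. \<zeta> powi k * cinner (bdry a \<zeta>) (g \<zeta>))"
      by (intro integrable_powi_cinner g sq_integrable_psum sq_integrable_bdry)+
    have "(\<integral>\<zeta>. \<zeta> powi k * cinner (bdry a \<zeta>) (g \<zeta>) \<partial>\<sigma>) - (\<integral>\<zeta>. \<zeta> powi k * cinner (psum a M \<zeta>) (g \<zeta>) \<partial>\<sigma>)
        = (\<integral>\<zeta>. \<zeta> powi k * cinner (bdry a \<zeta> - psum a M \<zeta>) (g \<zeta>) \<partial>\<sigma>)"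
      using i1 i2 by (simp add: cinner.diff_left right_diff_distrib)
    moreover have "cmod (\<integral>\<zeta>. \<zeta> powi k * cinner (bdry a \<zeta> - psum a M \<zeta>) (g \<zeta>) \<partial>\<sigma>)
        \<le> sqrt (\<integral>\<zeta>. (norm (bdry a \<zeta> - psum a M \<zeta>))\<^sup>2 \<partial>\<sigma>) * ?B"
      by (intro norm_integral_powi_cinner_le sq_integrable_diff sq_integrable_bdry sq_integrable_psum g)
    ultimately show "norm ((\<integral>\<zeta>. \<zeta> powi k * cinner (psum a M \<zeta>) (g \<zeta>) \<partial>\<sigma>)
      - (\<integral>\<zeta>. \<zeta> powi k * cinner (bdry a \<zeta>) (g \<zeta>) \<partial>\<sigma>))
      \<le> sqrt (\<integral>\<zeta>. (norm (bdry a \<zeta> - psum a M \<zeta>))\<^sup>2 \<partial>\<sigma>) * ?B"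
      by (subst norm_minus_commute) simp
  qed
qed

lemma integral_psum_cinner:
  assumes g: "sq_integrable g"
  shows "(\<integral>\<zeta>. \<zeta> powi k * cinner (psum a M \<zeta>) (g \<zeta>) \<partial>\<sigma>)
    = (\<Sum>n<M. \<integral>\<zeta>. \<zeta> powi (k + int n) * cinner (a n) (g \<zeta>) \<partial>\<sigma>)"
proof -
  have "(\<integral>\<zeta>. \<zeta> powi k * cinner (psum a M \<zeta>) (g \<zeta>) \<partial>\<sigma>)
      = (\<integral>\<zeta>. (\<Sum>n<M. \<zeta> powi (k + int n) * cinner (a n) (g \<zeta>)) \<partial>\<sigma>)"
    by (intro Bochner_Integration.integral_cong)
      (auto simp: psum_def cinner.sum_left cinner_scaleC_left sum_distrib_left sphere_powi_add mult.assoc)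
  also have "\<dots> = (\<Sum>n<M. \<integral>\<zeta>. \<zeta> powi (k + int n) * cinner (a n) (g \<zeta>) \<partial>\<sigma>)"
    by (rule Bochner_Integration.integral_sum) (intro integrable_powi_cinner sq_integrable_const g)
  finally show ?thesis .
qed

text \<open>The partial sums converge in mean square, hence their Fourier coefficients converge as well.\<close>

lemma fourier_bdry:
  "(\<integral>\<zeta>. \<zeta> powi k * cinner (bdry a \<zeta>) v \<partial>\<sigma>) = (if k \<le> 0 then cinner (a (nat (- k))) v else 0)"
proof -
  have "(\<lambda>M. \<Sum>n<M. \<integral>\<zeta>. \<zeta> powi (k + int n) * cinner (a n) v \<partial>\<sigma>)
      \<longlonglongrightarrow> (\<integral>\<zeta>. \<zeta> powi k * cinner (bdry a \<zeta>) v \<partial>\<sigma>)"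
    using integral_psum_tendsto[OF sq_integrable_const[of v], of k]
    by (simp only: integral_psum_cinner[OF sq_integrable_const])
  moreover have "(\<integral>\<zeta>. \<zeta> powi (k + int n) * cinner (a n) v \<partial>\<sigma>)
      = (if n = nat (- k) then if k \<le> 0 then cinner (a n) v else 0 else 0)" for n
    by (auto simp: integral_powi)
  ultimately have "(\<lambda>n. if n = nat (- k) then if k \<le> 0 then cinner (a n) v else 0 else 0)
      sums (\<integral>\<zeta>. \<zeta> powi k * cinner (bdry a \<zeta>) v \<partial>\<sigma>)" by (simp add: sums_def)
  from sums_unique2[OF this sums_single] show ?thesis by simp
qed

text \<open>The Poisson integral of the norm of the boundary function is a majorant.\<close>

lemma norm_hardy_le:
  assumes C: "AE \<zeta> in \<sigma>. norm (bdry a \<zeta>) \<le> C" and z: "z \<in> ball 0 1"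
  shows "norm (hardy a z) \<le> C"
proof -
  have "compact (poisson z ` sphere 0 1)" by (intro compact_continuous_image continuous_poisson z) auto
  then obtain B where B: "\<forall>\<zeta>\<in>sphere 0 1. norm (poisson z \<zeta>) \<le> B"
    by (auto dest!: compact_imp_bounded simp: bounded_iff)
  have pB: "poisson z \<zeta> \<le> B" if "\<zeta> \<in> sphere 0 1" for \<zeta> using B that by force
  have B0: "0 \<le> B" using pB[of 1] poisson_nonneg[OF z, of 1] by simp
  have iP: "integrable \<sigma> (poisson z)" by (intro integrable_sigma_continuous continuous_poisson z)
  let ?e = "\<lambda>M. sqrt (\<integral>\<zeta>. (norm (bdry a \<zeta> - psum a M \<zeta>))\<^sup>2 \<partial>\<sigma>)"
  have est: "norm (psum a M z) \<le> C + B * ?e M" for M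
  proof -
    have sd: "sq_integrable (\<lambda>\<zeta>. bdry a \<zeta> - psum a M \<zeta>)"
      by (intro sq_integrable_diff sq_integrable_bdry sq_integrable_psum)
    have id: "integrable \<sigma> (\<lambda>\<zeta>. norm (bdry a \<zeta> - psum a M \<zeta>))"
      by (intro integrable_norm sq_integrable_integrable sd)
    have "norm (psum a M z) \<le> (\<integral>\<zeta>. poisson z \<zeta> * norm (psum a M \<zeta>) \<partial>\<sigma>)"
      by (rule norm_psum_le_poisson[OF z])
    also have "\<dots> \<le> (\<integral>\<zeta>. poisson z \<zeta> * C + B * norm (bdry a \<zeta> - psum a M \<zeta>) \<partial>\<sigma>)"
    proof (rule integral_mono_AE)
      show "integrable \<sigma> (\<lambda>\<zeta>. poisson z \<zeta> * norm (psum a M \<zeta>))"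
        by (intro integrable_sigma_continuous continuous_on_mult continuous_poisson z continuous_on_norm continuous_psum)
      show "integrable \<sigma> (\<lambda>\<zeta>. poisson z \<zeta> * C + B * norm (bdry a \<zeta> - psum a M \<zeta>))"
        using iP id by auto
      have "AE \<zeta> in \<sigma>. \<zeta> \<in> sphere 0 1" by (rule AE_sphere)
      with C show "AE \<zeta> in \<sigma>. poisson z \<zeta> * norm (psum a M \<zeta>) \<le> poisson z \<zeta> * C + B * norm (bdry a \<zeta> - psum a M \<zeta>)"
      proof eventually_elim
        case (elim \<zeta>)
        have "norm (psum a M \<zeta>) \<le> norm (bdry a \<zeta>) + norm (bdry a \<zeta> - psum a M \<zeta>)"
          by (metis norm_minus_commute norm_triangle_sub)
        then have "norm (psum a M \<zeta>) \<le> C + norm (bdry a \<zeta> - psum a M \<zeta>)" using elim(1) by linarith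
        then have "poisson z \<zeta> * norm (psum a M \<zeta>) \<le> poisson z \<zeta> * C + poisson z \<zeta> * norm (bdry a \<zeta> - psum a M \<zeta>)"
          using mult_left_mono[OF _ poisson_nonneg[OF z], of "norm (psum a M \<zeta>)" _ \<zeta>] by (simp flip: distrib_left)
        also have "\<dots> \<le> poisson z \<zeta> * C + B * norm (bdry a \<zeta> - psum a M \<zeta>)"
          by (intro add_left_mono mult_right_mono pB elim) auto
        finally show ?case .
      qed
    qed
    also have "\<dots> = C + B * (\<integral>\<zeta>. norm (bdry a \<zeta> - psum a M \<zeta>) \<partial>\<sigma>)"
      using iP id integral_poisson[OF z] by simp
    also have "\<dots> \<le> C + B * ?e M"
      by (intro add_left_mono mult_left_mono integral_norm_le sd B0)
    finally show ?thesis .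
  qed
  have "(\<lambda>M. C + B * ?e M) \<longlonglongrightarrow> C + B * 0"
    by (intro tendsto_add tendsto_mult tendsto_const bdry_psum_tendsto)
  moreover have "(\<lambda>M. norm (psum a M z)) \<longlonglongrightarrow> norm (hardy a z)"
    by (intro tendsto_norm psum_tendsto_hardy[OF norm_coeff_le[OF a] z])
  ultimately show ?thesis
    using LIMSEQ_le[of "\<lambda>M. norm (psum a M z)" _ "\<lambda>M. C + B * ?e M"] est by auto
qed

end

lemma integral_powi_cinner_commute:
  fixes f g :: "complex \<Rightarrow> 'g::{chilbert_space, second_countable_topology}"
  shows "(\<integral>\<zeta>. \<zeta> powi k * cinner (f \<zeta>) (g \<zeta>) \<partial>\<sigma>) = cnj (\<integral>\<zeta>. \<zeta> powi (- k) * cinner (g \<zeta>) (f \<zeta>) \<partial>\<sigma>)"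
proof -
  have "cnj (\<integral>\<zeta>. \<zeta> powi (- k) * cinner (g \<zeta>) (f \<zeta>) \<partial>\<sigma>) = (\<integral>\<zeta>. cnj (\<zeta> powi (- k) * cinner (g \<zeta>) (f \<zeta>)) \<partial>\<sigma>)"
    by (rule Bochner_Integration.integral_cnj[symmetric])
  also have "\<dots> = (\<integral>\<zeta>. \<zeta> powi k * cinner (f \<zeta>) (g \<zeta>) \<partial>\<sigma>)"
  proof (intro Bochner_Integration.integral_cong refl)
    fix \<zeta> assume "\<zeta> \<in> space \<sigma>"
    then have c: "cnj \<zeta> = inverse \<zeta>" by (intro sphere_cnj) simp
    have "cnj (\<zeta> powi (- k)) = \<zeta> powi k"
      by (simp add: power_int_def c power_inverse)
    then show "cnj (\<zeta> powi (- k) * cinner (g \<zeta>) (f \<zeta>)) = \<zeta> powi k * cinner (f \<zeta>) (g \<zeta>)"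
      by (simp flip: cinner_commute)
  qed
  finally show ?thesis by simp
qed

theorem fourier_unique:
  fixes f g :: "complex \<Rightarrow> 'g::{chilbert_space, second_countable_topology}"
  assumes f: "sq_integrable f" and g: "sq_integrable g"
    and eq: "\<And>k v. (\<integral>\<zeta>. \<zeta> powi k * cinner (f \<zeta>) v \<partial>\<sigma>) = (\<integral>\<zeta>. \<zeta> powi k * cinner (g \<zeta>) v \<partial>\<sigma>)"
  shows "AE \<zeta> in \<sigma>. f \<zeta> = g \<zeta>"
proof -
  have "AE \<zeta> in \<sigma>. cinner (f \<zeta> - g \<zeta>) v = 0" for v
  proof (rule fourier_null_AE_eq_0)
    have i: "integrable \<sigma> (\<lambda>\<zeta>. \<zeta> powi k * cinner (f \<zeta> - g \<zeta>) v)" for k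
      by (intro integrable_powi_cinner sq_integrable_diff f g sq_integrable_const)
    have "(\<integral>\<zeta>. \<zeta> powi k * cinner (f \<zeta> - g \<zeta>) v \<partial>\<sigma>) = 0" for k
    proof -
      have "(\<integral>\<zeta>. \<zeta> powi k * cinner (f \<zeta> - g \<zeta>) v \<partial>\<sigma>)
          = (\<integral>\<zeta>. \<zeta> powi k * cinner (f \<zeta>) v - \<zeta> powi k * cinner (g \<zeta>) v \<partial>\<sigma>)"
        by (simp add: cinner.diff_left right_diff_distrib)
      also have "\<dots> = 0"
        using integrable_powi_cinner[OF f sq_integrable_const] integrable_powi_cinner[OF g sq_integrable_const]
        by (subst Bochner_Integration.integral_diff) (auto simp: eq)
      finally show ?thesis .
    qed
    then show "fourier_null (\<lambda>\<zeta>. cinner (f \<zeta> - g \<zeta>) v)"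
      using i[of 0] by (simp add: fourier_null_def)
  qed
  then have "AE \<zeta> in \<sigma>. f \<zeta> - g \<zeta> = 0" by (rule AE_eq_0_weak)
  then show ?thesis by simp
qed

text \<open>The partial sums of the first series are paired with the second boundary function, whose Fourier
  coefficients are known.\<close>

lemma parseval_bdry:
  fixes a b :: "nat \<Rightarrow> 'g::{chilbert_space, second_countable_topology}"
  assumes a: "summable (\<lambda>n. (norm (a n))\<^sup>2)" and b: "summable (\<lambda>n. (norm (b n))\<^sup>2)"
  shows "(\<lambda>n. cinner (a n) (b (n + k))) sums (\<integral>\<zeta>. \<zeta> powi int k * cinner (bdry a \<zeta>) (bdry b \<zeta>) \<partial>\<sigma>)"
proof -
  have "(\<integral>\<zeta>. \<zeta> powi (int k + int n) * cinner (a n) (bdry b \<zeta>) \<partial>\<sigma>) = cinner (a n) (b (n + k))" for n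
  proof -
    have nat_e: "nat (int k + int n) = n + k" "nat (int n + int k) = n + k" by auto
    have "(\<integral>\<zeta>. \<zeta> powi (int k + int n) * cinner (a n) (bdry b \<zeta>) \<partial>\<sigma>) = cnj (cinner (b (nat (int k + int n))) (a n))"
      using nat_e integral_powi_cinner_commute[of "int k + int n" "\<lambda>_. a n" "bdry b"] fourier_bdry[OF b, of "- (int k + int n)" "a n"]
      by simp
    also have "\<dots> = cinner (a n) (b (n + k))"
      by (simp add: nat_e flip: cinner_commute)
    finally show ?thesis .
  qed
  then show ?thesis
    using integral_psum_tendsto[OF a sq_integrable_bdry[OF b], of "int k"]
    by (simp only: integral_psum_cinner[OF a sq_integrable_bdry[OF b]] sums_def)
qed

section \<open>Fourier coefficients and Bessel's inequality\<close>

definition fourier :: "(complex \<Rightarrow> 'g::{chilbert_space, second_countable_topology}) \<Rightarrow> nat \<Rightarrow> 'g"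
  where "fourier f n = (\<integral>\<zeta>. \<zeta> powi (- int n) *\<^sub>C f \<zeta> \<partial>\<sigma>)"

lemma cinner_fourier:
  fixes f :: "complex \<Rightarrow> 'g::{chilbert_space, second_countable_topology}"
  assumes f: "sq_integrable f"
  shows "cinner (fourier f n) v = (\<integral>\<zeta>. \<zeta> powi (- int n) * cinner (f \<zeta>) v \<partial>\<sigma>)"
proof -
  have "integrable \<sigma> (\<lambda>\<zeta>. \<zeta> powi (- int n) *\<^sub>C f \<zeta>)"
  proof (rule Bochner_Integration.integrable_bound[OF sq_integrable_integrable[OF f]])
    have [measurable]: "f \<in> borel_measurable \<sigma>" using f by (simp add: sq_integrable_def)
    show "(\<lambda>\<zeta>. \<zeta> powi (- int n) *\<^sub>C f \<zeta>) \<in> borel_measurable \<sigma>" by measurable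
  qed (auto intro!: AE_I2 simp: norm_scaleC)
  from integral_bounded_linear[OF cinner.bounded_linear_left[of v] this]
  show ?thesis by (simp add: fourier_def cinner_scaleC_left)
qed

theorem bessel_inequality:
  fixes f :: "complex \<Rightarrow> 'g::{chilbert_space, second_countable_topology}"
  assumes f: "sq_integrable f"
  shows "(\<Sum>n<N. (norm (fourier f n))\<^sup>2) \<le> (\<integral>\<zeta>. (norm (f \<zeta>))\<^sup>2 \<partial>\<sigma>)"
proof -
  let ?p = "psum (fourier f) N"
  have i: "integrable \<sigma> (\<lambda>\<zeta>. (norm (f \<zeta>))\<^sup>2)" "integrable \<sigma> (\<lambda>\<zeta>. (norm (?p \<zeta>))\<^sup>2)"
    using f sq_integrable_psum[of "fourier f" N] by (auto simp: sq_integrable_def)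
  have ic: "integrable \<sigma> (\<lambda>\<zeta>. cinner (f \<zeta>) (?p \<zeta>))"
    using integrable_powi_cinner[OF f sq_integrable_psum, of 0] by simp
  have "(\<integral>\<zeta>. cinner (f \<zeta>) (?p \<zeta>) \<partial>\<sigma>) = (\<integral>\<zeta>. (\<Sum>n<N. \<zeta> powi (- int n) * cinner (f \<zeta>) (fourier f n)) \<partial>\<sigma>)"
  proof (intro Bochner_Integration.integral_cong refl)
    fix \<zeta> assume "\<zeta> \<in> space \<sigma>"
    then have "cnj \<zeta> = inverse \<zeta>" by (intro sphere_cnj) simp
    then show "cinner (f \<zeta>) (?p \<zeta>) = (\<Sum>n<N. \<zeta> powi (- int n) * cinner (f \<zeta>) (fourier f n))"
      by (simp add: psum_def cinner.sum_right cinner_scaleC_right power_int_minus power_inverse)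
  qed
  also have "\<dots> = (\<Sum>n<N. cinner (fourier f n) (fourier f n))"
    using integrable_powi_cinner[OF f sq_integrable_const] by (simp add: cinner_fourier[OF f])
  finally have c: "(\<integral>\<zeta>. Re (cinner (f \<zeta>) (?p \<zeta>)) \<partial>\<sigma>) = (\<Sum>n<N. (norm (fourier f n))\<^sup>2)"
    using ic by (simp add: cinner_self)
  have "0 \<le> (\<integral>\<zeta>. (norm (f \<zeta> - ?p \<zeta>))\<^sup>2 \<partial>\<sigma>)" by simp
  also have "\<dots> = (\<integral>\<zeta>. (norm (f \<zeta>))\<^sup>2 \<partial>\<sigma>) + (\<Sum>n<N. (norm (fourier f n))\<^sup>2) - 2 * (\<Sum>n<N. (norm (fourier f n))\<^sup>2)"
    using i ic by (simp add: norm_diff_sq c integral_norm_psum)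
  finally show ?thesis by simp
qed

lemma summable_fourier:
  fixes f :: "complex \<Rightarrow> 'g::{chilbert_space, second_countable_topology}"
  assumes f: "sq_integrable f"
  shows "summable (\<lambda>n. (norm (fourier f n))\<^sup>2)"
  by (rule summableI_nonneg_bounded[OF _ bessel_inequality[OF f]]) auto

section \<open>Power series expansion of vector-valued analytic functions\<close>

lemma analytic_disk_continuous:
  assumes "analytic_disk f" "S \<subseteq> ball 0 1"
  shows "continuous_on S f"
proof (rule continuous_at_imp_continuous_on, rule ballI)
  fix z assume "z \<in> S"
  then obtain d where "(f has_derivative (\<lambda>h. h *\<^sub>C d)) (at z)"
    using assms by (auto simp: analytic_disk_def)
  then show "isCont f z" by (rule has_derivative_continuous)
qed

lemma circle_continuous:
  assumes "analytic_disk f" "0 \<le> r" "r < 1"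
  shows "continuous_on (sphere 0 1) (\<lambda>\<zeta>. f (of_real r * \<zeta>))"
proof (rule continuous_on_compose2[OF analytic_disk_continuous[OF assms(1) order_refl]])
  show "(\<lambda>\<zeta>. complex_of_real r * \<zeta>) ` sphere 0 1 \<subseteq> ball 0 1" using assms by (auto simp: norm_mult)
qed (intro continuous_intros)

text \<open>The scalar functions \<open>z \<mapsto> cinner (f z) v\<close> are holomorphic and have power series. Their coefficients
  depend on \<open>v\<close> through a vector, namely a Fourier coefficient of \<open>f\<close> on a circle, and Bessel's inequality
  on a larger circle gives convergence in norm.\<close>

theorem analytic_disk_expansion:
  fixes f :: "complex \<Rightarrow> 'g::{chilbert_space, second_countable_topology}"
  assumes f: "analytic_disk f"
  shows "\<exists>a. (\<forall>z\<in>ball 0 1. (\<lambda>n. z ^ n *\<^sub>C a n) sums f z) \<and>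
    (\<forall>r n. 0 \<le> r \<longrightarrow> r < 1 \<longrightarrow> fourier (\<lambda>\<zeta>. f (of_real r * \<zeta>)) n = of_real r ^ n *\<^sub>C a n)"
proof -
  define d where "d v n = (deriv ^^ n) (\<lambda>z. cinner (f z) v) 0 / fact n" for v n
  have hol: "(\<lambda>z. cinner (f z) v) holomorphic_on ball 0 1" for v
  proof (rule holomorphic_onI)
    fix z :: complex assume z: "z \<in> ball 0 1"
    then obtain d where "(f has_derivative (\<lambda>h. h *\<^sub>C d)) (at z)"
      using f unfolding analytic_disk_def by blast
    then have "((\<lambda>z. cinner (f z) v) has_derivative (\<lambda>h. cinner (h *\<^sub>C d) v)) (at z)"
      by (rule bounded_linear.has_derivative[OF cinner.bounded_linear_left])
    then have "((\<lambda>z. cinner (f z) v) has_field_derivative cinner d v) (at z)"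
      by (simp add: has_field_derivative_def cinner_scaleC_left mult_commute_abs)
    then show "(\<lambda>z. cinner (f z) v) field_differentiable (at z within ball 0 1)"
      using field_differentiable_at_within field_differentiable_def by blast
  qed
  have dsum: "(\<lambda>n. d v n * z ^ n) sums cinner (f z) v" if "z \<in> ball 0 1" for v z
    using holomorphic_power_series[OF hol that] by (simp add: d_def)
  note circ = circle_continuous[OF f]
  define c where "c r = fourier (\<lambda>\<zeta>. f (of_real r * \<zeta>))" for r
  have coef: "cinner (c r m) v = d v m * of_real r ^ m" if r: "0 \<le> r" "r < 1" for r m v
  proof -
    have "cinner (c r m) v = (\<integral>\<zeta>. \<zeta> powi (- int m) * cinner (f (of_real r * \<zeta>)) v \<partial>\<sigma>)"
      unfolding c_def by (rule cinner_fourier[OF sq_integrable_continuous[OF circ[OF r]]])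
    also have "\<dots> = (\<integral>\<zeta>. (\<Sum>n. d v n * of_real r ^ n * \<zeta> powi (int n - int m)) \<partial>\<sigma>)"
    proof (intro Bochner_Integration.integral_cong refl)
      fix \<zeta> assume \<zeta>: "\<zeta> \<in> space \<sigma>"
      then have "of_real r * \<zeta> \<in> ball 0 1" using r by (simp add: norm_mult)
      then have "(\<lambda>n. \<zeta> powi (- int m) * (d v n * (of_real r * \<zeta>) ^ n)) sums (\<zeta> powi (- int m) * cinner (f (of_real r * \<zeta>)) v)"
        by (intro sums_mult dsum)
      moreover have "\<zeta> powi (- int m) * (d v n * (of_real r * \<zeta>) ^ n) = d v n * of_real r ^ n * \<zeta> powi (int n - int m)" for n
      proof -
        have "\<zeta> powi (int n - int m) = \<zeta> ^ n * \<zeta> powi (- int m)"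
          using \<zeta> sphere_powi_add[of \<zeta> "int n" "- int m"] by simp
        then show ?thesis by (simp add: power_mult_distrib)
      qed
      ultimately show "\<zeta> powi (- int m) * cinner (f (of_real r * \<zeta>)) v = (\<Sum>n. d v n * of_real r ^ n * \<zeta> powi (int n - int m))"
        by (simp add: sums_iff)
    qed
    also have "\<dots> = d v m * of_real r ^ m"
    proof -
      have abs: "summable (\<lambda>n. cmod (d v n) * r ^ n)"
      proof -
        have "summable (\<lambda>n. d v n * of_real ((1 + r) / 2) ^ n)"
        proof (rule sums_summable[OF dsum])
          show "complex_of_real ((1 + r) / 2) \<in> ball 0 1"
            unfolding mem_ball dist_0_norm norm_of_real using r by auto
        qed
        then have "summable (\<lambda>n. norm (d v n * of_real r ^ n))"
          by (rule powser_insidea) (unfold norm_of_real, use r in auto)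
        then show ?thesis using r by (simp add: norm_mult norm_power)
      qed
      have "(\<lambda>n. \<integral>\<zeta>. d v n * of_real r ^ n * \<zeta> powi (int n - int m) \<partial>\<sigma>)
          sums (\<integral>\<zeta>. (\<Sum>n. d v n * of_real r ^ n * \<zeta> powi (int n - int m)) \<partial>\<sigma>)"
      proof (rule sums_integral)
        show "integrable \<sigma> (\<lambda>\<zeta>. d v n * of_real r ^ n * \<zeta> powi (int n - int m))" for n
          by (intro integrable_sigma_continuous continuous_on_mult continuous_on_const continuous_on_sphere_powi)
        show "AE \<zeta> in \<sigma>. summable (\<lambda>n. norm (d v n * of_real r ^ n * \<zeta> powi (int n - int m)))"
          using abs r by (intro AE_I2) (simp add: norm_mult norm_power)
        have "(\<integral>\<zeta>. norm (d v n * of_real r ^ n * \<zeta> powi (int n - int m)) \<partial>\<sigma>) = (\<integral>\<zeta>. cmod (d v n) * r ^ n \<partial>\<sigma>)" for n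
          using r by (intro Bochner_Integration.integral_cong) (auto simp: norm_mult norm_power)
        then show "summable (\<lambda>n. \<integral>\<zeta>. norm (d v n * of_real r ^ n * \<zeta> powi (int n - int m)) \<partial>\<sigma>)"
          using abs by simp
      qed
      moreover have "(\<integral>\<zeta>. d v n * of_real r ^ n * \<zeta> powi (int n - int m) \<partial>\<sigma>) = (if n = m then d v n * of_real r ^ n else 0)" for n
        by (simp add: integral_powi)
      ultimately have "(\<lambda>n. if n = m then d v n * of_real r ^ n else 0)
          sums (\<integral>\<zeta>. (\<Sum>n. d v n * of_real r ^ n * \<zeta> powi (int n - int m)) \<partial>\<sigma>)" by simp
      from sums_unique2[OF this sums_single] show ?thesis by simp
    qed
    finally show ?thesis .
  qed
  define a where "a n = 2 ^ n *\<^sub>C c (1/2) n" for n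
  have av: "cinner (a n) v = d v n" for n v
    using coef[of "1/2" n v] by (simp add: a_def cinner_scaleC_left power_divide)
  have ca: "c r n = of_real r ^ n *\<^sub>C a n" if "0 \<le> r" "r < 1" for r n
    by (rule cinner_ext) (simp add: coef[OF that] cinner_scaleC_left av)
  have "(\<lambda>n. z ^ n *\<^sub>C a n) sums f z" if z: "z \<in> ball 0 1" for z
  proof -
    define r where "r = (1 + cmod z) / 2"
    have r: "0 < r" "r < 1" "cmod z < r" using z by (auto simp: r_def add_pos_nonneg)
    define I where "I = (\<integral>\<zeta>. (norm (f (of_real r * \<zeta>)))\<^sup>2 \<partial>\<sigma>)"
    have cr: "norm (c r n) \<le> sqrt I" for n
    proof (rule real_le_rsqrt)
      have "(norm (c r n))\<^sup>2 \<le> (\<Sum>n<Suc n. (norm (c r n))\<^sup>2)" by (intro member_le_sum) auto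
      also have "\<dots> \<le> I" unfolding c_def I_def
        by (intro bessel_inequality sq_integrable_continuous circ) (use r in auto)
      finally show "(norm (c r n))\<^sup>2 \<le> I" .
    qed
    have an: "norm (a n) = norm (c r n) / r ^ n" for n
      using r ca[of r n] by (simp add: norm_scaleC norm_power)
    have "summable (\<lambda>n. z ^ n *\<^sub>C a n)"
    proof (rule summable_comparison_test')
      show "summable (\<lambda>n. sqrt I * (cmod z / r) ^ n)"
        using r by (intro summable_mult summable_geometric) auto
      show "norm (z ^ n *\<^sub>C a n) \<le> sqrt I * (cmod z / r) ^ n" for n
        using mult_left_mono[OF cr, of "(cmod z / r) ^ n" n] r
        by (simp add: norm_scaleC norm_power an power_divide mult.commute)
    qed
    then have s: "(\<lambda>n. z ^ n *\<^sub>C a n) sums (\<Sum>n. z ^ n *\<^sub>C a n)" by (rule summable_sums)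
    have "(\<Sum>n. z ^ n *\<^sub>C a n) = f z"
    proof (rule cinner_ext)
      fix v
      have "(\<lambda>n. cinner (z ^ n *\<^sub>C a n) v) sums cinner (\<Sum>n. z ^ n *\<^sub>C a n) v"
        by (rule bounded_linear.sums[OF cinner.bounded_linear_left s])
      then have "(\<lambda>n. d v n * z ^ n) sums cinner (\<Sum>n. z ^ n *\<^sub>C a n) v"
        by (simp add: cinner_scaleC_left av mult.commute)
      then show "cinner (\<Sum>n. z ^ n *\<^sub>C a n) v = cinner (f z) v"
        by (rule sums_unique2[OF _ dsum[OF z]])
    qed
    with s show ?thesis by simp
  qed
  with ca show ?thesis unfolding c_def by blast
qed

text \<open>Bessel's inequality on the circle of radius \<open>r\<close> bounds the finite sums of \<open>(r\<^sup>n norm (a n))\<^sup>2\<close>; then let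
  \<open>r\<close> tend to \<open>1\<close>.\<close>

theorem H2_expansion:
  fixes f :: "complex \<Rightarrow> 'g::{chilbert_space, second_countable_topology}"
  assumes f: "f \<in> H2"
  obtains a where "summable (\<lambda>n. (norm (a n))\<^sup>2)" "\<And>z. z \<in> ball 0 1 \<Longrightarrow> f z = hardy a z"
    "(\<Sum>n. (norm (a n))\<^sup>2) \<le> (H2_norm f)\<^sup>2"
proof -
  have an: "analytic_disk f" using f by (simp add: H2_def)
  let ?I = "\<lambda>r. \<integral>\<zeta>. (norm (f (of_real r * \<zeta>)))\<^sup>2 \<partial>\<sigma>"
  obtain C where C: "\<forall>r\<in>{0..<1}. ?I r \<le> C" using f unfolding H2_def by blast
  then have bdd: "bdd_above (?I ` {0..<1})" by (auto simp: bdd_above_def)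
  obtain a where a: "\<And>z. z \<in> ball 0 1 \<Longrightarrow> (\<lambda>n. z ^ n *\<^sub>C a n) sums f z"
    "\<And>r n. 0 \<le> r \<Longrightarrow> r < 1 \<Longrightarrow> fourier (\<lambda>\<zeta>. f (of_real r * \<zeta>)) n = of_real r ^ n *\<^sub>C a n"
    using analytic_disk_expansion[OF an] by blast
  define S where "S = (SUP r\<in>{0..<1}. ?I r)"
  have le: "(\<Sum>n<N. (norm (a n))\<^sup>2) \<le> S" for N
  proof -
    have r: "(\<Sum>n<N. (r ^ n * norm (a n))\<^sup>2) \<le> S" if r: "0 \<le> r" "r < 1" for r
    proof -
      from circle_continuous[OF an r]
      have "(\<Sum>n<N. (norm (fourier (\<lambda>\<zeta>. f (of_real r * \<zeta>)) n))\<^sup>2) \<le> ?I r"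
        by (intro bessel_inequality sq_integrable_continuous)
      also have "\<dots> \<le> S" unfolding S_def by (intro cSUP_upper bdd) (use r in auto)
      finally show ?thesis using r by (simp add: a(2) norm_scaleC norm_power)
    qed
    have "((\<lambda>r. \<Sum>n<N. (r ^ n * norm (a n))\<^sup>2) \<longlongrightarrow> (\<Sum>n<N. (1 ^ n * norm (a n))\<^sup>2)) (at_left 1)"
      by (intro tendsto_intros)
    moreover have "\<forall>\<^sub>F r in at_left (1::real). (\<Sum>n<N. (r ^ n * norm (a n))\<^sup>2) \<le> S"
      using eventually_at_left_field[of "\<lambda>r. (\<Sum>n<N. (r ^ n * norm (a n))\<^sup>2) \<le> S" 1] r
      by (metis less_eq_real_def zero_less_one)
    ultimately have "(\<Sum>n<N. (1 ^ n * norm (a n))\<^sup>2) \<le> S"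
      by (rule tendsto_upperbound) simp
    then show ?thesis by simp
  qed
  have sum: "summable (\<lambda>n. (norm (a n))\<^sup>2)"
    by (rule summableI_nonneg_bounded[OF _ le]) auto
  show ?thesis
  proof (rule that[OF sum])
    show "f z = hardy a z" if "z \<in> ball 0 1" for z
      using a(1)[OF that] by (simp add: hardy_def sums_iff)
    have "0 \<le> S" using le[of 0] by simp
    then have "(H2_norm f)\<^sup>2 = S" by (simp add: H2_norm_def S_def)
    then show "(\<Sum>n. (norm (a n))\<^sup>2) \<le> (H2_norm f)\<^sup>2"
      using suminf_le_const[OF sum le] by simp
  qed
qed

section \<open>The Hilbert space of square-integrable functions on the circle\<close>

text \<open>The relation is partial: its domain singles out the square-integrable functions.\<close>

quotient_type (overloaded) 'g L2 = "complex \<Rightarrow> 'g::{chilbert_space, second_countable_topology}" /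
  partial: "\<lambda>f g. sq_integrable f \<and> sq_integrable g \<and> (AE \<zeta> in \<sigma>. f \<zeta> = g \<zeta>)"
proof (rule part_equivpI)
  show "\<exists>f::complex \<Rightarrow> 'g. sq_integrable f \<and> sq_integrable f \<and> (AE \<zeta> in \<sigma>. f \<zeta> = f \<zeta>)"
    using sq_integrable_const by auto
  show "symp (\<lambda>(f::complex \<Rightarrow> 'g) g. sq_integrable f \<and> sq_integrable g \<and> (AE \<zeta> in \<sigma>. f \<zeta> = g \<zeta>))"
    by (rule sympI) (auto elim: eventually_mono)
  show "transp (\<lambda>(f::complex \<Rightarrow> 'g) g. sq_integrable f \<and> sq_integrable g \<and> (AE \<zeta> in \<sigma>. f \<zeta> = g \<zeta>))"
  proof (rule transpI)
    fix f g h :: "complex \<Rightarrow> 'g"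
    assume *: "sq_integrable f \<and> sq_integrable g \<and> (AE \<zeta> in \<sigma>. f \<zeta> = g \<zeta>)"
      "sq_integrable g \<and> sq_integrable h \<and> (AE \<zeta> in \<sigma>. g \<zeta> = h \<zeta>)"
    then have "AE \<zeta> in \<sigma>. f \<zeta> = g \<zeta>" "AE \<zeta> in \<sigma>. g \<zeta> = h \<zeta>" by auto
    then have "AE \<zeta> in \<sigma>. f \<zeta> = h \<zeta>" by eventually_elim simp
    with * show "sq_integrable f \<and> sq_integrable h \<and> (AE \<zeta> in \<sigma>. f \<zeta> = h \<zeta>)" by auto
  qed
qed

lemma sq_integrable_measurable: "sq_integrable f \<Longrightarrow> f \<in> borel_measurable \<sigma>"
  by (simp add: sq_integrable_def)

lemma integral_cinner_cong:
  fixes f g :: "complex \<Rightarrow> 'g::{chilbert_space, second_countable_topology}"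
  assumes "sq_integrable f" "sq_integrable f'" "AE \<zeta> in \<sigma>. f \<zeta> = f' \<zeta>"
    and "sq_integrable g" "sq_integrable g'" "AE \<zeta> in \<sigma>. g \<zeta> = g' \<zeta>"
  shows "(\<integral>\<zeta>. cinner (f \<zeta>) (g \<zeta>) \<partial>\<sigma>) = (\<integral>\<zeta>. cinner (f' \<zeta>) (g' \<zeta>) \<partial>\<sigma>)"
proof (rule integral_cong_AE)
  have [measurable]: "f \<in> borel_measurable \<sigma>" "f' \<in> borel_measurable \<sigma>" "g \<in> borel_measurable \<sigma>" "g' \<in> borel_measurable \<sigma>"
    using assms by (auto intro: sq_integrable_measurable)
  show "(\<lambda>\<zeta>. cinner (f \<zeta>) (g \<zeta>)) \<in> borel_measurable \<sigma>" "(\<lambda>\<zeta>. cinner (f' \<zeta>) (g' \<zeta>)) \<in> borel_measurable \<sigma>"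
    by measurable
  show "AE \<zeta> in \<sigma>. cinner (f \<zeta>) (g \<zeta>) = cinner (f' \<zeta>) (g' \<zeta>)"
    using assms(3,6) by eventually_elim simp
qed

lemma integrable_cinner:
  fixes f g :: "complex \<Rightarrow> 'g::{chilbert_space, second_countable_topology}"
  shows "sq_integrable f \<Longrightarrow> sq_integrable g \<Longrightarrow> integrable \<sigma> (\<lambda>\<zeta>. cinner (f \<zeta>) (g \<zeta>))"
  using integrable_powi_cinner[of f g 0] by simp

instantiation L2 :: ("{chilbert_space, second_countable_topology}") "{real_vector, scaleC}"
begin

lift_definition zero_L2 :: "'a L2" is "\<lambda>\<zeta>. 0" by (simp add: sq_integrable_const)

lift_definition plus_L2 :: "'a L2 \<Rightarrow> 'a L2 \<Rightarrow> 'a L2" is "\<lambda>f g \<zeta>. f \<zeta> + g \<zeta>"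
  by (auto simp: sq_integrable_add elim: eventually_elim2)

lift_definition minus_L2 :: "'a L2 \<Rightarrow> 'a L2 \<Rightarrow> 'a L2" is "\<lambda>f g \<zeta>. f \<zeta> - g \<zeta>"
  by (auto simp: sq_integrable_diff elim: eventually_elim2)

lift_definition uminus_L2 :: "'a L2 \<Rightarrow> 'a L2" is "\<lambda>f \<zeta>. - f \<zeta>"
  by (auto simp: sq_integrable_minus elim: eventually_mono)

lift_definition scaleC_L2 :: "complex \<Rightarrow> 'a L2 \<Rightarrow> 'a L2" is "\<lambda>c f \<zeta>. c *\<^sub>C f \<zeta>"
  by (auto simp: sq_integrable_scaleC elim: eventually_mono)

lift_definition scaleR_L2 :: "real \<Rightarrow> 'a L2 \<Rightarrow> 'a L2" is "\<lambda>c f \<zeta>. c *\<^sub>R f \<zeta>"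
  by (auto simp: sq_integrable_scaleC scaleR_scaleC elim: eventually_mono)

instance
  by standard (transfer, auto simp: sq_integrable_add sq_integrable_diff sq_integrable_minus sq_integrable_const
      sq_integrable_scaleC scaleR_scaleC scaleC_add_right scaleC_add_left scaleC_scaleC)+

end

instantiation L2 :: ("{chilbert_space, second_countable_topology}") complex_inner
begin

lift_definition cinner_L2 :: "'a L2 \<Rightarrow> 'a L2 \<Rightarrow> complex" is "\<lambda>f g. \<integral>\<zeta>. cinner (f \<zeta>) (g \<zeta>) \<partial>\<sigma>"
  by (rule integral_cinner_cong) auto

definition inner_L2 :: "'a L2 \<Rightarrow> 'a L2 \<Rightarrow> real" where "inner_L2 x y = Re (cinner x y)"

definition norm_L2 :: "'a L2 \<Rightarrow> real" where "norm_L2 x = sqrt (inner x x)"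

definition dist_L2 :: "'a L2 \<Rightarrow> 'a L2 \<Rightarrow> real" where "dist_L2 x y = norm (x - y)"

definition sgn_L2 :: "'a L2 \<Rightarrow> 'a L2" where "sgn_L2 x = inverse (norm x) *\<^sub>R x"

definition uniformity_L2 :: "('a L2 \<times> 'a L2) filter"
  where "uniformity_L2 = (INF e\<in>{0<..}. principal {(x, y). dist x y < e})"

definition open_L2 :: "'a L2 set \<Rightarrow> bool"
  where "open_L2 S = (\<forall>x\<in>S. \<forall>\<^sub>F (x', y) in uniformity. x' = x \<longrightarrow> y \<in> S)"

lemma cinner_L2_commute: "cinner x y = cnj (cinner y (x :: 'a L2))"
proof transfer
  fix x y :: "complex \<Rightarrow> 'a"
  have "(\<integral>\<zeta>. cinner (x \<zeta>) (y \<zeta>) \<partial>\<sigma>) = (\<integral>\<zeta>. cnj (cinner (y \<zeta>) (x \<zeta>)) \<partial>\<sigma>)"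
    by (intro Bochner_Integration.integral_cong cinner_commute refl)
  then show "(\<integral>\<zeta>. cinner (x \<zeta>) (y \<zeta>) \<partial>\<sigma>) = cnj (\<integral>\<zeta>. cinner (y \<zeta>) (x \<zeta>) \<partial>\<sigma>)"
    by (simp only: Bochner_Integration.integral_cnj)
qed

lemma cinner_L2_add_left: "cinner (x + y) z = cinner x z + cinner y (z :: 'a L2)"
  by transfer (simp add: cinner_add_left integrable_cinner)

lemma cinner_L2_scaleC_left: "cinner (c *\<^sub>C x) y = c * cinner x (y :: 'a L2)"
  by transfer (simp add: cinner_scaleC_left integrable_cinner)

lemma scaleR_scaleC_L2: "r *\<^sub>R x = complex_of_real r *\<^sub>C (x :: 'a L2)"
  by transfer (simp add: scaleR_scaleC sq_integrable_scaleC)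

lemma inner_L2_self: "inner x x = Re (cinner x x)" "0 \<le> inner x x" "inner x x = 0 \<longleftrightarrow> x = 0" for x :: "'a L2"
proof -
  show "inner x x = Re (cinner x x)" by (simp add: inner_L2_def)
  have *: "sq_integrable f \<Longrightarrow> Re (\<integral>\<zeta>. cinner (f \<zeta>) (f \<zeta>) \<partial>\<sigma>) = (\<integral>\<zeta>. (norm (f \<zeta>))\<^sup>2 \<partial>\<sigma>)" for f :: "complex \<Rightarrow> 'a"
    by (simp add: cinner_self del: of_real_power)
  show "0 \<le> inner x x"
    unfolding inner_L2_def by transfer (simp add: *)
  show "inner x x = 0 \<longleftrightarrow> x = 0"
    unfolding inner_L2_def
    by transfer (auto simp: * sq_integrable_const integral_nonneg_eq_0_iff_AE sq_integrable_def)
qed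

instance
proof
  fix x y z :: "'a L2" and r :: real and a b :: complex
  show "dist x y = norm (x - y)" by (rule dist_L2_def)
  show "sgn x = inverse (norm x) *\<^sub>R x" by (rule sgn_L2_def)
  show "uniformity = (INF e\<in>{0<..}. principal {(x :: 'a L2, y). dist x y < e})" by (rule uniformity_L2_def)
  show "open S = (\<forall>x\<in>S. \<forall>\<^sub>F (x', y) in uniformity. x' = x \<longrightarrow> y \<in> S)" for S :: "'a L2 set" by (rule open_L2_def)
  show com: "inner x y = inner y x" for x y :: "'a L2"
    unfolding inner_L2_def by (subst cinner_L2_commute) simp
  show add: "inner (x + y) z = inner x z + inner y z" for x y z :: "'a L2" by (simp add: inner_L2_def cinner_L2_add_left)
  show sc: "inner (r *\<^sub>R x) y = r * inner x y" for r and x y :: "'a L2"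
    by (simp add: inner_L2_def scaleR_scaleC_L2 cinner_L2_scaleC_left)
  show ge: "0 \<le> inner x x" for x :: "'a L2" by (rule inner_L2_self)
  show zero: "inner x x = 0 \<longleftrightarrow> x = 0" for x :: "'a L2" by (rule inner_L2_self)
  show nrm: "norm x = sqrt (inner x x)" for x :: "'a L2" by (rule norm_L2_def)
  show "norm x = 0 \<longleftrightarrow> x = 0" for x :: "'a L2" using ge zero by (simp add: nrm)
  show "norm (r *\<^sub>R x) = \<bar>r\<bar> * norm x"
    by (simp add: nrm sc com[of x "r *\<^sub>R x"] real_sqrt_mult flip: mult.assoc)
  show "norm (x + y) \<le> norm x + norm y"
  proof -
    have cs: "inner x y \<le> norm x * norm y"
    proof (cases "inner y y = 0")
      case True
      then show ?thesis using zero ge sc[of 0 0 x] com by (simp add: nrm)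
    next
      case False
      define t where "t = inner x y / inner y y"
      have "0 \<le> inner (x + (- t) *\<^sub>R y) (x + (- t) *\<^sub>R y)" by (rule ge)
      also have "\<dots> = inner x x - 2 * t * inner x y + t * t * inner y y"
        using com[of y x] com[of x "(- t) *\<^sub>R y"] com[of x "x + (- t) *\<^sub>R y"] com[of y "x + (- t) *\<^sub>R y"]
        by (simp only: add sc) (simp add: algebra_simps)
      also have "\<dots> = inner x x - (inner x y)\<^sup>2 / inner y y"
        using False by (simp add: t_def power2_eq_square field_simps)
      finally have "(inner x y)\<^sup>2 \<le> inner x x * inner y y"
        using ge[of y] False by (simp add: field_simps)
      then have "inner x y \<le> sqrt (inner x x * inner y y)" by (rule real_le_rsqrt)
      then show ?thesis by (simp add: nrm real_sqrt_mult)
    qed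
    have n2: "(norm z)\<^sup>2 = inner z z" for z :: "'a L2" using ge by (simp add: nrm)
    have "(norm (x + y))\<^sup>2 = inner x x + 2 * inner x y + inner y y"
      using com[of x "x + y"] com[of y "x + y"] com[of y x] by (simp only: n2 add)
    also have "\<dots> \<le> (norm x + norm y)\<^sup>2" using cs by (simp add: power2_sum n2)
    finally show ?thesis by (rule power2_le_imp_le) (simp add: nrm ge)
  qed
  show "a *\<^sub>C (x + y) = a *\<^sub>C x + a *\<^sub>C y"
    by transfer (auto simp: scaleC_add_right sq_integrable_add sq_integrable_scaleC)
  show "(a + b) *\<^sub>C x = a *\<^sub>C x + b *\<^sub>C x"
    by transfer (auto simp: scaleC_add_left sq_integrable_add sq_integrable_scaleC)
  show "a *\<^sub>C b *\<^sub>C x = (a * b) *\<^sub>C x"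
    by transfer (auto simp: scaleC_scaleC sq_integrable_scaleC)
  show "r *\<^sub>R x = complex_of_real r *\<^sub>C x" by (rule scaleR_scaleC_L2)
  show "norm (a *\<^sub>C x) = cmod a * norm x"
  proof -
    have "cinner (a *\<^sub>C x) (a *\<^sub>C x) = of_real ((cmod a)\<^sup>2) * cinner x x"
      using cinner_L2_commute[of x "a *\<^sub>C x"] cinner_L2_commute[of x x]
      by (simp only: cinner_L2_scaleC_left complex_norm_square complex_cnj_mult mult.assoc)
    then show ?thesis by (simp add: nrm inner_L2_def real_sqrt_mult del: of_real_power)
  qed
  show "cinner x y = cnj (cinner y x)" by (rule cinner_L2_commute)
  show "cinner (x + y) z = cinner x z + cinner y z" by (rule cinner_L2_add_left)
  show "cinner (a *\<^sub>C x) y = a * cinner x y" by (rule cinner_L2_scaleC_left)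
  show "inner x y = Re (cinner x y)" by (rule inner_L2_def)
qed

end

lemma norm_abs_L2_diff:
  fixes f g :: "complex \<Rightarrow> 'g::{chilbert_space, second_countable_topology}"
  assumes f: "sq_integrable f" and g: "sq_integrable g"
  shows "(norm (abs_L2 f - abs_L2 g))\<^sup>2 = (\<integral>\<zeta>. (norm (f \<zeta> - g \<zeta>))\<^sup>2 \<partial>\<sigma>)"
proof -
  have d: "sq_integrable (\<lambda>\<zeta>. f \<zeta> - g \<zeta>)" by (rule sq_integrable_diff[OF f g])
  have "complex_of_real ((norm (abs_L2 f - abs_L2 g))\<^sup>2) = cinner (abs_L2 (\<lambda>\<zeta>. f \<zeta> - g \<zeta>)) (abs_L2 (\<lambda>\<zeta>. f \<zeta> - g \<zeta>))"
    using f g by (simp only: cinner_self[symmetric]) (simp add: minus_L2.abs_eq)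
  also have "\<dots> = (\<integral>\<zeta>. cinner (f \<zeta> - g \<zeta>) (f \<zeta> - g \<zeta>) \<partial>\<sigma>)"
    using d by (simp add: cinner_L2.abs_eq)
  also have "\<dots> = complex_of_real (\<integral>\<zeta>. (norm (f \<zeta> - g \<zeta>))\<^sup>2 \<partial>\<sigma>)"
    by (simp only: cinner_self integral_complex_of_real)
  finally show ?thesis by (simp only: of_real_eq_iff)
qed

lemma L2_cases:
  fixes x :: "'g::{chilbert_space, second_countable_topology} L2"
  obtains f where "sq_integrable f" "x = abs_L2 f"
proof (rule that)
  show "sq_integrable (rep_L2 x)" using Quotient_rep_reflp[OF Quotient_L2, of x] by simp
  show "x = abs_L2 (rep_L2 x)" using Quotient_abs_rep[OF Quotient_L2, of x] by simp
qed

text \<open>Completeness: a subsequence with summable increments converges almost everywhere, and by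
  Fatou's lemma also in the mean.\<close>

lemma sq_integrable_subsequence_limit:
  fixes f :: "nat \<Rightarrow> complex \<Rightarrow> 'g::{chilbert_space, second_countable_topology}"
  assumes f: "\<And>n. sq_integrable (f n)"
    and inc: "\<And>m n. m \<le> n \<Longrightarrow> sqrt (\<integral>\<zeta>. (norm (f n \<zeta> - f m \<zeta>))\<^sup>2 \<partial>\<sigma>) \<le> (1/2) ^ m"
  obtains g where "sq_integrable g" "\<And>m. sqrt (\<integral>\<zeta>. (norm (g \<zeta> - f m \<zeta>))\<^sup>2 \<partial>\<sigma>) \<le> (1/2) ^ m"
proof -
  have [measurable]: "f n \<in> borel_measurable \<sigma>" for n using f by (rule sq_integrable_measurable)
  define d where "d n \<zeta> = f (Suc n) \<zeta> - f n \<zeta>" for n \<zeta>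
  have dsq: "sq_integrable (d n)" for n unfolding d_def by (intro sq_integrable_diff f)
  then have [measurable]: "d n \<in> borel_measurable \<sigma>" for n by (rule sq_integrable_measurable)
  have "(\<integral>\<^sup>+\<zeta>. (\<Sum>n. ennreal (norm (d n \<zeta>))) \<partial>\<sigma>) = (\<Sum>n. \<integral>\<^sup>+\<zeta>. ennreal (norm (d n \<zeta>)) \<partial>\<sigma>)"
    by (rule nn_integral_suminf) measurable
  also have "\<dots> \<le> (\<Sum>n. ennreal ((1/2) ^ n))"
  proof (intro suminf_le allI)
    fix n
    have "(\<integral>\<^sup>+\<zeta>. ennreal (norm (d n \<zeta>)) \<partial>\<sigma>) = ennreal (\<integral>\<zeta>. norm (d n \<zeta>) \<partial>\<sigma>)"
      by (intro nn_integral_eq_integral integrable_norm sq_integrable_integrable dsq) auto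
    also have "\<dots> \<le> ennreal ((1/2) ^ n)"
    proof (rule ennreal_leI)
      have "(\<integral>\<zeta>. norm (d n \<zeta>) \<partial>\<sigma>) \<le> sqrt (\<integral>\<zeta>. (norm (d n \<zeta>))\<^sup>2 \<partial>\<sigma>)" by (rule integral_norm_le[OF dsq])
      also have "\<dots> \<le> (1/2) ^ n" unfolding d_def by (rule inc) simp
      finally show "(\<integral>\<zeta>. norm (d n \<zeta>) \<partial>\<sigma>) \<le> (1/2) ^ n" .
    qed
    finally show "(\<integral>\<^sup>+\<zeta>. ennreal (norm (d n \<zeta>)) \<partial>\<sigma>) \<le> ennreal ((1/2) ^ n)" .
  qed auto
  also have "\<dots> = ennreal (\<Sum>n. (1/2) ^ n)" by (intro suminf_ennreal2 summable_geometric) auto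
  also have "\<dots> < \<infinity>" by simp
  finally have fin: "(\<integral>\<^sup>+\<zeta>. (\<Sum>n. ennreal (norm (d n \<zeta>))) \<partial>\<sigma>) \<noteq> \<infinity>" by simp
  have "AE \<zeta> in \<sigma>. (\<Sum>n. ennreal (norm (d n \<zeta>))) \<noteq> \<infinity>"
    by (rule nn_integral_PInf_AE[OF _ fin]) measurable
  then have conv: "AE \<zeta> in \<sigma>. convergent (\<lambda>n. f n \<zeta>)"
  proof eventually_elim
    case (elim \<zeta>)
    then have "summable (\<lambda>n. norm (d n \<zeta>))" by (intro summable_suminf_not_top) auto
    then have "summable (\<lambda>n. d n \<zeta>)" by (rule summable_norm_cancel)
    then have "convergent (\<lambda>n. f 0 \<zeta> + (\<Sum>k<n. d k \<zeta>))"
      by (intro convergent_add convergent_const) (simp add: summable_iff_convergent)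
    moreover have "f 0 \<zeta> + (\<Sum>k<n. d k \<zeta>) = f n \<zeta>" for n
      unfolding d_def using sum_lessThan_telescope[of "\<lambda>k. f k \<zeta>" n] by simp
    ultimately show ?case by simp
  qed
  define g where "g \<zeta> = lim (\<lambda>n. f n \<zeta>)" for \<zeta>
  have [measurable]: "g \<in> borel_measurable \<sigma>" unfolding g_def by measurable
  have nn: "(\<integral>\<^sup>+\<zeta>. ennreal ((norm (g \<zeta> - f m \<zeta>))\<^sup>2) \<partial>\<sigma>) \<le> ennreal (((1/2) ^ m)\<^sup>2)" for m
  proof -
    have "(\<integral>\<^sup>+\<zeta>. ennreal ((norm (g \<zeta> - f m \<zeta>))\<^sup>2) \<partial>\<sigma>)
        = (\<integral>\<^sup>+\<zeta>. liminf (\<lambda>n. ennreal ((norm (f n \<zeta> - f m \<zeta>))\<^sup>2)) \<partial>\<sigma>)"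
    proof (rule nn_integral_cong_AE)
      show "AE \<zeta> in \<sigma>. ennreal ((norm (g \<zeta> - f m \<zeta>))\<^sup>2) = liminf (\<lambda>n. ennreal ((norm (f n \<zeta> - f m \<zeta>))\<^sup>2))"
        using conv
      proof eventually_elim
        case (elim \<zeta>)
        then have l: "(\<lambda>n. f n \<zeta>) \<longlonglongrightarrow> g \<zeta>" by (simp add: g_def convergent_LIMSEQ_iff)
        have "(\<lambda>n. ennreal ((norm (f n \<zeta> - f m \<zeta>))\<^sup>2)) \<longlonglongrightarrow> ennreal ((norm (g \<zeta> - f m \<zeta>))\<^sup>2)"
          by (intro tendsto_ennrealI tendsto_power tendsto_norm tendsto_diff l tendsto_const)
        then show ?case using lim_imp_Liminf[OF sequentially_bot] by metis
      qed
    qed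
    also have "\<dots> \<le> liminf (\<lambda>n. \<integral>\<^sup>+\<zeta>. ennreal ((norm (f n \<zeta> - f m \<zeta>))\<^sup>2) \<partial>\<sigma>)"
      by (rule nn_integral_liminf) measurable
    also have "\<dots> \<le> limsup (\<lambda>n. \<integral>\<^sup>+\<zeta>. ennreal ((norm (f n \<zeta> - f m \<zeta>))\<^sup>2) \<partial>\<sigma>)"
      by (rule Liminf_le_Limsup) simp
    also have "\<dots> \<le> ennreal (((1/2) ^ m)\<^sup>2)"
    proof (rule Limsup_bounded)
      show "\<forall>\<^sub>F n in sequentially. (\<integral>\<^sup>+\<zeta>. ennreal ((norm (f n \<zeta> - f m \<zeta>))\<^sup>2) \<partial>\<sigma>) \<le> ennreal (((1/2) ^ m)\<^sup>2)"
        using eventually_ge_at_top[of m]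
      proof eventually_elim
        case (elim n)
        have "(\<integral>\<^sup>+\<zeta>. ennreal ((norm (f n \<zeta> - f m \<zeta>))\<^sup>2) \<partial>\<sigma>) = ennreal (\<integral>\<zeta>. (norm (f n \<zeta> - f m \<zeta>))\<^sup>2 \<partial>\<sigma>)"
          using sq_integrable_diff[OF f f, of n m] by (intro nn_integral_eq_integral) (auto simp: sq_integrable_def)
        also have "\<dots> \<le> ennreal (((1/2) ^ m)\<^sup>2)" by (intro ennreal_leI sqrt_le_D inc elim)
        finally show ?case .
      qed
    qed
    finally show ?thesis .
  qed
  have i: "integrable \<sigma> (\<lambda>\<zeta>. (norm (g \<zeta> - f m \<zeta>))\<^sup>2)" for m
    by (rule integrableI_bounded) (use nn[of m] in \<open>auto simp: less_top[symmetric] top_unique\<close>)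
  then have "sq_integrable (\<lambda>\<zeta>. g \<zeta> - f 0 \<zeta>)" by (simp add: sq_integrable_def)
  then have "sq_integrable (\<lambda>\<zeta>. (g \<zeta> - f 0 \<zeta>) + f 0 \<zeta>)" by (intro sq_integrable_add f)
  then have g: "sq_integrable g" by simp
  show ?thesis
  proof (rule that[OF g])
    fix m
    have "ennreal (\<integral>\<zeta>. (norm (g \<zeta> - f m \<zeta>))\<^sup>2 \<partial>\<sigma>) \<le> ennreal (((1/2) ^ m)\<^sup>2)"
      using nn[of m] nn_integral_eq_integral[OF i[of m]] by simp
    then have "(\<integral>\<zeta>. (norm (g \<zeta> - f m \<zeta>))\<^sup>2 \<partial>\<sigma>) \<le> ((1/2) ^ m)\<^sup>2" by simp
    then show "sqrt (\<integral>\<zeta>. (norm (g \<zeta> - f m \<zeta>))\<^sup>2 \<partial>\<sigma>) \<le> (1/2) ^ m" by (intro real_le_lsqrt) auto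
  qed
qed

instance L2 :: ("{chilbert_space, second_countable_topology}") chilbert_space
proof
  fix X :: "nat \<Rightarrow> 'a L2" assume X: "Cauchy X"
  have "\<exists>N. \<forall>k. (\<forall>m\<ge>N k. \<forall>n\<ge>N k. norm (X m - X n) < (1/2) ^ k) \<and> N k < N (Suc k)"
  proof (rule dependent_nat_choice)
    show "\<exists>x. \<forall>m\<ge>x. \<forall>n\<ge>x. norm (X m - X n) < (1/2) ^ 0" using CauchyD[OF X, of 1] by auto
    fix x k
    obtain M where M: "\<forall>m\<ge>M. \<forall>n\<ge>M. norm (X m - X n) < (1/2) ^ Suc k" using CauchyD[OF X, of "(1/2) ^ Suc k"] by auto
    then show "\<exists>y. (\<forall>m\<ge>y. \<forall>n\<ge>y. norm (X m - X n) < (1/2) ^ Suc k) \<and> x < y"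
      by (intro exI[of _ "max M (Suc x)"]) auto
  qed
  then obtain N where N: "\<And>k m n. N k \<le> m \<Longrightarrow> N k \<le> n \<Longrightarrow> norm (X m - X n) < (1/2) ^ k" "\<And>k. N k < N (Suc k)"
    by blast
  have sm: "strict_mono N" using N(2) by (simp add: strict_mono_Suc_iff)
  have "\<exists>f. sq_integrable f \<and> X (N k) = abs_L2 f" for k using L2_cases by metis
  then obtain f where f: "\<And>k. sq_integrable (f k)" "\<And>k. X (N k) = abs_L2 (f k)" by metis
  have nf: "sqrt (\<integral>\<zeta>. (norm (h \<zeta> - f m \<zeta>))\<^sup>2 \<partial>\<sigma>) = norm (abs_L2 h - X (N m))" if "sq_integrable h" for h m
    using norm_abs_L2_diff[OF that f(1)[of m]] by (simp add: f(2) real_sqrt_unique)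
  have inc: "sqrt (\<integral>\<zeta>. (norm (f n \<zeta> - f m \<zeta>))\<^sup>2 \<partial>\<sigma>) \<le> (1/2) ^ m" if "m \<le> n" for m n
    using N(1)[of m "N n" "N m"] strict_mono_mono[OF sm, THEN monoD, OF that] nf[OF f(1), of n m]
    by (simp add: f(2)[symmetric])
  obtain g where g: "sq_integrable g" "\<And>m. sqrt (\<integral>\<zeta>. (norm (g \<zeta> - f m \<zeta>))\<^sup>2 \<partial>\<sigma>) \<le> (1/2) ^ m"
    using sq_integrable_subsequence_limit[of f, OF f(1) inc] by blast
  have "(\<lambda>m. X (N m)) \<longlonglongrightarrow> abs_L2 g"
  proof (rule LIM_zero_cancel, rule Lim_null_comparison)
    show "(\<lambda>m. (1/2 :: real) ^ m) \<longlonglongrightarrow> 0" by (intro LIMSEQ_power_zero) simp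
    show "\<forall>\<^sub>F m in sequentially. norm (X (N m) - abs_L2 g) \<le> (1/2) ^ m"
      using g(2) by (simp add: nf[OF g(1)] norm_minus_commute)
  qed
  then have "X \<longlonglongrightarrow> abs_L2 g"
    using Cauchy_converges_subseq[OF X sm] by (simp add: o_def)
  then show "convergent X" by (auto simp: convergent_def)
qed

section \<open>Square roots of nonnegative operators\<close>

text \<open>Polarization: the defect form vanishes on the diagonal, and it is evaluated at \<open>u + v\<close> and \<open>u + \<i> v\<close>.\<close>

lemma nonneg_op_selfadjoint:
  fixes A :: "'h::chilbert_space \<Rightarrow>\<^sub>L 'h"
  assumes A: "A \<in> cbounded_ops" and nn: "nonneg_op A"
  shows "cinner (blinfun_apply A u) v = cinner u (blinfun_apply A v)"
proof -
  define B where "B u v = cinner (blinfun_apply A u) v - cinner u (blinfun_apply A v)" for u v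
  have B0: "B w w = 0" for w
  proof -
    have "cinner (blinfun_apply A w) w \<in> \<real>\<^sub>\<ge>\<^sub>0" using nn by (simp add: nonneg_op_def)
    then have "cnj (cinner (blinfun_apply A w) w) = cinner (blinfun_apply A w) w"
      by (auto simp: complex_nonneg_Reals_iff complex_eq_iff)
    then show ?thesis using cinner_commute[of w "blinfun_apply A w"] by (simp add: B_def)
  qed
  have 1: "B u v + B v u = 0"
    using B0[of "u + v"] B0[of u] B0[of v]
    by (simp add: B_def blinfun.add_right cinner_add_left cinner_add_right algebra_simps)
  have "B u (\<i> *\<^sub>C v) + B (\<i> *\<^sub>C v) u = 0"
    using B0[of "u + \<i> *\<^sub>C v"] B0[of u] B0[of "\<i> *\<^sub>C v"]
    by (simp add: B_def blinfun.add_right cinner_add_left cinner_add_right algebra_simps)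
  moreover have "B u (\<i> *\<^sub>C v) = - \<i> * B u v" "B (\<i> *\<^sub>C v) u = \<i> * B v u"
    by (simp_all add: B_def cbounded_opsD[OF A] cinner_scaleC_left cinner_scaleC_right right_diff_distrib)
  ultimately have "\<i> * (B v u - B u v) = 0" by (simp add: right_diff_distrib)
  then have "B v u = B u v" by simp
  with 1 have "B u v = 0" by simp
  then show ?thesis by (simp add: B_def)
qed

text \<open>That is \<open>A\<^sup>2 \<le> A\<close> for \<open>0 \<le> A \<le> 1\<close>; it follows from nonnegativity of \<open>A\<close> at the vector \<open>u - A u\<close>.\<close>

lemma nonneg_op_norm_sq_le:
  fixes A :: "'h::chilbert_space \<Rightarrow>\<^sub>L 'h"
  assumes A: "A \<in> cbounded_ops" and nn: "nonneg_op A" and n1: "norm A \<le> 1"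
  shows "(norm (blinfun_apply A u))\<^sup>2 \<le> Re (cinner (blinfun_apply A u) u)"
proof -
  let ?A = "blinfun_apply A"
  have "0 \<le> Re (cinner (?A (u - ?A u)) (u - ?A u))"
    using nn by (auto simp: nonneg_op_def complex_nonneg_Reals_iff)
  also have "\<dots> = Re (cinner (?A u) u) - 2 * (norm (?A u))\<^sup>2 + Re (cinner (?A (?A u)) (?A u))"
    using nonneg_op_selfadjoint[OF A nn, of "?A u" u]
    by (simp add: blinfun.diff_right cinner.diff_left cinner.diff_right cinner_self)
  also have "Re (cinner (?A (?A u)) (?A u)) \<le> (norm (?A u))\<^sup>2"
  proof -
    have "Re (cinner (?A (?A u)) (?A u)) \<le> norm (?A (?A u)) * norm (?A u)"
      using complex_Re_le_cmod norm_cinner_le order_trans by blast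
    also have "\<dots> \<le> norm (?A u) * norm (?A u)"
      using norm_blinfun[of A "?A u"] mult_right_mono[OF n1, of "norm (?A u)"] by (intro mult_right_mono) auto
    finally show ?thesis by (simp add: power2_eq_square)
  qed
  finally show ?thesis by simp
qed

lemma norm_id_minus_nonneg_op:
  fixes A :: "'h::chilbert_space \<Rightarrow>\<^sub>L 'h"
  assumes A: "A \<in> cbounded_ops" and nn: "nonneg_op A" and n1: "norm A \<le> 1"
  shows "norm (id_blinfun - A) \<le> 1"
proof (rule norm_blinfun_bound)
  fix u
  have "(norm (u - blinfun_apply A u))\<^sup>2 \<le> (norm u)\<^sup>2"
    using nonneg_op_norm_sq_le[OF assms, of u] Re_complex_of_real cinner_commute[of u "blinfun_apply A u"]
    by (simp add: norm_diff_sq)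
      (smt (verit) nonneg_op_norm_sq_le[OF assms] zero_le_power2)
  then have "norm (u - blinfun_apply A u) \<le> norm u" by (rule power2_le_imp_le) simp
  then show "norm (blinfun_apply (id_blinfun - A) u) \<le> 1 * norm u" by (simp add: blinfun.diff_left)
qed simp

text \<open>The iteration \<open>Y\<^sub>0 = 0\<close>, \<open>Y\<^sub>n\<^sub>+\<^sub>1 = (I - A + Y\<^sub>n\<^sup>2) / 2\<close> converges in norm to \<open>I - A\<^sup>1\<^sup>/\<^sup>2\<close>. Its increments are
  dominated by those of the same iteration for the scalar \<open>A = 0\<close>, which increases to \<open>1\<close>.\<close>

primrec sqrt_iter :: "('h::real_normed_vector \<Rightarrow>\<^sub>L 'h) \<Rightarrow> nat \<Rightarrow> 'h \<Rightarrow>\<^sub>L 'h"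
  where "sqrt_iter A 0 = 0"
  | "sqrt_iter A (Suc n) = (1/2) *\<^sub>R (id_blinfun - A + (sqrt_iter A n o\<^sub>L sqrt_iter A n))"

primrec scalar_iter :: "nat \<Rightarrow> real"
  where "scalar_iter 0 = 0"
  | "scalar_iter (Suc n) = (1 + (scalar_iter n)\<^sup>2) / 2"

definition sqrt_op :: "('h::real_normed_vector \<Rightarrow>\<^sub>L 'h) \<Rightarrow> 'h \<Rightarrow>\<^sub>L 'h"
  where "sqrt_op A = id_blinfun - lim (sqrt_iter A)"

lemma scalar_iter_bounds: "0 \<le> scalar_iter n \<and> scalar_iter n \<le> 1 \<and> scalar_iter n \<le> scalar_iter (Suc n)"
proof (induction n)
  case (Suc n)
  then have "(scalar_iter n)\<^sup>2 \<le> (scalar_iter (Suc n))\<^sup>2" "(scalar_iter n)\<^sup>2 \<le> 1"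
    by (auto intro: power_mono power_le_one)
  then show ?case by auto
qed simp

context
  fixes A :: "'h::chilbert_space \<Rightarrow>\<^sub>L 'h"
  assumes A: "A \<in> cbounded_ops" and nn: "nonneg_op A" and n1: "norm A \<le> 1"
begin

lemma sqrt_iter_bounds:
  "norm (sqrt_iter A n) \<le> scalar_iter n \<and>
   norm (sqrt_iter A (Suc n) - sqrt_iter A n) \<le> scalar_iter (Suc n) - scalar_iter n"
proof (induction n)
  case 0
  show ?case using norm_id_minus_nonneg_op[OF A nn n1] by simp
next
  case (Suc n)
  let ?Y = "sqrt_iter A" and ?y = scalar_iter
  have a: "norm (?Y (Suc n)) \<le> ?y (Suc n)"
    using norm_triangle_sub[of "?Y (Suc n)" "?Y n"] conjunct1[OF Suc] conjunct2[OF Suc] by linarith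
  have "?Y (Suc (Suc n)) - ?Y (Suc n) = (1/2) *\<^sub>R ((?Y (Suc n) o\<^sub>L ?Y (Suc n)) - (?Y n o\<^sub>L ?Y n))"
    by (simp only: sqrt_iter.simps(2)[of A "Suc n"] sqrt_iter.simps(2)[of A n, symmetric])
      (simp add: scaleR_right_diff_distrib scaleR_right_distrib)
  also have "(?Y (Suc n) o\<^sub>L ?Y (Suc n)) - (?Y n o\<^sub>L ?Y n)
      = (?Y (Suc n) o\<^sub>L (?Y (Suc n) - ?Y n)) + ((?Y (Suc n) - ?Y n) o\<^sub>L ?Y n)"
    by (rule blinfun_eqI) (simp add: blinfun.diff_left blinfun.diff_right blinfun.add_left)
  also have "norm ((1/2) *\<^sub>R \<dots>) \<le> (?y (Suc n) * (?y (Suc n) - ?y n) + (?y (Suc n) - ?y n) * ?y n) / 2"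
  proof -
    have "norm ((?Y (Suc n) o\<^sub>L (?Y (Suc n) - ?Y n)) + ((?Y (Suc n) - ?Y n) o\<^sub>L ?Y n))
        \<le> norm (?Y (Suc n)) * norm (?Y (Suc n) - ?Y n) + norm (?Y (Suc n) - ?Y n) * norm (?Y n)"
      by (rule norm_triangle_le[OF add_mono[OF norm_blinfun_compose norm_blinfun_compose]])
    also have "\<dots> \<le> ?y (Suc n) * (?y (Suc n) - ?y n) + (?y (Suc n) - ?y n) * ?y n"
      using Suc a scalar_iter_bounds[of n] scalar_iter_bounds[of "Suc n"] by (intro add_mono mult_mono) auto
    finally show ?thesis by simp
  qed
  also have "\<dots> = ?y (Suc (Suc n)) - ?y (Suc n)"
  proof -
    have q: "?y n * ?y n = 2 * ?y (Suc n) - 1" by (simp add: power2_eq_square field_simps)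
    have "?y (Suc (Suc n)) = (1 + ?y (Suc n) * ?y (Suc n)) / 2"
      by (simp only: scalar_iter.simps(2)[of "Suc n"] power2_eq_square)
    moreover have "(p * (p - q) + (p - q) * q) / 2 = r - p"
      if "r = (1 + p * p) / 2" "q * q = 2 * p - 1" for p q r :: real
    proof -
      have "p * (p - q) + (p - q) * q = p * p - q * q" by (simp add: algebra_simps)
      with that show ?thesis by (simp add: field_simps)
    qed
    ultimately show ?thesis using q by blast
  qed
  finally show ?case using a by simp
qed

lemma sqrt_iter_tendsto: "sqrt_iter A \<longlonglongrightarrow> lim (sqrt_iter A)"
proof -
  let ?Y = "sqrt_iter A" and ?y = scalar_iter
  have "incseq ?y" using scalar_iter_bounds by (intro incseq_SucI) blast
  moreover have "\<forall>n. ?y n \<le> 1" using scalar_iter_bounds by blast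
  ultimately obtain L where "?y \<longlonglongrightarrow> L" by (rule incseq_convergent)
  then have yc: "Cauchy ?y" by (rule LIMSEQ_imp_Cauchy)
  have diff: "norm (?Y m - ?Y n) \<le> ?y m - ?y n" if "n \<le> m" for m n
    using that
  proof (induction m rule: dec_induct)
    case (step m)
    then show ?case
      using norm_triangle_ineq[of "?Y (Suc m) - ?Y m" "?Y m - ?Y n"] sqrt_iter_bounds[of m] by simp
  qed simp
  have "Cauchy ?Y"
  proof (rule CauchyI')
    fix e :: real assume "e > 0"
    then obtain M where M: "\<forall>m\<ge>M. \<forall>n\<ge>M. norm (?y m - ?y n) < e" using CauchyD[OF yc] by blast
    have "dist (?Y m) (?Y n) < e" if "m \<ge> M" "n > m" for m n
    proof -
      have "dist (?Y m) (?Y n) \<le> ?y n - ?y m" using diff[of m n] that by (simp add: dist_norm norm_minus_commute)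
      also have "\<dots> < e" using M[rule_format, of n m] that by (simp add: abs_less_iff)
      finally show ?thesis .
    qed
    then show "\<exists>M. \<forall>m\<ge>M. \<forall>n>m. dist (?Y m) (?Y n) < e" by blast
  qed
  then show ?thesis by (simp add: Cauchy_convergent_iff convergent_LIMSEQ_iff)
qed

lemma sqrt_op_square: "sqrt_op A o\<^sub>L sqrt_op A = A"
proof -
  let ?Y = "lim (sqrt_iter A)"
  have t: "sqrt_iter A \<longlonglongrightarrow> ?Y" by (rule sqrt_iter_tendsto)
  have "(\<lambda>n. sqrt_iter A (Suc n)) \<longlonglongrightarrow> (1/2) *\<^sub>R (id_blinfun - A + (?Y o\<^sub>L ?Y))"
    unfolding sqrt_iter.simps
    by (intro tendsto_scaleR tendsto_add tendsto_const bounded_bilinear.tendsto[OF bounded_bilinear_blinfun_compose] t)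
  then have Y: "?Y = (1/2) *\<^sub>R (id_blinfun - A + (?Y o\<^sub>L ?Y))"
    using LIMSEQ_Suc[OF t] LIMSEQ_unique by blast
  show ?thesis
  proof (rule blinfun_eqI)
    fix u
    have "blinfun_apply ?Y u = (1/2) *\<^sub>R (u - blinfun_apply A u + blinfun_apply ?Y (blinfun_apply ?Y u))"
      using arg_cong[OF Y, of "\<lambda>B. blinfun_apply B u"]
      by (simp add: blinfun.scaleR_left blinfun.add_left blinfun.diff_left)
    then have "2 *\<^sub>R blinfun_apply ?Y u = u - blinfun_apply A u + blinfun_apply ?Y (blinfun_apply ?Y u)"
      by (metis scaleR_half_double scaleR_2 scaleR_right_distrib)
    then show "blinfun_apply (sqrt_op A o\<^sub>L sqrt_op A) u = blinfun_apply A u"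
      by (simp add: sqrt_op_def blinfun.diff_left blinfun.diff_right scaleR_2 algebra_simps)
  qed
qed

lemma sqrt_iter_apply_tendsto: "(\<lambda>n. blinfun_apply (sqrt_iter A n) u) \<longlonglongrightarrow> blinfun_apply (lim (sqrt_iter A)) u"
  by (intro blinfun.tendsto sqrt_iter_tendsto tendsto_const)

lemma sqrt_op_cbounded: "sqrt_op A \<in> cbounded_ops"
proof -
  have "blinfun_apply (sqrt_iter A n) (c *\<^sub>C x) = c *\<^sub>C blinfun_apply (sqrt_iter A n) x" for n c x
    by (induction n arbitrary: x)
      (simp_all add: scaleC.zero_right blinfun.scaleR_left blinfun.add_left blinfun.diff_left cbounded_opsD[OF A]
        scaleC_add_right scaleC.diff_right scaleC.scaleR_right)
  then have "(\<lambda>n. c *\<^sub>C blinfun_apply (sqrt_iter A n) x) \<longlonglongrightarrow> blinfun_apply (lim (sqrt_iter A)) (c *\<^sub>C x)" for c x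
    using sqrt_iter_apply_tendsto[of "c *\<^sub>C x"] by simp
  moreover have "(\<lambda>n. c *\<^sub>C blinfun_apply (sqrt_iter A n) x) \<longlonglongrightarrow> c *\<^sub>C blinfun_apply (lim (sqrt_iter A)) x" for c x
    by (intro scaleC.tendsto tendsto_const sqrt_iter_apply_tendsto)
  ultimately have "blinfun_apply (lim (sqrt_iter A)) (c *\<^sub>C x) = c *\<^sub>C blinfun_apply (lim (sqrt_iter A)) x" for c x
    using LIMSEQ_unique by blast
  then show ?thesis
    by (simp add: cbounded_ops_def sqrt_op_def blinfun.diff_left scaleC.diff_right)
qed

lemma sqrt_op_selfadjoint: "cinner (blinfun_apply (sqrt_op A) u) v = cinner u (blinfun_apply (sqrt_op A) v)"
proof -
  have "cinner (blinfun_apply (sqrt_iter A n) u) v = cinner u (blinfun_apply (sqrt_iter A n) v)" for n u v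
    by (induction n arbitrary: u v)
      (simp_all add: cinner.zero_left cinner.zero_right blinfun.scaleR_left blinfun.add_left blinfun.diff_left
        nonneg_op_selfadjoint[OF A nn] cinner_add_left cinner_add_right cinner.diff_left cinner.diff_right
        cinner.scaleR_left cinner.scaleR_right)
  then have "(\<lambda>n. cinner u (blinfun_apply (sqrt_iter A n) v)) \<longlonglongrightarrow> cinner (blinfun_apply (lim (sqrt_iter A)) u) v"
    using cinner.tendsto[OF sqrt_iter_apply_tendsto[of u] tendsto_const[of v]] by simp
  moreover have "(\<lambda>n. cinner u (blinfun_apply (sqrt_iter A n) v)) \<longlonglongrightarrow> cinner u (blinfun_apply (lim (sqrt_iter A)) v)"
    by (intro cinner.tendsto tendsto_const sqrt_iter_apply_tendsto)
  ultimately have "cinner (blinfun_apply (lim (sqrt_iter A)) u) v = cinner u (blinfun_apply (lim (sqrt_iter A)) v)"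
    using LIMSEQ_unique by blast
  then show ?thesis
    by (simp add: sqrt_op_def blinfun.diff_left cinner.diff_left cinner.diff_right)
qed

lemma norm_sqrt_op_apply_le: "norm (blinfun_apply (sqrt_op A) u) \<le> norm u"
proof -
  have "complex_of_real ((norm (blinfun_apply (sqrt_op A) u))\<^sup>2) = cinner (blinfun_apply (sqrt_op A o\<^sub>L sqrt_op A) u) u"
    by (simp add: cinner_self[symmetric] sqrt_op_selfadjoint[of "blinfun_apply (sqrt_op A) u"] del: of_real_power)
  then have "(norm (blinfun_apply (sqrt_op A) u))\<^sup>2 = Re (cinner (blinfun_apply A u) u)"
    by (metis sqrt_op_square Re_complex_of_real)
  also have "\<dots> \<le> norm (blinfun_apply A u) * norm u"
    using complex_Re_le_cmod norm_cinner_le order_trans by blast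
  also have "\<dots> \<le> norm u * norm u"
    using norm_blinfun[of A u] mult_right_mono[OF n1, of "norm u"] by (intro mult_right_mono) auto
  finally have "(norm (blinfun_apply (sqrt_op A) u))\<^sup>2 \<le> (norm u)\<^sup>2" by (simp only: power2_eq_square)
  then show ?thesis by (rule power2_le_imp_le) simp
qed

text \<open>Let \<open>q\<close> be the component of \<open>A\<^sup>1\<^sup>/\<^sup>2 w\<close> orthogonal to the range of \<open>A\<close>. Then \<open>A\<^sup>1\<^sup>/\<^sup>2 q = 0\<close>, as the square of its
  norm is the inner product of \<open>q\<close> and \<open>A q\<close>. So \<open>q\<close> is orthogonal to \<open>A\<^sup>1\<^sup>/\<^sup>2 w\<close> too, and it vanishes.\<close>

lemma sqrt_op_in_closure_range: "blinfun_apply (sqrt_op A) w \<in> closure (range (blinfun_apply A))"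
proof -
  let ?R = "blinfun_apply (sqrt_op A)" and ?A = "blinfun_apply A"
  have AR: "?A u = ?R (?R u)" for u using sqrt_op_square by (metis blinfun_apply_blinfun_compose)
  have M: "closed_csubspace (closure (range ?A))"
    unfolding closed_csubspace_def
  proof (intro conjI ballI allI)
    have "0 \<in> range ?A" by (rule range_eqI[of _ _ 0]) (simp add: blinfun.zero_right)
    then show "0 \<in> closure (range ?A)" by (rule subsetD[OF closure_subset])
  next
    fix x y assume x: "x \<in> closure (range ?A)" and y: "y \<in> closure (range ?A)"
    from x[unfolded closure_sequential] obtain f where f: "\<forall>n. f n \<in> range ?A" "f \<longlonglongrightarrow> x" by blast
    from y[unfolded closure_sequential] obtain g where g: "\<forall>n. g n \<in> range ?A" "g \<longlonglongrightarrow> y" by blast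
    have "f n + g n \<in> range ?A" for n
    proof -
      obtain u v where "f n = ?A u" "g n = ?A v" using f(1) g(1) by blast
      then have "f n + g n = ?A (u + v)" by (simp add: blinfun.add_right)
      then show ?thesis by blast
    qed
    then have "\<forall>n. f n + g n \<in> range ?A" by blast
    from conjI[OF this tendsto_add[OF f(2) g(2)]] show "x + y \<in> closure (range ?A)"
      unfolding closure_sequential by (rule exI[of _ "\<lambda>n. f n + g n"])
  next
    fix c x assume x: "x \<in> closure (range ?A)"
    from x[unfolded closure_sequential] obtain f where f: "\<forall>n. f n \<in> range ?A" "f \<longlonglongrightarrow> x" by blast
    have "c *\<^sub>C f n \<in> range ?A" for n
    proof -
      obtain u where "f n = ?A u" using f(1) by blast
      then have "c *\<^sub>C f n = ?A (c *\<^sub>C u)" by (simp add: cbounded_opsD[OF A])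
      then show ?thesis by blast
    qed
    then have "\<forall>n. c *\<^sub>C f n \<in> range ?A" by blast
    from conjI[OF this scaleC.tendsto[OF tendsto_const[of c] f(2)]] show "c *\<^sub>C x \<in> closure (range ?A)"
      unfolding closure_sequential by (rule exI[of _ "\<lambda>n. c *\<^sub>C f n"])
  qed simp
  obtain p where p: "p \<in> closure (range ?A)" "\<And>m. m \<in> closure (range ?A) \<Longrightarrow> cinner (?R w - p) m = 0"
    by (rule orthogonal_projection[OF M]) blast
  define q where "q = ?R w - p"
  have qA: "cinner q (?A u) = 0" for u
    unfolding q_def by (rule p(2), rule subsetD[OF closure_subset], rule rangeI)
  have "cinner (?R q) (?R q) = 0"
    using qA[of q] by (simp add: AR sqrt_op_selfadjoint)
  then have Rq: "?R q = 0" by (simp only: cinner_self) simp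
  have "cinner q q = cinner (?R w) q - cinner p q" by (simp add: q_def cinner.diff_left)
  also have "cinner p q = 0" using p(2)[OF p(1)] by (simp add: q_def cinner_eq_0_commute[of p])
  also have "cinner (?R w) q = 0" by (simp add: sqrt_op_selfadjoint Rq cinner.zero_right)
  finally have "q = 0" by (simp add: cinner_self)
  then show ?thesis using p(1) by (simp add: q_def)
qed

end

section \<open>Power series with coefficients in a Banach space\<close>

text \<open>Term-by-term differentiation; the differentiated series converges uniformly on smaller disks.\<close>

lemma analytic_disk_power_series:
  fixes a :: "nat \<Rightarrow> 'b::{complex_normed_vector, banach}"
  assumes C: "\<And>n. norm (a n) \<le> C"
  shows "analytic_disk (\<lambda>z. \<Sum>n. z ^ n *\<^sub>C a n)"
    and "z \<in> ball 0 1 \<Longrightarrow> summable (\<lambda>n. z ^ n *\<^sub>C a n)"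
proof -
  have sm: "summable (\<lambda>n. z ^ n *\<^sub>C a n)" if z: "z \<in> ball 0 1" for z
  proof (rule summable_comparison_test')
    show "summable (\<lambda>n. C * cmod z ^ n)" using z by (intro summable_mult summable_geometric) auto
    show "norm (z ^ n *\<^sub>C a n) \<le> C * cmod z ^ n" for n
      using mult_right_mono[OF C, of "cmod z ^ n" n] by (simp add: norm_scaleC norm_power mult.commute)
  qed
  then show "z \<in> ball 0 1 \<Longrightarrow> summable (\<lambda>n. z ^ n *\<^sub>C a n)" .
  define D where "D n z = (of_nat n * z ^ (n - 1)) *\<^sub>C a n" for n and z :: complex
  show "analytic_disk (\<lambda>z. \<Sum>n. z ^ n *\<^sub>C a n)"
    unfolding analytic_disk_def
  proof
    fix z0 :: complex assume z0: "z0 \<in> ball 0 1"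
    define r where "r = (1 + cmod z0) / 2"
    have r: "0 < r" "r < 1" "cmod z0 < r" using z0 by (auto simp: r_def add_pos_nonneg)
    have sM: "summable (\<lambda>n. C * (real n * r ^ (n - 1)))"
    proof (intro summable_mult)
      have "summable (\<lambda>n. real (Suc n) * r ^ n)"
        using geometric_deriv_sums[of r] r by (auto simp: sums_iff)
      then show "summable (\<lambda>n. real n * r ^ (n - 1))"
        using summable_Suc_iff[of "\<lambda>n. real n * r ^ (n - 1)"] by simp
    qed
    have U: "uniform_limit (ball 0 r) (\<lambda>n x. \<Sum>i<n. D i x) (\<lambda>x. \<Sum>i. D i x) sequentially"
    proof (rule Weierstrass_m_test[OF _ sM])
      fix n x assume x: "x \<in> ball (0::complex) r"
      have "norm (D n x) = real n * cmod x ^ (n - 1) * norm (a n)"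
        by (simp add: D_def norm_scaleC norm_mult norm_power)
      also have "\<dots> \<le> real n * r ^ (n - 1) * C"
        using x C[of n] r by (intro mult_mono mult_left_mono power_mono) auto
      finally show "norm (D n x) \<le> C * (real n * r ^ (n - 1))" by (simp add: mult_ac)
    qed
    have "\<exists>g. \<forall>x\<in>ball 0 r. (\<lambda>n. x ^ n *\<^sub>C a n) sums (g x) \<and>
        (g has_derivative (\<lambda>h. h *\<^sub>C (\<Sum>i. D i x))) (at x within ball 0 r)"
    proof (rule has_derivative_series[where f'="\<lambda>n x h. h *\<^sub>C D n x"])
      show "((\<lambda>z. z ^ n *\<^sub>C a n) has_derivative (\<lambda>h. h *\<^sub>C D n x)) (at x within ball 0 r)"
        if "x \<in> ball 0 r" for n x
      proof -
        have "((\<lambda>z. z ^ n) has_derivative (\<lambda>h. of_nat n * h * x ^ (n - 1))) (at x within ball 0 r)"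
          by (auto intro!: derivative_eq_intros)
        from bounded_linear.has_derivative[OF scaleC.bounded_linear_left this, of "a n"]
        show ?thesis by (simp add: D_def scaleC_scaleC mult_ac)
      qed
      show "\<forall>\<^sub>F n in sequentially. \<forall>x\<in>ball 0 r. \<forall>h. norm ((\<Sum>i<n. h *\<^sub>C D i x) - h *\<^sub>C (\<Sum>i. D i x)) \<le> e * norm h"
        if "e > 0" for e
        using uniform_limitD[OF U that]
      proof eventually_elim
        case (elim n)
        show ?case
        proof (intro ballI allI)
          fix x h assume "x \<in> ball (0::complex) r"
          then have "norm ((\<Sum>i<n. D i x) - (\<Sum>i. D i x)) \<le> e" using elim by (simp add: dist_norm less_imp_le)
          then have "cmod h * norm ((\<Sum>i<n. D i x) - (\<Sum>i. D i x)) \<le> cmod h * e" by (intro mult_left_mono) auto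
          then show "norm ((\<Sum>i<n. h *\<^sub>C D i x) - h *\<^sub>C (\<Sum>i. D i x)) \<le> e * norm h"
            by (simp add: mult.commute norm_scaleC flip: scaleC.sum_right scaleC.diff_right)
        qed
      qed
      show "(0::complex) \<in> ball 0 r" using r by simp
      show "(\<lambda>n. 0 ^ n *\<^sub>C a n) sums (\<Sum>n. 0 ^ n *\<^sub>C a n)" by (intro summable_sums sm) simp
    qed simp
    then obtain g where g: "\<And>x. x \<in> ball 0 r \<Longrightarrow> (\<lambda>n. x ^ n *\<^sub>C a n) sums (g x)"
      "\<And>x. x \<in> ball 0 r \<Longrightarrow> (g has_derivative (\<lambda>h. h *\<^sub>C (\<Sum>i. D i x))) (at x within ball 0 r)" by blast
    have z0r: "z0 \<in> ball 0 r" using r by simp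
    have "(g has_derivative (\<lambda>h. h *\<^sub>C (\<Sum>i. D i z0))) (at z0)"
      using g(2)[OF z0r] at_within_open[OF z0r open_ball] by simp
    then have "((\<lambda>z. \<Sum>n. z ^ n *\<^sub>C a n) has_derivative (\<lambda>h. h *\<^sub>C (\<Sum>i. D i z0))) (at z0)"
      by (rule has_derivative_transform_within_open[OF _ open_ball z0r]) (use g(1) in \<open>auto simp: sums_iff\<close>)
    then show "\<exists>d. ((\<lambda>z. \<Sum>n. z ^ n *\<^sub>C a n) has_derivative (\<lambda>h. h *\<^sub>C d)) (at z0)" by blast
  qed
qed

section \<open>Hardy classes and boundary functions of operator-valued functions\<close>

lemma nontangential_limit_unique:
  fixes f :: "complex \<Rightarrow> 'b::t2_space"
  assumes "nontangential_limit f \<zeta> l" "nontangential_limit f \<zeta> l'" "\<zeta> \<in> sphere 0 1"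
  shows "l = l'"
  using assms stolz_region_nontrivial[of \<zeta> 2] tendsto_unique
  unfolding nontangential_limit_def by (metis one_less_numeral_iff semiring_norm(76))

lemma nontangential_limit_cong:
  assumes "nontangential_limit f \<zeta> l" "\<And>z. z \<in> ball 0 1 \<Longrightarrow> f z = g z"
  shows "nontangential_limit g \<zeta> l"
  unfolding nontangential_limit_def
proof (intro allI impI)
  fix a :: real assume "1 < a"
  then have "(f \<longlongrightarrow> l) (at \<zeta> within stolz_region a \<zeta>)" using assms(1) by (simp add: nontangential_limit_def)
  then show "(g \<longlongrightarrow> l) (at \<zeta> within stolz_region a \<zeta>)"
  proof (rule Lim_transform_eventually)
    show "\<forall>\<^sub>F z in at \<zeta> within stolz_region a \<zeta>. f z = g z"
      using assms(2) by (simp add: eventually_at_filter stolz_region_def)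
  qed
qed

lemma eventually_stolz: "(\<And>z. z \<in> ball 0 1 \<Longrightarrow> P z) \<Longrightarrow> \<forall>\<^sub>F z in at \<zeta> within stolz_region a \<zeta>. P z"
  by (simp add: eventually_at_filter stolz_region_def)

lemma norm_nontangential_limit_le:
  fixes f :: "complex \<Rightarrow> 'b::real_normed_vector"
  assumes "nontangential_limit f \<zeta> l" "\<zeta> \<in> sphere 0 1" "\<And>z. z \<in> ball 0 1 \<Longrightarrow> norm (f z) \<le> C"
  shows "norm l \<le> C"
proof (rule tendsto_upperbound)
  show "((\<lambda>z. norm (f z)) \<longlongrightarrow> norm l) (at \<zeta> within stolz_region 2 \<zeta>)"
    using assms(1) by (intro tendsto_norm) (simp add: nontangential_limit_def)
qed (use assms stolz_region_nontrivial in \<open>auto intro!: eventually_stolz\<close>)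

text \<open>Boundedness of \<open>F\<close> reduces the claim to constant \<open>f\<close>, where strong convergence is enough.\<close>

lemma nontangential_limit_apply:
  fixes F :: "complex \<Rightarrow> 'g::real_normed_vector \<Rightarrow>\<^sub>L 'h::real_normed_vector"
  assumes F: "\<And>u. nontangential_limit (\<lambda>z. blinfun_apply (F z) u) \<zeta> (blinfun_apply \<Phi> u)"
    and f: "nontangential_limit f \<zeta> v" and C: "\<And>z. z \<in> ball 0 1 \<Longrightarrow> norm (F z) \<le> C"
  shows "nontangential_limit (\<lambda>z. blinfun_apply (F z) (f z)) \<zeta> (blinfun_apply \<Phi> v)"
  unfolding nontangential_limit_def
proof (intro allI impI)
  fix a :: real assume a: "1 < a"
  let ?Fil = "at \<zeta> within stolz_region a \<zeta>"
  have "((\<lambda>z. f z - v) \<longlongrightarrow> 0) ?Fil" using f a by (intro LIM_zero) (simp add: nontangential_limit_def)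
  then have "((\<lambda>z. C * norm (f z - v)) \<longlongrightarrow> 0) ?Fil" by (intro tendsto_mult_right_zero tendsto_norm_zero)
  then have 1: "((\<lambda>z. blinfun_apply (F z) (f z - v)) \<longlongrightarrow> 0) ?Fil"
  proof (rule Lim_null_comparison[rotated])
    show "\<forall>\<^sub>F z in ?Fil. norm (blinfun_apply (F z) (f z - v)) \<le> C * norm (f z - v)"
      by (rule eventually_stolz, rule order_trans[OF norm_blinfun mult_right_mono[OF C norm_ge_zero]])
  qed
  have "((\<lambda>z. blinfun_apply (F z) v) \<longlongrightarrow> blinfun_apply \<Phi> v) ?Fil"
    using F a by (simp add: nontangential_limit_def)
  from tendsto_add[OF 1 this] show "((\<lambda>z. blinfun_apply (F z) (f z)) \<longlongrightarrow> blinfun_apply \<Phi> v) ?Fil"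
    by (simp add: blinfun.diff_right)
qed

lemma nontangential_limit_scaleC:
  fixes g :: "complex \<Rightarrow> 'b::complex_normed_vector"
  assumes "nontangential_limit f \<zeta> c" "nontangential_limit g \<zeta> v"
  shows "nontangential_limit (\<lambda>z. f z *\<^sub>C g z) \<zeta> (c *\<^sub>C v)"
  unfolding nontangential_limit_def
proof (intro allI impI)
  fix a :: real assume "1 < a"
  then have "(f \<longlongrightarrow> c) (at \<zeta> within stolz_region a \<zeta>)" "(g \<longlongrightarrow> v) (at \<zeta> within stolz_region a \<zeta>)"
    using assms by (auto simp: nontangential_limit_def)
  then show "((\<lambda>z. f z *\<^sub>C g z) \<longlongrightarrow> c *\<^sub>C v) (at \<zeta> within stolz_region a \<zeta>)" by (rule scaleC.tendsto)
qed

lemma nontangential_limit_diff: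
  fixes f g :: "complex \<Rightarrow> 'b::real_normed_vector"
  assumes "nontangential_limit f \<zeta> u" "nontangential_limit g \<zeta> v"
  shows "nontangential_limit (\<lambda>z. f z - g z) \<zeta> (u - v)"
  using assms by (auto simp: nontangential_limit_def intro!: tendsto_diff)

lemma nontangential_limit_const: "nontangential_limit (\<lambda>z. u) \<zeta> u"
  by (simp add: nontangential_limit_def)

text \<open>Boundedness of \<open>F\<close> makes \<open>z \<mapsto> F z (d n)\<close> converge uniformly, so the limits may be interchanged.\<close>

lemma nontangential_limit_closed:
  fixes F :: "complex \<Rightarrow> 'g::real_normed_vector \<Rightarrow>\<^sub>L 'h::banach"
  assumes \<zeta>: "\<zeta> \<in> sphere 0 1" and C: "\<And>z. z \<in> ball 0 1 \<Longrightarrow> norm (F z) \<le> C"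
    and d: "\<And>n. nontangential_limit (\<lambda>z. blinfun_apply (F z) (d n)) \<zeta> (l n)" and u: "d \<longlonglongrightarrow> u"
  shows "\<exists>l. nontangential_limit (\<lambda>z. blinfun_apply (F z) u) \<zeta> l"
proof -
  have C0: "0 \<le> C" by (rule order_trans[OF norm_ge_zero C[of 0]]) simp
  have Fle: "norm (blinfun_apply (F z) v) \<le> C * norm v" if "z \<in> ball 0 1" for z v
    by (rule order_trans[OF norm_blinfun mult_right_mono[OF C[OF that] norm_ge_zero]])
  have lle: "norm (l m - l n) \<le> C * norm (d m - d n)" for m n
    by (rule norm_nontangential_limit_le[OF nontangential_limit_diff[OF d d] \<zeta>])
      (simp add: Fle flip: blinfun.diff_right)
  have "Cauchy l"
  proof (rule CauchyI)
    fix e :: real assume e: "e > 0"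
    then obtain M where M: "\<forall>m\<ge>M. \<forall>n\<ge>M. norm (d m - d n) < e / (C + 1)"
      using CauchyD[OF LIMSEQ_imp_Cauchy[OF u], of "e / (C + 1)"] C0 by auto
    have "norm (l m - l n) < e" if "m \<ge> M" "n \<ge> M" for m n
    proof -
      have "norm (d m - d n) < e / (C + 1)" using M that by blast
      then have "(C + 1) * norm (d m - d n) < e" using C0 by (simp add: field_simps)
      moreover have "C * norm (d m - d n) \<le> (C + 1) * norm (d m - d n)" by (intro mult_right_mono) auto
      ultimately show ?thesis using lle[of m n] by linarith
    qed
    then show "\<exists>M. \<forall>m\<ge>M. \<forall>n\<ge>M. norm (l m - l n) < e" by blast
  qed
  then obtain L where L: "l \<longlonglongrightarrow> L" by (auto simp: Cauchy_convergent_iff convergent_def)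
  have "nontangential_limit (\<lambda>z. blinfun_apply (F z) u) \<zeta> L"
    unfolding nontangential_limit_def
  proof (intro allI impI)
    fix a :: real assume a: "1 < a"
    show "((\<lambda>z. blinfun_apply (F z) u) \<longlongrightarrow> L) (at \<zeta> within stolz_region a \<zeta>)"
    proof (rule swap_uniform_limit[where F=sequentially and f="\<lambda>n z. blinfun_apply (F z) (d n)", OF _ L])
      show "\<forall>\<^sub>F n in sequentially. ((\<lambda>z. blinfun_apply (F z) (d n)) \<longlongrightarrow> l n) (at \<zeta> within stolz_region a \<zeta>)"
        using d a by (simp add: nontangential_limit_def)
      show "uniform_limit (stolz_region a \<zeta>) (\<lambda>n z. blinfun_apply (F z) (d n)) (\<lambda>z. blinfun_apply (F z) u) sequentially"
      proof (rule uniform_limitI)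
        fix e :: real assume e: "e > 0"
        have "\<forall>\<^sub>F n in sequentially. dist (d n) u < e / (C + 1)" using e C0 by (intro tendstoD[OF u]) simp
        then show "\<forall>\<^sub>F n in sequentially. \<forall>z\<in>stolz_region a \<zeta>. dist (blinfun_apply (F z) (d n)) (blinfun_apply (F z) u) < e"
        proof eventually_elim
          case (elim n)
          show ?case
          proof
            fix z assume "z \<in> stolz_region a \<zeta>"
            then have "norm (blinfun_apply (F z) (d n - u)) \<le> C * norm (d n - u)"
              by (intro Fle) (simp add: stolz_region_def)
            also have "\<dots> \<le> (C + 1) * norm (d n - u)" by (intro mult_right_mono) auto
            also have "\<dots> < e" using elim C0 by (simp add: dist_norm field_simps)
            finally show "dist (blinfun_apply (F z) (d n)) (blinfun_apply (F z) u) < e"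
              by (simp add: dist_norm blinfun.diff_right)
          qed
        qed
      qed
    qed simp
  qed
  then show ?thesis by blast
qed

lemma analytic_disk_apply:
  fixes F :: "complex \<Rightarrow> 'g::complex_inner \<Rightarrow>\<^sub>L 'g"
  assumes F: "analytic_op F" and f: "analytic_disk f"
  shows "analytic_disk (\<lambda>z. blinfun_apply (F z) (f z))"
  unfolding analytic_disk_def
proof
  fix z :: complex assume z: "z \<in> ball 0 1"
  obtain D where D: "(F has_derivative (\<lambda>h. h *\<^sub>C D)) (at z)"
    using F z unfolding analytic_op_def analytic_disk_def by blast
  obtain d where d: "(f has_derivative (\<lambda>h. h *\<^sub>C d)) (at z)"
    using f z unfolding analytic_disk_def by blast
  have Fc: "F z \<in> cbounded_ops" using F z by (simp add: analytic_op_def)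
  have "((\<lambda>z. blinfun_apply (F z) (f z)) has_derivative
      (\<lambda>h. blinfun_apply (F z) (h *\<^sub>C d) + blinfun_apply (h *\<^sub>C D) (f z))) (at z)"
    by (rule bounded_bilinear.FDERIV[OF bounded_bilinear_blinfun_apply D d])
  then have "((\<lambda>z. blinfun_apply (F z) (f z)) has_derivative
      (\<lambda>h. h *\<^sub>C (blinfun_apply (F z) d + blinfun_apply D (f z)))) (at z)"
    by (simp add: cbounded_opsD[OF Fc] blinfun_apply_scaleC scaleC_add_right)
  then show "\<exists>d. ((\<lambda>z. blinfun_apply (F z) (f z)) has_derivative (\<lambda>h. h *\<^sub>C d)) (at z)" by blast
qed

lemma analytic_disk_const: "analytic_disk (\<lambda>z. u)"
proof -
  have "((\<lambda>z. u) has_derivative (\<lambda>h::complex. h *\<^sub>C 0)) (at z)" for z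
    by (simp add: scaleC.zero_right)
  then show ?thesis unfolding analytic_disk_def by blast
qed

lemma analytic_disk_diff:
  assumes "analytic_disk f" "analytic_disk g"
  shows "analytic_disk (\<lambda>z. f z - g z)"
  unfolding analytic_disk_def
proof
  fix z :: complex assume z: "z \<in> ball 0 1"
  obtain d e where "(f has_derivative (\<lambda>h. h *\<^sub>C d)) (at z)" "(g has_derivative (\<lambda>h. h *\<^sub>C e)) (at z)"
    using assms z unfolding analytic_disk_def by blast
  from has_derivative_diff[OF this]
  have "((\<lambda>z. f z - g z) has_derivative (\<lambda>h. h *\<^sub>C (d - e))) (at z)" by (simp add: scaleC.diff_right)
  then show "\<exists>d. ((\<lambda>z. f z - g z) has_derivative (\<lambda>h. h *\<^sub>C d)) (at z)" by blast
qed

lemma analytic_disk_scaleC: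
  assumes "analytic_disk f" "analytic_disk g"
  shows "analytic_disk (\<lambda>z. f z *\<^sub>C g z)"
  unfolding analytic_disk_def
proof
  fix z :: complex assume z: "z \<in> ball 0 1"
  obtain d e where "(f has_derivative (\<lambda>h. h *\<^sub>C d)) (at z)" "(g has_derivative (\<lambda>h. h *\<^sub>C e)) (at z)"
    using assms z unfolding analytic_disk_def by blast
  from bounded_bilinear.FDERIV[OF bounded_bilinear_scaleC this]
  have "((\<lambda>z. f z *\<^sub>C g z) has_derivative (\<lambda>h. h *\<^sub>C (f z *\<^sub>C e + d *\<^sub>C g z))) (at z)"
    by (simp add: scaleC_scaleC scaleC_add_right scaleC_complex_def mult.commute)
  then show "\<exists>d. ((\<lambda>z. f z *\<^sub>C g z) has_derivative (\<lambda>h. h *\<^sub>C d)) (at z)" by blast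
qed

lemma H2_bound:
  fixes f g :: "complex \<Rightarrow> 'g::{chilbert_space, second_countable_topology}"
  assumes f: "f \<in> H2" and g: "analytic_disk g" and K: "\<And>z. z \<in> ball 0 1 \<Longrightarrow> norm (g z) \<le> K * norm (f z)"
  shows "g \<in> H2"
proof -
  have af: "analytic_disk f" using f by (simp add: H2_def)
  obtain C where C: "\<And>r. r \<in> {0..<1::real} \<Longrightarrow> (\<integral>\<zeta>. (norm (f (of_real r * \<zeta>)))\<^sup>2 \<partial>\<sigma>) \<le> C"
    using f unfolding H2_def by blast
  have "(\<integral>\<zeta>. (norm (g (of_real r * \<zeta>)))\<^sup>2 \<partial>\<sigma>) \<le> K\<^sup>2 * C" if r: "r \<in> {0..<1::real}" for r
  proof -
    have "(\<integral>\<zeta>. (norm (g (of_real r * \<zeta>)))\<^sup>2 \<partial>\<sigma>) \<le> (\<integral>\<zeta>. K\<^sup>2 * (norm (f (of_real r * \<zeta>)))\<^sup>2 \<partial>\<sigma>)"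
    proof (rule integral_mono)
      have cf: "continuous_on (sphere 0 1) (\<lambda>\<zeta>. f (of_real r * \<zeta>))"
        and cg: "continuous_on (sphere 0 1) (\<lambda>\<zeta>. g (of_real r * \<zeta>))"
        using r by (auto intro!: circle_continuous af g)
      show "integrable \<sigma> (\<lambda>\<zeta>. (norm (g (of_real r * \<zeta>)))\<^sup>2)"
        by (intro integrable_sigma_continuous continuous_on_power continuous_on_norm cg)
      show "integrable \<sigma> (\<lambda>\<zeta>. K\<^sup>2 * (norm (f (of_real r * \<zeta>)))\<^sup>2)"
        by (intro integrable_sigma_continuous continuous_on_mult continuous_on_const continuous_on_power continuous_on_norm cf)
      fix \<zeta> assume "\<zeta> \<in> space \<sigma>"
      then have "norm (g (of_real r * \<zeta>)) \<le> K * norm (f (of_real r * \<zeta>))"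
        using r by (intro K) (simp add: norm_mult)
      then have "(norm (g (of_real r * \<zeta>)))\<^sup>2 \<le> (K * norm (f (of_real r * \<zeta>)))\<^sup>2" by (intro power_mono) auto
      then show "(norm (g (of_real r * \<zeta>)))\<^sup>2 \<le> K\<^sup>2 * (norm (f (of_real r * \<zeta>)))\<^sup>2" by (simp add: power_mult_distrib)
    qed
    also have "\<dots> \<le> K\<^sup>2 * C" using C[OF r] by (simp add: mult_left_mono)
    finally show ?thesis .
  qed
  then show ?thesis using g unfolding H2_def by blast
qed

lemma H2_const:
  fixes u :: "'g::{chilbert_space, second_countable_topology}"
  shows "(\<lambda>z. u) \<in> H2"
  unfolding H2_def using analytic_disk_const by auto

lemma H2_bounded:
  fixes f :: "complex \<Rightarrow> 'g::{chilbert_space, second_countable_topology}"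
  assumes f: "analytic_disk f" and C: "\<And>z. z \<in> ball 0 1 \<Longrightarrow> norm (f z) \<le> C"
  shows "f \<in> H2"
proof -
  have "(\<integral>\<zeta>. (norm (f (of_real r * \<zeta>)))\<^sup>2 \<partial>\<sigma>) \<le> C\<^sup>2" if r: "r \<in> {0..<1::real}" for r
  proof -
    have "(\<integral>\<zeta>. (norm (f (of_real r * \<zeta>)))\<^sup>2 \<partial>\<sigma>) \<le> (\<integral>\<zeta>. C\<^sup>2 \<partial>\<sigma>)"
    proof (rule integral_mono)
      show "integrable \<sigma> (\<lambda>\<zeta>. (norm (f (of_real r * \<zeta>)))\<^sup>2)"
        using r by (intro integrable_sigma_continuous continuous_on_power continuous_on_norm circle_continuous f) auto
      show "(norm (f (of_real r * \<zeta>)))\<^sup>2 \<le> C\<^sup>2" if "\<zeta> \<in> space \<sigma>" for \<zeta>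
        using that r by (intro power_mono C) (auto simp: norm_mult)
    qed simp
    then show ?thesis by simp
  qed
  then show ?thesis using f unfolding H2_def by blast
qed

lemma H2_diff:
  fixes f g :: "complex \<Rightarrow> 'g::{chilbert_space, second_countable_topology}"
  assumes f: "f \<in> H2" and g: "g \<in> H2"
  shows "(\<lambda>z. f z - g z) \<in> H2"
proof -
  have a: "analytic_disk f" "analytic_disk g" using f g by (auto simp: H2_def)
  obtain C D where C: "\<And>r. r \<in> {0..<1::real} \<Longrightarrow> (\<integral>\<zeta>. (norm (f (of_real r * \<zeta>)))\<^sup>2 \<partial>\<sigma>) \<le> C"
    and D: "\<And>r. r \<in> {0..<1::real} \<Longrightarrow> (\<integral>\<zeta>. (norm (g (of_real r * \<zeta>)))\<^sup>2 \<partial>\<sigma>) \<le> D"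
    using f g unfolding H2_def by blast
  have "(\<integral>\<zeta>. (norm (f (of_real r * \<zeta>) - g (of_real r * \<zeta>)))\<^sup>2 \<partial>\<sigma>) \<le> 2 * C + 2 * D" if r: "r \<in> {0..<1::real}" for r
  proof -
    have cf: "continuous_on (sphere 0 1) (\<lambda>\<zeta>. f (of_real r * \<zeta>))"
      and cg: "continuous_on (sphere 0 1) (\<lambda>\<zeta>. g (of_real r * \<zeta>))"
      using r by (auto intro!: circle_continuous a)
    have i: "integrable \<sigma> (\<lambda>\<zeta>. (norm (f (of_real r * \<zeta>)))\<^sup>2)" "integrable \<sigma> (\<lambda>\<zeta>. (norm (g (of_real r * \<zeta>)))\<^sup>2)"
      by (intro integrable_sigma_continuous continuous_on_power continuous_on_norm cf cg)+
    have "(\<integral>\<zeta>. (norm (f (of_real r * \<zeta>) - g (of_real r * \<zeta>)))\<^sup>2 \<partial>\<sigma>)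
        \<le> (\<integral>\<zeta>. 2 * (norm (f (of_real r * \<zeta>)))\<^sup>2 + 2 * (norm (g (of_real r * \<zeta>)))\<^sup>2 \<partial>\<sigma>)"
    proof (rule integral_mono)
      show "integrable \<sigma> (\<lambda>\<zeta>. (norm (f (of_real r * \<zeta>) - g (of_real r * \<zeta>)))\<^sup>2)"
        by (intro integrable_sigma_continuous continuous_on_power continuous_on_norm continuous_on_diff cf cg)
    qed (use i norm_diff_sq_le in auto)
    also have "\<dots> \<le> 2 * C + 2 * D" using i C[OF r] D[OF r] by simp
    finally show ?thesis .
  qed
  then show ?thesis using analytic_disk_diff[OF a] unfolding H2_def by blast
qed

lemma H2_boundary:
  fixes f :: "complex \<Rightarrow> 'g::{chilbert_space, second_countable_topology}"
  assumes f: "f \<in> H2"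
  obtains g where "sq_integrable g" "AE \<zeta> in \<sigma>. nontangential_limit f \<zeta> (g \<zeta>)"
    "\<And>k v. 0 < k \<Longrightarrow> (\<integral>\<zeta>. \<zeta> powi k * cinner (g \<zeta>) v \<partial>\<sigma>) = 0"
    "(\<integral>\<zeta>. (norm (g \<zeta>))\<^sup>2 \<partial>\<sigma>) \<le> (H2_norm f)\<^sup>2"
proof -
  obtain a where a: "summable (\<lambda>n. (norm (a n))\<^sup>2)" "\<And>z. z \<in> ball 0 1 \<Longrightarrow> f z = hardy a z"
    "(\<Sum>n. (norm (a n))\<^sup>2) \<le> (H2_norm f)\<^sup>2" by (rule H2_expansion[OF f]) blast
  show ?thesis
  proof (rule that[of "bdry a"])
    show "AE \<zeta> in \<sigma>. nontangential_limit f \<zeta> (bdry a \<zeta>)"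
      using fatou[OF a(1)] by eventually_elim (rule nontangential_limit_cong, auto simp: a(2))
  qed (use sq_integrable_bdry[OF a(1)] fourier_bdry[OF a(1)] integral_norm_bdry_le[OF a(1)] a(3) in auto)
qed

text \<open>By Fatou's theorem the limits exist almost everywhere for each vector of a countable dense set.
  Outside one null set they then exist for all vectors and define a bounded operator. Elsewhere the
  boundary function is set to \<open>0\<close>, so that its properties hold at every point.\<close>

theorem Hinf_op_boundary_exists:
  fixes F :: "complex \<Rightarrow> 'g::{chilbert_space, second_countable_topology} \<Rightarrow>\<^sub>L 'g"
  assumes F: "F \<in> Hinf_op"
  obtains \<Phi> C where "has_boundary_op F \<Phi>" "\<And>u. (\<lambda>\<zeta>. blinfun_apply (\<Phi> \<zeta>) u) \<in> borel_measurable \<sigma>"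
    "\<And>\<zeta>. norm (\<Phi> \<zeta>) \<le> C" "\<And>\<zeta>. \<Phi> \<zeta> \<in> cbounded_ops"
proof -
  obtain C where C: "\<And>z. z \<in> ball 0 1 \<Longrightarrow> norm (F z) \<le> C" using F unfolding Hinf_op_def by blast
  have aF: "analytic_op F" using F by (simp add: Hinf_op_def)
  have C0: "0 \<le> C" by (rule order_trans[OF norm_ge_zero C[of 0]]) simp
  have Fle: "norm (blinfun_apply (F z) v) \<le> C * norm v" if "z \<in> ball 0 1" for z v
    by (rule order_trans[OF norm_blinfun mult_right_mono[OF C[OF that] norm_ge_zero]])
  have "\<exists>g. g \<in> borel_measurable \<sigma> \<and> (AE \<zeta> in \<sigma>. nontangential_limit (\<lambda>z. blinfun_apply (F z) u) \<zeta> (g \<zeta>))" for u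
  proof -
    have "(\<lambda>z. blinfun_apply (F z) u) \<in> H2"
      by (rule H2_bounded[OF analytic_disk_apply[OF aF analytic_disk_const] Fle])
    then show ?thesis by (rule H2_boundary) (auto intro: sq_integrable_measurable)
  qed
  then obtain g where g: "\<And>u. g u \<in> borel_measurable \<sigma>"
    "\<And>u. AE \<zeta> in \<sigma>. nontangential_limit (\<lambda>z. blinfun_apply (F z) u) \<zeta> (g u \<zeta>)" by metis
  obtain d :: "nat \<Rightarrow> 'g" where d: "\<And>S. open S \<Longrightarrow> S \<noteq> {} \<Longrightarrow> \<exists>n. d n \<in> S"
    using dense_sequence_exists by metis
  have approx: "\<exists>s. (\<forall>n. s n \<in> range d) \<and> s \<longlonglongrightarrow> u" for u
  proof -
    have "\<exists>n. d n \<in> ball u (inverse (real (Suc k)))" for k by (rule d) auto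
    then obtain m where m: "\<And>k. d (m k) \<in> ball u (inverse (real (Suc k)))" by metis
    have "(\<lambda>k. d (m k)) \<longlonglongrightarrow> u"
    proof (rule metric_tendsto_imp_tendsto[OF LIMSEQ_inverse_real_of_nat])
      show "\<forall>\<^sub>F k in sequentially. dist (d (m k)) u \<le> dist (inverse (real (Suc k))) 0"
        using m by (auto simp: dist_commute less_imp_le)
    qed
    then show ?thesis by (intro exI[of _ "\<lambda>k. d (m k)"] conjI) auto
  qed
  define good where "good \<zeta> \<longleftrightarrow> \<zeta> \<in> sphere 0 1 \<and> (\<forall>u. \<exists>l. nontangential_limit (\<lambda>z. blinfun_apply (F z) u) \<zeta> l)" for \<zeta>
  have AEgood: "AE \<zeta> in \<sigma>. good \<zeta>"
  proof -
    have "AE \<zeta> in \<sigma>. \<forall>n. nontangential_limit (\<lambda>z. blinfun_apply (F z) (d n)) \<zeta> (g (d n) \<zeta>)"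
      using g(2) by (simp add: AE_all_countable)
    moreover have "AE \<zeta> in \<sigma>. \<zeta> \<in> sphere 0 1" by (rule AE_sphere)
    ultimately show ?thesis
    proof eventually_elim
      case (elim \<zeta>)
      have "\<exists>l. nontangential_limit (\<lambda>z. blinfun_apply (F z) u) \<zeta> l" for u
      proof -
        obtain s where s: "\<forall>n. s n \<in> range d" "s \<longlonglongrightarrow> u" using approx[of u] by (elim exE conjE)
        have nt: "nontangential_limit (\<lambda>z. blinfun_apply (F z) (s n)) \<zeta> (g (s n) \<zeta>)" for n
        proof -
          obtain m where "s n = d m" using s(1) by blast
          then show ?thesis using elim(1) by simp
        qed
        show ?thesis by (rule nontangential_limit_closed[OF elim(2) C nt s(2)])
      qed
      then show ?case using elim by (simp add: good_def)
    qed
  qed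
  define L where "L \<zeta> u = (SOME l. nontangential_limit (\<lambda>z. blinfun_apply (F z) u) \<zeta> l)" for \<zeta> u
  have L: "nontangential_limit (\<lambda>z. blinfun_apply (F z) u) \<zeta> (L \<zeta> u)" if "good \<zeta>" for \<zeta> u
    using that unfolding good_def L_def by (metis someI_ex)
  have Lu: "L \<zeta> u = l" if "good \<zeta>" "nontangential_limit (\<lambda>z. blinfun_apply (F z) u) \<zeta> l" for \<zeta> u l
    using nontangential_limit_unique[OF L[OF that(1)] that(2)] that(1) by (simp add: good_def)
  have Lnorm: "norm (L \<zeta> u) \<le> C * norm u" if "good \<zeta>" for \<zeta> u
    using that by (intro norm_nontangential_limit_le[OF L[OF that]] Fle) (simp_all add: good_def)
  have LC: "L \<zeta> (c *\<^sub>C u) = c *\<^sub>C L \<zeta> u" if "good \<zeta>" for \<zeta> c u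
  proof (rule Lu[OF that])
    have "F z \<in> cbounded_ops" if "z \<in> ball 0 1" for z using aF that by (simp add: analytic_op_def)
    then show "nontangential_limit (\<lambda>z. blinfun_apply (F z) (c *\<^sub>C u)) \<zeta> (c *\<^sub>C L \<zeta> u)"
      by (intro nontangential_limit_cong[OF nontangential_limit_scaleC[OF nontangential_limit_const L[OF that]]])
        (simp add: cbounded_opsD)
  qed
  have Lbl: "bounded_linear (L \<zeta>)" if "good \<zeta>" for \<zeta>
  proof (rule bounded_linear_intro[where K=C])
    show "L \<zeta> (u + v) = L \<zeta> u + L \<zeta> v" for u v
    proof (rule Lu[OF that])
      have "nontangential_limit (\<lambda>z. blinfun_apply (F z) u - blinfun_apply (F z) (- v)) \<zeta> (L \<zeta> u - L \<zeta> (- v))"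
        by (rule nontangential_limit_diff[OF L[OF that] L[OF that]])
      moreover have "L \<zeta> (- v) = - L \<zeta> v" using LC[OF that, of "- 1" v] by (simp add: scaleC.minus_left)
      ultimately show "nontangential_limit (\<lambda>z. blinfun_apply (F z) (u + v)) \<zeta> (L \<zeta> u + L \<zeta> v)"
        by (simp add: blinfun.minus_right blinfun.add_right)
    qed
    show "L \<zeta> (r *\<^sub>R u) = r *\<^sub>R L \<zeta> u" for r u by (simp add: scaleR_scaleC LC[OF that])
    show "norm (L \<zeta> u) \<le> norm u * C" for u using Lnorm[OF that] by (simp add: mult.commute)
  qed
  define \<Phi> where "\<Phi> \<zeta> = (if good \<zeta> then Blinfun (L \<zeta>) else 0)" for \<zeta>
  have \<Phi>: "blinfun_apply (\<Phi> \<zeta>) u = L \<zeta> u" if "good \<zeta>" for \<zeta> u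
    using that by (simp add: \<Phi>_def bounded_linear_Blinfun_apply[OF Lbl])
  show ?thesis
  proof (rule that[of \<Phi> C])
    show "has_boundary_op F \<Phi>"
      unfolding has_boundary_op_def using AEgood by eventually_elim (simp add: \<Phi> L)
    show "(\<lambda>\<zeta>. blinfun_apply (\<Phi> \<zeta>) u) \<in> borel_measurable \<sigma>" for u
    proof (rule borel_measurable_sigma_AE[OF g(1)[of u]])
      show "AE \<zeta> in \<sigma>. g u \<zeta> = blinfun_apply (\<Phi> \<zeta>) u"
        using AEgood g(2)[of u] by eventually_elim (simp add: \<Phi> Lu)
    qed
    show "norm (\<Phi> \<zeta>) \<le> C" for \<zeta>
      by (cases "good \<zeta>") (auto intro!: norm_blinfun_bound C0 Lnorm simp: \<Phi>, simp add: \<Phi>_def C0)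
    show "\<Phi> \<zeta> \<in> cbounded_ops" for \<zeta>
    proof (cases "good \<zeta>")
      case True
      then show ?thesis by (simp add: cbounded_ops_def \<Phi> LC)
    qed (simp add: \<Phi>_def cbounded_ops_def scaleC.zero_right)
  qed
qed

theorem Hinf_op_from_coefficients:
  fixes A :: "nat \<Rightarrow> 'g \<Rightarrow> 'g::{chilbert_space, second_countable_topology}"
  assumes bl: "\<And>n. bounded_linear (A n)" and AC: "\<And>n c u. A n (c *\<^sub>C u) = c *\<^sub>C A n u"
    and le: "\<And>n u. norm (A n u) \<le> C * norm u" and C: "0 \<le> C"
    and bound: "\<And>z u. z \<in> ball 0 1 \<Longrightarrow> norm (hardy (\<lambda>n. A n u) z) \<le> C * norm u"
  obtains G where "G \<in> Hinf_op" "\<And>z u. z \<in> ball 0 1 \<Longrightarrow> blinfun_apply (G z) u = hardy (\<lambda>n. A n u) z"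
proof -
  define B where "B n = Blinfun (A n)" for n
  have B: "blinfun_apply (B n) u = A n u" for n u by (simp add: B_def bounded_linear_Blinfun_apply[OF bl])
  have nB: "norm (B n) \<le> C" for n by (rule norm_blinfun_bound[OF C]) (simp add: B le)
  define G where "G z = (\<Sum>n. z ^ n *\<^sub>C B n)" for z :: complex
  have G: "blinfun_apply (G z) u = hardy (\<lambda>n. A n u) z" if "z \<in> ball 0 1" for z u
  proof -
    have s: "summable (\<lambda>n. z ^ n *\<^sub>C B n)" by (rule analytic_disk_power_series(2)[OF nB that])
    have "blinfun_apply (G z) u = (\<Sum>n. blinfun_apply (z ^ n *\<^sub>C B n) u)"
      unfolding G_def by (rule bounded_linear.suminf[OF blinfun.bounded_linear_left s])
    then show ?thesis by (simp add: blinfun_apply_scaleC B hardy_def)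
  qed
  show ?thesis
  proof (rule that[OF _ G])
    have "G z \<in> cbounded_ops" if z: "z \<in> ball 0 1" for z
    proof -
      have "hardy (\<lambda>n. A n (c *\<^sub>C u)) z = c *\<^sub>C hardy (\<lambda>n. A n u) z" for c u
      proof -
        have s: "(\<lambda>N. psum (\<lambda>n. A n v) N z) \<longlonglongrightarrow> hardy (\<lambda>n. A n v) z" for v
          by (rule psum_tendsto_hardy[OF le z])
        have "psum (\<lambda>n. A n (c *\<^sub>C u)) N z = c *\<^sub>C psum (\<lambda>n. A n u) N z" for N
          by (simp add: psum_def AC scaleC.sum_right scaleC_scaleC mult.commute)
        then have "(\<lambda>N. c *\<^sub>C psum (\<lambda>n. A n u) N z) \<longlonglongrightarrow> hardy (\<lambda>n. A n (c *\<^sub>C u)) z" using s[of "c *\<^sub>C u"] by simp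
        moreover have "(\<lambda>N. c *\<^sub>C psum (\<lambda>n. A n u) N z) \<longlonglongrightarrow> c *\<^sub>C hardy (\<lambda>n. A n u) z"
          by (intro scaleC.tendsto tendsto_const s)
        ultimately show ?thesis by (rule LIMSEQ_unique)
      qed
      then show ?thesis by (simp add: cbounded_ops_def G[OF z])
    qed
    moreover have "analytic_disk G" unfolding G_def[abs_def] by (rule analytic_disk_power_series(1)[OF nB])
    moreover have "norm (G z) \<le> C" if "z \<in> ball 0 1" for z
      by (rule norm_blinfun_bound[OF C]) (simp add: G[OF that] bound[OF that])
    ultimately show "G \<in> Hinf_op" unfolding Hinf_op_def analytic_op_def by blast
  qed
qed

section \<open>Scalar outer functions are analytic\<close>

text \<open>The kernel \<open>(\<zeta> + z) / (\<zeta> - z)\<close> is \<open>1 + 2 \<Sum>\<^sub>n (z / \<zeta>)\<^sup>n\<close> with \<open>n\<close> from \<open>1\<close>, so the exponent is a power series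
  whose coefficients are bounded by twice the integral of \<open>\<bar>k\<bar>\<close>.\<close>

lemma scalar_outer_analytic:
  assumes "scalar_outer \<phi>"
  shows "analytic_disk \<phi>" "z \<in> ball 0 1 \<Longrightarrow> \<phi> z \<noteq> 0"
proof -
  obtain \<alpha> k where \<alpha>: "cmod \<alpha> = 1" and k: "integrable \<sigma> (k :: complex \<Rightarrow> real)"
    and \<phi>: "\<forall>z\<in>ball 0 1. \<phi> z = \<alpha> * exp (\<integral>\<zeta>. (\<zeta> + z) / (\<zeta> - z) * of_real (k \<zeta>) \<partial>\<sigma>)"
    using assms unfolding scalar_outer_def by blast
  show "z \<in> ball 0 1 \<Longrightarrow> \<phi> z \<noteq> 0" using \<phi> \<alpha> by auto
  define I where "I = (\<integral>\<zeta>. \<bar>k \<zeta>\<bar> \<partial>\<sigma>)"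
  have I0: "0 \<le> I" by (simp add: I_def)
  have ik: "integrable \<sigma> (\<lambda>\<zeta>. \<zeta> powi m * complex_of_real (k \<zeta>))" for m
    by (intro integrable_mult_continuous continuous_on_sphere_powi) (use k in simp)
  define b where "b n = (if n = 0 then 1 else 2) * (\<integral>\<zeta>. \<zeta> powi (- int n) * complex_of_real (k \<zeta>) \<partial>\<sigma>)" for n :: nat
  have nb: "norm (b n) \<le> 2 * I" for n
  proof -
    have "cmod (\<integral>\<zeta>. \<zeta> powi (- int n) * complex_of_real (k \<zeta>) \<partial>\<sigma>)
        \<le> (\<integral>\<zeta>. cmod (\<zeta> powi (- int n) * complex_of_real (k \<zeta>)) \<partial>\<sigma>)" by (rule integral_norm_bound)
    also have "\<dots> = I" unfolding I_def by (intro Bochner_Integration.integral_cong) (auto simp: norm_mult)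
    finally have le: "cmod (\<integral>\<zeta>. \<zeta> powi (- int n) * complex_of_real (k \<zeta>) \<partial>\<sigma>) \<le> I" .
    show ?thesis
      unfolding b_def norm_mult by (rule mult_mono[OF _ le]) auto
  qed
  have rep: "(\<integral>\<zeta>. (\<zeta> + z) / (\<zeta> - z) * of_real (k \<zeta>) \<partial>\<sigma>) = (\<Sum>n. z ^ n *\<^sub>C b n)" if z: "z \<in> ball 0 1" for z
  proof -
    define f where "f n \<zeta> = (if n = 0 then 1 else 2) * z ^ n * (\<zeta> powi (- int n) * complex_of_real (k \<zeta>))" for n :: nat and \<zeta>
    have "(\<lambda>n. \<integral>\<zeta>. f n \<zeta> \<partial>\<sigma>) sums (\<integral>\<zeta>. (\<Sum>n. f n \<zeta>) \<partial>\<sigma>)"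
    proof (rule sums_integral)
      show "integrable \<sigma> (f n)" for n unfolding f_def by (intro integrable_mult_right ik)
      have nf: "norm (f n \<zeta>) \<le> 2 * \<bar>k \<zeta>\<bar> * cmod z ^ n" if "\<zeta> \<in> sphere 0 1" for n \<zeta>
        using that by (auto simp: f_def norm_mult norm_power mult_ac intro!: mult_right_mono)
      show "AE \<zeta> in \<sigma>. summable (\<lambda>n. norm (f n \<zeta>))"
      proof (rule AE_I2)
        fix \<zeta> assume \<zeta>: "\<zeta> \<in> space \<sigma>"
        show "summable (\<lambda>n. norm (f n \<zeta>))"
        proof (rule summable_comparison_test')
          show "summable (\<lambda>n. 2 * \<bar>k \<zeta>\<bar> * cmod z ^ n)" using z by (intro summable_mult summable_geometric) auto
          show "norm (norm (f n \<zeta>)) \<le> 2 * \<bar>k \<zeta>\<bar> * cmod z ^ n" for n using nf[of \<zeta> n] \<zeta> by simp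
        qed
      qed
      show "summable (\<lambda>n. \<integral>\<zeta>. norm (f n \<zeta>) \<partial>\<sigma>)"
      proof (rule summable_comparison_test')
        show "summable (\<lambda>n. 2 * I * cmod z ^ n)" using z by (intro summable_mult summable_geometric) auto
        fix n
        have "(\<integral>\<zeta>. norm (f n \<zeta>) \<partial>\<sigma>) \<le> (\<integral>\<zeta>. 2 * \<bar>k \<zeta>\<bar> * cmod z ^ n \<partial>\<sigma>)"
          using nf k unfolding f_def by (intro integral_mono integrable_norm integrable_mult_right ik integrable_mult_left) auto
        also have "\<dots> = 2 * I * cmod z ^ n" by (simp add: I_def)
        finally show "norm (\<integral>\<zeta>. norm (f n \<zeta>) \<partial>\<sigma>) \<le> 2 * I * cmod z ^ n" by simp
      qed
    qed
    moreover have "(\<integral>\<zeta>. f n \<zeta> \<partial>\<sigma>) = z ^ n *\<^sub>C b n" for n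
      by (simp add: f_def b_def scaleC_complex_def mult_ac)
    moreover have "(\<integral>\<zeta>. (\<Sum>n. f n \<zeta>) \<partial>\<sigma>) = (\<integral>\<zeta>. (\<zeta> + z) / (\<zeta> - z) * of_real (k \<zeta>) \<partial>\<sigma>)"
    proof (intro Bochner_Integration.integral_cong refl)
      fix \<zeta> assume "\<zeta> \<in> space \<sigma>"
      then have \<zeta>: "cmod \<zeta> = 1" "\<zeta> \<noteq> 0" by auto
      have w: "cmod (z / \<zeta>) < 1" using z \<zeta> by (simp add: norm_divide)
      have zn: "\<zeta> - z \<noteq> 0" using z \<zeta> by auto
      have "(\<lambda>n. 2 * (z / \<zeta>) ^ n) sums (2 * (1 / (1 - z / \<zeta>)))" by (intro sums_mult geometric_sums w)
      from sums_diff[OF this sums_single[of 0 "\<lambda>_. 1"]]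
      have "(\<lambda>n. 2 * (z / \<zeta>) ^ n - (if n = 0 then 1 else 0)) sums (2 * (1 / (1 - z / \<zeta>)) - 1)" by simp
      then have "(\<lambda>n. (2 * (z / \<zeta>) ^ n - (if n = 0 then 1 else 0)) * complex_of_real (k \<zeta>))
          sums ((2 * (1 / (1 - z / \<zeta>)) - 1) * of_real (k \<zeta>))" by (rule sums_mult2)
      moreover have "(2 * (z / \<zeta>) ^ n - (if n = 0 then 1 else 0)) * complex_of_real (k \<zeta>) = f n \<zeta>" for n
        by (simp add: f_def power_divide power_int_minus divide_inverse power_inverse power_mult_distrib mult_ac)
      moreover have "2 * (1 / (1 - z / \<zeta>)) - 1 = (\<zeta> + z) / (\<zeta> - z)"
        using \<zeta> zn by (simp add: field_simps)
      ultimately show "(\<Sum>n. f n \<zeta>) = (\<zeta> + z) / (\<zeta> - z) * of_real (k \<zeta>)" by (simp add: sums_iff)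
    qed
    ultimately show ?thesis by (simp add: sums_iff)
  qed
  show "analytic_disk \<phi>"
    unfolding analytic_disk_def
  proof
    fix z :: complex assume z: "z \<in> ball 0 1"
    obtain d where "((\<lambda>z. \<Sum>n. z ^ n *\<^sub>C b n) has_derivative (\<lambda>h. h *\<^sub>C d)) (at z)"
      using analytic_disk_power_series(1)[where a=b, OF nb] z unfolding analytic_disk_def by blast
    then have "((\<lambda>z. \<Sum>n. z ^ n *\<^sub>C b n) has_field_derivative d) (at z)"
      by (simp add: has_field_derivative_def scaleC_complex_def mult_commute_abs)
    then have "((\<lambda>z. \<alpha> * exp (\<Sum>n. z ^ n *\<^sub>C b n)) has_field_derivative \<alpha> * (exp (\<Sum>n. z ^ n *\<^sub>C b n) * d)) (at z)"
      by (intro DERIV_cmult DERIV_fun_exp)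
    then have "((\<lambda>z. \<alpha> * exp (\<Sum>n. z ^ n *\<^sub>C b n)) has_derivative (\<lambda>h. h *\<^sub>C (\<alpha> * (exp (\<Sum>n. z ^ n *\<^sub>C b n) * d)))) (at z)"
      by (simp add: has_field_derivative_def scaleC_complex_def mult_commute_abs)
    then have "(\<phi> has_derivative (\<lambda>h. h *\<^sub>C (\<alpha> * (exp (\<Sum>n. z ^ n *\<^sub>C b n) * d)))) (at z)"
      by (rule has_derivative_transform_within_open[OF _ open_ball z]) (use \<phi> rep in simp)
    then show "\<exists>d. (\<phi> has_derivative (\<lambda>h. h *\<^sub>C d)) (at z)" by blast
  qed
qed

lemma bounded_scalar_outer_one: "bounded_scalar_outer (\<lambda>z. 1)"
  unfolding bounded_scalar_outer_def scalar_outer_def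
  by (auto intro!: exI[of _ 1] exI[of _ "\<lambda>_. 0"] simp: image_constant_conv)

section \<open>Measurable operator-valued functions\<close>

text \<open>The exceptional sets of a dense sequence of vectors have a common null set, and both operators are
  continuous.\<close>

lemma AE_blinfun_eq:
  fixes \<Phi> \<Psi> :: "'a \<Rightarrow> 'g::{real_normed_vector, second_countable_topology} \<Rightarrow>\<^sub>L 'h::real_normed_vector"
  assumes "\<And>u. AE x in M. blinfun_apply (\<Phi> x) u = blinfun_apply (\<Psi> x) u"
  shows "AE x in M. \<Phi> x = \<Psi> x"
proof -
  obtain d :: "nat \<Rightarrow> 'g" where d: "\<And>S. open S \<Longrightarrow> S \<noteq> {} \<Longrightarrow> \<exists>n. d n \<in> S"
    using dense_sequence_exists by metis
  have "AE x in M. \<forall>n. blinfun_apply (\<Phi> x) (d n) = blinfun_apply (\<Psi> x) (d n)"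
    using assms by (simp add: AE_all_countable)
  then show ?thesis
  proof eventually_elim
    case (elim x)
    show ?case
    proof (rule blinfun_eqI, rule ccontr)
      fix u assume u: "blinfun_apply (\<Phi> x) u \<noteq> blinfun_apply (\<Psi> x) u"
      have "open {u. blinfun_apply (\<Phi> x) u \<noteq> blinfun_apply (\<Psi> x) u}"
        by (intro open_Collect_neq blinfun.continuous_on continuous_on_const continuous_on_id)
      moreover have "{u. blinfun_apply (\<Phi> x) u \<noteq> blinfun_apply (\<Psi> x) u} \<noteq> {}" using u by blast
      ultimately obtain n where "d n \<in> {u. blinfun_apply (\<Phi> x) u \<noteq> blinfun_apply (\<Psi> x) u}" using d by blast
      with elim show False by simp
    qed
  qed
qed

text \<open>A change on a null set turns almost everywhere statements into statements at every point.\<close>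

lemma Linf_op_representative:
  fixes \<Phi> :: "complex \<Rightarrow> 'g::{chilbert_space, second_countable_topology} \<Rightarrow>\<^sub>L 'g"
  assumes \<Phi>: "\<Phi> \<in> Linf_op" and P: "AE \<zeta> in \<sigma>. P (\<Phi> \<zeta>)" and P0: "P 0"
  obtains \<Psi> C where "AE \<zeta> in \<sigma>. \<Phi> \<zeta> = \<Psi> \<zeta>" "\<And>u. (\<lambda>\<zeta>. blinfun_apply (\<Psi> \<zeta>) u) \<in> borel_measurable \<sigma>"
    "\<And>\<zeta>. \<Psi> \<zeta> \<in> cbounded_ops" "\<And>\<zeta>. norm (\<Psi> \<zeta>) \<le> C" "0 < C" "\<And>\<zeta>. P (\<Psi> \<zeta>)"
proof -
  have wm: "weakly_measurable_op \<Phi>" using \<Phi> by (simp add: Linf_op_def)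
  obtain C where C: "AE \<zeta> in \<sigma>. norm (\<Phi> \<zeta>) \<le> C" using \<Phi> unfolding Linf_op_def by blast
  define \<Psi> where "\<Psi> \<zeta> = (if \<zeta> \<in> sphere 0 1 \<and> norm (\<Phi> \<zeta>) \<le> C \<and> P (\<Phi> \<zeta>) then \<Phi> \<zeta> else 0)" for \<zeta>
  have "AE \<zeta> in \<sigma>. \<zeta> \<in> sphere 0 1" by (rule AE_sphere)
  with C P have ae: "AE \<zeta> in \<sigma>. \<Phi> \<zeta> = \<Psi> \<zeta>" by eventually_elim (simp add: \<Psi>_def)
  show ?thesis
  proof (rule that[OF ae])
    show "(\<lambda>\<zeta>. blinfun_apply (\<Psi> \<zeta>) u) \<in> borel_measurable \<sigma>" for u
    proof (rule borel_measurable_sigma_AE)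
      show "(\<lambda>\<zeta>. blinfun_apply (\<Phi> \<zeta>) u) \<in> borel_measurable \<sigma>"
        by (rule borel_measurable_weak) (use wm in \<open>simp add: weakly_measurable_op_def\<close>)
      show "AE \<zeta> in \<sigma>. blinfun_apply (\<Phi> \<zeta>) u = blinfun_apply (\<Psi> \<zeta>) u" using ae by eventually_elim simp
    qed
    have "(0 :: 'g \<Rightarrow>\<^sub>L 'g) \<in> cbounded_ops" by (simp add: cbounded_ops_def scaleC.zero_right)
    then show "\<Psi> \<zeta> \<in> cbounded_ops" for \<zeta> using wm by (simp add: \<Psi>_def weakly_measurable_op_def)
    show "norm (\<Psi> \<zeta>) \<le> max 1 C" for \<zeta> by (auto simp: \<Psi>_def)
    show "0 < max 1 C" by simp
    show "P (\<Psi> \<zeta>)" for \<zeta> using P0 by (simp add: \<Psi>_def)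
  qed
qed

lemma borel_measurable_sqrt_op:
  fixes A :: "'a \<Rightarrow> 'g::{chilbert_space, second_countable_topology} \<Rightarrow>\<^sub>L 'g"
  assumes m: "\<And>u. (\<lambda>x. blinfun_apply (A x) u) \<in> borel_measurable M"
    and A: "\<And>x. A x \<in> cbounded_ops" "\<And>x. nonneg_op (A x)" "\<And>x. norm (A x) \<le> 1"
  shows "(\<lambda>x. blinfun_apply (sqrt_op (A x)) u) \<in> borel_measurable M"
proof -
  have it: "(\<lambda>x. blinfun_apply (sqrt_iter (A x) n) u) \<in> borel_measurable M" for n u
  proof (induction n arbitrary: u)
    case 0
    show ?case by simp
  next
    case (Suc n)
    have [measurable]: "(\<lambda>x. blinfun_apply (A x) u) \<in> borel_measurable M" by (rule m)
    have [measurable]: "(\<lambda>x. blinfun_apply (sqrt_iter (A x) n) (blinfun_apply (sqrt_iter (A x) n) u)) \<in> borel_measurable M"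
      by (rule borel_measurable_blinfun_apply[OF Suc Suc])
    show ?case by (simp add: blinfun.scaleR_left blinfun.add_left blinfun.diff_left)
  qed
  have [measurable]: "(\<lambda>x. blinfun_apply (lim (sqrt_iter (A x))) u) \<in> borel_measurable M"
    by (rule borel_measurable_LIMSEQ_metric[OF it sqrt_iter_apply_tendsto]) (rule A)+
  show ?thesis unfolding sqrt_op_def blinfun.diff_left by measurable
qed

text \<open>After scaling to norm at most \<open>1\<close> the square root is a pointwise limit of the iterates, which depend
  on the operator polynomially and so stay measurable.\<close>

lemma measurable_square_root:
  fixes F :: "'a \<Rightarrow> 'g::{chilbert_space, second_countable_topology} \<Rightarrow>\<^sub>L 'g"
  assumes m: "\<And>u. (\<lambda>x. blinfun_apply (F x) u) \<in> borel_measurable M"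
    and F: "\<And>x. F x \<in> cbounded_ops" "\<And>x. nonneg_op (F x)" "\<And>x. norm (F x) \<le> C" and C: "0 < C"
  obtains S where "\<And>u. (\<lambda>x. blinfun_apply (S x) u) \<in> borel_measurable M" "\<And>x. S x \<in> cbounded_ops"
    "\<And>x u v. cinner (blinfun_apply (S x) u) v = cinner u (blinfun_apply (S x) v)"
    "\<And>x u. blinfun_apply (S x) (blinfun_apply (S x) u) = blinfun_apply (F x) u"
    "\<And>x u. norm (blinfun_apply (S x) u) \<le> sqrt C * norm u"
    "\<And>x u. blinfun_apply (S x) u \<in> closure (range (blinfun_apply (F x)))"
proof -
  define A where "A x = (1 / C) *\<^sub>R F x" for x
  have A1: "A x \<in> cbounded_ops" for x
    using F(1)[of x] by (simp add: A_def cbounded_ops_def blinfun.scaleR_left scaleC.scaleR_right)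
  have A2: "nonneg_op (A x)" for x
    using F(2)[of x] C by (simp add: A_def nonneg_op_def blinfun.scaleR_left cinner.scaleR_left complex_nonneg_Reals_iff)
  have A3: "norm (A x) \<le> 1" for x using F(3)[of x] C by (simp add: A_def)
  note A = A1 A2 A3
  define S where "S x = sqrt C *\<^sub>R sqrt_op (A x)" for x
  have Sa: "blinfun_apply (S x) u = sqrt C *\<^sub>R blinfun_apply (sqrt_op (A x)) u" for x u
    by (simp add: S_def blinfun.scaleR_left)
  have mA: "(\<lambda>x. blinfun_apply (A x) u) \<in> borel_measurable M" for u
    using m[of u] by (simp add: A_def blinfun.scaleR_left)
  have [measurable]: "(\<lambda>x. blinfun_apply (sqrt_op (A x)) u) \<in> borel_measurable M" for u
    by (rule borel_measurable_sqrt_op[OF mA A])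
  have SS: "blinfun_apply (S x) (blinfun_apply (S x) u) = blinfun_apply (F x) u" for x u
  proof -
    have "blinfun_apply (S x) (blinfun_apply (S x) u) = C *\<^sub>R blinfun_apply (sqrt_op (A x) o\<^sub>L sqrt_op (A x)) u"
      using C by (simp add: Sa blinfun.scaleR_right)
    also have "\<dots> = blinfun_apply (F x) u"
      unfolding sqrt_op_square[OF A] using C by (simp add: A_def blinfun.scaleR_left)
    finally show ?thesis .
  qed
  have rng: "range (blinfun_apply (A x)) = range (blinfun_apply (F x))" for x
  proof -
    have e: "blinfun_apply (A x) u = blinfun_apply (F x) ((1 / C) *\<^sub>R u)"
      "blinfun_apply (F x) u = blinfun_apply (A x) (C *\<^sub>R u)" for u
      using C by (simp_all add: A_def blinfun.scaleR_left blinfun.scaleR_right)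
    show ?thesis
    proof (intro equalityI image_subsetI)
      show "blinfun_apply (A x) u \<in> range (blinfun_apply (F x))" for u unfolding e(1) by (rule rangeI)
      show "blinfun_apply (F x) u \<in> range (blinfun_apply (A x))" for u unfolding e(2) by (rule rangeI)
    qed
  qed
  show ?thesis
  proof (rule that[OF _ _ _ SS])
    show "(\<lambda>x. blinfun_apply (S x) u) \<in> borel_measurable M" for u unfolding Sa by measurable
    show "S x \<in> cbounded_ops" for x
      using sqrt_op_cbounded[OF A, of x] by (simp add: cbounded_ops_def Sa scaleC.scaleR_right)
    show "cinner (blinfun_apply (S x) u) v = cinner u (blinfun_apply (S x) v)" for x u v
      by (simp add: Sa cinner.scaleR_left cinner.scaleR_right sqrt_op_selfadjoint[OF A])
    show "norm (blinfun_apply (S x) u) \<le> sqrt C * norm u" for x u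
      using norm_sqrt_op_apply_le[OF A, of x u] C by (simp add: Sa mult_left_mono)
    show "blinfun_apply (S x) u \<in> closure (range (blinfun_apply (F x)))" for x u
      using sqrt_op_in_closure_range[OF A, of x "sqrt C *\<^sub>R u"] by (simp add: rng Sa blinfun.scaleR_right)
  qed
qed

section \<open>Multiplication by the coordinate function\<close>

lemma sq_integrable_zeta:
  fixes f :: "complex \<Rightarrow> 'g::{chilbert_space, second_countable_topology}"
  assumes "sq_integrable f"
  shows "sq_integrable (\<lambda>\<zeta>. \<zeta> powi k *\<^sub>C f \<zeta>)"
proof (rule sq_integrable_bound[OF assms, of _ 1])
  have [measurable]: "f \<in> borel_measurable \<sigma>" using assms by (rule sq_integrable_measurable)
  show "(\<lambda>\<zeta>. \<zeta> powi k *\<^sub>C f \<zeta>) \<in> borel_measurable \<sigma>" by measurable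
qed (auto intro!: AE_I2 simp: norm_scaleC)

lemma sq_integrable_zeta_1:
  fixes f :: "complex \<Rightarrow> 'g::{chilbert_space, second_countable_topology}"
  shows "sq_integrable f \<Longrightarrow> sq_integrable (\<lambda>\<zeta>. \<zeta> *\<^sub>C f \<zeta>)"
  using sq_integrable_zeta[of f 1] by simp

lift_definition mult_zeta :: "'g::{chilbert_space, second_countable_topology} L2 \<Rightarrow> 'g L2"
  is "\<lambda>f \<zeta>. \<zeta> *\<^sub>C f \<zeta>"
  by (auto intro: sq_integrable_zeta_1 elim: eventually_mono)

lemma cinner_abs_L2: "sq_integrable f \<Longrightarrow> sq_integrable g \<Longrightarrow> cinner (abs_L2 f) (abs_L2 g) = (\<integral>\<zeta>. cinner (f \<zeta>) (g \<zeta>) \<partial>\<sigma>)"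
  by (simp add: cinner_L2.abs_eq)

lemma mult_zeta_add: "mult_zeta (x + y) = mult_zeta x + mult_zeta y"
  by transfer (auto simp: scaleC_add_right intro!: sq_integrable_add sq_integrable_zeta_1)

lemma mult_zeta_scaleC: "mult_zeta (c *\<^sub>C x) = c *\<^sub>C mult_zeta x"
proof transfer
  fix c and f :: "complex \<Rightarrow> 'a"
  assume f: "sq_integrable f \<and> sq_integrable f \<and> (AE \<zeta> in \<sigma>. f \<zeta> = f \<zeta>)"
  have e: "\<zeta> *\<^sub>C c *\<^sub>C f \<zeta> = c *\<^sub>C \<zeta> *\<^sub>C f \<zeta>" for \<zeta>
    by (simp add: scaleC_scaleC mult.commute)
  have "sq_integrable (\<lambda>\<zeta>. c *\<^sub>C \<zeta> *\<^sub>C f \<zeta>)"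
    using f by (intro sq_integrable_scaleC sq_integrable_zeta_1) auto
  then show "sq_integrable (\<lambda>\<zeta>. \<zeta> *\<^sub>C c *\<^sub>C f \<zeta>) \<and> sq_integrable (\<lambda>\<zeta>. c *\<^sub>C \<zeta> *\<^sub>C f \<zeta>) \<and>
      (AE \<zeta> in \<sigma>. \<zeta> *\<^sub>C c *\<^sub>C f \<zeta> = c *\<^sub>C \<zeta> *\<^sub>C f \<zeta>)" by (simp only: e) simp
qed

lemma cinner_mult_zeta: "cinner (mult_zeta x) (mult_zeta y) = cinner x y"
proof transfer
  fix f g :: "complex \<Rightarrow> 'a"
  have "cinner (\<zeta> *\<^sub>C f \<zeta>) (\<zeta> *\<^sub>C g \<zeta>) = cinner (f \<zeta>) (g \<zeta>)" if "\<zeta> \<in> sphere 0 1" for \<zeta>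
  proof -
    have "cnj \<zeta> * (\<zeta> * cinner (f \<zeta>) (g \<zeta>)) = (\<zeta> * cnj \<zeta>) * cinner (f \<zeta>) (g \<zeta>)" by simp
    also have "\<zeta> * cnj \<zeta> = 1" using sphere_cnj[OF that] sphere_ne_0[OF that] by simp
    finally show ?thesis by (simp add: cinner_scaleC_left cinner_scaleC_right mult.left_commute)
  qed
  then show "(\<integral>\<zeta>. cinner (\<zeta> *\<^sub>C f \<zeta>) (\<zeta> *\<^sub>C g \<zeta>) \<partial>\<sigma>) = (\<integral>\<zeta>. cinner (f \<zeta>) (g \<zeta>) \<partial>\<sigma>)"
    by (intro Bochner_Integration.integral_cong) auto
qed

lemma bounded_linear_mult_zeta: "bounded_linear mult_zeta"
proof (rule bounded_linear_intro[where K=1])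
  show "mult_zeta (r *\<^sub>R x) = r *\<^sub>R mult_zeta x" for r and x :: "'a L2" by (simp add: scaleR_scaleC mult_zeta_scaleC)
  show "norm (mult_zeta x) \<le> norm x * 1" for x :: "'a L2"
  proof -
    have "complex_of_real ((norm (mult_zeta x))\<^sup>2) = complex_of_real ((norm x)\<^sup>2)"
      by (simp only: cinner_self[symmetric] cinner_mult_zeta)
    then have "(norm (mult_zeta x))\<^sup>2 = (norm x)\<^sup>2" by (simp only: of_real_eq_iff)
    then show ?thesis by simp
  qed
qed (rule mult_zeta_add)

lemma funpow_mult_zeta:
  fixes f :: "complex \<Rightarrow> 'g::{chilbert_space, second_countable_topology}"
  assumes f: "sq_integrable f"
  shows "(mult_zeta ^^ n) (abs_L2 f) = abs_L2 (\<lambda>\<zeta>. \<zeta> powi int n *\<^sub>C f \<zeta>)"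
proof (induction n)
  case 0
  show ?case by simp
next
  case (Suc n)
  have "(mult_zeta ^^ Suc n) (abs_L2 f) = mult_zeta (abs_L2 (\<lambda>\<zeta>. \<zeta> powi int n *\<^sub>C f \<zeta>))" by (simp only: funpow.simps o_apply Suc)
  also have "\<dots> = abs_L2 (\<lambda>\<zeta>. \<zeta> *\<^sub>C \<zeta> powi int n *\<^sub>C f \<zeta>)"
    by (rule mult_zeta.abs_eq) (simp add: sq_integrable_zeta[OF f] del: power_int_of_nat)
  also have "(\<lambda>\<zeta>. \<zeta> *\<^sub>C \<zeta> powi int n *\<^sub>C f \<zeta>) = (\<lambda>\<zeta>. \<zeta> powi int (Suc n) *\<^sub>C f \<zeta>)"
    by (simp only: scaleC_scaleC power_int_of_nat power_Suc)
  finally show ?case .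
qed

lemma cnj_powi_sphere:
  assumes "\<zeta> \<in> sphere 0 1"
  shows "cnj (\<zeta> powi k) = \<zeta> powi (- k)"
  using sphere_cnj[OF assms] by (simp add: power_int_def power_inverse)

section \<open>Existence of the factorization\<close>

lemma integral_powi_cinner_cong_AE:
  fixes f g :: "complex \<Rightarrow> 'g::{chilbert_space, second_countable_topology}"
  assumes "f \<in> borel_measurable \<sigma>" "g \<in> borel_measurable \<sigma>" "AE \<zeta> in \<sigma>. f \<zeta> = g \<zeta>"
  shows "(\<integral>\<zeta>. \<zeta> powi k * cinner (f \<zeta>) v \<partial>\<sigma>) = (\<integral>\<zeta>. \<zeta> powi k * cinner (g \<zeta>) v \<partial>\<sigma>)"
proof (rule integral_cong_AE)
  show "(\<lambda>\<zeta>. \<zeta> powi k * cinner (f \<zeta>) v) \<in> borel_measurable \<sigma>" "(\<lambda>\<zeta>. \<zeta> powi k * cinner (g \<zeta>) v) \<in> borel_measurable \<sigma>"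
    using assms(1,2) by measurable
  show "AE \<zeta> in \<sigma>. \<zeta> powi k * cinner (f \<zeta>) v = \<zeta> powi k * cinner (g \<zeta>) v"
    using assms(3) by eventually_elim simp
qed

text \<open>Nontangential limits are unique, so \<open>g\<close> agrees almost everywhere with the boundary function of the
  expansion of \<open>f\<close>.\<close>

lemma H2_boundary_coefficients:
  fixes f :: "complex \<Rightarrow> 'g::{chilbert_space, second_countable_topology}"
  assumes f: "f \<in> H2" and g: "g \<in> borel_measurable \<sigma>" "AE \<zeta> in \<sigma>. nontangential_limit f \<zeta> (g \<zeta>)"
  shows "sq_integrable g" "0 < k \<Longrightarrow> (\<integral>\<zeta>. \<zeta> powi k * cinner (g \<zeta>) v \<partial>\<sigma>) = 0"
    "(\<integral>\<zeta>. (norm (g \<zeta>))\<^sup>2 \<partial>\<sigma>) \<le> (H2_norm f)\<^sup>2"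
proof -
  obtain h where h: "sq_integrable h" "AE \<zeta> in \<sigma>. nontangential_limit f \<zeta> (h \<zeta>)"
    "\<And>k v. 0 < k \<Longrightarrow> (\<integral>\<zeta>. \<zeta> powi k * cinner (h \<zeta>) v \<partial>\<sigma>) = 0"
    "(\<integral>\<zeta>. (norm (h \<zeta>))\<^sup>2 \<partial>\<sigma>) \<le> (H2_norm f)\<^sup>2" by (rule H2_boundary[OF f]) blast
  have hm: "h \<in> borel_measurable \<sigma>" by (rule sq_integrable_measurable[OF h(1)])
  have ae: "AE \<zeta> in \<sigma>. h \<zeta> = g \<zeta>"
    using h(2) g(2) AE_sphere by eventually_elim (rule nontangential_limit_unique)
  show "sq_integrable g"
    by (rule sq_integrable_bound[OF h(1) g(1), of 1]) (use ae in eventually_elim, simp)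
  show "(\<integral>\<zeta>. \<zeta> powi k * cinner (g \<zeta>) v \<partial>\<sigma>) = 0" if "0 < k"
    using integral_powi_cinner_cong_AE[OF hm g(1) ae, of k v] h(3)[OF that] by simp
  have "(\<integral>\<zeta>. (norm (g \<zeta>))\<^sup>2 \<partial>\<sigma>) = (\<integral>\<zeta>. (norm (h \<zeta>))\<^sup>2 \<partial>\<sigma>)"
    by (rule integral_cong_AE) (use ae g(1) hm in \<open>auto elim: eventually_mono\<close>)
  then show "(\<integral>\<zeta>. (norm (g \<zeta>))\<^sup>2 \<partial>\<sigma>) \<le> (H2_norm f)\<^sup>2" using h(4) by simp
qed

lemma Hinf_op_apply_H2:
  fixes H :: "complex \<Rightarrow> 'g::{chilbert_space, second_countable_topology} \<Rightarrow>\<^sub>L 'g"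
  assumes H: "H \<in> Hinf_op" and f: "f \<in> H2"
  shows "(\<lambda>z. blinfun_apply (H z) (f z)) \<in> H2"
proof -
  obtain C where C: "\<And>z. z \<in> ball 0 1 \<Longrightarrow> norm (H z) \<le> C" using H unfolding Hinf_op_def by blast
  show ?thesis
  proof (rule H2_bound[OF f analytic_disk_apply])
    show "analytic_op H" "analytic_disk f" using H f by (auto simp: Hinf_op_def H2_def)
    show "norm (blinfun_apply (H z) (f z)) \<le> C * norm (f z)" if "z \<in> ball 0 1" for z
      by (rule order_trans[OF norm_blinfun mult_right_mono[OF C[OF that] norm_ge_zero]])
  qed
qed

text \<open>Bounds for the boundary functions pass to the disk because a power series is dominated by the Poisson
  integral of the norm of its boundary function.\<close>

lemma Hinf_op_from_boundary_series:
  fixes A :: "nat \<Rightarrow> 'g \<Rightarrow> 'g::{chilbert_space, second_countable_topology}"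
  assumes bl: "\<And>n. bounded_linear (A n)" and AC: "\<And>n c u. A n (c *\<^sub>C u) = c *\<^sub>C A n u"
    and le: "\<And>n u. norm (A n u) \<le> C * norm u" and C: "0 \<le> C"
    and sum: "\<And>u. summable (\<lambda>n. (norm (A n u))\<^sup>2)"
    and bound: "\<And>u. AE \<zeta> in \<sigma>. norm (bdry (\<lambda>n. A n u) \<zeta>) \<le> C * norm u"
  obtains G \<Gamma> where "G \<in> Hinf_op" "has_boundary_op G \<Gamma>" "\<And>\<zeta>. \<Gamma> \<zeta> \<in> cbounded_ops"
    "\<And>u. AE \<zeta> in \<sigma>. blinfun_apply (\<Gamma> \<zeta>) u = bdry (\<lambda>n. A n u) \<zeta>"
proof -
  have hb: "norm (hardy (\<lambda>n. A n u) z) \<le> C * norm u" if "z \<in> ball 0 1" for z u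
    by (rule norm_hardy_le[OF sum bound that])
  obtain G where G: "G \<in> Hinf_op" "\<And>z u. z \<in> ball 0 1 \<Longrightarrow> blinfun_apply (G z) u = hardy (\<lambda>n. A n u) z"
    by (rule Hinf_op_from_coefficients[OF bl AC le C hb]) blast+
  obtain \<Gamma> B where \<Gamma>: "has_boundary_op G \<Gamma>" "\<And>u. (\<lambda>\<zeta>. blinfun_apply (\<Gamma> \<zeta>) u) \<in> borel_measurable \<sigma>"
    "\<And>\<zeta>. norm (\<Gamma> \<zeta>) \<le> B" "\<And>\<zeta>. \<Gamma> \<zeta> \<in> cbounded_ops" by (rule Hinf_op_boundary_exists[OF G(1)]) blast
  have "AE \<zeta> in \<sigma>. blinfun_apply (\<Gamma> \<zeta>) u = bdry (\<lambda>n. A n u) \<zeta>" for u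
    using \<Gamma>(1)[unfolded has_boundary_op_def] fatou[OF sum[of u]] AE_sphere
  proof eventually_elim
    case (elim \<zeta>)
    have "nontangential_limit (hardy (\<lambda>n. A n u)) \<zeta> (blinfun_apply (\<Gamma> \<zeta>) u)"
      by (rule nontangential_limit_cong[OF elim(1)[rule_format, of u]]) (simp add: G(2))
    then show ?case by (rule nontangential_limit_unique[OF _ elim(2,3)])
  qed
  from that[OF G(1) \<Gamma>(1,4) this] show ?thesis .
qed

text \<open>The isometry is multiplication by \<open>\<zeta>\<close> on \<open>L2\<close>, applied to the vectors \<open>x u = F\<^sup>1\<^sup>/\<^sup>2 u\<close>. It is pure: if \<open>X\<close>
  is represented by \<open>w\<close> and lies in the closed span of the \<open>\<zeta>\<^sup>k F\<^sup>1\<^sup>/\<^sup>2 u\<close> with \<open>k \<ge> n\<close> for every \<open>n\<close>, then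
  \<open>\<psi> F\<^sup>1\<^sup>/\<^sup>2 w\<close> is a limit of combinations of the \<open>\<zeta>\<^sup>k \<psi> F u\<close>, whose Fourier coefficients of index below
  \<open>k\<close> vanish. Hence \<open>\<psi> F\<^sup>1\<^sup>/\<^sup>2 w = 0\<close>, and \<open>F\<^sup>1\<^sup>/\<^sup>2 w = 0\<close> by injectivity, which makes \<open>X\<close> orthogonal to the
  space that contains it. The operators delivered by the Wold decomposition are the Taylor coefficients
  of \<open>G\<close>: the boundary function of \<open>G\<close> and \<open>F\<^sup>1\<^sup>/\<^sup>2\<close> have the same Gram matrices, because their Fourier
  coefficients agree.\<close>

theorem analytic_factorization_exists:
  fixes F \<psi> :: "complex \<Rightarrow> 'g::{chilbert_space, second_countable_topology} \<Rightarrow>\<^sub>L 'g"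
  assumes Fm: "\<And>u. (\<lambda>\<zeta>. blinfun_apply (F \<zeta>) u) \<in> borel_measurable \<sigma>"
    and F: "\<And>\<zeta>. F \<zeta> \<in> cbounded_ops" "\<And>\<zeta>. nonneg_op (F \<zeta>)" "\<And>\<zeta>. norm (F \<zeta>) \<le> C" "0 < C"
    and \<psi>m: "\<And>u. (\<lambda>\<zeta>. blinfun_apply (\<psi> \<zeta>) u) \<in> borel_measurable \<sigma>"
    and \<psi>: "\<And>\<zeta>. \<psi> \<zeta> \<in> cbounded_ops" "\<And>\<zeta>. norm (\<psi> \<zeta>) \<le> D"
    and analytic: "\<And>k u v. 0 < k \<Longrightarrow> (\<integral>\<zeta>. \<zeta> powi k * cinner (blinfun_apply (\<psi> \<zeta>) (blinfun_apply (F \<zeta>) u)) v \<partial>\<sigma>) = 0"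
    and inj: "AE \<zeta> in \<sigma>. inj_on (blinfun_apply (\<psi> \<zeta>)) (closure (range (blinfun_apply (F \<zeta>))))"
  obtains G \<Gamma> where "G \<in> Hinf_op" "has_boundary_op G \<Gamma>" "AE \<zeta> in \<sigma>. F \<zeta> = cadjoint (\<Gamma> \<zeta>) o\<^sub>L \<Gamma> \<zeta>"
proof -
  obtain S where Sm: "\<And>u. (\<lambda>x. blinfun_apply (S x) u) \<in> borel_measurable \<sigma>" and Sc: "\<And>x. S x \<in> cbounded_ops"
    and Ssa: "\<And>x u v. cinner (blinfun_apply (S x) u) v = cinner u (blinfun_apply (S x) v)"
    and SS: "\<And>x u. blinfun_apply (S x) (blinfun_apply (S x) u) = blinfun_apply (F x) u"
    and Sn: "\<And>x u. norm (blinfun_apply (S x) u) \<le> sqrt C * norm u"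
    and Scl: "\<And>x u. blinfun_apply (S x) u \<in> closure (range (blinfun_apply (F x)))"
    by (rule measurable_square_root[OF Fm F]) blast
  have Ssq: "sq_integrable (\<lambda>\<zeta>. blinfun_apply (S \<zeta>) u)" for u
    by (rule sq_integrable_bounded[OF Sm]) (auto intro: Sn)
  have Sapp: "sq_integrable (\<lambda>\<zeta>. blinfun_apply (S \<zeta>) (w \<zeta>))" if "sq_integrable w" for w
    by (rule sq_integrable_bound[OF that borel_measurable_blinfun_apply[OF Sm sq_integrable_measurable[OF that]]])
      (auto intro: Sn)
  define x where "x u = abs_L2 (\<lambda>\<zeta>. blinfun_apply (S \<zeta>) u)" for u
  have Ux: "(mult_zeta ^^ n) (x u) = abs_L2 (\<lambda>\<zeta>. \<zeta> powi int n *\<^sub>C blinfun_apply (S \<zeta>) u)" for n u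
    unfolding x_def by (rule funpow_mult_zeta[OF Ssq])
  have cinner_Ux: "cinner (abs_L2 w) ((mult_zeta ^^ n) (x u)) = (\<integral>\<zeta>. \<zeta> powi (- int n) * cinner (blinfun_apply (S \<zeta>) (w \<zeta>)) u \<partial>\<sigma>)"
    if w: "sq_integrable w" for w n u
    unfolding Ux cinner_abs_L2[OF w sq_integrable_zeta[OF Ssq]]
  proof (intro Bochner_Integration.integral_cong refl)
    fix \<zeta> assume "\<zeta> \<in> space \<sigma>"
    then have s: "\<zeta> \<in> sphere 0 1" by simp
    show "cinner (w \<zeta>) (\<zeta> powi int n *\<^sub>C blinfun_apply (S \<zeta>) u) = \<zeta> powi (- int n) * cinner (blinfun_apply (S \<zeta>) (w \<zeta>)) u"
      by (simp only: cinner_scaleC_right cnj_powi_sphere[OF s] Ssa)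
  qed
  have xU: "cinner ((mult_zeta ^^ n) (x u)) (x v) = (\<integral>\<zeta>. \<zeta> powi int n * cinner (blinfun_apply (F \<zeta>) u) v \<partial>\<sigma>)" for n u v
    unfolding Ux unfolding x_def cinner_abs_L2[OF sq_integrable_zeta[OF Ssq] Ssq]
    by (intro Bochner_Integration.integral_cong) (auto simp: cinner_scaleC_left Ssa SS[symmetric])
  have xadd: "x (u + v) = x u + x v" for u v
    using Ssq[of u] Ssq[of v] by (simp add: x_def plus_L2.abs_eq blinfun.add_right)
  have xC: "x (c *\<^sub>C u) = c *\<^sub>C x u" for c u
    using Ssq[of u] by (simp add: x_def scaleC_L2.abs_eq cbounded_opsD[OF Sc])
  have xnorm: "norm (x u) \<le> sqrt C * norm u" for u
  proof -
    have "(norm (x u))\<^sup>2 = (\<integral>\<zeta>. (norm (blinfun_apply (S \<zeta>) u))\<^sup>2 \<partial>\<sigma>)"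
    proof -
      have "complex_of_real ((norm (x u))\<^sup>2) = (\<integral>\<zeta>. complex_of_real ((norm (blinfun_apply (S \<zeta>) u))\<^sup>2) \<partial>\<sigma>)"
        unfolding cinner_self[symmetric] unfolding x_def by (rule cinner_abs_L2[OF Ssq Ssq])
      then show ?thesis by (simp only: integral_complex_of_real of_real_eq_iff)
    qed
    also have "\<dots> \<le> (\<integral>\<zeta>. (sqrt C * norm u)\<^sup>2 \<partial>\<sigma>)"
    proof (rule integral_mono)
      show "integrable \<sigma> (\<lambda>\<zeta>. (norm (blinfun_apply (S \<zeta>) u))\<^sup>2)" using Ssq[of u] by (simp add: sq_integrable_def)
      show "(norm (blinfun_apply (S \<zeta>) u))\<^sup>2 \<le> (sqrt C * norm u)\<^sup>2" for \<zeta> by (rule power_mono[OF Sn]) simp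
    qed simp
    finally have "(norm (x u))\<^sup>2 \<le> (sqrt C * norm u)\<^sup>2" by simp
    then show ?thesis by (rule power2_le_imp_le) (use F(4) in simp)
  qed
  have xbl: "bounded_linear x"
    by (rule bounded_linear_intro[where K="sqrt C"]) (use xadd xC xnorm in \<open>auto simp: scaleR_scaleC mult.commute\<close>)
  have pure: "X = 0" if X: "\<And>n. X \<in> cclspan {(mult_zeta ^^ k) (x u) |k u. n \<le> k}" for X
  proof -
    obtain w where w: "sq_integrable w" "X = abs_L2 w" by (rule L2_cases)
    define y where "y \<zeta> = blinfun_apply (\<psi> \<zeta>) (blinfun_apply (S \<zeta>) (w \<zeta>))" for \<zeta>
    have ysq: "sq_integrable y"
      unfolding y_def
    proof (rule sq_integrable_bound[OF Sapp[OF w(1)]])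
      show "(\<lambda>\<zeta>. blinfun_apply (\<psi> \<zeta>) (blinfun_apply (S \<zeta>) (w \<zeta>))) \<in> borel_measurable \<sigma>"
        by (rule borel_measurable_blinfun_apply[OF \<psi>m sq_integrable_measurable[OF Sapp[OF w(1)]]])
      show "AE \<zeta> in \<sigma>. norm (blinfun_apply (\<psi> \<zeta>) (blinfun_apply (S \<zeta>) (w \<zeta>))) \<le> D * norm (blinfun_apply (S \<zeta>) (w \<zeta>))"
        by (rule AE_I2, rule order_trans[OF norm_blinfun mult_right_mono[OF \<psi>(2) norm_ge_zero]])
    qed
    \<comment> \<open>pairing with \<open>\<zeta>\<^sup>-\<^sup>k F\<^sup>1\<^sup>/\<^sup>2 \<psi>\<^sup>* v\<close> is a continuous functional of \<open>X\<close>; it vanishes on the generators with exponent at least \<open>1 - k\<close>\<close>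
    have coeff: "(\<integral>\<zeta>. \<zeta> powi k * cinner (y \<zeta>) v \<partial>\<sigma>) = 0" for k v
    proof -
      define q where "q \<zeta> = blinfun_apply (S \<zeta>) (blinfun_apply (cadjoint (\<psi> \<zeta>)) v)" for \<zeta>
      have qsq: "sq_integrable q"
        unfolding q_def
      proof (rule Sapp, rule sq_integrable_bounded)
        show "(\<lambda>\<zeta>. blinfun_apply (cadjoint (\<psi> \<zeta>)) v) \<in> borel_measurable \<sigma>"
          by (rule borel_measurable_cadjoint[OF \<psi>m \<psi>(1)])
        show "AE \<zeta> in \<sigma>. norm (blinfun_apply (cadjoint (\<psi> \<zeta>)) v) \<le> D * norm v"
          by (rule AE_I2, rule order_trans[OF norm_blinfun mult_right_mono[OF order_trans[OF norm_cadjoint_le[OF \<psi>(1)] \<psi>(2)] norm_ge_zero]])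
      qed
      have pair: "cinner (abs_L2 h) (abs_L2 (\<lambda>\<zeta>. \<zeta> powi (- k) *\<^sub>C q \<zeta>))
          = (\<integral>\<zeta>. \<zeta> powi k * cinner (blinfun_apply (\<psi> \<zeta>) (blinfun_apply (S \<zeta>) (h \<zeta>))) v \<partial>\<sigma>)"
        if h: "sq_integrable h" for h
        unfolding cinner_abs_L2[OF h sq_integrable_zeta[OF qsq]]
      proof (intro Bochner_Integration.integral_cong refl)
        fix \<zeta> assume "\<zeta> \<in> space \<sigma>"
        then have s: "\<zeta> \<in> sphere 0 1" by simp
        show "cinner (h \<zeta>) (\<zeta> powi (- k) *\<^sub>C q \<zeta>) = \<zeta> powi k * cinner (blinfun_apply (\<psi> \<zeta>) (blinfun_apply (S \<zeta>) (h \<zeta>))) v"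
          by (simp only: cinner_scaleC_right cnj_powi_sphere[OF s] q_def Ssa[symmetric] cinner_cadjoint[OF \<psi>(1)] minus_minus)
      qed
      have "cinner X (abs_L2 (\<lambda>\<zeta>. \<zeta> powi (- k) *\<^sub>C q \<zeta>)) = 0"
      proof (rule cclspan_orth[OF X[of "nat (1 - k)"]])
        fix s assume "s \<in> {(mult_zeta ^^ m) (x u) |m u. nat (1 - k) \<le> m}"
        then obtain m u where s: "s = (mult_zeta ^^ m) (x u)" "nat (1 - k) \<le> m" by auto
        have "cinner s (abs_L2 (\<lambda>\<zeta>. \<zeta> powi (- k) *\<^sub>C q \<zeta>))
            = (\<integral>\<zeta>. \<zeta> powi k * cinner (blinfun_apply (\<psi> \<zeta>) (blinfun_apply (S \<zeta>) (\<zeta> powi int m *\<^sub>C blinfun_apply (S \<zeta>) u))) v \<partial>\<sigma>)"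
          unfolding s(1) Ux by (rule pair[OF sq_integrable_zeta[OF Ssq]])
        also have "\<dots> = (\<integral>\<zeta>. \<zeta> powi (k + int m) * cinner (blinfun_apply (\<psi> \<zeta>) (blinfun_apply (F \<zeta>) u)) v \<partial>\<sigma>)"
          by (intro Bochner_Integration.integral_cong)
            (auto simp: cbounded_opsD[OF Sc] cbounded_opsD[OF \<psi>(1)] SS cinner_scaleC_left sphere_powi_add mult.assoc)
        also have "\<dots> = 0" using s(2) by (intro analytic) auto
        finally show "cinner s (abs_L2 (\<lambda>\<zeta>. \<zeta> powi (- k) *\<^sub>C q \<zeta>)) = 0" .
      qed
      then show ?thesis using pair[OF w(1)] by (simp add: w(2) y_def)
    qed
    have "AE \<zeta> in \<sigma>. y \<zeta> = 0"
      by (rule fourier_unique[OF ysq sq_integrable_const]) (simp add: coeff cinner.zero_left)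
    with inj have Sw: "AE \<zeta> in \<sigma>. blinfun_apply (S \<zeta>) (w \<zeta>) = 0"
    proof eventually_elim
      case (elim \<zeta>)
      have "0 \<in> closure (range (blinfun_apply (F \<zeta>)))" using Scl[of \<zeta> 0] by (simp add: blinfun.zero_right)
      moreover have "blinfun_apply (\<psi> \<zeta>) (blinfun_apply (S \<zeta>) (w \<zeta>)) = blinfun_apply (\<psi> \<zeta>) 0"
        using elim(2) by (simp add: y_def blinfun.zero_right)
      ultimately show ?case using inj_onD[OF elim(1) _ Scl] by blast
    qed
    have "cinner X X = 0"
    proof (rule cclspan_orth_right[OF X[of 0]])
      fix s assume "s \<in> {(mult_zeta ^^ k) (x u) |k u. 0 \<le> k}"
      then obtain k u where s: "s = (mult_zeta ^^ k) (x u)" by auto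
      have "cinner X s = (\<integral>\<zeta>. \<zeta> powi (- int k) * cinner (blinfun_apply (S \<zeta>) (w \<zeta>)) u \<partial>\<sigma>)"
        unfolding s w(2) by (rule cinner_Ux[OF w(1)])
      also have "\<dots> = (\<integral>\<zeta>. \<zeta> powi (- int k) * cinner 0 u \<partial>\<sigma>)"
        by (rule integral_powi_cinner_cong_AE[OF sq_integrable_measurable[OF Sapp[OF w(1)]] _ Sw]) simp
      finally show "cinner X s = 0" by (simp add: cinner.zero_left)
    qed
    then show ?thesis by (simp add: cinner_self)
  qed
  have "\<exists>A :: nat \<Rightarrow> 'g \<Rightarrow> 'g. (\<forall>n. bounded_linear (A n)) \<and> (\<forall>n c u. A n (c *\<^sub>C u) = c *\<^sub>C A n u) \<and>
      (\<forall>n u. norm (A n u) \<le> norm (x u)) \<and>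
      (\<forall>a u v. (\<lambda>m. cinner (A m u) (A (m + a) v)) sums cinner ((mult_zeta ^^ a) (x u)) (x v))"
  proof (rule pure_isometry_factorization[OF bounded_linear_mult_zeta mult_zeta_scaleC cinner_mult_zeta xbl xC pure])
    fix A :: "nat \<Rightarrow> 'g \<Rightarrow> 'g"
    assume A: "\<And>n. bounded_linear (A n)" "\<And>n c u. A n (c *\<^sub>C u) = c *\<^sub>C A n u"
      "\<And>n u. norm (A n u) \<le> norm (x u)"
      "\<And>a u v. (\<lambda>m. cinner (A m u) (A (m + a) v)) sums cinner ((mult_zeta ^^ a) (x u)) (x v)"
    show ?thesis by (intro exI[of _ A] conjI allI A)
  qed
  then obtain A :: "nat \<Rightarrow> 'g \<Rightarrow> 'g" where "(\<forall>n. bounded_linear (A n)) \<and> (\<forall>n c u. A n (c *\<^sub>C u) = c *\<^sub>C A n u) \<and>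
      (\<forall>n u. norm (A n u) \<le> norm (x u)) \<and>
      (\<forall>a u v. (\<lambda>m. cinner (A m u) (A (m + a) v)) sums cinner ((mult_zeta ^^ a) (x u)) (x v))"
    by (rule exE)
  then have A: "bounded_linear (A n)" "A n (c *\<^sub>C u) = c *\<^sub>C A n u" "norm (A n u) \<le> norm (x u)"
    "(\<lambda>m. cinner (A m u) (A (m + k) v)) sums cinner ((mult_zeta ^^ k) (x u)) (x v)" for n c u v k
    by (elim conjE; simp)+
  define a where "a u n = A n u" for u n
  have sum_a: "summable (\<lambda>n. (norm (a u n))\<^sup>2)" for u
  proof -
    have "summable (\<lambda>n. Re (cinner (A n u) (A (n + 0) u)))"
      by (rule summable_Re[OF sums_summable[OF A(4)]])
    then show ?thesis by (simp add: a_def cinner_self)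
  qed
  have eqk: "(\<integral>\<zeta>. \<zeta> powi int k * cinner (bdry (a u) \<zeta>) (bdry (a v) \<zeta>) \<partial>\<sigma>)
      = (\<integral>\<zeta>. \<zeta> powi int k * cinner (blinfun_apply (F \<zeta>) u) v \<partial>\<sigma>)" for k u v
  proof -
    have "(\<lambda>n. cinner (a u n) (a v (n + k))) sums cinner ((mult_zeta ^^ k) (x u)) (x v)"
      using A(4) by (simp only: a_def)
    from sums_unique2[OF parseval_bdry[OF sum_a sum_a] this] show ?thesis by (simp only: xU)
  qed
  have Fsq: "sq_integrable (\<lambda>\<zeta>. blinfun_apply (F \<zeta>) u)" for u
    by (rule sq_integrable_bounded[OF Fm, of _ "C * norm u"])
      (rule AE_I2, rule order_trans[OF norm_blinfun mult_right_mono[OF F(3) norm_ge_zero]])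
  \<comment> \<open>both Gram matrices are Hermitian, which gives the coefficients of negative index\<close>
  have eq_all: "(\<integral>\<zeta>. \<zeta> powi k * cinner (bdry (a u) \<zeta>) (bdry (a v) \<zeta>) \<partial>\<sigma>)
      = (\<integral>\<zeta>. \<zeta> powi k * cinner (blinfun_apply (F \<zeta>) u) v \<partial>\<sigma>)" for k u v
  proof (cases "0 \<le> k")
    case True
    then show ?thesis using eqk[of "nat k" u v] by simp
  next
    case False
    have "(\<integral>\<zeta>. \<zeta> powi k * cinner (bdry (a u) \<zeta>) (bdry (a v) \<zeta>) \<partial>\<sigma>)
        = cnj (\<integral>\<zeta>. \<zeta> powi (- k) * cinner (bdry (a v) \<zeta>) (bdry (a u) \<zeta>) \<partial>\<sigma>)"
      by (rule integral_powi_cinner_commute)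
    also have "\<dots> = cnj (\<integral>\<zeta>. \<zeta> powi (- k) * cinner (blinfun_apply (F \<zeta>) v) u \<partial>\<sigma>)"
      using False eqk[of "nat (- k)" v u] by simp
    also have "\<dots> = cnj (\<integral>\<zeta>. \<zeta> powi (- k) * cinner v (blinfun_apply (F \<zeta>) u) \<partial>\<sigma>)"
      by (simp only: nonneg_op_selfadjoint[OF F(1,2)])
    also have "\<dots> = (\<integral>\<zeta>. \<zeta> powi k * cinner (blinfun_apply (F \<zeta>) u) v \<partial>\<sigma>)"
      by (rule integral_powi_cinner_commute[symmetric])
    finally show ?thesis .
  qed
  have gram: "AE \<zeta> in \<sigma>. cinner (bdry (a u) \<zeta>) (bdry (a v) \<zeta>) = cinner (blinfun_apply (F \<zeta>) u) v" for u v
  proof -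
    have i1: "integrable \<sigma> (\<lambda>\<zeta>. \<zeta> powi k * cinner (bdry (a u) \<zeta>) (bdry (a v) \<zeta>))"
      and i2: "integrable \<sigma> (\<lambda>\<zeta>. \<zeta> powi k * cinner (blinfun_apply (F \<zeta>) u) v)" for k
      by (intro integrable_powi_cinner sq_integrable_bdry sum_a Fsq sq_integrable_const)+
    have "fourier_null (\<lambda>\<zeta>. cinner (bdry (a u) \<zeta>) (bdry (a v) \<zeta>) - cinner (blinfun_apply (F \<zeta>) u) v)"
      unfolding fourier_null_def right_diff_distrib
      using i1 i2 i1[of 0] i2[of 0] by (simp add: eq_all)
    from fourier_null_AE_eq_0[OF this] show ?thesis by simp
  qed
  have bound: "AE \<zeta> in \<sigma>. norm (bdry (a u) \<zeta>) \<le> sqrt C * norm u" for u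
    using gram[of u u]
  proof eventually_elim
    case (elim \<zeta>)
    have "complex_of_real ((norm (bdry (a u) \<zeta>))\<^sup>2) = complex_of_real ((norm (blinfun_apply (S \<zeta>) u))\<^sup>2)"
      using elim by (simp only: cinner_self[symmetric] SS[symmetric] Ssa[symmetric])
    then have "(norm (bdry (a u) \<zeta>))\<^sup>2 = (norm (blinfun_apply (S \<zeta>) u))\<^sup>2" by (simp only: of_real_eq_iff)
    then have "norm (bdry (a u) \<zeta>) = norm (blinfun_apply (S \<zeta>) u)" by simp
    then show ?case using Sn[of \<zeta> u] by simp
  qed
  have An: "norm (A n u) \<le> sqrt C * norm u" for n u using A(3) xnorm order_trans by blast
  have C0: "0 \<le> sqrt C" using F(4) by simp
  obtain G \<Gamma> where G: "G \<in> Hinf_op" "has_boundary_op G \<Gamma>" "\<And>\<zeta>. \<Gamma> \<zeta> \<in> cbounded_ops"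
    and \<Gamma>b: "\<And>u. AE \<zeta> in \<sigma>. blinfun_apply (\<Gamma> \<zeta>) u = bdry (a u) \<zeta>"
    using Hinf_op_from_boundary_series[OF A(1,2) An C0 sum_a[unfolded a_def] bound[unfolded a_def[abs_def]]]
    unfolding a_def[abs_def] by blast
  have "AE \<zeta> in \<sigma>. F \<zeta> = cadjoint (\<Gamma> \<zeta>) o\<^sub>L \<Gamma> \<zeta>"
  proof (rule AE_blinfun_eq)
    fix u
    have "AE \<zeta> in \<sigma>. blinfun_apply (F \<zeta>) u - blinfun_apply (cadjoint (\<Gamma> \<zeta>) o\<^sub>L \<Gamma> \<zeta>) u = 0"
    proof (rule AE_eq_0_weak)
      fix v
      show "AE \<zeta> in \<sigma>. cinner (blinfun_apply (F \<zeta>) u - blinfun_apply (cadjoint (\<Gamma> \<zeta>) o\<^sub>L \<Gamma> \<zeta>) u) v = 0"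
        using gram[of u v] \<Gamma>b[of u] \<Gamma>b[of v]
      proof eventually_elim
        case (elim \<zeta>)
        have "cinner (blinfun_apply (cadjoint (\<Gamma> \<zeta>)) (blinfun_apply (\<Gamma> \<zeta>) u)) v
            = cnj (cinner (blinfun_apply (\<Gamma> \<zeta>) v) (blinfun_apply (\<Gamma> \<zeta>) u))"
          by (simp only: cinner_cadjoint[OF G(3)] cinner_commute[symmetric])
        also have "\<dots> = cinner (bdry (a u) \<zeta>) (bdry (a v) \<zeta>)"
          by (simp add: elim(2,3) flip: cinner_commute)
        finally show ?case using elim(1) by (simp add: cinner.diff_left)
      qed
    qed
    then show "AE \<zeta> in \<sigma>. blinfun_apply (F \<zeta>) u = blinfun_apply (cadjoint (\<Gamma> \<zeta>) o\<^sub>L \<Gamma> \<zeta>) u" by simp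
  qed
  then show ?thesis by (rule that[OF G(1,2)])
qed

section \<open>Analyticity of the second factor\<close>

text \<open>The Fourier coefficients of nonnegative index are the Taylor coefficients of a bounded analytic
  function, and its boundary function has the Fourier coefficients of \<open>\<omega>\<close>.\<close>

lemma Hinf_op_of_fourier_coefficients:
  fixes \<omega> :: "complex \<Rightarrow> 'g::{chilbert_space, second_countable_topology} \<Rightarrow>\<^sub>L 'g"
  assumes m: "\<And>u. (\<lambda>\<zeta>. blinfun_apply (\<omega> \<zeta>) u) \<in> borel_measurable \<sigma>"
    and c: "\<And>\<zeta>. \<omega> \<zeta> \<in> cbounded_ops" and C: "\<And>\<zeta>. norm (\<omega> \<zeta>) \<le> C"
    and 0: "\<And>k u v. 0 < k \<Longrightarrow> (\<integral>\<zeta>. \<zeta> powi k * cinner (blinfun_apply (\<omega> \<zeta>) u) v \<partial>\<sigma>) = 0"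
  shows "\<omega> \<in> Hinf_op_boundary"
proof -
  have C0: "0 \<le> C" using C norm_ge_zero order_trans by blast
  have le: "norm (blinfun_apply (\<omega> \<zeta>) u) \<le> C * norm u" for \<zeta> u
    by (rule order_trans[OF norm_blinfun mult_right_mono[OF C norm_ge_zero]])
  have sq: "sq_integrable (\<lambda>\<zeta>. blinfun_apply (\<omega> \<zeta>) u)" for u
    by (rule sq_integrable_bounded[OF m AE_I2[OF le]])
  define A where "A n u = fourier (\<lambda>\<zeta>. blinfun_apply (\<omega> \<zeta>) u) n" for n u
  have cA: "cinner (A n u) v = (\<integral>\<zeta>. \<zeta> powi (- int n) * cinner (blinfun_apply (\<omega> \<zeta>) u) v \<partial>\<sigma>)" for n u v
    unfolding A_def by (rule cinner_fourier[OF sq])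
  have i: "integrable \<sigma> (\<lambda>\<zeta>. \<zeta> powi k * cinner (blinfun_apply (\<omega> \<zeta>) u) v)" for k u v
    by (rule integrable_powi_cinner[OF sq sq_integrable_const])
  have Aadd: "A n (u + v) = A n u + A n v" for n u v
    by (rule cinner_ext) (simp only: cA cinner_add_left blinfun.add_right distrib_left Bochner_Integration.integral_add[OF i i])
  have AC: "A n (a *\<^sub>C u) = a *\<^sub>C A n u" for n a u
    by (rule cinner_ext) (simp only: cA cinner_scaleC_left cbounded_opsD[OF c] mult.left_commute[of _ a] integral_mult_right_zero)
  have sum: "summable (\<lambda>n. (norm (A n u))\<^sup>2)" for u
    unfolding A_def by (rule summable_fourier[OF sq])
  have An: "norm (A n u) \<le> C * norm u" for n u
  proof (rule power2_le_imp_le)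
    have "(norm (A n u))\<^sup>2 \<le> (\<Sum>k<Suc n. (norm (A k u))\<^sup>2)" by (simp add: sum_nonneg)
    also have "\<dots> \<le> (\<integral>\<zeta>. (norm (blinfun_apply (\<omega> \<zeta>) u))\<^sup>2 \<partial>\<sigma>)"
      unfolding A_def by (rule bessel_inequality[OF sq])
    also have "\<dots> \<le> (\<integral>\<zeta>. (C * norm u)\<^sup>2 \<partial>\<sigma>)"
    proof (rule integral_mono)
      show "integrable \<sigma> (\<lambda>\<zeta>. (norm (blinfun_apply (\<omega> \<zeta>) u))\<^sup>2)" using sq[of u] by (simp add: sq_integrable_def)
      show "(norm (blinfun_apply (\<omega> \<zeta>) u))\<^sup>2 \<le> (C * norm u)\<^sup>2" for \<zeta> by (rule power_mono[OF le]) simp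
    qed simp
    finally show "(norm (A n u))\<^sup>2 \<le> (C * norm u)\<^sup>2" by simp
  qed (use C0 in simp)
  have bl: "bounded_linear (A n)" for n
    by (rule bounded_linear_intro[where K=C]) (use Aadd AC An in \<open>auto simp: scaleR_scaleC mult.commute\<close>)
  have ae: "AE \<zeta> in \<sigma>. bdry (\<lambda>n. A n u) \<zeta> = blinfun_apply (\<omega> \<zeta>) u" for u
  proof (rule fourier_unique[OF sq_integrable_bdry[OF sum] sq])
    fix k v
    show "(\<integral>\<zeta>. \<zeta> powi k * cinner (bdry (\<lambda>n. A n u) \<zeta>) v \<partial>\<sigma>) = (\<integral>\<zeta>. \<zeta> powi k * cinner (blinfun_apply (\<omega> \<zeta>) u) v \<partial>\<sigma>)"
      unfolding fourier_bdry[OF sum] cA using 0 by simp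
  qed
  have bd: "AE \<zeta> in \<sigma>. norm (bdry (\<lambda>n. A n u) \<zeta>) \<le> C * norm u" for u
    using ae[of u] by eventually_elim (simp add: le)
  show ?thesis
  proof (rule Hinf_op_from_boundary_series[OF bl AC An C0 sum bd])
    fix H \<Phi> assume H: "H \<in> Hinf_op" "has_boundary_op H \<Phi>"
      and \<Phi>: "\<And>u. AE \<zeta> in \<sigma>. blinfun_apply (\<Phi> \<zeta>) u = bdry (\<lambda>n. A n u) \<zeta>"
    have "AE \<zeta> in \<sigma>. \<Phi> \<zeta> = \<omega> \<zeta>"
    proof (rule AE_blinfun_eq)
      show "AE \<zeta> in \<sigma>. blinfun_apply (\<Phi> \<zeta>) u = blinfun_apply (\<omega> \<zeta>) u" for u
        using \<Phi>[of u] ae[of u] by eventually_elim simp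
    qed
    with H(2) have "has_boundary_op H \<omega>"
      unfolding has_boundary_op_def by eventually_elim simp
    with H(1) show ?thesis by (auto simp: Hinf_op_boundary_def)
  qed
qed

lemma Hinf_op_boundary_cong:
  assumes "\<Phi> \<in> Hinf_op_boundary" "AE \<zeta> in \<sigma>. \<Phi> \<zeta> = \<Psi> \<zeta>"
  shows "\<Psi> \<in> Hinf_op_boundary"
proof -
  obtain H where H: "H \<in> Hinf_op" "has_boundary_op H \<Phi>" using assms(1) by (auto simp: Hinf_op_boundary_def)
  from H(2) assms(2) have "has_boundary_op H \<Psi>" unfolding has_boundary_op_def by eventually_elim simp
  with H(1) show ?thesis by (auto simp: Hinf_op_boundary_def)
qed

text \<open>A nontangential limit is a limit along a sequence of radii, and on each circle \<open>f\<close> is continuous.\<close>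

lemma borel_measurable_nontangential_limit:
  fixes f :: "complex \<Rightarrow> 'g::{chilbert_space, second_countable_topology}"
  assumes f: "analytic_disk f" and g: "AE \<zeta> in \<sigma>. nontangential_limit f \<zeta> (g \<zeta>)"
  shows "g \<in> borel_measurable \<sigma>"
proof -
  define r where "r n = 1 - inverse (real (Suc n))" for n
  have r: "0 \<le> r n" "r n < 1" for n by (auto simp: r_def field_simps)
  have r1: "r \<longlonglongrightarrow> 1" unfolding r_def using tendsto_diff[OF tendsto_const LIMSEQ_inverse_real_of_nat, of 1] by simp
  have m: "(\<lambda>\<zeta>. f (of_real (r n) * \<zeta>)) \<in> borel_measurable \<sigma>" for n
    by (rule borel_measurable_sigma_continuous[OF circle_continuous[OF f r]])
  have ae: "AE \<zeta> in \<sigma>. (\<lambda>n. f (of_real (r n) * \<zeta>)) \<longlonglongrightarrow> g \<zeta>"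
    using g AE_sphere
  proof eventually_elim
    case (elim \<zeta>)
    have "(f \<longlongrightarrow> g \<zeta>) (at \<zeta> within stolz_region 2 \<zeta>)" using elim(1) by (simp add: nontangential_limit_def)
    moreover have "filterlim (\<lambda>n. of_real (r n) * \<zeta>) (at \<zeta> within stolz_region 2 \<zeta>) sequentially"
      unfolding filterlim_at
    proof
      have "(\<lambda>n. of_real (r n) * \<zeta>) \<longlonglongrightarrow> of_real 1 * \<zeta>" by (intro tendsto_mult tendsto_of_real r1 tendsto_const)
      then show "(\<lambda>n. of_real (r n) * \<zeta>) \<longlonglongrightarrow> \<zeta>" by simp
      have "of_real (r n) * \<zeta> \<noteq> \<zeta>" for n using r(2)[of n] sphere_ne_0[OF elim(2)] by simp
      then show "\<forall>\<^sub>F n in sequentially. of_real (r n) * \<zeta> \<in> stolz_region 2 \<zeta> \<and> of_real (r n) * \<zeta> \<noteq> \<zeta>"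
        using radial_in_stolz[OF elim(2) _ r, of 2] by simp
    qed
    ultimately show ?case by (rule filterlim_compose)
  qed
  have "(\<lambda>\<zeta>. lim (\<lambda>n. f (of_real (r n) * \<zeta>))) \<in> borel_measurable \<sigma>"
    using m by (rule borel_measurable_lim_metric)
  moreover have "AE \<zeta> in \<sigma>. lim (\<lambda>n. f (of_real (r n) * \<zeta>)) = g \<zeta>" using ae by eventually_elim (rule limI)
  ultimately show ?thesis by (rule borel_measurable_sigma_AE)
qed

lemma H2_norm_nonneg:
  assumes "f \<in> H2"
  shows "0 \<le> H2_norm f"
proof -
  have "bdd_above ((\<lambda>r::real. \<integral>\<zeta>. (norm (f (of_real r * \<zeta>)))\<^sup>2 \<partial>\<sigma>) ` {0..<1})"
    using assms by (auto simp: H2_def bdd_above_def)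
  then have "0 \<le> (SUP r\<in>{0..<1::real}. \<integral>\<zeta>. (norm (f (of_real r * \<zeta>)))\<^sup>2 \<partial>\<sigma>)"
    by (rule cSUP_upper2[of _ _ 0]) auto
  then show ?thesis by (simp add: H2_norm_def)
qed

text \<open>Let \<open>\<phi> G\<close> be outer with range space \<open>M\<close>. For \<open>f\<close> in \<open>H2\<close> the function \<open>\<psi> \<Gamma>\<^sup>*\<close> takes the boundary values
  \<open>\<phi> \<Gamma> f\<close> to \<open>\<phi> \<psi> F f\<close>, which are boundary values of a function in \<open>H2\<close>. A constant \<open>u\<close> in \<open>M\<close> is a limit
  of functions \<open>\<phi> G f\<close>, so the negative Fourier coefficients of \<open>\<psi> \<Gamma>\<^sup>* u\<close> vanish. For \<open>u\<close> orthogonal to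
  \<open>M\<close> already \<open>\<Gamma>\<^sup>* u = 0\<close>, because \<open>\<Gamma>\<close> takes its values in \<open>M\<close>.\<close>

theorem outer_factor_mult_cadjoint_Hinf:
  fixes F \<psi> :: "complex \<Rightarrow> 'g::{chilbert_space, second_countable_topology} \<Rightarrow>\<^sub>L 'g"
  assumes F: "\<And>\<zeta>. norm (F \<zeta>) \<le> C" "0 < C"
    and \<psi>m: "\<And>u. (\<lambda>\<zeta>. blinfun_apply (\<psi> \<zeta>) u) \<in> borel_measurable \<sigma>"
    and \<psi>: "\<And>\<zeta>. \<psi> \<zeta> \<in> cbounded_ops" "\<And>\<zeta>. norm (\<psi> \<zeta>) \<le> D" "0 < D"
    and \<psi>F: "(\<lambda>\<zeta>. \<psi> \<zeta> o\<^sub>L F \<zeta>) \<in> Hinf_op_boundary"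
    and G: "outer_Nplus G" "has_boundary_op G \<Gamma>" "AE \<zeta> in \<sigma>. F \<zeta> = cadjoint (\<Gamma> \<zeta>) o\<^sub>L \<Gamma> \<zeta>"
  shows "(\<lambda>\<zeta>. \<psi> \<zeta> o\<^sub>L cadjoint (\<Gamma> \<zeta>)) \<in> Hinf_op_boundary"
proof -
  have aG: "analytic_op G" using G(1) by (simp add: outer_Nplus_def Nplus_op_def)
  obtain \<phi> where \<phi>o: "bounded_scalar_outer \<phi>" and o: "outer_Hinf (\<lambda>z. \<phi> z *\<^sub>C G z)"
    using G(1) unfolding outer_Nplus_def by blast
  have \<phi>s: "scalar_outer \<phi>" using \<phi>o by (simp add: bounded_scalar_outer_def)
  have a\<phi>: "analytic_disk \<phi>" by (rule scalar_outer_analytic(1)[OF \<phi>s])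
  obtain K where K: "\<And>z. z \<in> ball 0 1 \<Longrightarrow> norm (\<phi> z) \<le> K"
    using \<phi>o unfolding bounded_scalar_outer_def bounded_iff by blast
  have \<phi>G: "(\<lambda>z. \<phi> z *\<^sub>C G z) \<in> Hinf_op" using o by (simp add: outer_Hinf_def)
  obtain M where M: "closed_csubspace M"
    and in_M: "\<And>f. f \<in> H2 \<Longrightarrow> (\<lambda>z. blinfun_apply (\<phi> z *\<^sub>C G z) (f z)) \<in> H2_in M"
    and dense: "\<And>h e. h \<in> H2_in M \<Longrightarrow> 0 < e \<Longrightarrow> \<exists>f\<in>H2. H2_norm (\<lambda>z. h z - blinfun_apply (\<phi> z *\<^sub>C G z) (f z)) < e"
    using o unfolding outer_Hinf_def by blast
  obtain K' where K': "\<And>z. z \<in> ball 0 1 \<Longrightarrow> norm (\<phi> z *\<^sub>C G z) \<le> K'" using \<phi>G unfolding Hinf_op_def by blast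
  have GM: "blinfun_apply (G z) u \<in> M" if z: "z \<in> ball 0 1" for z u
  proof -
    have "\<phi> z *\<^sub>C blinfun_apply (G z) u \<in> M"
      using in_M[OF H2_const, of u] z by (simp add: H2_in_def blinfun_apply_scaleC)
    then have "inverse (\<phi> z) *\<^sub>C \<phi> z *\<^sub>C blinfun_apply (G z) u \<in> M" by (rule closed_csubspaceD(4)[OF M])
    then show ?thesis using scalar_outer_analytic(2)[OF \<phi>s z]
      by (simp add: scaleC_scaleC flip: scaleR_scaleC[of 1, simplified])
  qed
  \<comment> \<open>\<open>\<Gamma>\<close> is prescribed almost everywhere only, so it is replaced by \<open>0\<close> on a null set\<close>
  define good where "good \<zeta> \<longleftrightarrow> \<Gamma> \<zeta> \<in> cbounded_ops \<and> (\<forall>u. blinfun_apply (\<Gamma> \<zeta>) u \<in> M) \<and> F \<zeta> = cadjoint (\<Gamma> \<zeta>) o\<^sub>L \<Gamma> \<zeta>" for \<zeta>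
  have good: "AE \<zeta> in \<sigma>. good \<zeta>"
    using G(2)[unfolded has_boundary_op_def] G(3) AE_sphere
  proof eventually_elim
    case (elim \<zeta>)
    note lim = elim(1)[rule_format]
    have "blinfun_apply (\<Gamma> \<zeta>) (c *\<^sub>C u) = c *\<^sub>C blinfun_apply (\<Gamma> \<zeta>) u" for c u
    proof (rule nontangential_limit_unique[OF lim _ elim(3)])
      show "nontangential_limit (\<lambda>z. blinfun_apply (G z) (c *\<^sub>C u)) \<zeta> (c *\<^sub>C blinfun_apply (\<Gamma> \<zeta>) u)"
        by (rule nontangential_limit_cong[OF nontangential_limit_scaleC[OF nontangential_limit_const lim]])
          (use aG in \<open>simp add: analytic_op_def cbounded_opsD\<close>)
    qed
    moreover have "blinfun_apply (\<Gamma> \<zeta>) u \<in> M" for u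
    proof (rule Lim_in_closed_set[OF closed_csubspaceD(1)[OF M]])
      show "((\<lambda>z. blinfun_apply (G z) u) \<longlongrightarrow> blinfun_apply (\<Gamma> \<zeta>) u) (at \<zeta> within stolz_region 2 \<zeta>)"
        using lim[of u] by (simp add: nontangential_limit_def)
      show "\<forall>\<^sub>F z in at \<zeta> within stolz_region 2 \<zeta>. blinfun_apply (G z) u \<in> M" by (rule eventually_stolz) (rule GM)
      show "at \<zeta> within stolz_region 2 \<zeta> \<noteq> bot" using elim(3) by (rule stolz_region_nontrivial) simp
    qed
    ultimately show ?case using elim(2) by (simp add: good_def cbounded_ops_def)
  qed
  define \<Gamma>1 where "\<Gamma>1 \<zeta> = (if good \<zeta> then \<Gamma> \<zeta> else 0)" for \<zeta>
  have "(0 :: 'g \<Rightarrow>\<^sub>L 'g) \<in> cbounded_ops" by (simp add: cbounded_ops_def scaleC.zero_right)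
  then have \<Gamma>c: "\<Gamma>1 \<zeta> \<in> cbounded_ops" for \<zeta> by (simp add: \<Gamma>1_def good_def)
  have \<Gamma>M: "blinfun_apply (\<Gamma>1 \<zeta>) u \<in> M" for \<zeta> u using closed_csubspaceD(2)[OF M] by (simp add: \<Gamma>1_def good_def)
  have \<Gamma>eq: "AE \<zeta> in \<sigma>. \<Gamma> \<zeta> = \<Gamma>1 \<zeta>" using good by eventually_elim (simp add: \<Gamma>1_def)
  have \<Gamma>m: "(\<lambda>\<zeta>. blinfun_apply (\<Gamma>1 \<zeta>) u) \<in> borel_measurable \<sigma>" for u
  proof (rule borel_measurable_nontangential_limit[OF analytic_disk_apply[OF aG analytic_disk_const]])
    show "AE \<zeta> in \<sigma>. nontangential_limit (\<lambda>z. blinfun_apply (G z) u) \<zeta> (blinfun_apply (\<Gamma>1 \<zeta>) u)"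
      using G(2)[unfolded has_boundary_op_def] \<Gamma>eq by eventually_elim simp
  qed
  have \<Gamma>n: "norm (\<Gamma>1 \<zeta>) \<le> sqrt C" for \<zeta>
  proof (rule norm_blinfun_bound)
    fix u
    show "norm (blinfun_apply (\<Gamma>1 \<zeta>) u) \<le> sqrt C * norm u"
    proof (cases "good \<zeta>")
      case True
      have "(norm (blinfun_apply (\<Gamma> \<zeta>) u))\<^sup>2 = cmod (cinner (blinfun_apply (\<Gamma> \<zeta>) u) (blinfun_apply (\<Gamma> \<zeta>) u))"
        by (simp add: cinner_self norm_power)
      also have "\<dots> = cmod (cinner u (blinfun_apply (F \<zeta>) u))"
        using True cinner_cadjoint[of "\<Gamma> \<zeta>" u "blinfun_apply (\<Gamma> \<zeta>) u"] by (simp add: good_def)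
      also have "\<dots> \<le> norm u * norm (blinfun_apply (F \<zeta>) u)" by (rule norm_cinner_le)
      also have "\<dots> \<le> norm u * (C * norm u)"
        by (intro mult_left_mono norm_ge_zero order_trans[OF norm_blinfun mult_right_mono[OF F(1) norm_ge_zero]])
      also have "\<dots> = (sqrt C * norm u)\<^sup>2" using F(2) by (simp add: power2_eq_square)
      finally have "norm (blinfun_apply (\<Gamma> \<zeta>) u) \<le> sqrt C * norm u" by (rule power2_le_imp_le) (use F(2) in simp)
      then show ?thesis using True by (simp add: \<Gamma>1_def)
    qed (use F(2) in \<open>simp add: \<Gamma>1_def\<close>)
  qed (use F(2) in simp)
  define \<omega> where "\<omega> \<zeta> = \<psi> \<zeta> o\<^sub>L cadjoint (\<Gamma>1 \<zeta>)" for \<zeta>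
  have \<omega>c: "\<omega> \<zeta> \<in> cbounded_ops" for \<zeta>
    by (simp add: \<omega>_def cbounded_ops_def cbounded_opsD[OF \<psi>(1)] cbounded_opsD[OF cadjoint_in_cbounded_ops[OF \<Gamma>c]])
  have \<omega>n: "norm (\<omega> \<zeta>) \<le> D * sqrt C" for \<zeta>
    unfolding \<omega>_def
    by (rule order_trans[OF norm_blinfun_compose mult_mono[OF \<psi>(2) order_trans[OF norm_cadjoint_le[OF \<Gamma>c] \<Gamma>n]]]) (use \<psi>(3) in auto)
  have \<omega>le: "norm (blinfun_apply (\<omega> \<zeta>) u) \<le> D * sqrt C * norm u" for \<zeta> u
    by (rule order_trans[OF norm_blinfun mult_right_mono[OF \<omega>n norm_ge_zero]])
  have \<omega>m: "(\<lambda>\<zeta>. blinfun_apply (\<omega> \<zeta>) u) \<in> borel_measurable \<sigma>" for u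
    unfolding \<omega>_def by (simp add: borel_measurable_blinfun_apply[OF \<psi>m borel_measurable_cadjoint[OF \<Gamma>m \<Gamma>c]])
  obtain H0 where H0: "H0 \<in> Hinf_op" "has_boundary_op H0 (\<lambda>\<zeta>. \<psi> \<zeta> o\<^sub>L F \<zeta>)"
    using \<psi>F by (auto simp: Hinf_op_boundary_def)
  have aH0: "analytic_op H0" using H0(1) by (simp add: Hinf_op_def)
  obtain L where L: "\<And>z. z \<in> ball 0 1 \<Longrightarrow> norm (H0 z) \<le> L" using H0(1) unfolding Hinf_op_def by blast
  have "\<phi> \<in> H2" by (rule H2_bounded[OF a\<phi> K])
  then obtain \<phi>b where \<phi>b: "AE \<zeta> in \<sigma>. nontangential_limit \<phi> \<zeta> (\<phi>b \<zeta>)"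
    by (rule H2_boundary)
  have coeff_M: "(\<integral>\<zeta>. \<zeta> powi k * cinner (blinfun_apply (\<omega> \<zeta>) u) v \<partial>\<sigma>) = 0" if k: "0 < k" and u: "u \<in> M" for k u v
  proof -
    have "cmod (\<integral>\<zeta>. \<zeta> powi k * cinner (blinfun_apply (\<omega> \<zeta>) u) v \<partial>\<sigma>) \<le> D * sqrt C * e * norm v" if e: "0 < e" for e
    proof -
      have "(\<lambda>z. u) \<in> H2_in M" using u by (simp add: H2_in_def H2_const)
      from dense[OF this e] obtain f where f: "f \<in> H2"
        and fe: "H2_norm (\<lambda>z. u - blinfun_apply (\<phi> z *\<^sub>C G z) (f z)) < e" by blast
      \<comment> \<open>the error of the approximation, and the analytic function that \<open>\<psi> \<Gamma>\<^sup>*\<close> makes of the approximant\<close>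
      define q where "q z = u - blinfun_apply (\<phi> z *\<^sub>C G z) (f z)" for z
      define p where "p z = \<phi> z *\<^sub>C blinfun_apply (H0 z) (f z)" for z
      have q: "q \<in> H2" unfolding q_def by (intro H2_diff H2_const Hinf_op_apply_H2[OF \<phi>G f])
      have af: "analytic_disk f" using f by (simp add: H2_def)
      have p: "p \<in> H2"
        unfolding p_def
      proof (rule H2_bound[OF Hinf_op_apply_H2[OF H0(1) f]])
        show "analytic_disk (\<lambda>z. \<phi> z *\<^sub>C blinfun_apply (H0 z) (f z))"
          by (rule analytic_disk_scaleC[OF a\<phi> analytic_disk_apply[OF aH0 af]])
        show "norm (\<phi> z *\<^sub>C blinfun_apply (H0 z) (f z)) \<le> K * norm (blinfun_apply (H0 z) (f z))" if "z \<in> ball 0 1" for z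
          unfolding norm_scaleC by (rule mult_right_mono[OF K[OF that] norm_ge_zero])
      qed
      obtain fb where fb: "AE \<zeta> in \<sigma>. nontangential_limit f \<zeta> (fb \<zeta>)" by (rule H2_boundary[OF f])
      define qb where "qb \<zeta> = u - \<phi>b \<zeta> *\<^sub>C blinfun_apply (\<Gamma>1 \<zeta>) (fb \<zeta>)" for \<zeta>
      define pb where "pb \<zeta> = \<phi>b \<zeta> *\<^sub>C blinfun_apply (\<psi> \<zeta>) (blinfun_apply (F \<zeta>) (fb \<zeta>))" for \<zeta>
      have q_lim: "AE \<zeta> in \<sigma>. nontangential_limit q \<zeta> (qb \<zeta>)"
        using \<phi>b fb G(2)[unfolded has_boundary_op_def] \<Gamma>eq
      proof eventually_elim
        case (elim \<zeta>)
        have "nontangential_limit (\<lambda>z. blinfun_apply (\<phi> z *\<^sub>C G z) w) \<zeta> (blinfun_apply (\<phi>b \<zeta> *\<^sub>C \<Gamma>1 \<zeta>) w)" for w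
          unfolding blinfun_apply_scaleC
          using nontangential_limit_scaleC[OF elim(1) elim(3)[rule_format, of w]] elim(4) by simp
        from nontangential_limit_diff[OF nontangential_limit_const nontangential_limit_apply[OF this elim(2) K'], of u]
        show ?case by (simp add: q_def[abs_def] qb_def blinfun_apply_scaleC)
      qed
      have p_lim: "AE \<zeta> in \<sigma>. nontangential_limit p \<zeta> (pb \<zeta>)"
        using \<phi>b fb H0(2)[unfolded has_boundary_op_def]
      proof eventually_elim
        case (elim \<zeta>)
        from nontangential_limit_scaleC[OF elim(1) nontangential_limit_apply[OF elim(3)[rule_format] elim(2) L]]
        show ?case by (simp add: p_def[abs_def] pb_def)
      qed
      have qm: "qb \<in> borel_measurable \<sigma>" and pm: "pb \<in> borel_measurable \<sigma>"
        using borel_measurable_nontangential_limit q_lim p_lim p q by (auto simp: H2_def)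
      note qb = H2_boundary_coefficients[OF q qm q_lim] and pb = H2_boundary_coefficients[OF p pm p_lim]
      have \<omega>q: "sq_integrable (\<lambda>\<zeta>. blinfun_apply (\<omega> \<zeta>) (qb \<zeta>))"
        by (rule sq_integrable_bound[OF qb(1) borel_measurable_blinfun_apply[OF \<omega>m qm] AE_I2[OF \<omega>le]])
      have "AE \<zeta> in \<sigma>. blinfun_apply (\<omega> \<zeta>) u = blinfun_apply (\<omega> \<zeta>) (qb \<zeta>) + pb \<zeta>"
        using good
      proof eventually_elim
        case (elim \<zeta>)
        then have "F \<zeta> = cadjoint (\<Gamma>1 \<zeta>) o\<^sub>L \<Gamma>1 \<zeta>" by (simp add: \<Gamma>1_def good_def)
        then have "pb \<zeta> = blinfun_apply (\<omega> \<zeta>) (\<phi>b \<zeta> *\<^sub>C blinfun_apply (\<Gamma>1 \<zeta>) (fb \<zeta>))"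
          unfolding cbounded_opsD[OF \<omega>c] by (simp add: pb_def \<omega>_def)
        then show ?case by (simp add: qb_def flip: blinfun.add_right)
      qed
      then have "(\<integral>\<zeta>. \<zeta> powi k * cinner (blinfun_apply (\<omega> \<zeta>) u) v \<partial>\<sigma>)
          = (\<integral>\<zeta>. \<zeta> powi k * cinner (blinfun_apply (\<omega> \<zeta>) (qb \<zeta>) + pb \<zeta>) v \<partial>\<sigma>)"
        by (intro integral_powi_cinner_cong_AE \<omega>m borel_measurable_add sq_integrable_measurable[OF \<omega>q] pm)
      also have "\<dots> = (\<integral>\<zeta>. \<zeta> powi k * cinner (blinfun_apply (\<omega> \<zeta>) (qb \<zeta>)) v \<partial>\<sigma>) + (\<integral>\<zeta>. \<zeta> powi k * cinner (pb \<zeta>) v \<partial>\<sigma>)"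
        unfolding cinner_add_left distrib_left
        by (intro Bochner_Integration.integral_add integrable_powi_cinner \<omega>q pb(1) sq_integrable_const)
      finally have "cmod (\<integral>\<zeta>. \<zeta> powi k * cinner (blinfun_apply (\<omega> \<zeta>) u) v \<partial>\<sigma>)
          = cmod (\<integral>\<zeta>. \<zeta> powi k * cinner (blinfun_apply (\<omega> \<zeta>) (qb \<zeta>)) v \<partial>\<sigma>)" by (simp add: pb(2)[OF k])
      also have "\<dots> \<le> sqrt (\<integral>\<zeta>. (norm (blinfun_apply (\<omega> \<zeta>) (qb \<zeta>)))\<^sup>2 \<partial>\<sigma>) * sqrt (\<integral>\<zeta>. (norm v)\<^sup>2 \<partial>\<sigma>)"
        by (rule norm_integral_powi_cinner_le[OF \<omega>q sq_integrable_const])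
      also have "\<dots> \<le> D * sqrt C * e * norm v"
      proof (rule mult_mono)
        have "(\<integral>\<zeta>. (norm (blinfun_apply (\<omega> \<zeta>) (qb \<zeta>)))\<^sup>2 \<partial>\<sigma>) \<le> (\<integral>\<zeta>. (D * sqrt C)\<^sup>2 * (norm (qb \<zeta>))\<^sup>2 \<partial>\<sigma>)"
        proof (rule integral_mono)
          show "integrable \<sigma> (\<lambda>\<zeta>. (norm (blinfun_apply (\<omega> \<zeta>) (qb \<zeta>)))\<^sup>2)" using \<omega>q by (simp add: sq_integrable_def)
          show "integrable \<sigma> (\<lambda>\<zeta>. (D * sqrt C)\<^sup>2 * (norm (qb \<zeta>))\<^sup>2)" using qb(1) by (simp add: sq_integrable_def)
          show "(norm (blinfun_apply (\<omega> \<zeta>) (qb \<zeta>)))\<^sup>2 \<le> (D * sqrt C)\<^sup>2 * (norm (qb \<zeta>))\<^sup>2" for \<zeta>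
            unfolding power_mult_distrib[symmetric] by (rule power_mono[OF \<omega>le norm_ge_zero])
        qed
        also have "\<dots> = (D * sqrt C)\<^sup>2 * (\<integral>\<zeta>. (norm (qb \<zeta>))\<^sup>2 \<partial>\<sigma>)" by (rule integral_mult_right_zero)
        also have "\<dots> \<le> (D * sqrt C)\<^sup>2 * e\<^sup>2"
        proof (rule mult_left_mono)
          show "(\<integral>\<zeta>. (norm (qb \<zeta>))\<^sup>2 \<partial>\<sigma>) \<le> e\<^sup>2"

            using order_trans[OF qb(3) power_mono[OF less_imp_le H2_norm_nonneg[OF q], of e 2]] fe
            unfolding q_def[abs_def] by blast
        qed simp
        finally have "(\<integral>\<zeta>. (norm (blinfun_apply (\<omega> \<zeta>) (qb \<zeta>)))\<^sup>2 \<partial>\<sigma>) \<le> (D * sqrt C * e)\<^sup>2" by (simp only: power_mult_distrib)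
        then show "sqrt (\<integral>\<zeta>. (norm (blinfun_apply (\<omega> \<zeta>) (qb \<zeta>)))\<^sup>2 \<partial>\<sigma>) \<le> D * sqrt C * e"
          by (rule real_le_lsqrt[OF _, rotated]) (use \<psi>(3) F(2) e in auto)
      qed (use \<psi>(3) F(2) e in auto)
      finally show ?thesis .
    qed
    note le = this
    have "cmod (\<integral>\<zeta>. \<zeta> powi k * cinner (blinfun_apply (\<omega> \<zeta>) u) v \<partial>\<sigma>) \<le> 0"
    proof (rule tendsto_lowerbound)
      have "((\<lambda>e. D * sqrt C * e * norm v) \<longlongrightarrow> D * sqrt C * 0 * norm v) (at_right 0)" by (intro tendsto_intros)
      then show "((\<lambda>e. D * sqrt C * e * norm v) \<longlongrightarrow> 0) (at_right 0)" by simp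
      show "\<forall>\<^sub>F e in at_right 0. cmod (\<integral>\<zeta>. \<zeta> powi k * cinner (blinfun_apply (\<omega> \<zeta>) u) v \<partial>\<sigma>) \<le> D * sqrt C * e * norm v"
        using eventually_at_right_less[of 0] by eventually_elim (rule le)
    qed simp
    then show ?thesis by simp
  qed
  have "\<omega> \<in> Hinf_op_boundary"
  proof (rule Hinf_op_of_fourier_coefficients[OF \<omega>m \<omega>c \<omega>n])
    fix k :: int and u v :: 'g assume k: "0 < k"
    obtain w where w: "w \<in> M" "\<And>m. m \<in> M \<Longrightarrow> cinner (u - w) m = 0" by (rule orthogonal_projection[OF M]) blast
    have "blinfun_apply (cadjoint (\<Gamma>1 \<zeta>)) (u - w) = 0" for \<zeta>
    proof -
      \<comment> \<open>the range of \<open>\<Gamma>1 \<zeta>\<close> lies in \<open>M\<close>\<close>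
      define c where "c = blinfun_apply (cadjoint (\<Gamma>1 \<zeta>)) (u - w)"
      have "cinner c c = cinner (blinfun_apply (\<Gamma>1 \<zeta>) c) (u - w)" by (simp only: cinner_cadjoint[OF \<Gamma>c] c_def)
      also have "\<dots> = cnj (cinner (u - w) (blinfun_apply (\<Gamma>1 \<zeta>) c))" by (rule cinner_commute)
      also have "\<dots> = 0" by (simp add: w(2)[OF \<Gamma>M])
      finally have "c = 0" by (simp add: cinner_self)
      then show ?thesis by (simp only: c_def)
    qed
    then have "blinfun_apply (\<omega> \<zeta>) u = blinfun_apply (\<omega> \<zeta>) w" for \<zeta>
      by (simp add: \<omega>_def blinfun.diff_right)
    then show "(\<integral>\<zeta>. \<zeta> powi k * cinner (blinfun_apply (\<omega> \<zeta>) u) v \<partial>\<sigma>) = 0" using coeff_M[OF k w(1)] by simp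
  qed
  moreover have "AE \<zeta> in \<sigma>. \<omega> \<zeta> = \<psi> \<zeta> o\<^sub>L cadjoint (\<Gamma> \<zeta>)" using \<Gamma>eq by eventually_elim (simp add: \<omega>_def)
  ultimately show ?thesis by (rule Hinf_op_boundary_cong)
qed

section \<open>A sufficient condition for factorability\<close>

theorem theorem4p3:
  fixes F \<psi> :: "complex \<Rightarrow> 'g::{chilbert_space, second_countable_topology} \<Rightarrow>\<^sub>L 'g"
  assumes F_Linf: "F \<in> Linf_op"
    and F_nonneg: "AE \<zeta> in \<sigma>. nonneg_op (F \<zeta>)"
    and \<psi>_Linf: "\<psi> \<in> Linf_op"
    and \<psi>F_Hinf: "(\<lambda>\<zeta>. \<psi> \<zeta> o\<^sub>L F \<zeta>) \<in> Hinf_op_boundary"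
    and \<psi>_inj: "AE \<zeta> in \<sigma>. inj_on (blinfun_apply (\<psi> \<zeta>)) (closure (range (blinfun_apply (F \<zeta>))))"
  shows "factorable F \<and>
    (\<forall>G \<Gamma>. G \<in> Nplus_op \<and> outer_Nplus G \<and> factorization F G \<Gamma> \<longrightarrow>
      (\<lambda>\<zeta>. \<psi> \<zeta> o\<^sub>L cadjoint (\<Gamma> \<zeta>)) \<in> Hinf_op_boundary)"
proof -
  have "nonneg_op (0 :: 'g \<Rightarrow>\<^sub>L 'g)" by (simp add: nonneg_op_def cinner.zero_left)
  then obtain F1 C where F1: "AE \<zeta> in \<sigma>. F \<zeta> = F1 \<zeta>" "\<And>u. (\<lambda>\<zeta>. blinfun_apply (F1 \<zeta>) u) \<in> borel_measurable \<sigma>"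
    "\<And>\<zeta>. F1 \<zeta> \<in> cbounded_ops" "\<And>\<zeta>. norm (F1 \<zeta>) \<le> C" "0 < C" "\<And>\<zeta>. nonneg_op (F1 \<zeta>)"
    using Linf_op_representative[OF F_Linf F_nonneg] by blast
  obtain \<psi>1 D where \<psi>1: "AE \<zeta> in \<sigma>. \<psi> \<zeta> = \<psi>1 \<zeta>" "\<And>u. (\<lambda>\<zeta>. blinfun_apply (\<psi>1 \<zeta>) u) \<in> borel_measurable \<sigma>"
    "\<And>\<zeta>. \<psi>1 \<zeta> \<in> cbounded_ops" "\<And>\<zeta>. norm (\<psi>1 \<zeta>) \<le> D" "0 < D"
    using Linf_op_representative[OF \<psi>_Linf, of "\<lambda>_. True"] by auto
  have \<psi>F1: "(\<lambda>\<zeta>. \<psi>1 \<zeta> o\<^sub>L F1 \<zeta>) \<in> Hinf_op_boundary"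
    by (rule Hinf_op_boundary_cong[OF \<psi>F_Hinf]) (use F1(1) \<psi>1(1) in eventually_elim, simp)
  then obtain H where H: "H \<in> Hinf_op" "has_boundary_op H (\<lambda>\<zeta>. \<psi>1 \<zeta> o\<^sub>L F1 \<zeta>)" by (auto simp: Hinf_op_boundary_def)
  have coeff: "(\<integral>\<zeta>. \<zeta> powi k * cinner (blinfun_apply (\<psi>1 \<zeta>) (blinfun_apply (F1 \<zeta>) u)) v \<partial>\<sigma>) = 0" if "0 < k" for k u v
  proof (rule H2_boundary_coefficients(2)[OF Hinf_op_apply_H2[OF H(1) H2_const] _ _ that])
    show "(\<lambda>\<zeta>. blinfun_apply (\<psi>1 \<zeta>) (blinfun_apply (F1 \<zeta>) u)) \<in> borel_measurable \<sigma>"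
      by (rule borel_measurable_blinfun_apply[OF \<psi>1(2) F1(2)])
    show "AE \<zeta> in \<sigma>. nontangential_limit (\<lambda>z. blinfun_apply (H z) u) \<zeta> (blinfun_apply (\<psi>1 \<zeta>) (blinfun_apply (F1 \<zeta>) u))"
      using H(2)[unfolded has_boundary_op_def] by eventually_elim (metis blinfun_apply_blinfun_compose)
  qed
  have inj: "AE \<zeta> in \<sigma>. inj_on (blinfun_apply (\<psi>1 \<zeta>)) (closure (range (blinfun_apply (F1 \<zeta>))))"
    using \<psi>_inj F1(1) \<psi>1(1) by eventually_elim simp
  obtain G \<Gamma> where G: "G \<in> Hinf_op" "has_boundary_op G \<Gamma>" "AE \<zeta> in \<sigma>. F1 \<zeta> = cadjoint (\<Gamma> \<zeta>) o\<^sub>L \<Gamma> \<zeta>"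
    using analytic_factorization_exists[OF F1(2,3,6,4,5) \<psi>1(2-4) coeff inj] by blast
  have "(\<lambda>z. 1 *\<^sub>C G z) = G" by (simp flip: scaleR_scaleC[of 1, simplified])
  then have "\<exists>\<phi>. bounded_scalar_outer \<phi> \<and> (\<lambda>z. \<phi> z *\<^sub>C G z) \<in> Hinf_op"
    using G(1) bounded_scalar_outer_one by (intro exI[of _ "\<lambda>z. 1"]) simp
  then have "G \<in> Nplus_op" using G(1) by (simp add: Nplus_op_def Hinf_op_def)
  moreover have "factorization F G \<Gamma>"
    unfolding factorization_def using G(2) by (rule conjI) (use F1(1) G(3) in eventually_elim, simp)
  ultimately have "factorable F"
    using F_Linf F_nonneg by (auto simp: factorable_def Linf_op_def)
  moreover have "(\<lambda>\<zeta>. \<psi> \<zeta> o\<^sub>L cadjoint (\<Gamma> \<zeta>)) \<in> Hinf_op_boundary"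
    if G: "outer_Nplus G" and fac: "factorization F G \<Gamma>" for G \<Gamma>
  proof (rule Hinf_op_boundary_cong)
    have "AE \<zeta> in \<sigma>. F \<zeta> = cadjoint (\<Gamma> \<zeta>) o\<^sub>L \<Gamma> \<zeta>" using fac by (simp add: factorization_def)
    with F1(1) have "AE \<zeta> in \<sigma>. F1 \<zeta> = cadjoint (\<Gamma> \<zeta>) o\<^sub>L \<Gamma> \<zeta>" by eventually_elim simp
    then show "(\<lambda>\<zeta>. \<psi>1 \<zeta> o\<^sub>L cadjoint (\<Gamma> \<zeta>)) \<in> Hinf_op_boundary"
      using fac by (intro outer_factor_mult_cadjoint_Hinf[OF F1(4,5) \<psi>1(2-5) \<psi>F1 G]) (simp_all add: factorization_def)
    show "AE \<zeta> in \<sigma>. \<psi>1 \<zeta> o\<^sub>L cadjoint (\<Gamma> \<zeta>) = \<psi> \<zeta> o\<^sub>L cadjoint (\<Gamma> \<zeta>)" using \<psi>1(1) by eventually_elim simp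
  qed
  ultimately show ?thesis by blast
qed

end
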